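(* The triangle groups $(2,4,5)$ and $(2,5,5)$ are not systolic. That is, for $j\in\{4,5\}$ the group $\Gamma=\langle r,s,t \mid r^2, s^2, t^2, (rs)^2, (st)^j, (rt)^5\rangle$ does not admit a geometric action on any systolic complex.
   Context: A cycle of length $n$ in a flag simplicial complex $X$ is a set of $n$ edges of $X$ which topologically forms a circle. A diagonal of a cycle $C$ is an edge of $X$ connecting two nonconsecutive vertices of $C$. For $k\ge 4$, a flag simplicial complex $X$ is $k$-large if every cycle $C$ of length at least $4$ and strictly less than $k$ has a diagonal. A simplicial complex $X$ is systolic if it is connected, simply connected, and all its vertex links are $6$-large. A group is systolic if it admits a geometric action (by simplicial automorphisms, properly discontinuous and cocompact) on a systolic complex. The triangle group $(2,4,5)$ (respectively $(2,5,5)$) is the group $\langle r,s,t \mid r^2, s^2, t^2, (rs)^2, (st)^j, (rt)^5\rangle$ with $j=4$ (respectively $j=5$). *)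

theory Defs
  imports "HOL-Analysis.Analysis" "HOL-Algebra.Group_Action"
begin

section \<open>Simplicial complexes\<close>

text \<open>A simplicial complex is given by its set of simplices, which are finite and nonempty;
  its vertex set is the union of the simplices.\<close>

definition simplicial_complex :: "'a set set \<Rightarrow> bool" where
  "simplicial_complex X \<longleftrightarrow>
     (\<forall>\<sigma>\<in>X. finite \<sigma> \<and> \<sigma> \<noteq> {}) \<and> (\<forall>\<sigma>\<in>X. \<forall>\<tau>. \<tau> \<noteq> {} \<and> \<tau> \<subseteq> \<sigma> \<longrightarrow> \<tau> \<in> X)"

definition vertices :: "'a set set \<Rightarrow> 'a set" where
  "vertices X = \<Union>X"

definition edges :: "'a set set \<Rightarrow> 'a set set" where
  "edges X = {\<sigma> \<in> X. card \<sigma> = 2}"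

definition flag_complex :: "'a set set \<Rightarrow> bool" where
  "flag_complex X \<longleftrightarrow> simplicial_complex X \<and>
     (\<forall>\<sigma>. finite \<sigma> \<and> \<sigma> \<noteq> {} \<and> \<sigma> \<subseteq> vertices X \<and>
          (\<forall>u\<in>\<sigma>. \<forall>v\<in>\<sigma>. u \<noteq> v \<longrightarrow> {u, v} \<in> edges X) \<longrightarrow> \<sigma> \<in> X)"

definition link :: "'a set set \<Rightarrow> 'a \<Rightarrow> 'a set set" where
  "link X v = {\<sigma>. \<sigma> \<noteq> {} \<and> v \<notin> \<sigma> \<and> insert v \<sigma> \<in> X}"

text \<open>A cycle is a set of edges whose union is a triangulated circle, i.e. the edge set of a closed
  edge path through at least three pairwise distinct vertices.\<close>

definition is_cycle :: "'a set set \<Rightarrow> nat \<Rightarrow> 'a set set \<Rightarrow> bool" where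
  "is_cycle X n C \<longleftrightarrow> C \<subseteq> edges X \<and> 3 \<le> n \<and>
     (\<exists>vs. distinct vs \<and> length vs = n \<and> C = {{vs ! i, vs ! (Suc i mod n)} | i. i < n})"

text \<open>Two distinct vertices of a cycle are consecutive iff they span an edge of the cycle.\<close>

definition is_diagonal :: "'a set set \<Rightarrow> 'a set set \<Rightarrow> 'a set \<Rightarrow> bool" where
  "is_diagonal X C e \<longleftrightarrow> e \<in> edges X \<and> e \<subseteq> \<Union>C \<and> e \<notin> C"

definition k_large :: "nat \<Rightarrow> 'a set set \<Rightarrow> bool" where
  "k_large k X \<longleftrightarrow> flag_complex X \<and>
     (\<forall>n C. is_cycle X n C \<and> 4 \<le> n \<and> n < k \<longrightarrow> (\<exists>e. is_diagonal X C e))"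


section \<open>Geometric realization\<close>

text \<open>Points of the realization are given by their barycentric coordinates.\<close>

definition support :: "('a \<Rightarrow> real) \<Rightarrow> 'a set" where
  "support x = {v. x v \<noteq> 0}"

definition realization_points :: "'a set set \<Rightarrow> ('a \<Rightarrow> real) set" where
  "realization_points X = {x. support x \<in> X \<and> (\<forall>v. 0 \<le> x v) \<and> sum x (support x) = 1}"

definition closed_simplex :: "'a set set \<Rightarrow> 'a set \<Rightarrow> ('a \<Rightarrow> real) set" where
  "closed_simplex X \<sigma> = {x \<in> realization_points X. support x \<subseteq> \<sigma>}"

text \<open>The weak topology: a set is open iff it meets every closed simplex in a relatively open set.
  Each closed simplex carries its Euclidean topology, which is induced from the product
  topology on functions, since only finitely many coordinates are nonzero.\<close>

definition realization :: "'a set set \<Rightarrow> ('a \<Rightarrow> real) topology" where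
  "realization X = topology (\<lambda>U. U \<subseteq> realization_points X \<and>
     (\<forall>\<sigma>\<in>X. openin (top_of_set (closed_simplex X \<sigma>)) (U \<inter> closed_simplex X \<sigma>)))"

lemma openin_realization:
  "openin (realization X) U \<longleftrightarrow> U \<subseteq> realization_points X \<and>
     (\<forall>\<sigma>\<in>X. openin (top_of_set (closed_simplex X \<sigma>)) (U \<inter> closed_simplex X \<sigma>))"
proof -
  let ?P = "\<lambda>U. U \<subseteq> realization_points X \<and>
     (\<forall>\<sigma>\<in>X. openin (top_of_set (closed_simplex X \<sigma>)) (U \<inter> closed_simplex X \<sigma>))"
  have "istopology ?P"
    unfolding istopology_def
  proof (intro conjI allI impI)
    fix U V assume U: "?P U" and V: "?P V"
    show "U \<inter> V \<subseteq> realization_points X" using U by blast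
    show "\<forall>\<sigma>\<in>X. openin (top_of_set (closed_simplex X \<sigma>)) (U \<inter> V \<inter> closed_simplex X \<sigma>)"
    proof
      fix \<sigma> assume "\<sigma> \<in> X"
      then have "openin (top_of_set (closed_simplex X \<sigma>))
          ((U \<inter> closed_simplex X \<sigma>) \<inter> (V \<inter> closed_simplex X \<sigma>))"
        using U V by (blast intro: openin_Int)
      then show "openin (top_of_set (closed_simplex X \<sigma>)) (U \<inter> V \<inter> closed_simplex X \<sigma>)"
        by (simp add: Int_ac)
    qed
  next
    fix K assume K: "\<forall>U\<in>K. ?P U"
    then show "\<Union>K \<subseteq> realization_points X" by blast
    show "\<forall>\<sigma>\<in>X. openin (top_of_set (closed_simplex X \<sigma>)) (\<Union>K \<inter> closed_simplex X \<sigma>)"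
    proof
      fix \<sigma> assume "\<sigma> \<in> X"
      then have "openin (top_of_set (closed_simplex X \<sigma>)) (\<Union>U\<in>K. U \<inter> closed_simplex X \<sigma>)"
        using K by (intro openin_Union) auto
      then show "openin (top_of_set (closed_simplex X \<sigma>)) (\<Union>K \<inter> closed_simplex X \<sigma>)"
        by (simp add: Int_commute Int_Union)
    qed
  qed
  then show ?thesis
    unfolding realization_def by (simp add: topology_inverse')
qed

lemma topspace_realization [simp]: "topspace (realization X) = realization_points X"
proof
  show "topspace (realization X) \<subseteq> realization_points X"
    using openin_realization[of X "topspace (realization X)"] by simp
  have "openin (realization X) (realization_points X)"
  proof -
    have "realization_points X \<inter> closed_simplex X \<sigma> = closed_simplex X \<sigma>" for \<sigma>
      by (auto simp: closed_simplex_def)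
    then show ?thesis by (simp add: openin_realization)
  qed
  then show "realization_points X \<subseteq> topspace (realization X)"
    by (rule openin_subset)
qed

text \<open>The map of realizations induced by a vertex map.\<close>

definition realization_map :: "('a \<Rightarrow> 'b) \<Rightarrow> ('a \<Rightarrow> real) \<Rightarrow> ('b \<Rightarrow> real)" where
  "realization_map f x = (\<lambda>w. \<Sum>v | v \<in> support x \<and> f v = w. x v)"

text \<open>This is the analogue of \<^const>\<open>simply_connected\<close> for abstract topological spaces.\<close>

definition simply_connected_space :: "'b topology \<Rightarrow> bool" where
  "simply_connected_space T \<longleftrightarrow>
     (\<forall>p q. pathin T p \<and> p 1 = p 0 \<and> pathin T q \<and> q 1 = q 0 \<longrightarrow>
        homotopic_with (\<lambda>r. r 1 = r 0) (top_of_set {0..1}) T p q)"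


section \<open>Systolic complexes and geometric actions\<close>

text \<open>For \<^const>\<open>connected_space\<close> and \<^const>\<open>simply_connected_space\<close> the empty space qualifies,
  so nonemptiness is required separately. (Every group acts geometrically on the empty complex.)\<close>

definition systolic_complex :: "'a set set \<Rightarrow> bool" where
  "systolic_complex X \<longleftrightarrow> simplicial_complex X \<and> X \<noteq> {} \<and>
     connected_space (realization X) \<and> simply_connected_space (realization X) \<and>
     (\<forall>v\<in>vertices X. k_large 6 (link X v))"

definition simplicial_automorphism :: "'a set set \<Rightarrow> ('a \<Rightarrow> 'a) \<Rightarrow> bool" where
  "simplicial_automorphism X f \<longleftrightarrow> bij_betw f (vertices X) (vertices X) \<and>
     (\<forall>\<sigma>. \<sigma> \<subseteq> vertices X \<longrightarrow> (f ` \<sigma> \<in> X \<longleftrightarrow> \<sigma> \<in> X))"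

definition properly_discontinuous ::
    "('g, 'm) monoid_scheme \<Rightarrow> 'b topology \<Rightarrow> ('g \<Rightarrow> 'b \<Rightarrow> 'b) \<Rightarrow> bool" where
  "properly_discontinuous G T act \<longleftrightarrow>
     (\<forall>K. compactin T K \<longrightarrow> finite {g \<in> carrier G. act g ` K \<inter> K \<noteq> {}})"

definition cocompact ::
    "('g, 'm) monoid_scheme \<Rightarrow> 'b topology \<Rightarrow> ('g \<Rightarrow> 'b \<Rightarrow> 'b) \<Rightarrow> bool" where
  "cocompact G T act \<longleftrightarrow> (\<exists>K. compactin T K \<and> (\<Union>g\<in>carrier G. act g ` K) = topspace T)"

definition geometric_action ::
    "('g, 'm) monoid_scheme \<Rightarrow> 'a set set \<Rightarrow> ('g \<Rightarrow> 'a \<Rightarrow> 'a) \<Rightarrow> bool" where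
  "geometric_action G X \<phi> \<longleftrightarrow>
     group_action G (vertices X) \<phi> \<and>
     (\<forall>g\<in>carrier G. simplicial_automorphism X (\<phi> g)) \<and>
     properly_discontinuous G (realization X) (\<lambda>g. realization_map (\<phi> g)) \<and>
     cocompact G (realization X) (\<lambda>g. realization_map (\<phi> g))"

text \<open>The type argument is the type of vertices; a group is systolic if this holds for some
  type of vertices.\<close>

definition systolic_group :: "'a itself \<Rightarrow> ('g, 'm) monoid_scheme \<Rightarrow> bool" where
  "systolic_group (_ :: 'a itself) G \<longleftrightarrow>
     (\<exists>(X :: 'a set set) \<phi>. systolic_complex X \<and> geometric_action G X \<phi>)"


section \<open>Groups given by a presentation\<close>

text \<open>A letter \<open>(x, True)\<close> stands for the generator \<open>x\<close> and \<open>(x, False)\<close> for its formal inverse;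
  all elements of the type of \<open>x\<close> are generators.\<close>

type_synonym 'x word = "('x \<times> bool) list"

inductive pres_eq :: "'x word set \<Rightarrow> 'x word \<Rightarrow> 'x word \<Rightarrow> bool" for R where
  refl: "pres_eq R w w"
| sym: "pres_eq R v w \<Longrightarrow> pres_eq R w v"
| trans: "pres_eq R u v \<Longrightarrow> pres_eq R v w \<Longrightarrow> pres_eq R u w"
| cancel: "pres_eq R (u @ [(x, b), (x, \<not> b)] @ v) (u @ v)"
| relator: "w \<in> R \<Longrightarrow> pres_eq R (u @ w @ v) (u @ v)"

definition pres_class :: "'x word set \<Rightarrow> 'x word \<Rightarrow> 'x word set" where
  "pres_class R w = {v. pres_eq R w v}"

definition presented_group :: "'x word set \<Rightarrow> 'x word set monoid" where
  "presented_group R =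
     \<lparr>carrier = range (pres_class R),
      monoid.mult = (\<lambda>A B. \<Union>u\<in>A. \<Union>v\<in>B. pres_class R (u @ v)),
      one = pres_class R []\<rparr>"

lemma pres_eq_append_cong:
  assumes "pres_eq R u u'" and "pres_eq R v v'"
  shows "pres_eq R (u @ v) (u' @ v')"
proof -
  have left: "pres_eq R (a @ w) (a @ w')" if "pres_eq R w w'" for a w w'
    using that
  proof induction
    case (cancel u x b v)
    show ?case using pres_eq.cancel[of R "a @ u" x b v] by simp
  next
    case (relator w u v)
    then show ?case using pres_eq.relator[of w R "a @ u" v] by simp
  qed (simp add: pres_eq.refl, rule pres_eq.sym, assumption, rule pres_eq.trans, assumption+)
  have right: "pres_eq R (w @ a) (w' @ a)" if "pres_eq R w w'" for a w w'
    using that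
  proof induction
    case (cancel u x b v)
    show ?case using pres_eq.cancel[of R u x b "v @ a"] by simp
  next
    case (relator w u v)
    then show ?case using pres_eq.relator[of w R u "v @ a"] by simp
  qed (simp add: pres_eq.refl, rule pres_eq.sym, assumption, rule pres_eq.trans, assumption+)
  show ?thesis
    using right[OF assms(1)] left[OF assms(2)] by (rule pres_eq.trans)
qed

lemma pres_class_eq_iff: "pres_class R u = pres_class R v \<longleftrightarrow> pres_eq R u v"
proof
  assume "pres_class R u = pres_class R v"
  moreover have "v \<in> pres_class R v" by (simp add: pres_class_def pres_eq.refl)
  ultimately have "v \<in> pres_class R u" by simp
  then show "pres_eq R u v" by (simp add: pres_class_def)
next
  assume uv: "pres_eq R u v"
  have "pres_eq R u w \<longleftrightarrow> pres_eq R v w" for w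
    by (rule iffI) (fact pres_eq.trans[OF pres_eq.sym[OF uv]], fact pres_eq.trans[OF uv])
  then show "pres_class R u = pres_class R v" by (simp add: pres_class_def)
qed

lemma presented_group_mult:
  "pres_class R u \<otimes>\<^bsub>presented_group R\<^esub> pres_class R v = pres_class R (u @ v)"
proof -
  have "pres_class R (a @ b) = pres_class R (u @ v)"
    if "a \<in> pres_class R u" "b \<in> pres_class R v" for a b
    unfolding pres_class_eq_iff using that
    by (intro pres_eq.sym[OF pres_eq_append_cong]) (simp_all add: pres_class_def)
  moreover have "u \<in> pres_class R u" "v \<in> pres_class R v"
    by (simp_all add: pres_class_def pres_eq.refl)
  ultimately have "(\<Union>a\<in>pres_class R u. \<Union>b\<in>pres_class R v. pres_class R (a @ b)) =
      pres_class R (u @ v)"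
    by blast
  then show ?thesis
    by (simp add: presented_group_def)
qed

lemma pres_eq_inverse: "pres_eq R (rev (map (\<lambda>(x, b). (x, \<not> b)) w) @ w) []"
proof (induction w)
  case Nil
  show ?case by (simp add: pres_eq.refl)
next
  case (Cons l w)
  obtain x b where l: "l = (x, b)" by (cases l)
  have "pres_eq R (rev (map (\<lambda>(x, b). (x, \<not> b)) w) @ [(x, \<not> b), (x, \<not> \<not> b)] @ w)
          (rev (map (\<lambda>(x, b). (x, \<not> b)) w) @ w)"
    by (rule pres_eq.cancel)
  then have "pres_eq R (rev (map (\<lambda>(x, b). (x, \<not> b)) w) @ [(x, \<not> b), (x, \<not> \<not> b)] @ w) []"
    using Cons.IH by (rule pres_eq.trans)
  then show ?case
    by (simp add: l)
qed

lemma group_presented_group: "group (presented_group R)"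
proof (rule groupI)
  let ?G = "presented_group R"
  have carr: "carrier ?G = range (pres_class R)" and one: "\<one>\<^bsub>?G\<^esub> = pres_class R []"
    by (simp_all add: presented_group_def)
  show "\<one>\<^bsub>?G\<^esub> \<in> carrier ?G"
    by (simp add: carr one)
  show "x \<otimes>\<^bsub>?G\<^esub> y \<in> carrier ?G" if "x \<in> carrier ?G" "y \<in> carrier ?G" for x y
    using that by (auto simp: carr presented_group_mult)
  show "x \<otimes>\<^bsub>?G\<^esub> y \<otimes>\<^bsub>?G\<^esub> z = x \<otimes>\<^bsub>?G\<^esub> (y \<otimes>\<^bsub>?G\<^esub> z)"
    if "x \<in> carrier ?G" "y \<in> carrier ?G" "z \<in> carrier ?G" for x y z
    using that by (auto simp: carr presented_group_mult)
  show "\<one>\<^bsub>?G\<^esub> \<otimes>\<^bsub>?G\<^esub> x = x" if "x \<in> carrier ?G" for x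
    using that by (auto simp: carr one presented_group_mult)
  show "\<exists>y\<in>carrier ?G. y \<otimes>\<^bsub>?G\<^esub> x = \<one>\<^bsub>?G\<^esub>" if "x \<in> carrier ?G" for x
  proof -
    obtain w where x: "x = pres_class R w" using \<open>x \<in> carrier ?G\<close> unfolding carr by blast
    have "pres_class R (rev (map (\<lambda>(x, b). (x, \<not> b)) w)) \<otimes>\<^bsub>?G\<^esub> x = \<one>\<^bsub>?G\<^esub>"
      by (simp add: x one presented_group_mult pres_class_eq_iff pres_eq_inverse)
    then show ?thesis by (auto simp: carr)
  qed
qed

datatype triangle_gen = gen_r | gen_s | gen_t

definition word_power :: "'x list \<Rightarrow> nat \<Rightarrow> 'x word" where
  "word_power xs n = concat (replicate n (map (\<lambda>x. (x, True)) xs))"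

definition triangle_relators :: "nat \<Rightarrow> nat \<Rightarrow> nat \<Rightarrow> triangle_gen word set" where
  "triangle_relators i j k =
     {word_power [gen_r] 2, word_power [gen_s] 2, word_power [gen_t] 2,
      word_power [gen_r, gen_s] i, word_power [gen_s, gen_t] j, word_power [gen_r, gen_t] k}"

definition triangle_group :: "nat \<Rightarrow> nat \<Rightarrow> nat \<Rightarrow> triangle_gen word set monoid" where
  "triangle_group i j k = presented_group (triangle_relators i j k)"

end

theory Submission
  imports Defs "HOL-Library.FSet"
begin

text \<open>Both groups contain elements \<open>\<alpha>\<close>, \<open>\<beta>\<close> of order five such that \<open>\<alpha> \<beta>\<close> has order two and \<open>\<alpha> \<beta>\<^sup>-\<^sup>1\<close> has infinite
  order: \<open>\<alpha> = rt\<close>, \<open>\<beta> = ts\<close> for \<open>j = 5\<close>, and \<open>\<alpha> = rt\<close> with \<open>\<beta>\<close> its conjugate by \<open>ts\<close> for \<open>j = 4\<close>. Since simplices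
  have finite stabilizers under a geometric action, it suffices that two such automorphisms of a systolic complex
  always preserve a common simplex.

  Comparing the complex with its universal cover, built level by level, shows that its 1-skeleton is bridged: the
  vertices of a simplex in a sphere have a common neighbour closer to the centre, and the neighbours of a vertex closer
  to the centre span a simplex. The complex whose vertices are the simplices has the same properties, so fixed
  vertices are wanted. An Euler characteristic count modulo five gives invariant simplices of \<open>\<alpha>\<close> and of
  \<open>\<beta>\<close> separately; let \<open>N\<close> be the least distance between a vertex moved by at most one by \<open>\<alpha>\<close> and one moved by at most
  one by \<open>\<beta>\<close>. If \<open>N > 0\<close>, the relation \<open>(\<alpha> \<beta>)\<^sup>2 = 1\<close> turns a path realizing \<open>N\<close> into a ring around the orbit of its
  end that is periodic under \<open>\<alpha>\<close>. Minimality of \<open>N\<close> keeps this ring far away from the orbit, and pushing a ring towards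
  the orbit shortens it by two per level, at two different places. The ring in question is too short for this, or it
  could be shortened at a single place only.\<close>

section \<open>Bridged graphs\<close>

text \<open>The members of a pair at distance \<open>N\<close> need not be fixed, and this shapes
  the argument. Going around an end \<open>z\<close> that \<open>x\<close> moves costs an extra edge
  from \<open>y z\<close> to \<open>y (x z)\<close>, and the clique \<open>orb z\<close> replaces a
  single centre; the number \<open>e\<close> in the ring bounds tells the two cases apart. If the
  other end is moved by \<open>y\<close>, its translates lie one level further out, so the ring runs
  at level \<open>N + 1\<close> and its lift has to pass through that end. Prescribing this value
  may cost one of the two places of shortening, so equality has to be excluded by an exchange. The
  end is chosen as a largest simplex, so that joins of adjacent candidates contradict the choice.
  One degenerate configuration remains: \<open>z\<close> and its translate are both at distance
  \<open>N\<close>. Then the extra edge can be avoided, and a further minimal choice keeps the ring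
  away from the vertices that would spoil the bound. Order five enters through pentagons: the steps
  of an orbit form one, and so do its double steps, so an automorphism and its square move the same
  vertices by at most one.\<close>

locale metric_graph =
  fixes V :: "'a set" and d :: "'a \<Rightarrow> 'a \<Rightarrow> nat"
  assumes d_sym: "d a b = d b a"
    and d_refl [simp]: "d a a = 0"
    and d_zero: "a \<in> V \<Longrightarrow> b \<in> V \<Longrightarrow> d a b = 0 \<Longrightarrow> a = b"
    and d_tri: "a \<in> V \<Longrightarrow> b \<in> V \<Longrightarrow> c \<in> V \<Longrightarrow> d a c \<le> d a b + d b c"
    and d_geo: "a \<in> V \<Longrightarrow> b \<in> V \<Longrightarrow> d a b = Suc n \<Longrightarrow> \<exists>c\<in>V. d a c = 1 \<and> d c b = n"
begin

definition E :: "'a \<Rightarrow> 'a \<Rightarrow> bool" where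
  "E a b \<longleftrightarrow> a \<in> V \<and> b \<in> V \<and> d a b = 1"

definition A :: "'a \<Rightarrow> 'a \<Rightarrow> bool" where
  "A a b \<longleftrightarrow> a \<in> V \<and> b \<in> V \<and> d a b \<le> 1"

lemma A_refl [simp]: "A a a \<longleftrightarrow> a \<in> V"
  by (simp add: A_def)

lemma A_sym: "A a b \<Longrightarrow> A b a"
  by (simp add: A_def d_sym)

lemma E_sym: "E a b \<Longrightarrow> E b a"
  by (simp add: E_def d_sym)

lemma E_irrefl [simp]: "\<not> E a a"
  by (simp add: E_def)

lemma AV: "A a b \<Longrightarrow> a \<in> V" "A a b \<Longrightarrow> b \<in> V"
  by (simp_all add: A_def)

lemma EV: "E a b \<Longrightarrow> a \<in> V" "E a b \<Longrightarrow> b \<in> V"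
  by (simp_all add: E_def)

lemma EA: "E a b \<Longrightarrow> A a b"
  by (simp add: A_def E_def)

lemma A_iff: "A a b \<longleftrightarrow> E a b \<or> a = b \<and> a \<in> V"
  using d_zero by (auto simp: A_def E_def le_Suc_eq)

lemma A_neq: "A a b \<Longrightarrow> a \<noteq> b \<Longrightarrow> E a b"
  by (simp add: A_iff)

lemma d_A: "A b c \<Longrightarrow> a \<in> V \<Longrightarrow> d a c \<le> Suc (d a b)" "A b c \<Longrightarrow> a \<in> V \<Longrightarrow> d c a \<le> Suc (d b a)"
  using d_tri[of a b c] d_tri[of c b a] by (auto simp: A_def d_sym)

lemma d_E: "E b c \<Longrightarrow> a \<in> V \<Longrightarrow> d a c \<le> Suc (d a b)" "E b c \<Longrightarrow> a \<in> V \<Longrightarrow> d c a \<le> Suc (d b a)"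
  using d_A EA by blast+

lemma d_geo': "a \<in> V \<Longrightarrow> b \<in> V \<Longrightarrow> d a b = Suc n \<Longrightarrow> \<exists>c. E b c \<and> d a c = n"
  using d_geo[of b a n] by (auto simp: d_sym E_def)

text \<open>A walk carries a predicate on its vertices, so that a condition such as staying away
  from certain vertices can be followed while the walk is shortened.\<close>

definition wk :: "('a \<Rightarrow> bool) \<Rightarrow> nat \<Rightarrow> 'a \<Rightarrow> 'a \<Rightarrow> bool" where
  "wk Q n a b \<longleftrightarrow> (\<exists>p. p 0 = a \<and> p n = b \<and> (\<forall>k\<le>n. p k \<in> V \<and> Q (p k)) \<and> (\<forall>k<n. E (p k) (p (Suc k))))"

lemma wk_0: "wk Q 0 a b \<longleftrightarrow> a = b \<and> a \<in> V \<and> Q a"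
  unfolding wk_def by (auto intro: exI[of _ "\<lambda>_. a"])

lemma wk_Suc: "wk Q (Suc n) a b \<longleftrightarrow> a \<in> V \<and> Q a \<and> (\<exists>c. E a c \<and> wk Q n c b)"
proof
  assume "wk Q (Suc n) a b"
  then obtain p where p: "p 0 = a" "p (Suc n) = b" "\<forall>k\<le>Suc n. p k \<in> V \<and> Q (p k)"
    "\<forall>k<Suc n. E (p k) (p (Suc k))" unfolding wk_def by auto
  then have "wk Q n (p 1) b"
    unfolding wk_def by (intro exI[of _ "\<lambda>k. p (Suc k)"]) simp
  moreover have "E a (p 1)" "a \<in> V" "Q a" using p by auto
  ultimately show "a \<in> V \<and> Q a \<and> (\<exists>c. E a c \<and> wk Q n c b)" by blast
next
  assume "a \<in> V \<and> Q a \<and> (\<exists>c. E a c \<and> wk Q n c b)"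
  then obtain c p where c: "a \<in> V" "Q a" "E a c" and p: "p 0 = c" "p n = b" "\<forall>k\<le>n. p k \<in> V \<and> Q (p k)"
    "\<forall>k<n. E (p k) (p (Suc k))" unfolding wk_def by auto
  show "wk Q (Suc n) a b"
    unfolding wk_def
    by (intro exI[of _ "\<lambda>k. case k of 0 \<Rightarrow> a | Suc k \<Rightarrow> p k"])
      (use c p in \<open>auto simp: less_Suc_eq_0_disj le_Suc_eq split: nat.split\<close>)
qed

lemma wk_trans: "wk Q m a b \<Longrightarrow> wk Q n b c \<Longrightarrow> wk Q (m + n) a c"
  by (induction m arbitrary: a) (auto simp: wk_0 wk_Suc)

lemma wk_ends: "wk Q n a b \<Longrightarrow> a \<in> V \<and> b \<in> V \<and> Q a \<and> Q b"
  unfolding wk_def by auto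

lemma wk_A: "A a b \<Longrightarrow> Q a \<Longrightarrow> Q b \<Longrightarrow> \<exists>n\<le>1. wk Q n a b"
proof (cases "a = b")
  case True
  assume "A a b" "Q a"
  then have "wk Q 0 a b" using True by (auto simp: wk_0)
  then show ?thesis by blast
next
  case False
  assume "A a b" "Q a" "Q b"
  then have "wk Q 1 a b" using False A_neq[of a b] EV[of a b] by (auto simp: wk_0 wk_Suc)
  then show ?thesis by blast
qed

lemma wkI: "i \<le> j \<Longrightarrow> (\<And>k. i \<le> k \<Longrightarrow> k \<le> j \<Longrightarrow> p k \<in> V \<and> Q (p k)) \<Longrightarrow>
    (\<And>k. i \<le> k \<Longrightarrow> k < j \<Longrightarrow> E (p k) (p (Suc k))) \<Longrightarrow> wk Q (j - i) (p i) (p j)"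
  unfolding wk_def by (intro exI[of _ "\<lambda>k. p (i + k)"]) auto

lemma wk_mono: "wk Q n a b \<Longrightarrow> (\<And>v. v \<in> V \<Longrightarrow> Q v \<Longrightarrow> Q' v) \<Longrightarrow> wk Q' n a b"
  unfolding wk_def by blast

lemma wk_snoc: "wk Q n a b \<Longrightarrow> E b c \<Longrightarrow> Q c \<Longrightarrow> wk Q (Suc n) a c"
  using wk_trans[of Q n a b 1 c] EV[of b c] wk_ends[of Q n a b] by (simp add: wk_0 wk_Suc)

lemma wk_rev: "wk Q n a b \<Longrightarrow> wk Q n b a"
proof (induction n arbitrary: a)
  case (Suc n)
  then obtain c where "a \<in> V" "Q a" "E a c" "wk Q n c b" by (auto simp: wk_Suc)
  then show ?case using wk_snoc[OF Suc.IH E_sym] by blast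
qed (auto simp: wk_0)

lemma geodesic: "a \<in> V \<Longrightarrow> b \<in> V \<Longrightarrow> wk (\<lambda>v. d a v + d v b = d a b) (d a b) a b"
proof (induction "d a b" arbitrary: a)
  case 0
  then have "a = b" using d_zero[of a b] by simp
  then show ?case using 0 by (simp add: wk_0)
next
  case (Suc n)
  then obtain c where c: "c \<in> V" "d a c = 1" "d c b = n" using d_geo[of a b n] by auto
  have "wk (\<lambda>v. d c v + d v b = d c b) n c b" using Suc.hyps(1)[of c] Suc.prems c by simp
  then have "wk (\<lambda>v. d a v + d v b = d a b) n c b"
  proof (rule wk_mono)
    fix v assume v: "v \<in> V" "d c v + d v b = d c b"
    show "d a v + d v b = d a b"
      using d_tri[of a c v] d_tri[of a v b] v c Suc.prems Suc.hyps(2) by simp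
  qed
  moreover have "E a c" using c Suc.prems by (simp add: E_def)
  ultimately have "wk (\<lambda>v. d a v + d v b = d a b) (Suc n) a b" using Suc.prems by (auto simp: wk_Suc)
  then show ?case using Suc.hyps(2) by simp
qed

end

text \<open>\<open>B1\<close> and \<open>B2\<close> are the conditions on lower neighbours that hold
  around every centre in a simply connected complex with 6-large links. \<open>C5\<close> is stated
  for the reflexive relation \<open>A\<close>, so that degenerate pentagons need no case
  distinction; the condition for squares follows from \<open>B1\<close>.\<close>

locale bridged = metric_graph +
  assumes B1: "c \<in> V \<Longrightarrow> E v u \<Longrightarrow> E v w \<Longrightarrow> d c v = Suc n \<Longrightarrow> d c u = n \<Longrightarrow> d c w = n \<Longrightarrow> A u w"
    and B2: "c \<in> V \<Longrightarrow> E u w \<Longrightarrow> d c u = Suc n \<Longrightarrow> d c w = Suc n \<Longrightarrow>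
      \<exists>v. E u v \<and> E w v \<and> d c v = n"
    and C5: "A a b \<Longrightarrow> A b c \<Longrightarrow> A c e \<Longrightarrow> A e f \<Longrightarrow> A f a \<Longrightarrow>
      A a c \<or> A a e \<or> A b e \<or> A b f \<or> A c f"
begin

text \<open>If the first diagonal is missing, \<open>a\<close> and \<open>c\<close> have distance
  two, and \<open>b\<close> and \<open>e\<close> are two neighbours of \<open>c\<close> closer to
  \<open>a\<close>, to which \<open>B1\<close> applies.\<close>

lemma C4:
  assumes "A a b" "A b c" "A c e" "A e a"
  shows "A a c \<or> A b e"
proof (rule ccontr)
  assume neg: "\<not> (A a c \<or> A b e)"
  have V: "a \<in> V" "b \<in> V" "c \<in> V" "e \<in> V"
    using assms AV by blast+
  have ne: "a \<noteq> b" "b \<noteq> c" "c \<noteq> e" "e \<noteq> a"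
    using neg assms A_sym by auto
  have "d a c = 2"
    using neg V d_tri[of a b c] assms by (auto simp: A_def)
  moreover have "d a b = 1" "d a e = 1" "E c b" "E c e"
    using assms ne A_neq[of a b] A_neq[of e a] A_neq[of b c] A_neq[of c e] E_sym
    by (auto simp: E_def d_sym)
  ultimately show False
    using B1[of a c b e 1] V neg by auto
qed

text \<open>A strip between two edges cannot be twisted. A neighbour \<open>y\<close> of
  \<open>u'\<close> on the way to \<open>c'\<close> is, like \<open>u\<close>, closer to
  \<open>c\<close> than \<open>u'\<close>; so \<open>u\<close> and \<open>y\<close> are adjacent,
  and \<open>u\<close> is too close to \<open>c'\<close>.\<close>

lemma strip:
  assumes "E c c'" "E u u'" "d u c = Suc n" "d u' c' = Suc n" "d u c' = Suc (Suc n)"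
    "d u' c = Suc (Suc n)"
  shows False
proof -
  have V: "c \<in> V" "c' \<in> V" "u \<in> V" "u' \<in> V" using assms EV by blast+
  obtain y where y: "E u' y" "d c' y = n"
    using d_geo'[of c' u' n] V assms(4) by (auto simp: d_sym)
  have yV: "y \<in> V" using y EV by blast
  have "d c y \<le> Suc n"
    using d_E(2)[OF E_sym[OF assms(1)] yV] y by simp
  moreover have "Suc (Suc n) \<le> Suc (d c y)"
    using d_E(1)[OF E_sym[OF y(1)] V(1)] assms(6) by (simp add: d_sym)
  ultimately have "d c y = Suc n" by simp
  then have "A u y"
    using B1[of c u' u y "Suc n"] V y(1) assms E_sym by (simp add: d_sym)
  then have "d u c' \<le> Suc n"
    using d_A(1)[OF A_sym, of u y c'] y V by (simp add: d_sym)
  then show False using assms by simp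
qed

end

section \<open>Levels around a clique\<close>

locale bridged_clique = bridged +
  fixes Z :: "'a set"
  assumes Z_V: "Z \<subseteq> V" and Z_ne: "Z \<noteq> {}" and Z_cl: "a \<in> Z \<Longrightarrow> b \<in> Z \<Longrightarrow> A a b"
begin

definition lev :: "'a \<Rightarrow> nat" where
  "lev p = (LEAST n. \<exists>c\<in>Z. d p c = n)"

lemma lev_ex: "\<exists>c\<in>Z. d p c = lev p"
  unfolding lev_def by (rule LeastI_ex) (use Z_ne in blast)

lemma lev_le: "c \<in> Z \<Longrightarrow> lev p \<le> d p c"
  unfolding lev_def by (rule Least_le) blast

lemma lev_ge: "c \<in> Z \<Longrightarrow> p \<in> V \<Longrightarrow> d p c \<le> Suc (lev p)"
  using lev_ex[of p] d_A(1)[OF Z_cl] by metis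

lemma lev_A: "A p q \<Longrightarrow> lev q \<le> Suc (lev p)"
  using lev_ex[of p] lev_le[of _ q] d_A(2)[of p q] Z_V by (metis le_trans subsetD)

lemma lev_E: "E p q \<Longrightarrow> lev q \<le> Suc (lev p)"
  using lev_A EA by blast

lemma lev_d: "p \<in> V \<Longrightarrow> q \<in> V \<Longrightarrow> lev q \<le> lev p + d p q"
  using lev_ex[of p] lev_le[of _ q] d_tri[of q p] Z_V d_sym[of p q] by (metis add.commute le_trans subsetD)

lemma lev_0: "p \<in> V \<Longrightarrow> lev p = 0 \<longleftrightarrow> p \<in> Z"
  using lev_ex[of p] lev_le[of p p] d_zero Z_V by (metis d_refl le_zero_eq subsetD)

lemma lev_lower: "p \<in> V \<Longrightarrow> lev p = Suc n \<Longrightarrow> \<exists>q. E p q \<and> lev q = n"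
proof -
  assume p: "p \<in> V" "lev p = Suc n"
  then obtain c where c: "c \<in> Z" "d p c = Suc n" using lev_ex[of p] by auto
  then obtain q where q: "E p q" "d c q = n"
    using d_geo'[of c p n] p Z_V by (auto simp: d_sym)
  then have "lev q \<le> n" using lev_le[OF c(1), of q] by (simp add: d_sym)
  then show ?thesis
    using q lev_E[OF E_sym[OF q(1)]] p by auto
qed

lemma lev_far: "c \<in> Z \<Longrightarrow> p \<in> V \<Longrightarrow> d p c \<noteq> lev p \<Longrightarrow> d p c = Suc (lev p)"
  using lev_ge lev_le by (metis le_SucE le_antisym)

text \<open>If \<open>u\<close> and \<open>w\<close> have a common nearest vertex in
  \<open>Z\<close>, this is \<open>B2\<close>. Otherwise their nearest vertices span an edge, and
  the distances are those excluded by \<open>strip\<close>.\<close>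

lemma B2':
  assumes "E u w" "lev u = Suc n" "lev w = Suc n"
  shows "\<exists>v. E u v \<and> E w v \<and> lev v = n"
proof -
  have V: "u \<in> V" "w \<in> V" using assms EV by blast+
  have fin: ?thesis if "c \<in> Z" "d u c = Suc n" "d w c = Suc n" for c
  proof -
    have "c \<in> V" "d c u = Suc n" "d c w = Suc n" using that Z_V d_sym[of c] by auto
    then obtain v where v: "E u v" "E w v" "d c v = n"
      using B2 assms(1) by blast
    then have "lev v \<le> n" using lev_le[OF that(1), of v] by (simp add: d_sym)
    then show ?thesis using v lev_E[OF E_sym[OF v(1)]] assms by auto
  qed
  obtain c where c: "c \<in> Z" "d u c = Suc n" using lev_ex[of u] assms by auto
  obtain c' where c': "c' \<in> Z" "d w c' = Suc n" using lev_ex[of w] assms by auto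
  show ?thesis
  proof (cases "d u c' = Suc n \<or> d w c = Suc n")
    case True then show ?thesis using fin c c' by blast
  next
    case False
    then have 1: "d u c' = Suc (Suc n)" "d w c = Suc (Suc n)"
      using lev_far[OF c'(1) V(1)] lev_far[OF c(1) V(2)] assms by auto
    then have "c \<noteq> c'" using c by auto
    then have "E c c'" using Z_cl c c' A_neq by blast
    then show ?thesis using strip[of c c' u w n] assms c c' 1 by blast
  qed
qed

text \<open>If \<open>v\<close> and \<open>v'\<close> have no common nearest vertex, one more
  descent through \<open>m'\<close> gives vertices \<open>q\<close> and \<open>q'\<close> that are
  adjacent by induction, and the pentagon \<open>u v q q' v'\<close> admits no diagonal except the
  wanted one.\<close>

lemma B1':
  assumes "E u v" "E u v'" "lev u = Suc n" "lev v = n" "lev v' = n"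
  shows "A v v'"
  using assms
proof (induction n arbitrary: u v v')
  case 0
  then show ?case using lev_0 Z_cl EV by blast
next
  case (Suc n)
  have V: "u \<in> V" "v \<in> V" "v' \<in> V" using Suc.prems EV by blast+
  obtain c where c: "c \<in> Z" "d v c = Suc n" using lev_ex[of v] Suc.prems by auto
  obtain c' where c': "c' \<in> Z" "d v' c' = Suc n" using lev_ex[of v'] Suc.prems by auto
  have cV: "c \<in> V" "c' \<in> V" using c c' Z_V by auto
  have uc: "d u c = Suc (Suc n)" "d u c' = Suc (Suc n)"
    using lev_le[OF c(1), of u] lev_le[OF c'(1), of u] Suc.prems
      d_E(2)[OF E_sym[OF Suc.prems(1)] cV(1)] d_E(2)[OF E_sym[OF Suc.prems(2)] cV(2)] c c' by auto
  show ?case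
  proof (cases "d v c' = Suc n \<or> d v' c = Suc n")
    case True
    then show ?thesis
      using B1[OF cV(1) Suc.prems(1,2), of "Suc n"] B1[OF cV(2) Suc.prems(1,2), of "Suc n"] uc c c'
      by (auto simp: d_sym)
  next
    case False
    then have far: "d v c' = Suc (Suc n)" "d v' c = Suc (Suc n)"
      using lev_far[OF c'(1) V(2)] lev_far[OF c(1) V(3)] Suc.prems by auto
    obtain m' where m': "E u m'" "E v m'" "d c' m' = Suc n"
      using B2[OF cV(2) Suc.prems(1), of "Suc n"] uc far by (auto simp: d_sym)
    have mV: "m' \<in> V" using m' EV by blast
    have m'v': "A m' v'"
      using B1[OF cV(2) m'(1) Suc.prems(2), of "Suc n"] uc m' c' by (simp add: d_sym)
    obtain v1 where v1: "E v v1" "d c v1 = n" using d_geo'[of c v n] c cV V by (auto simp: d_sym)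
    have v1V: "v1 \<in> V" using v1 EV by blast
    have cc': "A c c'" using Z_cl c c' by blast
    have "d c' v1 = Suc n"
      using d_A(2)[OF cc' v1V] v1 d_E(2)[OF E_sym[OF v1(1)] cV(2)] far by (simp add: d_sym)
    then have "A m' v1"
      using B1[OF cV(2) m'(2) v1(1), of "Suc n"] far m' by (simp add: d_sym)
    then have "d c m' \<le> Suc n" using d_A(1)[OF A_sym, of m' v1 c] v1 cV by simp
    moreover have "lev m' \<ge> Suc n"
      using lev_E[OF E_sym[OF m'(1)]] Suc.prems by simp
    ultimately have m'c: "d m' c = Suc n" "lev m' = Suc n"
      using lev_le[OF c(1), of m'] by (simp_all add: d_sym)
    then have "m' \<noteq> v'" using far by auto
    then have m'v'E: "E m' v'" using m'v' A_neq by blast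
    obtain q where q: "E v q" "E m' q" "d c q = n"
      using B2[OF cV(1) m'(2), of n] c m'c by (auto simp: d_sym)
    obtain q' where q': "E m' q'" "E v' q'" "d c' q' = n"
      using B2[OF cV(2) m'v'E, of n] c' m' by (auto simp: d_sym)
    have "lev q = n" "lev q' = n"
      using lev_le[OF c(1), of q] lev_le[OF c'(1), of q'] lev_E[OF E_sym[OF q(1)]] lev_E[OF E_sym[OF q'(2)]]
        q q' Suc.prems by (auto simp: d_sym)
    then have "A q q'" using Suc.IH[OF q(2) q'(1)] m'c by simp
    moreover have "\<not> A u q" "\<not> A u q'"
      using lev_A A_sym \<open>lev q = n\<close> \<open>lev q' = n\<close> Suc.prems by fastforce+
    moreover have "\<not> A v q'"
    proof
      assume "A v q'"
      then have "d v c' \<le> Suc n" using d_A(2)[OF A_sym, of v q' c'] q' cV by (simp add: d_sym)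
      then show False using far by simp
    qed
    moreover have "\<not> A v' q"
    proof
      assume "A v' q"
      then have "d v' c \<le> Suc n" using d_A(2)[OF A_sym, of v' q c] q cV by (simp add: d_sym)
      then show False using far by simp
    qed
    ultimately show ?thesis
      using C5[of u v q q' v'] Suc.prems q q' EA E_sym A_sym by meson
  qed
qed

text \<open>A geodesic into a ball around the clique may be chosen to descend at once. By induction
  along a geodesic: a level first step is exchanged for a descent to a common lower neighbour, and a
  rising first step would leave a shortcut.\<close>

lemma dip:
  assumes "p \<in> V" "c \<in> V" "lev p = Suc n" "lev c \<le> n"
  shows "\<exists>s. E p s \<and> lev s = n \<and> Suc (d s c) = d p c"
  using assms
proof (induction "d p c" arbitrary: p n)
  case 0
  then show ?case using d_zero by force
next
  case (Suc m)
  obtain p1 where p1: "E p p1" "d c p1 = m"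
    using d_geo'[of c p m] Suc by (auto simp: d_sym)
  have p1V: "p1 \<in> V" using p1 EV by blast
  consider "lev p1 = n" | "lev p1 = Suc n" | "lev p1 = Suc (Suc n)"
    using lev_E[OF p1(1)] lev_E[OF E_sym[OF p1(1)]] Suc.prems by linarith
  then show ?case
  proof cases
    case 1 then show ?thesis using p1 Suc.hyps by (metis d_sym)
  next
    case 2
    obtain s1 where s1: "E p1 s1" "lev s1 = n" "Suc (d s1 c) = d p1 c"
      using Suc.hyps(1)[of p1 n] 2 p1 p1V Suc.prems by (auto simp: d_sym)
    obtain s0 where s0: "E p s0" "E p1 s0" "lev s0 = n"
      using B2'[OF p1(1)] Suc.prems 2 by blast
    have "A s0 s1" using B1'[OF s0(2) s1(1)] 2 s0 s1 by simp
    then have "d s0 c \<le> m" using d_A(2)[OF A_sym, of s0 s1 c] s1 p1 Suc.prems by (simp add: d_sym)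
    moreover have "d p c \<le> Suc (d s0 c)" using d_E(2)[OF E_sym[OF s0(1)]] Suc.prems by simp
    ultimately show ?thesis using s0 Suc.hyps by (metis le_antisym Suc_le_mono)
  next
    case 3
    obtain s1 where s1: "E p1 s1" "lev s1 = Suc n" "Suc (d s1 c) = d p1 c"
      using Suc.hyps(1)[of p1 "Suc n"] 3 p1 p1V Suc.prems by (auto simp: d_sym)
    have "A p s1" using B1'[OF E_sym[OF p1(1)] s1(1)] 3 Suc.prems s1 by simp
    then have "d p c \<le> m" using d_A(2)[OF A_sym, of p s1 c] s1 p1 Suc.prems by (simp add: d_sym)
    then show ?thesis using Suc.hyps by simp
  qed
qed

text \<open>The lower neighbour \<open>w\<close> of \<open>a\<close> that sees the most members of
  \<open>T\<close> sees all of them. If it misses \<open>b\<close>, take a common lower neighbour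
  \<open>w'\<close> of \<open>a\<close> and \<open>b\<close>: the squares \<open>b e w w'\<close>
  show that \<open>w'\<close> sees everything that \<open>w\<close> sees, and \<open>b\<close> in
  addition.\<close>

lemma clique_lower:
  assumes "finite T" "T \<noteq> {}" "T \<subseteq> V" "\<And>a b. a \<in> T \<Longrightarrow> b \<in> T \<Longrightarrow> A a b"
    "\<And>a. a \<in> T \<Longrightarrow> lev a = Suc n"
  shows "\<exists>v\<in>V. lev v = n \<and> (\<forall>a\<in>T. E a v)"
  using assms
proof (induction T rule: finite_ne_induct)
  case (singleton a)
  have "a \<in> V" "lev a = Suc n" using singleton by simp_all
  then obtain v where "E a v" "lev v = n" using lev_lower by blast
  then show ?case using EV(2) by auto
next
  case (insert a T)
  have a: "a \<in> V" "lev a = Suc n" using insert.prems by simp_all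
  have eq: "\<exists>w. E b w \<and> E a w \<and> lev w = n \<and> w \<in> V" if b: "b \<in> T" for b
  proof -
    have "A b a" "b \<noteq> a" "lev b = Suc n" using insert.prems(2)[of b a] insert.prems(3)[of b] b insert.hyps by auto
    then obtain w where "E b w" "E a w" "lev w = n" using B2'[of b a n] a A_neq by blast
    then show ?thesis using EV(2) by blast
  qed
  show ?case
  proof (cases "\<exists>v'\<in>V. lev v' = n \<and> E a v' \<and> (\<forall>b\<in>T. E b v')")
    case True then show ?thesis by blast
  next
    case False
    define S where "S w = {b\<in>T. E b w}" for w
    have fS: "finite (S w)" "card (S w) \<le> card T" for w
      unfolding S_def using insert.hyps by (auto intro: card_mono)
    obtain b0 where "b0 \<in> T" using insert.hyps by blast
    then obtain w0 where w0: "E a w0" "lev w0 = n" using eq[of b0] by auto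
    define w where "w = (ARG_MAX (card \<circ> S) w. E a w \<and> lev w = n)"
    have w: "E a w" "lev w = n" and wmax: "\<And>w'. E a w' \<Longrightarrow> lev w' = n \<Longrightarrow> card (S w') \<le> card (S w)"
      using arg_max_nat_lemma[of "\<lambda>w. E a w \<and> lev w = n" w0 "card \<circ> S" "Suc (card T)"] w0 fS(2)
      unfolding w_def by (auto simp: less_Suc_eq_le)
    have "S w \<noteq> T" using False w EV(2)[OF w(1)] unfolding S_def by auto
    then obtain b where b: "b \<in> T" "\<not> E b w" unfolding S_def by blast
    obtain w' where w': "E b w'" "E a w'" "lev w' = n" using eq[OF b(1)] by auto
    have "S w \<subseteq> S w'"
    proof
      fix e assume "e \<in> S w"
      then have e: "e \<in> T" "E e w" unfolding S_def by auto
      have "A w w'" using B1'[of a w w' n] w w' a by simp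
      moreover have "A b e" using insert.prems(2) b e by simp
      ultimately have "A b w \<or> A e w'"
        using C4[of b e w w'] EA[OF e(2)] A_sym[OF EA[OF w'(1)]] by simp
      moreover have "b \<noteq> w" "e \<noteq> w'"
        using insert.prems(3)[of b] insert.prems(3)[of e] b e w w' by auto
      ultimately show "e \<in> S w'" using b A_neq e unfolding S_def by blast
    qed
    moreover have "b \<in> S w'" "b \<notin> S w" using b w' unfolding S_def by auto
    ultimately have "card (S w) < card (S w')" using fS by (metis psubsetI psubset_card_mono)
    then show ?thesis using wmax w' by fastforce
  qed
qed

text \<open>A shortest walk above level \<open>n\<close> is pushed down to level \<open>n\<close> one excursion at a time:
  the edges of an excursion at level \<open>n + 1\<close> have common lower neighbours, which form a shorter walk.\<close>

lemma push_down:
  assumes Q: "\<And>v w. E v w \<Longrightarrow> Q v \<Longrightarrow> lev v = Suc (lev w) \<Longrightarrow> Q w"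
    and "wk (\<lambda>v. Q v \<and> lev v = Suc n) m a b" "E a a'" "E b b'" "lev a' = n" "lev b' = n"
  shows "\<exists>k\<le>Suc m. wk (\<lambda>v. Q v \<and> lev v = n) k a' b'"
  using assms(2-)
proof (induction m arbitrary: a a')
  case 0
  then have ab: "a = b" "Q a" "lev a = Suc n" by (auto simp: wk_0)
  then have "A a' b'" using B1'[of a a' b' n] 0 by simp
  moreover have "Q a'" "Q b'" using Q[of a a'] Q[of a b'] 0 ab by auto
  ultimately show ?case using wk_A[of a' b' "\<lambda>v. Q v \<and> lev v = n"] 0 by auto
next
  case (Suc m)
  then obtain c where c: "E a c" "wk (\<lambda>v. Q v \<and> lev v = Suc n) m c b" "Q a" "lev a = Suc n"
    by (auto simp: wk_Suc)
  then have lc: "lev c = Suc n" using wk_ends[OF c(2)] by blast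
  then obtain w where w: "E a w" "E c w" "lev w = n" using B2'[OF c(1)] c by blast
  obtain k where k: "k \<le> Suc m" "wk (\<lambda>v. Q v \<and> lev v = n) k w b'"
    using Suc.IH[OF c(2) w(2)] Suc.prems w by blast
  have "A a' w" using B1'[of a a' w n] Suc.prems w c by simp
  moreover have "Q a'" using Q[OF Suc.prems(2)] Suc.prems c by auto
  moreover have "Q w" using wk_ends[OF k(2)] by blast
  ultimately obtain j where j: "j \<le> 1" "wk (\<lambda>v. Q v \<and> lev v = n) j a' w"
    using wk_A[of a' w "\<lambda>v. Q v \<and> lev v = n"] Suc.prems w by auto
  have "wk (\<lambda>v. Q v \<and> lev v = n) (j + k) a' b'" using wk_trans[OF j(2) k(2)] .
  moreover have "j + k \<le> Suc (Suc m)" using j k by simp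
  ultimately show ?case by blast
qed

text \<open>The induction on the length treats all levels at once, since the inside of an excursion
  is straightened at level \<open>n + 1\<close>. Every excursion saves at least one edge, which
  makes the inequality strict.\<close>

lemma peel:
  assumes Q: "\<And>v w. E v w \<Longrightarrow> Q v \<Longrightarrow> lev v = Suc (lev w) \<Longrightarrow> Q w"
    and "\<And>k. k \<le> m \<Longrightarrow> Q (p k) \<and> n \<le> lev (p k)" "\<And>k. k < m \<Longrightarrow> E (p k) (p (Suc k))" "p m \<in> V"
    and "lev (p 0) = n" "lev (p m) = n"
  shows "(\<exists>k<m. wk (\<lambda>v. Q v \<and> lev v = n) k (p 0) (p m)) \<or> (\<forall>k\<le>m. lev (p k) = n)"
  using assms(2-)
proof (induction m arbitrary: n p rule: less_induct)
  case (less m)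
  let ?W = "\<lambda>n. wk (\<lambda>v. Q v \<and> lev v = n)"
  have V: "p k \<in> V" if "k \<le> m" for k
    using less.prems(2)[of k] less.prems(3) EV(1) that by (cases "k = m") auto
  have IH: "\<exists>k\<le>j - i. ?W l k (p i) (p j)"
    if "i \<le> j" "j \<le> m" "j - i < m" "lev (p i) = l" "lev (p j) = l"
      "\<And>k. i \<le> k \<Longrightarrow> k \<le> j \<Longrightarrow> l \<le> lev (p k)" for i j l
  proof -
    have "(\<exists>k<j - i. ?W l k (p (i + 0)) (p (i + (j - i)))) \<or> (\<forall>k\<le>j - i. lev (p (i + k)) = l)"
      using that less.prems V by (intro less.IH) auto
    then show ?thesis
    proof
      assume eq: "\<forall>k\<le>j - i. lev (p (i + k)) = l"
      have "lev (p k) = l" if "i \<le> k" "k \<le> j" for k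
        using that eq[rule_format, of "k - i"] by simp
      then have "?W l (j - i) (p i) (p j)"
        using that less.prems V by (intro wkI) auto
      then show ?thesis by blast
    next
      assume "\<exists>k<j - i. ?W l k (p (i + 0)) (p (i + (j - i)))"
      then show ?thesis using that(1) by (auto intro: less_imp_le)
    qed
  qed
  show ?case
  proof (cases "\<forall>k\<le>m. lev (p k) = n")
    case False
    then obtain k0 where k0: "k0 \<le> m" "lev (p k0) \<noteq> n" by blast
    define i where "i = Max {i. i \<le> k0 \<and> lev (p i) = n}"
    define j where "j = Min {j. k0 \<le> j \<and> j \<le> m \<and> lev (p j) = n}"
    have "i \<in> {i. i \<le> k0 \<and> lev (p i) = n}" unfolding i_def
      by (rule Max_in) (use less.prems in auto)
    then have i: "i < k0" "lev (p i) = n" using k0 by (auto simp: less_le)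
    have "j \<in> {j. k0 \<le> j \<and> j \<le> m \<and> lev (p j) = n}" unfolding j_def
      by (rule Min_in) (use less.prems k0 in auto)
    then have j: "k0 < j" "j \<le> m" "lev (p j) = n" using k0 by (auto simp: less_le)
    have above: "Suc n \<le> lev (p k)" if k: "i < k" "k < j" for k
    proof -
      have "lev (p k) \<noteq> n"
      proof
        assume eq: "lev (p k) = n"
        show False
        proof (cases "k \<le> k0")
          case True
          then have "k \<le> i" unfolding i_def using eq by (intro Max_ge) auto
          then show False using k by simp
        next
          case False
          then have "j \<le> k" unfolding j_def using eq k j by (intro Min_le) auto
          then show False using k by simp
        qed
      qed
      then show ?thesis using less.prems(1)[of k] k j by auto
    qed
    have e1: "E (p (Suc i)) (p i)" using less.prems(2)[of i] i j E_sym by auto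
    have e2: "E (p (j - 1)) (p j)" using less.prems(2)[of "j - 1"] i j by auto
    have l: "lev (p (Suc i)) = Suc n" "lev (p (j - 1)) = Suc n"
      using above[of "Suc i"] above[of "j - 1"] i j lev_E[OF E_sym[OF e1]] lev_E[OF E_sym[OF e2]] by auto
    have "\<exists>k\<le>j - 1 - Suc i. ?W (Suc n) k (p (Suc i)) (p (j - 1))"
      by (rule IH) (use l above i j in auto)
    then obtain k where k: "k \<le> j - 1 - Suc i" "?W (Suc n) k (p (Suc i)) (p (j - 1))" by blast
    have "\<exists>k'\<le>Suc k. ?W n k' (p i) (p j)"
      by (rule push_down[OF _ k(2) e1 e2 i(2) j(3)]) (rule Q)
    then obtain k' where k': "k' \<le> Suc k" "?W n k' (p i) (p j)" by blast
    have "\<exists>k\<le>i - 0. ?W n k (p 0) (p i)"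
      by (rule IH) (use less.prems i j in auto)
    then obtain k1 where k1: "k1 \<le> i" "?W n k1 (p 0) (p i)" by auto
    have "\<exists>k\<le>m - j. ?W n k (p j) (p m)"
      by (rule IH) (use less.prems i j in auto)
    then obtain k2 where k2: "k2 \<le> m - j" "?W n k2 (p j) (p m)" by blast
    have "?W n (k1 + k' + k2) (p 0) (p m)" using wk_trans[OF wk_trans[OF k1(2) k'(2)] k2(2)] .
    moreover have "k1 + k' + k2 < m" using k1 k' k2 k i j by linarith
    ultimately show ?thesis by blast
  qed blast
qed

text \<open>If all first steps of geodesics rise, so do the second steps: returning to the level of
  \<open>a\<close> would be a shortcut, and a level second step could be exchanged, through a common
  lower neighbour, for a first step that does not rise.\<close>

lemma rise:
  assumes "a \<in> V" "b \<in> V" "\<And>c. E a c \<Longrightarrow> d a b = Suc (d c b) \<Longrightarrow> lev c = Suc (lev a)"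
  shows "lev b = lev a + d a b"
  using assms
proof (induction "d a b" arbitrary: a)
  case 0 then show ?case using d_zero[of a b] by simp
next
  case (Suc m)
  obtain a1 where a1: "E a a1" "d a1 b = m" using d_geo[of a b m] Suc.prems(1,2) Suc.hyps(2) unfolding E_def by auto
  have l1: "lev a1 = Suc (lev a)" using Suc.prems(3)[OF a1(1)] a1 Suc.hyps by simp
  have "lev b = lev a1 + d a1 b"
  proof (rule Suc.hyps)
    show "a1 \<in> V" using a1 EV by blast
    fix c assume c: "E a1 c" "d a1 b = Suc (d c b)"
    have nA: "\<not> A a c"
    proof
      assume "A a c"
      then have "d a b \<le> Suc (d c b)" using d_A(2)[OF A_sym, of a c b] Suc.prems(2) by simp
      then show False using Suc.hyps(2) c(2) a1(2) by simp
    qed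
    have "lev c \<noteq> lev a"
      using B1'[OF E_sym[OF a1(1)] c(1)] l1 nA by auto
    moreover have "lev c \<noteq> lev a1"
    proof
      assume eq: "lev c = lev a1"
      then obtain w where w: "E a1 w" "E c w" "lev w = lev a" using B2'[OF c(1)] l1 by auto
      then have "A a w" using B1'[OF E_sym[OF a1(1)] w(1)] l1 by simp
      moreover have "a \<noteq> w" using w nA EA E_sym by blast
      ultimately have aw: "E a w" using A_neq by blast
      moreover have "d w b \<le> m" using d_E(2)[OF w(2), of b] Suc.prems(2) c(2) a1(2) by simp
      moreover have "d a b \<le> Suc (d w b)" using d_E(2)[OF E_sym[OF aw], of b] Suc.prems(2) by simp
      ultimately have "lev w = Suc (lev a)" using Suc.hyps(2) by (intro Suc.prems(3)) auto
      then show False using w by simp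
    qed
    ultimately show "lev c = Suc (lev a1)" using lev_E[OF c(1)] lev_E[OF E_sym[OF c(1)]] l1 by linarith
  qed (use a1 Suc.prems(2) in auto)
  then show ?case using l1 a1(2) Suc.hyps(2) by simp
qed

text \<open>The geodesic stays on level \<open>n\<close> as long as some first step allows it; once
  every first step rises, \<open>rise\<close> applies to the rest. The second alternative describes
  the rising part, where the level is determined by the distance to \<open>b\<close>.\<close>

lemma plateau_rise:
  assumes "a \<in> V" "b \<in> V" "lev a = n" "\<And>c. c \<in> V \<Longrightarrow> d a c + d c b = d a b \<Longrightarrow> n \<le> lev c"
  shows "wk (\<lambda>v. d a v + d v b = d a b \<and> (lev v = n \<or> lev b = lev v + d v b)) (d a b) a b"
  using assms
proof (induction "d a b" arbitrary: a)
  case 0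
  then have "a = b" using d_zero[of a b] by simp
  then show ?case using 0 by (simp add: wk_0)
next
  case (Suc m)
  show ?case
  proof (cases "\<forall>c. E a c \<longrightarrow> d a b = Suc (d c b) \<longrightarrow> lev c = Suc (lev a)")
    case True
    then have "lev b = lev a + d a b" using rise Suc.prems by blast
    then have "lev b = lev v + d v b" if "v \<in> V" "d a v + d v b = d a b" for v
      using lev_d[of a v] lev_d[of v b] that Suc.prems by simp
    then show ?thesis
      by (intro wk_mono[OF geodesic[OF Suc.prems(1,2)]]) auto
  next
    case False
    then obtain c where c: "E a c" "d a b = Suc (d c b)" "lev c \<noteq> Suc n" using Suc.prems by blast
    have cV: "c \<in> V" using c EV by blast
    have ac: "d a c = 1" using c by (simp add: E_def)
    have int: "d a v + d v b = d a b" if "v \<in> V" "d c v + d v b = d c b" for v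
      using d_tri[of a c v] d_tri[of a v b] that cV Suc.prems(1,2) c(2) ac by simp
    have lc: "lev c = n" using Suc.prems(4)[OF cV] lev_E[OF c(1)] ac c(2,3) Suc.prems(3) by auto
    have "wk (\<lambda>v. d c v + d v b = d c b \<and> (lev v = n \<or> lev b = lev v + d v b)) (d c b) c b"
      by (rule Suc.hyps) (use Suc.prems Suc.hyps(2) c cV int lc in auto)
    then have "wk (\<lambda>v. d a v + d v b = d a b \<and> (lev v = n \<or> lev b = lev v + d v b)) (d c b) c b"
      by (rule wk_mono) (use int in auto)
    then show ?thesis using c(1,2) Suc.prems(1,3) by (auto simp: wk_Suc)
  qed
qed

end

section \<open>Automorphisms of order five\<close>

locale rot5 = bridged +
  fixes x :: "'a \<Rightarrow> 'a"
  assumes xV [simp]: "x a \<in> V \<longleftrightarrow> a \<in> V"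
    and dx [simp]: "d (x a) (x b) = d a b"
    and x5 [simp]: "x (x (x (x (x a)))) = a"
begin

text \<open>The inverse of \<open>x\<close>.\<close>

definition g :: "'a \<Rightarrow> 'a" where
  "g a = x (x (x (x a)))"

lemma gx [simp]: "g (x a) = a" "x (g a) = a"
  by (simp_all add: g_def)

lemma gV [simp]: "g a \<in> V \<longleftrightarrow> a \<in> V"
  by (simp add: g_def)

lemma dg [simp]: "d (g a) (g b) = d a b"
  by (simp add: g_def)

lemma x_eq [simp]: "x a = x b \<longleftrightarrow> a = b"
  using gx(1) by metis

lemma g_eq [simp]: "g a = g b \<longleftrightarrow> a = b"
  using gx(2) by metis

lemma A_x [simp]: "A (x a) (x b) \<longleftrightarrow> A a b"
  by (simp add: A_def)

lemma E_x [simp]: "E (x a) (x b) \<longleftrightarrow> E a b"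
  by (simp add: E_def)

lemma A_g [simp]: "A (g a) (g b) \<longleftrightarrow> A a b"
  by (simp add: A_def)

lemma E_g [simp]: "E (g a) (g b) \<longleftrightarrow> E a b"
  by (simp add: E_def)

lemma A_gx: "A (g a) b \<longleftrightarrow> A a (x b)"
  using A_x[of "g a" b] by simp

definition M :: "'a set" where
  "M = {z \<in> V. A z (x z)}"

lemma M_iff: "z \<in> M \<longleftrightarrow> A z (x z)"
  using AV by (auto simp: M_def)

lemma M_iff_g: "z \<in> M \<longleftrightarrow> A (g z) z"
  unfolding M_iff A_gx ..

lemma M_V: "z \<in> M \<Longrightarrow> z \<in> V"
  by (simp add: M_def)

lemma M_x [simp]: "x z \<in> M \<longleftrightarrow> z \<in> M"
  by (simp add: M_iff)

lemma M_g [simp]: "g z \<in> M \<longleftrightarrow> z \<in> M"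
  using M_x[of "g z"] by simp

definition orb :: "'a \<Rightarrow> 'a set" where
  "orb z = {z, x z, x (x z), x (x (x z)), g z}"

lemma orb_self [simp]: "z \<in> orb z" "x z \<in> orb z" "g z \<in> orb z"
  by (simp_all add: orb_def)

lemma orb_x: "x ` orb z = orb z"
  by (auto simp: orb_def g_def)

lemma orb_g: "g ` orb z = orb z"
proof -
  have "g ` x ` orb z = orb z" by (simp add: image_image)
  then show ?thesis by (simp add: orb_x)
qed

lemma orb_trans: "w \<in> orb z \<Longrightarrow> orb w = orb z"
  by (auto simp: orb_def g_def)

lemma orb_closed: "x ` S \<subseteq> S \<Longrightarrow> z \<in> S \<Longrightarrow> orb z \<subseteq> S"
  by (auto simp: orb_def g_def)

text \<open>The double steps through an orbit of order five close up to a pentagon, and each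
  diagonal of it is a single step.\<close>

lemma M_square: "A z (x (x z)) \<Longrightarrow> z \<in> M"
proof -
  assume a: "A z (x (x z))"
  let ?z1 = "x z" and ?z2 = "x (x z)" and ?z3 = "x (x (x z))" and ?z4 = "x (x (x (x z)))"
  have 1: "A ?z1 ?z3" "A ?z2 ?z4" using a by simp_all
  have 2: "A ?z3 z" "A ?z4 ?z1" using A_x[of ?z3 z] A_x[of "x ?z3" z] A_x[of ?z4 ?z1] 1 a by (metis A_x x5)+
  have "A z ?z4 \<or> A z ?z1 \<or> A ?z2 ?z1 \<or> A ?z2 ?z3 \<or> A ?z4 ?z3"
    using C5[of z ?z2 ?z4 ?z1 ?z3] a 1 2 by blast
  moreover have "A z ?z4 \<longleftrightarrow> A (x z) z" using A_x[of z ?z4] by simp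
  ultimately show ?thesis using A_sym unfolding M_iff by (metis A_x)
qed

text \<open>Conversely the single steps form a pentagon, whose diagonals are double steps.\<close>

lemma M_square': "z \<in> M \<Longrightarrow> A z (x (x z))"
proof -
  assume "z \<in> M"
  then have a: "A z (x z)" by (simp add: M_iff)
  let ?z1 = "x z" and ?z2 = "x (x z)" and ?z3 = "x (x (x z))" and ?z4 = "x (x (x (x z)))"
  have 1: "A ?z1 ?z2" "A ?z2 ?z3" "A ?z3 ?z4" using a by simp_all
  have 2: "A ?z4 z" using A_x[of ?z4 z] a by simp
  have "A z ?z2 \<or> A z ?z3 \<or> A ?z1 ?z3 \<or> A ?z1 ?z4 \<or> A ?z2 ?z4"
    using C5[of z ?z1 ?z2 ?z3 ?z4] a 1 2 by blast
  moreover have "A z ?z3 \<longleftrightarrow> A (x (x z)) z" using A_x[of z ?z3] A_x[of ?z1 ?z4] by simp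
  moreover have "A ?z1 ?z4 \<longleftrightarrow> A z ?z3" by simp
  ultimately show ?thesis using A_sym by (metis A_x)
qed

lemma orb_clique:
  assumes "z \<in> M" "a \<in> orb z" "b \<in> orb z"
  shows "A a b"
proof -
  have *: "A w b" if "w \<in> M" "b \<in> orb w" for w b
  proof -
    have "A w (g w)" using that A_sym M_iff_g by blast
    moreover have "A w (x (x (x w)))" using M_square'[of w] that A_x[of "x (x w)" "x (x (x (x w)))"] A_x[of w "x (x (x w))"]
      A_x[of "x w" "x (x (x (x w)))"] A_sym by (metis x5)
    ultimately show ?thesis using that M_square'[of w] M_V[of w] unfolding M_iff by (auto simp: orb_def)
  qed
  have "a \<in> M" using assms by (auto simp: orb_def)
  then show ?thesis using * orb_trans[OF assms(2)] assms by blast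
qed

lemma orb_V: "z \<in> V \<Longrightarrow> orb z \<subseteq> V"
  by (auto simp: orb_def)

lemma orb_M: "z \<in> M \<Longrightarrow> orb z \<subseteq> M"
  by (auto simp: orb_def)

lemma finite_orb [simp]: "finite (orb z)"
  by (simp add: orb_def)

text \<open>Incomparable neighbourhoods would give a square \<open>a u u' b\<close> without
  diagonals.\<close>

lemma nested:
  assumes "A u u'" "\<And>a b. a \<in> W \<Longrightarrow> b \<in> W \<Longrightarrow> A a b"
  shows "(\<forall>w\<in>W. A w u \<longrightarrow> A w u') \<or> (\<forall>w\<in>W. A w u' \<longrightarrow> A w u)"
proof (rule ccontr)
  assume "\<not> ?thesis"
  then obtain a b where ab: "a \<in> W" "A a u" "\<not> A a u'" "b \<in> W" "A b u'" "\<not> A b u" by blast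
  then show False using C4[of a u u' b] assms A_sym by blast
qed

text \<open>The neighbourhoods in one orbit of the vertices of the other form a chain that is preserved by a cyclic
  permutation, so they are all equal.\<close>

lemma orb_complete:
  assumes "a \<in> M" "b \<in> M" "A a b" "v \<in> orb a" "w \<in> orb b"
  shows "A v w"
proof -
  have *: "A a w" if w: "w \<in> orb b" for w
  proof -
    have up: "(\<forall>w\<in>orb b. A w a \<longrightarrow> A w (x a)) \<or> (\<forall>w\<in>orb b. A w (x a) \<longrightarrow> A w a)"
      using nested[of a "x a" "orb b"] orb_clique assms M_iff by blast
    let ?S = "{w \<in> orb b. A w a}"
    have "b \<in> ?S" using assms A_sym by simp
    from up have "orb b \<subseteq> ?S"
    proof
      assume u: "\<forall>w\<in>orb b. A w a \<longrightarrow> A w (x a)"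
      have "g ` ?S \<subseteq> ?S"
      proof
        fix v assume "v \<in> g ` ?S"
        then obtain w where w: "w \<in> orb b" "A w a" "v = g w" by blast
        then have "A w (x a)" using u by blast
        then show "v \<in> ?S" using w orb_g[of b] A_gx by blast
      qed
      then have "(g \<circ> g \<circ> g \<circ> g) ` ?S \<subseteq> ?S" by (auto simp: image_subset_iff)
      moreover have "g (g (g (g w))) = x w" for w by (metis gx(1) g_def)
      ultimately have "x ` ?S \<subseteq> ?S" by (simp add: image_subset_iff)
      then show ?thesis using orb_closed \<open>b \<in> ?S\<close> by blast
    next
      assume u: "\<forall>w\<in>orb b. A w (x a) \<longrightarrow> A w a"
      have "x ` ?S \<subseteq> ?S"
      proof
        fix v assume "v \<in> x ` ?S"
        then obtain w where w: "w \<in> orb b" "A w a" "v = x w" by blast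
        then have "x w \<in> orb b" using orb_x by blast
        then show "v \<in> ?S" using w u by auto
      qed
      then show ?thesis using orb_closed \<open>b \<in> ?S\<close> by blast
    qed
    then show ?thesis using w A_sym by blast
  qed
  have "orb b = orb w" using orb_trans assms by metis
  have "A w' w" if "w' \<in> orb a" for w'
  proof -
    have inv: "A (x c) w" if c: "\<And>w. w \<in> orb b \<Longrightarrow> A c w" "w \<in> orb b" for c w
    proof -
      have "g w \<in> orb b" using c orb_g by blast
      then have "A c (g w)" using c by blast
      then show ?thesis using A_x[of c "g w"] by simp
    qed
    have "\<forall>w\<in>orb b. A w' w" using that * inv unfolding orb_def[of a] g_def by auto
    then show ?thesis using assms by blast
  qed
  then show ?thesis using assms by blast
qed

text \<open>Excludes rings of length two around an orbit, unless they see all of it.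
  \<open>J\<close> and \<open>K\<close> are the traces of the neighbourhoods of \<open>u0\<close>
  and \<open>u1\<close> on the orbit. Pentagons through the orbit force \<open>K\<close> to be
  everything, and then a square without diagonals remains.\<close>

lemma ring_two:
  assumes z: "z \<in> M" and u: "A u0 u1" "A u1 (g u0)" "u0 \<notin> M" "u1 \<notin> M"
    and w: "w0 \<in> orb z" "A w0 u0" "w \<in> orb z"
  shows "A w u0"
proof (rule ccontr)
  assume neg: "\<not> A w u0"
  let ?W = "orb z"
  define J where "J = {w \<in> ?W. A w u0}"
  define K where "K = {w \<in> ?W. A w u1}"
  have full: "S = ?W" if S: "S \<subseteq> ?W" "S \<noteq> {}" "g ` S = S" for S
  proof -
    obtain s where s: "s \<in> S" using S(2) by blast
    have "x ` S = x ` g ` S" using S(3) by simp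
    also have "\<dots> = S" by (simp add: image_image)
    finally have "orb s \<subseteq> S" using orb_closed s by blast
    then show ?thesis using orb_trans[of s z] s S(1) by blast
  qed
  have cl: "A a b" if "a \<in> ?W" "b \<in> ?W" for a b using orb_clique z that by blast
  have gW: "g a \<in> ?W" if "a \<in> ?W" for a using that orb_g by blast
  have gset: "{w \<in> ?W. A w (g v)} = g ` {w \<in> ?W. A w v}" for v
  proof
    show "{w \<in> ?W. A w (g v)} \<subseteq> g ` {w \<in> ?W. A w v}"
    proof
      fix a assume a: "a \<in> {w \<in> ?W. A w (g v)}"
      then have "x a \<in> ?W" "A (x a) v" using orb_x A_x[of a "g v"] by auto
      then show "a \<in> g ` {w \<in> ?W. A w v}" by (metis (mono_tags, lifting) gx(1) image_eqI mem_Collect_eq)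
    qed
  qed (use gW in auto)
  have Jm: "v \<in> J \<longleftrightarrow> v \<in> ?W \<and> A v u0" and Km: "v \<in> K \<longleftrightarrow> v \<in> ?W \<and> A v u1"
    and gJm: "v \<in> g ` J \<longleftrightarrow> v \<in> ?W \<and> A v (g u0)" and gKm: "v \<in> g ` K \<longleftrightarrow> v \<in> ?W \<and> A v (g u1)" for v
    using gset[of u0] gset[of u1] unfolding J_def K_def by auto
  have fin: "finite J" "finite K" unfolding J_def K_def by simp_all
  have cJ: "card (g ` J) = card J" "card (g ` K) = card K" by (simp_all add: card_image inj_on_def)
  have JK: "J \<subseteq> K \<or> K \<subseteq> J" using nested[OF u(1), of ?W] cl unfolding subset_iff Jm Km by auto
  have gJK: "g ` J \<subseteq> K \<or> K \<subseteq> g ` J" using nested[OF u(2), of ?W] cl unfolding subset_iff gJm Km by auto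
  have nA: "\<not> A u0 (g u0)" "\<not> A u1 (g u1)" using u M_iff_g A_sym by blast+
  have "J \<noteq> {}" "J \<subseteq> ?W" "J \<noteq> ?W" using w neg unfolding J_def by auto
  then have "g ` J \<noteq> J" using full by blast
  \<comment> \<open>If \<open>K\<close> were the smaller trace, \<open>a\<close>, \<open>u0\<close>,
    \<open>u1\<close>, \<open>g u0\<close>, \<open>b\<close> would be a pentagon without
    diagonals.\<close>
  have "\<not> (K \<subseteq> J \<and> K \<subseteq> g ` J)"
  proof
    assume KJ: "K \<subseteq> J \<and> K \<subseteq> g ` J"
    have "\<not> J \<subseteq> g ` J" "\<not> g ` J \<subseteq> J"
      using \<open>g ` J \<noteq> J\<close> card_subset_eq[of "g ` J" J] card_subset_eq[of J "g ` J"] fin cJ by auto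
    then obtain a b where a: "a \<in> J" "a \<notin> g ` J" and b: "b \<in> g ` J" "b \<notin> J" by blast
    have aW: "a \<in> ?W" "A a u0" "\<not> A a u1" "\<not> A a (g u0)" using a KJ Jm[of a] Km[of a] gJm[of a] by auto
    have bW: "b \<in> ?W" "\<not> A b u0" "\<not> A b u1" "A b (g u0)" using b KJ Jm[of b] Km[of b] gJm[of b] by auto
    show False using C5[OF aW(2) u(1,2) A_sym[OF bW(4)] cl[OF bW(1) aW(1)]] aW bW nA A_sym by blast
  qed
  then have sub: "J \<subseteq> K" "g ` J \<subseteq> K"
  proof -
    assume n: "\<not> (K \<subseteq> J \<and> K \<subseteq> g ` J)"
    have "\<not> J \<subseteq> g ` J" "\<not> g ` J \<subseteq> J"
      using \<open>g ` J \<noteq> J\<close> card_subset_eq[of "g ` J" J] card_subset_eq[of J "g ` J"] fin cJ by auto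
    then have "J \<subseteq> K \<and> g ` J \<subseteq> K" using n JK gJK by (metis subset_trans)
    then show "J \<subseteq> K" "g ` J \<subseteq> K" by auto
  qed
  \<comment> \<open>Otherwise \<open>k\<close>, \<open>u1\<close>, \<open>g u0\<close>,
    \<open>g u1\<close>, \<open>k'\<close> would be a pentagon without diagonals.\<close>
  have "K = g ` K"
  proof (rule ccontr)
    assume "K \<noteq> g ` K"
    then have "\<not> K \<subseteq> g ` K" "\<not> g ` K \<subseteq> K"
      using card_subset_eq[of "g ` K" K] card_subset_eq[of K "g ` K"] fin cJ by auto
    then obtain k k' where k: "k \<in> K" "k \<notin> g ` K" and k': "k' \<in> g ` K" "k' \<notin> K" by blast
    have "g ` J \<subseteq> g ` K" using sub by blast
    then have kW: "k \<in> ?W" "A k u1" "\<not> A k (g u1)" "\<not> A k (g u0)" using k Km[of k] gJm[of k] gKm[of k] by auto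
    have kW': "k' \<in> ?W" "\<not> A k' u1" "A k' (g u1)" "\<not> A k' (g u0)" using k' sub Km[of k'] gJm[of k'] gKm[of k'] by auto
    have "A (g u0) (g u1)" using u by simp
    then show False
      using C5[OF u(2) _ A_sym[OF kW'(3)] cl[OF kW'(1) kW(1)] kW(2)] kW kW' nA A_sym by blast
  qed
  have KW: "K = ?W"
    by (rule full) (use sub \<open>J \<noteq> {}\<close> \<open>K = g ` K\<close> in \<open>auto simp: K_def\<close>)
  have "g ` J \<noteq> ?W"
  proof
    assume "g ` J = ?W"
    then have "card J = card ?W" using cJ by simp
    then show False using card_subset_eq[of ?W J] \<open>J \<subseteq> ?W\<close> \<open>J \<noteq> ?W\<close> by simp
  qed
  then obtain k where k: "k \<in> ?W" "k \<notin> g ` J" unfolding set_eq_iff gJm by auto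
  then have "A k u1" "A k (g u1)" "\<not> A k (g u0)"
    using KW \<open>K = g ` K\<close> Km[of k] gJm[of k] gKm[of k] k by auto
  moreover have "A (g u0) (g u1)" using u by simp
  ultimately show False using C4[of u1 "g u0" "g u1" k] u(2) nA A_sym by blast
qed

end

section \<open>Rings around an invariant clique\<close>

lemma sum_window:
  fixes \<delta> :: "int \<Rightarrow> int"
  assumes "\<And>k. \<phi> (k + 1) = \<phi> k + \<delta> k" "a \<le> b"
  shows "sum \<delta> {a..<b} = \<phi> b - \<phi> a"
  using assms(2)
proof (induction b rule: int_ge_induct)
  case (step b)
  have "{a..<b + 1} = insert b {a..<b}" using step by auto
  then show ?case using step assms(1)[of b] by simp
qed simp

text \<open>Partial sums in both directions, so that positions along a two-sided periodic ring can
  be counted.\<close>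

lemma prefix_ex:
  fixes \<delta> :: "int \<Rightarrow> int"
  shows "\<exists>\<phi>. \<phi> 0 = 0 \<and> (\<forall>k. \<phi> (k + 1) = \<phi> k + \<delta> k)"
proof -
  define \<phi> where "\<phi> k = (if 0 \<le> k then sum \<delta> {0..<k} else - sum \<delta> {k..<0})" for k
  have "\<phi> (k + 1) = \<phi> k + \<delta> k" for k
  proof (cases "0 \<le> k")
    case True
    then have "{0..<k + 1} = insert k {0..<k}" by auto
    then show ?thesis using True by (simp add: \<phi>_def)
  next
    case False
    then have "{k..<0} = insert k {k + 1..<0}" by auto
    then show ?thesis using False by (auto simp: \<phi>_def)
  qed
  moreover have "\<phi> 0 = 0" by (simp add: \<phi>_def)
  ultimately show ?thesis by blast
qed

lemma int_step_crossing:
  fixes \<phi> :: "int \<Rightarrow> int"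
  assumes "a \<le> b" "\<phi> a \<le> j" "j < \<phi> b" "\<And>k. \<phi> (k + 1) \<le> \<phi> k + 1"
  shows "\<exists>k. \<phi> k = j \<and> \<phi> (k + 1) = j + 1"
  using assms(1-3)
proof (induction b rule: int_ge_induct)
  case (step b)
  show ?case
  proof (cases "j < \<phi> b")
    case False
    then show ?thesis using step assms(4)[of b] by (intro exI[of _ b]) auto
  qed (use step in auto)
qed simp

locale rot5_clique = rot5 + bridged_clique +
  assumes Z_x: "x ` Z = Z"
begin

lemma Z_M: "z \<in> Z \<Longrightarrow> z \<in> M"
  using Z_cl Z_x unfolding M_iff by blast

lemma lev_x [simp]: "lev (x p) = lev p"
proof -
  have *: "lev (x p) \<le> lev p" for p
  proof -
    obtain c where c: "c \<in> Z" "d p c = lev p" using lev_ex by blast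
    then have "x c \<in> Z" using Z_x by blast
    then show ?thesis using lev_le[of "x c" "x p"] c by simp
  qed
  have "lev p \<le> lev (x p)" using *[of "x p"] *[of "x (x p)"] *[of "x (x (x p))"] *[of "x (x (x (x p)))"] by simp
  then show ?thesis using *[of p] by simp
qed

lemma lev_g [simp]: "lev (g p) = lev p"
  by (simp add: g_def)

text \<open>A ring is a path at level \<open>i\<close> from \<open>u 0\<close> to \<open>g (u 0)\<close>, continued equivariantly. A lift covers its edges by
  common neighbours one level below. Collapsing the constant blocks of a lift gives a ring of length \<open>cost l c\<close>.\<close>

definition ring :: "int \<Rightarrow> nat \<Rightarrow> (int \<Rightarrow> 'a) \<Rightarrow> bool" where
  "ring l i u \<longleftrightarrow> 0 < l \<and> (\<forall>k. u (k + l) = g (u k)) \<and> (\<forall>k. E (u k) (u (k + 1))) \<and> (\<forall>k. lev (u k) = i)"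

definition lift :: "int \<Rightarrow> nat \<Rightarrow> (int \<Rightarrow> 'a) \<Rightarrow> (int \<Rightarrow> 'a) \<Rightarrow> bool" where
  "lift l i u c \<longleftrightarrow> (\<forall>k. c (k + l) = g (c k)) \<and> (\<forall>k. lev (c k) = i \<and> E (u k) (c k) \<and> E (u (k + 1)) (c k))"

text \<open>What prevents \<open>u k\<close> from covering only a single edge when \<open>u\<close>
  is a cheapest lift of a ring one level further out. The form \<open>Suc (lev t) = i\<close> makes
  the second alternative false at level zero.\<close>

definition flagged :: "nat \<Rightarrow> (int \<Rightarrow> 'a) \<Rightarrow> int \<Rightarrow> bool" where
  "flagged i u k \<longleftrightarrow> A (u (k - 1)) (u (k + 1)) \<or>
     (\<exists>t. Suc (lev t) = i \<and> E t (u (k - 1)) \<and> E t (u k) \<and> E t (u (k + 1)))"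

definition jump :: "(int \<Rightarrow> 'a) \<Rightarrow> int \<Rightarrow> int" where
  "jump c k = (if c k = c (k + 1) then 0 else 1)"

definition cost :: "int \<Rightarrow> (int \<Rightarrow> 'a) \<Rightarrow> int" where
  "cost l c = (\<Sum>k\<in>{0..<l}. jump c k)"

lemma cost_window:
  assumes "\<And>k. c (k + l) = g (c k)" "0 < l"
  shows "(\<Sum>k\<in>{a..<a + l}. jump c k) = cost l c"
proof -
  obtain \<phi> where \<phi>: "\<phi> 0 = 0" "\<And>k. \<phi> (k + 1) = \<phi> k + jump c k" using prefix_ex by metis
  have j: "jump c (k + l) = jump c k" for k
    using assms(1)[of k] assms(1)[of "k + 1"] by (simp add: jump_def add.commute add.left_commute)
  have "\<phi> (a + l) - \<phi> a = \<phi> l - \<phi> 0" for a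
  proof (induction a rule: int_induct[of _ 0])
    case (step1 a) then show ?case using \<phi>(2)[of a] \<phi>(2)[of "a + l"] j[of a] by (simp add: ac_simps)
  next
    case (step2 a) then show ?case using \<phi>(2)[of "a - 1"] \<phi>(2)[of "a - 1 + l"] j[of "a - 1"] by (simp add: ac_simps)
  qed simp
  then show ?thesis using sum_window[of \<phi> "jump c", OF \<phi>(2)] assms by (simp add: cost_def)
qed

lemma lift_A: "ring l (Suc i) u \<Longrightarrow> lift l i u c \<Longrightarrow> A (c k) (c (k + 1))"
  unfolding ring_def lift_def using B1'[of "u (k + 1)" "c k" "c (k + 1)" i] by auto

lemma lift_jump: "ring l (Suc i) u \<Longrightarrow> lift l i u c \<Longrightarrow> jump c k \<noteq> 0 \<Longrightarrow> E (c k) (c (k + 1))"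
  using lift_A A_neq unfolding jump_def by metis

text \<open>Integer powers of \<open>g\<close>; reducing the exponent modulo five provides the
  negative ones.\<close>

definition gp :: "int \<Rightarrow> 'a \<Rightarrow> 'a" where
  "gp n a = (g ^^ nat (n mod 5)) a"

lemma gp_Suc: "gp (n + 1) a = g (gp n a)"
proof -
  have "n mod 5 \<in> {0,1,2,3,4}" by auto
  moreover have "(n + 1) mod 5 = (if n mod 5 = 4 then 0 else n mod 5 + 1)" by presburger
  moreover have "g (g (g (g (g a)))) = a" by (simp add: g_def)
  ultimately show ?thesis unfolding gp_def by (auto simp: numeral_eq_Suc)
qed

lemma gp_0 [simp]: "gp 0 a = a"
  by (simp add: gp_def)

lemma gp_E: "E (gp n a) (gp n b) \<longleftrightarrow> E a b"
proof -
  have "E ((g ^^ k) a) ((g ^^ k) b) \<longleftrightarrow> E a b" for k by (induction k) auto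
  then show ?thesis by (simp add: gp_def)
qed

lemma gp_lev: "lev (gp n a) = lev a"
proof -
  have "lev ((g ^^ k) a) = lev a" for k by (induction k) auto
  then show ?thesis by (simp add: gp_def)
qed

lemma ring_gp:
  assumes "\<And>k. u (k + l) = g (u k)"
  shows "u (k + n * l) = gp n (u k)"
proof (induction n rule: int_induct[of _ 0])
  case (step1 n)
  have "u (k + (n + 1) * l) = g (u (k + n * l))" using assms[of "k + n * l"] by (simp add: algebra_simps)
  then show ?case using step1 by (simp add: gp_Suc)
next
  case (step2 n)
  have "u (k + n * l) = g (u (k + (n - 1) * l))" using assms[of "k + (n - 1) * l"] by (simp add: algebra_simps)
  moreover have "gp n (u k) = g (gp (n - 1) (u k))" using gp_Suc[of "n - 1"] by simp
  ultimately show ?case using step2 by simp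
qed simp

text \<open>Equivariant continuation of values prescribed on one period.\<close>

definition extend :: "int \<Rightarrow> (int \<Rightarrow> 'a) \<Rightarrow> int \<Rightarrow> 'a" where
  "extend l p k = gp (k div l) (p (k mod l))"

lemma extend_g: "0 < l \<Longrightarrow> extend l p (k + l) = g (extend l p k)"
  using div_add_self2[of l k] gp_Suc[of "k div l"] by (simp add: extend_def add.commute)

lemma extend_eq: "0 \<le> k \<Longrightarrow> k < l \<Longrightarrow> extend l p k = p k"
  by (simp add: extend_def)

lemma lift_extend:
  assumes "ring l (Suc i) u" "\<And>k. 0 \<le> k \<Longrightarrow> k < l \<Longrightarrow> lev (p k) = i \<and> E (u k) (p k) \<and> E (u (k + 1)) (p k)"
  shows "lift l i u (extend l p)"
proof -
  have l: "0 < l" and u: "\<And>k. u (k + l) = g (u k)" using assms unfolding ring_def by auto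
  have "lev (extend l p k) = i \<and> E (u k) (extend l p k) \<and> E (u (k + 1)) (extend l p k)" for k
  proof -
    let ?r = "k mod l" and ?n = "k div l"
    have "?r + ?n * l = k" by simp
    then have k: "u k = gp ?n (u ?r)" "u (k + 1) = gp ?n (u (?r + 1))"
      using ring_gp[of u l ?r ?n, OF u] ring_gp[of u l "?r + 1" ?n, OF u] by (simp_all add: algebra_simps)
    show ?thesis using assms(2)[of ?r] l unfolding k extend_def gp_E gp_lev by simp
  qed
  then show ?thesis using extend_g[OF l] unfolding lift_def by blast
qed

section \<open>Existence, improvement and collapse of lifts\<close>

lemma lift_ex:
  assumes "ring l (Suc i) u" "E (u 0) v" "E (u 1) v" "lev v = i"
  shows "\<exists>c. lift l i u c \<and> c 0 = v"
proof -
  have "\<exists>w. (lev w = i \<and> E (u k) w \<and> E (u (k + 1)) w) \<and> (k = 0 \<longrightarrow> w = v)" for k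
  proof (cases "k = 0")
    case False
    then show ?thesis using B2'[of "u k" "u (k + 1)" i] assms(1) unfolding ring_def by auto
  qed (use assms in auto)
  then obtain p where p: "\<And>k. (lev (p k) = i \<and> E (u k) (p k) \<and> E (u (k + 1)) (p k)) \<and> (k = 0 \<longrightarrow> p k = v)"
    by metis
  have "extend l p 0 = v" using p extend_eq[of 0 l p] assms(1) unfolding ring_def by simp
  then show ?thesis using lift_extend[OF assms(1)] p by blast
qed

text \<open>Copying the value of a neighbouring block to \<open>k0\<close> and all its translates
  removes a jump, as there were jumps on both sides of \<open>k0\<close>. Whether the value at zero
  survives is recorded because it may be prescribed.\<close>

lemma lift_update:
  assumes R: "ring l (Suc i) u" and c: "lift l i u c" and l: "1 < l"
    and v: "E (u k0) v" "E (u (k0 + 1)) v" "v \<in> {c (k0 - 1), c (k0 + 1)}"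
    and j: "jump c (k0 - 1) \<noteq> 0" "jump c k0 \<noteq> 0"
  shows "\<exists>c'. lift l i u c' \<and> cost l c' < cost l c \<and> c' k0 = v \<and> (\<not> l dvd k0 \<longrightarrow> c' 0 = c 0)"
proof -
  define c' where "c' k = (if l dvd k - k0 then gp ((k - k0) div l) v else c k)" for k
  have l0: "0 < l" using l by simp
  have lc: "lev (c k) = i" "E (u k) (c k)" "E (u (k + 1)) (c k)" and cl: "c (k + l) = g (c k)" for k
    using c unfolding lift_def by auto
  have ul: "u (k + l) = g (u k)" for k using R unfolding ring_def by auto
  have cl': "c' (k + l) = g (c' k)" for k
  proof -
    have "l dvd k + l - k0 \<longleftrightarrow> l dvd k - k0" by (metis add.commute add_diff_eq dvd_add_triv_left_iff)
    moreover have "(k + l - k0) div l = (k - k0) div l + 1" using l0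
      by (metis add.commute add_diff_eq div_add_self1 less_irrefl)
    ultimately show ?thesis using cl gp_Suc by (simp add: c'_def)
  qed
  have "lev v = i" using v lc by auto
  have "lev (c' k) = i \<and> E (u k) (c' k) \<and> E (u (k + 1)) (c' k)" for k
  proof (cases "l dvd k - k0")
    case True
    define n where "n = (k - k0) div l"
    have "k = k0 + n * l" using True by (simp add: n_def)
    then have "u k = gp n (u k0)" "u (k + 1) = gp n (u (k0 + 1))"
      using ring_gp[of u l k0 n, OF ul] ring_gp[of u l "k0 + 1" n, OF ul] by (simp_all add: algebra_simps)
    then show ?thesis using True v \<open>lev v = i\<close> by (simp add: c'_def gp_E gp_lev flip: n_def)
  qed (use lc in \<open>simp add: c'_def\<close>)
  then have L: "lift l i u c'" using cl' unfolding lift_def by blast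
  have k0: "c' k0 = v" by (simp add: c'_def)
  have far: "c' k = c k" if "k0 - l < k" "k < k0 + l" "k \<noteq> k0" for k
  proof -
    have "\<not> l dvd k - k0" using that zdvd_not_zless[of "k - k0" l] zdvd_not_zless[of "k0 - k" l]
      by (metis add_diff_cancel_left' diff_add_cancel diff_gt_0_iff_gt dvd_diff_commute less_diff_eq linorder_neqE_linordered_idom add.commute)
    then show ?thesis by (simp add: c'_def)
  qed
  have jf: "jump c' k = jump c k" if "k0 < k" "k < k0 + l - 1" for k
    using far[of k] far[of "k + 1"] that unfolding jump_def by auto
  have sp: "{k0 - 1..<k0 - 1 + l} = {k0 - 1, k0} \<union> {k0 + 1..<k0 + l - 1}" using l by auto
  have S: "(\<Sum>k\<in>{k0 - 1..<k0 - 1 + l}. f k) = f (k0 - 1) + f k0 + (\<Sum>k\<in>{k0 + 1..<k0 + l - 1}. f k)" for f :: "int \<Rightarrow> int"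
    unfolding sp by (subst sum.union_disjoint) auto
  have "(\<Sum>k\<in>{k0 + 1..<k0 + l - 1}. jump c' k) = (\<Sum>k\<in>{k0 + 1..<k0 + l - 1}. jump c k)"
    using jf by (intro sum.cong) auto
  moreover have "jump c' (k0 - 1) + jump c' k0 < jump c (k0 - 1) + jump c k0"
  proof -
    have "c' (k0 - 1) = c (k0 - 1)" "c' (k0 + 1) = c (k0 + 1)" using far[of "k0 - 1"] far[of "k0 + 1"] l by auto
    then have "jump c' (k0 - 1) = (if c (k0 - 1) = v then 0 else 1)" "jump c' k0 = (if v = c (k0 + 1) then 0 else 1)"
      using k0 by (simp_all add: jump_def)
    moreover have "jump c (k0 - 1) = 1" "jump c k0 = 1" using j by (simp_all add: jump_def split: if_splits)
    ultimately show ?thesis using v(3) by auto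
  qed
  ultimately have "cost l c' < cost l c"
    using cost_window[of c' l "k0 - 1", OF cl' l0] cost_window[of c l "k0 - 1", OF cl l0] unfolding S by simp
  moreover have "c' 0 = c 0" if "\<not> l dvd k0" using that by (simp add: c'_def)
  ultimately show ?thesis using L k0 by blast
qed

text \<open>\<open>\<phi>\<close> numbers the constant blocks and \<open>w\<close> lists their
  values. Since \<open>\<phi>\<close> moves by steps of zero or one and is unbounded in both
  directions, it is onto, and consecutive values of \<open>w\<close> come from an actual jump of
  \<open>c\<close>.\<close>

lemma lift_ring:
  assumes R: "ring l (Suc i) u" and c: "lift l i u c" and m: "0 < cost l c"
  shows "\<exists>\<phi> w. ring (cost l c) i w \<and> \<phi> 0 = 0 \<and> (\<forall>k. \<phi> (k + 1) = \<phi> k + jump c k) \<and>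
    (\<forall>k. \<phi> (k + l) = \<phi> k + cost l c) \<and> (\<forall>k. w (\<phi> k) = c k) \<and> (\<forall>j. \<exists>k. \<phi> k = j) \<and>
    (\<forall>n. \<phi> (n * l) = n * cost l c)"
proof -
  let ?m = "cost l c"
  obtain \<phi> where \<phi>: "\<phi> 0 = 0" "\<And>k. \<phi> (k + 1) = \<phi> k + jump c k" using prefix_ex by metis
  have l: "0 < l" using R unfolding ring_def by simp
  have cl: "c (k + l) = g (c k)" and lc: "lev (c k) = i" for k using c unfolding lift_def by auto
  have \<phi>l: "\<phi> (k + l) = \<phi> k + ?m" for k
    using cost_window[of c l k, OF cl l] sum_window[of \<phi> "jump c" k "k + l", OF \<phi>(2)] l by simp
  have \<phi>n: "\<phi> (n * l) = n * ?m" for n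
  proof (induction n rule: int_induct[of _ 0])
    case (step1 n) then show ?case using \<phi>l[of "n * l"] by (simp add: algebra_simps)
  next
    case (step2 n) then show ?case using \<phi>l[of "(n - 1) * l"] by (simp add: algebra_simps)
  qed (simp add: \<phi>)
  have j01: "jump c k = 0 \<or> jump c k = 1" for k by (simp add: jump_def)
  have cross: "\<exists>k. \<phi> k = j \<and> \<phi> (k + 1) = j + 1" for j
  proof (rule int_step_crossing)
    show "- \<bar>j\<bar> * l \<le> (\<bar>j\<bar> + 1) * l" using l by (intro mult_right_mono) auto
    have "\<bar>j\<bar> \<le> \<bar>j\<bar> * ?m" using m by (simp add: mult_le_cancel_left1)
    then show "\<phi> (- \<bar>j\<bar> * l) \<le> j" "j < \<phi> ((\<bar>j\<bar> + 1) * l)" using m unfolding \<phi>n by (auto simp: algebra_simps)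
    show "\<phi> (k + 1) \<le> \<phi> k + 1" for k using \<phi>(2)[of k] j01[of k] by auto
  qed
  have mono: "\<phi> a \<le> \<phi> b" if "a \<le> b" for a b
    using sum_window[of \<phi> "jump c" a b, OF \<phi>(2) that] sum_nonneg[of "{a..<b}" "jump c"] by (simp add: jump_def)
  have const: "c b = c a" if "a \<le> b" "\<phi> a = \<phi> b" for a b
    using that
  proof (induction b rule: int_ge_induct)
    case (step b)
    have "\<phi> a \<le> \<phi> b" "\<phi> b \<le> \<phi> (b + 1)" using mono step.hyps by simp_all
    then have b: "\<phi> a = \<phi> b" "jump c b = 0" using \<phi>(2)[of b] step.prems by linarith+
    have "c (b + 1) = c b" using b(2) unfolding jump_def by (metis zero_neq_one)
    then show ?case using step.IH b(1) by simp
  qed simp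
  have fib: "c a = c b" if "\<phi> a = \<phi> b" for a b
  proof (cases "a \<le> b")
    case True then show ?thesis using const[OF True] that by simp
  next
    case False then show ?thesis using const[of b a] that by simp
  qed
  define w where "w j = c (SOME k. \<phi> k = j)" for j
  have w: "w (\<phi> k) = c k" for k
    unfolding w_def by (rule fib) (rule someI[of "\<lambda>k'. \<phi> k' = \<phi> k" k], simp)
  have "w (j + ?m) = g (w j) \<and> E (w j) (w (j + 1)) \<and> lev (w j) = i" for j
  proof -
    obtain k where k: "\<phi> k = j" "\<phi> (k + 1) = j + 1" using cross by blast
    have "jump c k \<noteq> 0" using k \<phi>(2)[of k] by simp
    then have "E (c k) (c (k + 1))" using lift_jump[OF R c] by blast
    moreover have "w j = c k" "w (j + 1) = c (k + 1)" "w (j + ?m) = c (k + l)"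
      using w[of k] w[of "k + 1"] w[of "k + l"] \<phi>l[of k] k by simp_all
    ultimately show ?thesis using cl lc by simp
  qed
  then have "ring ?m i w" using m unfolding ring_def by blast
  then show ?thesis using \<phi> \<phi>l \<phi>n w cross by blast
qed

lemma ringD:
  assumes "ring l i u"
  shows "0 < l" "u (k + l) = g (u k)" "E (u k) (u (k + 1))" "lev (u k) = i"
  using assms unfolding ring_def by blast+

lemma liftD:
  assumes "lift l i u c"
  shows "c (k + l) = g (c k)" "lev (c k) = i" "E (u k) (c k)" "E (u (k + 1)) (c k)"
  using assms unfolding lift_def by blast+

lemma jump_01: "jump c k = 0 \<or> jump c k = 1"
  by (simp add: jump_def)

lemma jump_prefix:
  assumes "\<And>k. \<phi> (k + 1) = \<phi> k + jump c k" "a \<le> b"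
  shows "\<phi> a \<le> \<phi> b" "\<phi> b \<le> \<phi> a + (b - a)"
proof -
  have "\<phi> a \<le> \<phi> b \<and> \<phi> b \<le> \<phi> a + (b - a)"
    using assms(2)
  proof (induction b rule: int_ge_induct)
    case (step b)
    then show ?case using assms(1)[of b] jump_01[of c b] by linarith
  qed simp
  then show "\<phi> a \<le> \<phi> b" "\<phi> b \<le> \<phi> a + (b - a)" by auto
qed

lemma jump_eq: "jump c k = 0 \<Longrightarrow> c (k + 1) = c k"
  by (simp add: jump_def split: if_splits)

lemma cost_nonneg: "0 \<le> cost l c"
  unfolding cost_def by (rule sum_nonneg) (simp add: jump_def)

lemma cost_le: "0 < l \<Longrightarrow> cost l c \<le> l"
  unfolding cost_def using sum_mono[of "{0..<l}" "jump c" "\<lambda>_. 1"] by (simp add: jump_def)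

lemma lift_minimal:
  assumes "lift l i u c0" "c0 0 \<in> F"
  shows "\<exists>c. lift l i u c \<and> c 0 \<in> F \<and> (\<forall>c'. lift l i u c' \<longrightarrow> c' 0 \<in> F \<longrightarrow> cost l c \<le> cost l c')"
proof -
  obtain c where c: "lift l i u c \<and> c 0 \<in> F"
      "\<forall>c'. lift l i u c' \<and> c' 0 \<in> F \<longrightarrow> nat (cost l c) \<le> nat (cost l c')"
    using ex_has_least_nat[of "\<lambda>c. lift l i u c \<and> c 0 \<in> F" c0 "\<lambda>c. nat (cost l c)"] assms by blast
  then show ?thesis using cost_nonneg by (metis eq_nat_nat_iff nat_le_eq_zle)
qed

text \<open>The edge from \<open>u k\<close> to \<open>u (k + 1)\<close>, the values
  \<open>c (k - 1)\<close> and \<open>c (k + 1)\<close> and possibly the vertex \<open>t\<close>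
  form a square or a pentagon. A diagonal of it lets a neighbouring value cover this edge too, and
  merging contradicts minimality unless the value at \<open>k\<close> is tied to the prescribed
  one.\<close>

lemma lone_edge:
  assumes R: "ring l (Suc i) u" and c: "lift l i u c" "c 0 \<in> F"
    and min: "\<And>c'. lift l i u c' \<Longrightarrow> c' 0 \<in> F \<Longrightarrow> cost l c \<le> cost l c'" and m: "2 \<le> cost l c"
    and fl: "flagged i c k" and j: "jump c (k - 1) \<noteq> 0" "jump c k \<noteq> 0"
  shows "l dvd k \<and> F \<noteq> UNIV \<and> (\<exists>v\<in>{c (k - 1), c (k + 1)}. E (u k) v \<and> E (u (k + 1)) v)"
proof -
  have l: "1 < l" using cost_le[of l c] m ringD(1)[OF R] by simp
  note u = ringD(3)[OF R, of k] ringD(4)[OF R, of k] ringD(4)[OF R, of "k + 1"]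
  note lc = liftD(2-4)[OF c(1)]
  have cu: "E (u k) (c (k - 1))" "E (u (k + 1)) (c (k + 1))" using lc(3)[of "k - 1"] lc(2)[of "k + 1"] by auto
  have "A (u k) (c (k + 1)) \<or> A (u (k + 1)) (c (k - 1))"
  proof (cases "A (c (k - 1)) (c (k + 1))")
    case True
    then show ?thesis using C4[of "u k" "u (k + 1)" "c (k + 1)" "c (k - 1)"] u cu EA A_sym by blast
  next
    case False
    then obtain t where t: "Suc (lev t) = i" "E t (c (k - 1))" "E t (c (k + 1))"
      using fl unfolding flagged_def by blast
    have "\<not> A (u k) t" "\<not> A (u (k + 1)) t"
      using lev_A[of t "u k"] lev_A[of t "u (k + 1)"] A_sym t u by auto
    then show ?thesis
      using C5[of "u k" "u (k + 1)" "c (k + 1)" t "c (k - 1)"] False u cu t EA A_sym by blast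
  qed
  moreover have "u k \<noteq> c (k + 1)" "u (k + 1) \<noteq> c (k - 1)" using lc(1)[of "k + 1"] lc(1)[of "k - 1"] u by auto
  ultimately obtain v where v: "v \<in> {c (k - 1), c (k + 1)}" "E (u k) v" "E (u (k + 1)) v"
    using cu A_neq by blast
  obtain c' where c': "lift l i u c'" "cost l c' < cost l c" "\<not> l dvd k \<longrightarrow> c' 0 = c 0"
    using lift_update[OF R c(1) l v(2,3,1) j] by blast
  have "l dvd k \<and> F \<noteq> UNIV" using min[OF c'(1)] c' c(2) by force
  then show ?thesis using v by blast
qed

section \<open>Places where a ring can be shortened, and the length bound\<close>

lemma flagged_shift: "(\<And>k. u (k + l) = g (u k)) \<Longrightarrow> flagged i u (k + l) \<longleftrightarrow> flagged i u k"
proof -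
  assume u: "\<And>k. u (k + l) = g (u k)"
  have *: "u (k + l - 1) = g (u (k - 1))" "u (k + l + 1) = g (u (k + 1))" "u (k + l) = g (u k)"
    using u[of "k - 1"] u[of "k + 1"] u[of k] by (simp_all add: algebra_simps)
  have "(\<exists>t. Suc (lev t) = i \<and> E t (g (u (k - 1))) \<and> E t (g (u k)) \<and> E t (g (u (k + 1)))) \<longleftrightarrow>
    (\<exists>t. Suc (lev t) = i \<and> E t (u (k - 1)) \<and> E t (u k) \<and> E t (u (k + 1)))"
    (is "?L \<longleftrightarrow> ?R")
  proof
    have e: "E t (g a) \<longleftrightarrow> E (x t) a" for t a using E_g[of "x t" a] by simp
    assume ?L
    then obtain t where "Suc (lev t) = i \<and> E (x t) (u (k - 1)) \<and> E (x t) (u k) \<and> E (x t) (u (k + 1))"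
      unfolding e by blast
    then show ?R by (intro exI[of _ "x t"]) simp
  next
    assume ?R
    then obtain t where "Suc (lev t) = i \<and> E t (u (k - 1)) \<and> E t (u k) \<and> E t (u (k + 1))" by blast
    then show ?L by (intro exI[of _ "g t"]) simp
  qed
  then show ?thesis unfolding flagged_def * by simp
qed

lemma flagged_mod:
  assumes "\<And>k. u (k + l) = g (u k)"
  shows "flagged i u (k mod l) \<longleftrightarrow> flagged i u k"
proof -
  have "flagged i u (k + n * l) \<longleftrightarrow> flagged i u k" for n k
  proof (induction n rule: int_induct[of _ 0])
    case (step1 n)
    then show ?case using flagged_shift[of u l i "k + n * l", OF assms] by (simp add: algebra_simps)
  next
    case (step2 n)
    then show ?case using flagged_shift[of u l i "k + (n - 1) * l", OF assms] by (simp add: algebra_simps)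
  qed simp
  from this[of "k mod l" "k div l"] show ?thesis by simp
qed

definition two_flagged :: "int \<Rightarrow> nat \<Rightarrow> (int \<Rightarrow> 'a) \<Rightarrow> bool" where
  "two_flagged l i u \<longleftrightarrow> (\<exists>k1 k2. 0 \<le> k1 \<and> k1 < k2 \<and> k2 < l \<and> flagged i u k1 \<and> flagged i u k2)"

lemma two_flaggedI:
  assumes R: "ring l i u" and "k1 < k2" "k2 < k1 + l" "flagged i u k1" "flagged i u k2"
  shows "two_flagged l i u"
proof -
  note l = ringD(1)[OF R] and u = ringD(2)[OF R]
  have "\<not> l dvd k2 - k1" using assms(2,3) zdvd_not_zless[of "k2 - k1" l] by linarith
  then have "k1 mod l \<noteq> k2 mod l" by (metis mod_eq_dvd_iff)
  moreover have "flagged i u (k1 mod l)" "flagged i u (k2 mod l)"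
    using flagged_mod[of u l i, OF u] assms(4,5) by blast+
  moreover have "0 \<le> k1 mod l" "k1 mod l < l" "0 \<le> k2 mod l" "k2 mod l < l" using l by auto
  ultimately show ?thesis unfolding two_flagged_def by (meson linorder_neqE_linordered_idom)
qed

text \<open>Each constant position saves one edge of the ring per period. The repeated value is a
  common lower neighbour of three consecutive ring vertices, so the middle one is flagged on the
  outer ring.\<close>

lemma two_blocks:
  assumes R: "ring l (Suc i) u" and c: "lift l i u c"
    and \<phi>: "\<And>k. \<phi> (k + 1) = \<phi> k + jump c k" "\<And>k. \<phi> (k + l) = \<phi> k + cost l c"
    and k: "jump c k1 = 0" "jump c k2 = 0" "\<phi> k1 < \<phi> k2" "\<phi> k2 < \<phi> k1 + cost l c"
  shows "cost l c + 2 \<le> l \<and> two_flagged l (Suc i) u"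
proof -
  note mono = jump_prefix(1)[of \<phi> c, OF \<phi>(1)] and lip = jump_prefix(2)[of \<phi> c, OF \<phi>(1)]
  have lt: "k1 < k2" "k2 < k1 + l" using mono[of k2 k1] mono[of "k1 + l" k2] k \<phi>(2)[of k1] by linarith+
  have "\<phi> k2 - \<phi> (k1 + 1) \<le> k2 - (k1 + 1)" "\<phi> (k1 + l) - \<phi> (k2 + 1) \<le> k1 + l - (k2 + 1)"
    using lip[of "k1 + 1" k2] lip[of "k2 + 1" "k1 + l"] lt by linarith+
  then have "cost l c + 2 \<le> l" using \<phi>(1)[of k1] \<phi>(1)[of k2] \<phi>(2)[of k1] k by linarith
  moreover have fl: "flagged (Suc i) u (k + 1)" if "jump c k = 0" for k
  proof -
    have "E (c k) (u k)" "E (c k) (u (k + 1))" "E (c k) (u (k + 1 + 1))"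
      using liftD(3,4)[OF c, of k] liftD(4)[OF c, of "k + 1"] jump_eq[OF that] by (simp_all add: E_sym)
    then show ?thesis using liftD(2)[OF c, of k] unfolding flagged_def by auto
  qed
  have "flagged (Suc i) u (k1 + 1)" "flagged (Suc i) u (k2 + 1)" using fl k(1,2) by blast+
  then have "two_flagged l (Suc i) u" using two_flaggedI[OF R, of "k1 + 1" "k2 + 1"] lt by simp
  ultimately show ?thesis by blast
qed

lemma lift_dist:
  assumes R: "ring l (Suc i) u" and c: "lift l i u c"
  shows "int (d (c 0) (g (c 0))) \<le> cost l c"
proof -
  note V = EV(2)[OF liftD(3)[OF c]]
  have "int (d (c 0) (c k)) \<le> (\<Sum>j\<in>{0..<k}. jump c j)" if "0 \<le> k" for k
    using that
  proof (induction k rule: int_ge_induct)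
    case base
    show ?case by simp
  next
    case (step k)
    have "int (d (c 0) (c (k + 1))) \<le> int (d (c 0) (c k)) + jump c k"
    proof (cases "jump c k = 0")
      case True then show ?thesis by (simp add: jump_eq)
    next
      case False
      then have "E (c k) (c (k + 1))" using lift_jump[OF R c] by blast
      then have "d (c 0) (c (k + 1)) \<le> Suc (d (c 0) (c k))" using d_E(1) V by blast
      then show ?thesis using jump_01[of c k] False by simp
    qed
    moreover have "{0..<k + 1} = insert k {0..<k}" using step by auto
    ultimately show ?case using step.IH by simp
  qed
  from this[of l] show ?thesis using ringD(1)[OF R] liftD(1)[OF c, of 0] unfolding cost_def by simp
qed

text \<open>Needed for orbits as centres only. It keeps the ring off the vertices \<open>g v\<close>
  for which \<open>v\<close> and \<open>g v\<close> both have distance \<open>N\<close> from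
  \<open>q\<close>; through these a ring of length two around the orbit could pass. The required
  distance drops by one with each level.\<close>

definition far :: "'a \<Rightarrow> nat \<Rightarrow> nat \<Rightarrow> int \<Rightarrow> (int \<Rightarrow> 'a) \<Rightarrow> bool" where
  "far q N i l u \<longleftrightarrow> (\<forall>v\<in>M. (\<forall>w\<in>Z. A v w) \<longrightarrow> d v q = N \<longrightarrow> d (g v) q = N \<longrightarrow>
     (\<forall>k\<in>{0..l}. i \<le> d (u k) (g v)))"

lemma far_lift:
  assumes R: "ring l (Suc i) u" and c: "lift l i u c" and \<phi>: "\<phi> 0 = 0" "\<And>k. \<phi> (k + 1) = \<phi> k + jump c k"
    "\<And>k. \<phi> (k + l) = \<phi> k + cost l c" "\<And>k. w (\<phi> k) = c k" "\<And>j. \<exists>k. \<phi> k = j" and far: "far q N (Suc i) l u"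
  shows "far q N i (cost l c) w"
  unfolding far_def
proof (intro ballI impI)
  fix v j assume v: "v \<in> M" "\<forall>w\<in>Z. A v w" "d v q = N" "d (g v) q = N" "j \<in> {0..cost l c}"
  note l = ringD(1)[OF R] and mono = jump_prefix(1)[of \<phi> c, OF \<phi>(2)]
  obtain k where k: "\<phi> k = j" "k \<in> {0..l}"
  proof -
    obtain k where k: "\<phi> k = j" using \<phi>(5) by blast
    consider "j = cost l c" | "j \<noteq> cost l c" "k < 0" | "j \<noteq> cost l c" "l < k" | "0 \<le> k" "k \<le> l" by linarith
    then show ?thesis
    proof cases
      case 1 then show ?thesis using that[of l] \<phi>(3)[of 0] \<phi>(1) l by simp
    next
      case 2 then show ?thesis using that[of 0] mono[of k 0] k \<phi>(1) v(5) l by simp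
    next
      case 3 then show ?thesis using that[of l] mono[of l k] k \<phi>(3)[of 0] \<phi>(1) v(5) l by simp
    qed (use that[of k] k in simp)
  qed
  have "Suc i \<le> d (u k) (g v)" using far v k unfolding far_def by blast
  moreover have "d (u k) (g v) \<le> Suc (d (c k) (g v))"
    using d_E(2)[OF E_sym[OF liftD(3)[OF c]]] M_V v by simp
  ultimately show "i \<le> d (w j) (g v)" using \<phi>(4)[of k] k by simp
qed

text \<open>Induction on the level: in a lift of least cost, a flagged vertex covers two consecutive edges of the ring, as
  otherwise a common neighbour would allow to merge two blocks. So the ring is longer than its lift by two
  and is flagged at the same two places.\<close>

lemma ring_bound:
  assumes q: "q \<in> V" "\<And>v. v \<in> M \<Longrightarrow> N \<le> d v q"
    and kind: "e = 0 \<and> (\<exists>z. Z = {z}) \<or> e = 1 \<and> (\<exists>z. Z = orb z) \<and> (\<forall>v. (\<forall>w\<in>Z. A v w) \<longrightarrow> N \<le> d v q)"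
    and R: "ring l i u" and base: "d (u 0) q + i \<le> N" "1 \<le> i"
    and far: "e = 1 \<Longrightarrow> far q N i l u"
  shows "2 * int i + int e \<le> l \<and> two_flagged l i u"
  using R base far
proof (induction i arbitrary: l u)
  case (Suc i)
  note R = Suc.prems(1)
  note l = ringD(1)[OF R] and u = ringD(2-4)[OF R]
  note uV = EV(1)[OF u(2)]
  have near: "v \<notin> M" if "d v q < N" for v using q(2)[of v] that by auto
  obtain w0 where "E (u 0) w0" "E (u 1) w0" "lev w0 = i" using B2'[of "u 0" "u 1" i] u(2)[of 0] u(3) by auto
  then obtain c0 where c0: "lift l i u c0" using lift_ex[OF R] by blast
  obtain c where c: "lift l i u c" and min: "\<And>c'. lift l i u c' \<Longrightarrow> cost l c \<le> cost l c'"
    using lift_minimal[OF c0, of UNIV] by auto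
  note lc = liftD(2-4,1)[OF c]
  have lone: "jump c (k - 1) = 0 \<or> jump c k = 0" if "flagged i c k" "2 \<le> cost l c" for k
    using lone_edge[where F = UNIV and l = l and c = c and u = u and i = i and k = k, OF R c UNIV_I] min that by blast
  have dc0: "d (c 0) q \<le> Suc (d (u 0) q)"
    using d_E(2)[OF lc(2)[of 0]] q by blast
  show ?case
  proof (cases "i = 0")
    case False
    \<comment> \<open>Otherwise \<open>c 0\<close> is moved by at most one although its distance to
      \<open>q\<close> is less than \<open>N\<close>.\<close>
    have "\<not> cost l c \<le> 1"
    proof
      assume "cost l c \<le> 1"
      then have "A (c 0) (g (c 0))" using lift_dist[OF R c] EV(2)[OF lc(2)[of 0]] unfolding A_def by simp
      then have "c 0 \<in> M" using M_iff_g A_sym by blast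
      then show False using near[of "c 0"] dc0 Suc.prems False by simp
    qed
    then have m: "2 \<le> cost l c" by simp
    obtain \<phi> w where w: "ring (cost l c) i w" "\<phi> 0 = 0" "\<And>k. \<phi> (k + 1) = \<phi> k + jump c k"
      "\<And>k. \<phi> (k + l) = \<phi> k + cost l c" "\<And>k. w (\<phi> k) = c k" "\<And>j. \<exists>k. \<phi> k = j"
      using lift_ring[OF R c] m by auto
    have "far q N i (cost l c) w" if "e = 1"
      by (rule far_lift[OF R c w(2-6) Suc.prems(4)[OF that]])
    moreover have "d (w 0) q + i \<le> N" using w(5)[of 0] w(2) dc0 Suc.prems by simp
    ultimately have IH: "2 * int i + int e \<le> cost l c" "two_flagged (cost l c) i w"
      using Suc.IH[OF w(1)] False by auto
    obtain j1 j2 where j: "0 \<le> j1" "j1 < j2" "j2 < cost l c" "flagged i w j1" "flagged i w j2"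
      using IH(2) unfolding two_flagged_def by blast
    \<comment> \<open>A flagged value covering a single edge would contradict
      \<open>lone\<close>.\<close>
    have blk: "\<exists>k. \<phi> k = j \<and> jump c k = 0" if "flagged i w j" for j
    proof -
      obtain k where k: "\<phi> k = j" using w(6) by blast
      show ?thesis
      proof (rule ccontr)
        assume neg: "\<not> ?thesis"
        have 1: "jump c k = 1" using neg k jump_01 by blast
        have "jump c (k - 1) \<noteq> 0"
        proof
          assume "jump c (k - 1) = 0"
          then have "\<phi> (k - 1) = j" using w(3)[of "k - 1"] k by simp
          then show False using neg \<open>jump c (k - 1) = 0\<close> by blast
        qed
        then have 2: "jump c (k - 1) = 1" using jump_01 by blast
        have "c k = w j" "c (k + 1) = w (j + 1)" "c (k - 1) = w (j - 1)"
          using w(5)[of k] w(5)[of "k + 1"] w(5)[of "k - 1"] w(3)[of k] w(3)[of "k - 1"] 1 2 k by simp_all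
        then have "flagged i c k" using that unfolding flagged_def by simp
        then show False using lone m 1 2 by fastforce
      qed
    qed
    obtain k1 k2 where "\<phi> k1 = j1" "jump c k1 = 0" "\<phi> k2 = j2" "jump c k2 = 0" using blk j by blast
    then show ?thesis using two_blocks[where \<phi> = \<phi> and l = l and c = c and u = u and i = i, OF R c w(3) w(4), of k1 k2] j IH by simp
  next
    case i: True
    have cZ: "c k \<in> Z" for k using lc(1,2)[of k] lev_0[of "c k"] EV i by blast
    have u0: "u 0 \<notin> M" "d (u 0) q < N" using near Suc.prems by auto
    have l1: "l \<noteq> 1"
    proof
      assume "l = 1"
      then have "E (u 0) (g (u 0))" using u(1)[of 0] u(2)[of 0] by simp
      then show False using u0 M_iff_g EA A_sym by blast
    qed
    show ?thesis using kind
    proof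
      \<comment> \<open>Around a fixed vertex the centre itself is a common lower neighbour, so
        every vertex of the ring is flagged and only length one had to be excluded.\<close>
      assume "e = 0 \<and> (\<exists>z. Z = {z})"
      then obtain z where z: "Z = {z}" "e = 0" by blast
      then have "E z (u k)" for k using cZ[of k] lc(2)[of k] E_sym by auto
      moreover have "lev z = 0" using z lev_0[of z] Z_V by simp
      ultimately have fl: "flagged (Suc i) u k" for k using i unfolding flagged_def by auto
      have "two_flagged l (Suc i) u"
        using two_flaggedI[OF R, of 0 1] fl l l1 by simp
      then show ?thesis using i l l1 z by simp
    next
      assume "e = 1 \<and> (\<exists>z. Z = orb z) \<and> (\<forall>v. (\<forall>w\<in>Z. A v w) \<longrightarrow> N \<le> d v q)"
      then obtain z where z: "Z = orb z" and e: "e = 1" and join: "\<And>v. (\<forall>w\<in>Z. A v w) \<Longrightarrow> N \<le> d v q" by blast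
      have zM: "z \<in> M" using z Z_M by auto
      \<comment> \<open>A vertex joined to the whole orbit has distance at least \<open>N\<close>
        from \<open>q\<close>, unlike \<open>u 0\<close>.\<close>
      have nj: "\<not> (\<forall>w\<in>Z. A w (u 0))" using join[of "u 0"] u0 A_sym by fastforce
      have m0: "cost l c \<noteq> 0"
      proof
        assume "cost l c = 0"
        then have "d (c 0) (g (c 0)) = 0" using lift_dist[OF R c] by simp
        then have "g (c 0) = c 0" using d_zero[of "c 0" "g (c 0)"] cZ[of 0] Z_V by auto
        then have "x (c 0) = c 0" by (metis gx(2))
        then have "orb (c 0) = {c 0}" by (simp add: orb_def g_def)
        then have "Z = {c 0}" using orb_trans[of "c 0" z] cZ z by simp
        then show False using nj lc(2)[of 0] EA E_sym by auto
      qed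
      then have pos: "0 < cost l c" using cost_nonneg[of l c] by simp
      obtain \<phi> w where w: "\<phi> 0 = 0" "\<And>k. \<phi> (k + 1) = \<phi> k + jump c k"
        "\<And>k. \<phi> (k + l) = \<phi> k + cost l c" "\<And>k. w (\<phi> k) = c k" "\<And>j. \<exists>k. \<phi> k = j"
        using lift_ring[OF R c pos] by auto
      show ?thesis
      proof (cases "2 \<le> cost l c")
        case True
        \<comment> \<open>At level zero all values of the lift lie in the clique \<open>Z\<close>,
          so all of them are flagged.\<close>
        have fl: "flagged i c k" for k using Z_cl cZ unfolding flagged_def by blast
        have "\<exists>k. \<phi> k = j \<and> jump c k = 0" for j
        proof -
          obtain k where k: "\<phi> k = j" using w(5) by blast
          have "jump c (k - 1) = 0 \<Longrightarrow> \<phi> (k - 1) = j" using w(2)[of "k - 1"] k by simp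
          then show ?thesis using lone[OF fl[of k] True] k by blast
        qed
        then obtain k1 k2 where "\<phi> k1 = 0" "jump c k1 = 0" "\<phi> k2 = 1" "jump c k2 = 0" by meson
        then show ?thesis using two_blocks[where \<phi> = \<phi> and l = l and c = c and u = u and i = i, OF R c w(2) w(3), of k1 k2] True i e by simp
      next
        case False
        then have m: "cost l c = 1" using pos by simp
        show ?thesis
        proof (cases "l = 2")
          case True
          have u2: "u 2 = g (u 0)" using u(1)[of 0] True by simp
          have um: "u 1 = g (u (-1))" using u(1)[of "-1"] True by simp
          have A1: "A (u 0) (u 1)" "A (u 1) (g (u 0))" using u(2)[of 0] u(2)[of 1] u2 EA by auto
          show ?thesis
          proof (cases "u 1 \<in> M")
            case uM: True
            \<comment> \<open>This is the degenerate ring that \<open>far\<close> excludes: both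
              neighbours of \<open>u 0\<close> lie in \<open>M\<close> at distance \<open>N\<close>
              from \<open>q\<close>, and \<open>u 1\<close> is the translate of
              \<open>?v\<close>.\<close>
            let ?v = "u (-1)"
            have vM: "?v \<in> M" using uM um by simp
            have v: "?v \<in> orb ?v" "?v \<in> orb (u 1)" using um M_x by (auto simp: orb_def)
            have "A (u 1) (c 1)" using lc(2)[of 1] EA by blast
            then have "\<forall>w\<in>Z. A ?v w" using orb_complete[OF uM _ _ v(2)] cZ[of 1] z Z_M orb_trans by metis
            moreover have "d ?v q = N" "d (g ?v) q = N"
              using q(2)[OF vM] q(2)[OF uM] d_E(2)[OF u(2)[of 0] q(1)] d_E(2)[OF E_sym[OF u(2)[of "-1"]] q(1)]
                Suc.prems(2) i um by simp_all
            ultimately have "Suc i \<le> d (u 1) (g ?v)"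
              using Suc.prems(4)[OF e] vM l True unfolding far_def by force
            then show ?thesis using um by simp
          next
            case uM: False
            have "A w (u 0)" if "w \<in> Z" for w
              using ring_two[OF zM A1 u0(1) uM, of "c 0" w] that cZ[of 0] lc(2)[of 0] EA A_sym z by blast
            then show ?thesis using nj by blast
          qed
        next
          case False
          then have l3: "3 \<le> l" using l l1 by simp
          \<comment> \<open>With one jump in a period of length at least three, the constant block
            contains two consecutive constant positions, which flag two different vertices.\<close>
          obtain k0 where k0: "\<phi> k0 = 0" "\<phi> (k0 + 1) = 1"
            using int_step_crossing[of 0 l \<phi> 0] w(1) w(3)[of 0] m l w(2) jump_01
            by (metis add.right_neutral add_0 add_left_mono less_imp_le order_refl zero_less_one_class.zero_le_one zero_less_one)
          note mono = jump_prefix(1)[of \<phi> c, OF w(2)]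
          have "flagged (Suc i) u (k + 1)" if k: "k0 + 1 \<le> k" "k + 1 \<le> k0 + l" for k
          proof -
            have "jump c k = 0"
              using mono[of "k0 + 1" k] mono[of "k + 1" "k0 + l"] w(2)[of k] w(3)[of k0] k0 m k jump_01[of c k] by simp
            then have "c (k + 1) = c k" by (rule jump_eq)
            then have "E (c k) (u k)" "E (c k) (u (k + 1))" "E (c k) (u (k + 1 + 1))"
              using lc(2)[of k] lc(3)[of k] lc(3)[of "k + 1"] E_sym by auto
            then show ?thesis using lc(1)[of k] unfolding flagged_def by auto
          qed
          from this[of "k0 + 1"] this[of "k0 + 2"] have "two_flagged l (Suc i) u"
            using l3 two_flaggedI[OF R, of "k0 + 1 + 1" "k0 + 2 + 1"] by simp
          then show ?thesis using l3 i e by simp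
        qed
      qed
    qed
  qed
qed simp

end

section \<open>Two rotations of order five whose product is an involution\<close>

definition (in metric_graph) clq :: "'a set \<Rightarrow> bool" where
  "clq C \<longleftrightarrow> finite C \<and> C \<noteq> {} \<and> C \<subseteq> V \<and> (\<forall>a\<in>C. \<forall>b\<in>C. A a b)"

context rot5
begin

lemma orb_clq: "z \<in> M \<Longrightarrow> clq (orb z)"
  unfolding clq_def using orb_clique[of z] orb_V[OF M_V, of z] orb_self(1)[of z] finite_orb[of z]
  by (metis empty_iff)

lemma orb_fixed: "x z = z \<Longrightarrow> orb z = {z}"
  by (simp add: orb_def g_def)

end

text \<open>The vertices are meant to be the simplices of a complex: then the union of a clique of simplices is a simplex
  \<open>join C\<close>, of cardinality \<open>size (join C)\<close>.\<close>

locale rotations = bridged V d + X: rot5 V d x + Y: rot5 V d y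
  for V :: "'a set" and d x y +
  fixes join :: "'a set \<Rightarrow> 'a" and size :: "'a \<Rightarrow> nat"
  assumes rel [simp]: "x (y (x (y a))) = a"
    and join_V: "clq C \<Longrightarrow> join C \<in> V"
    and join_A: "clq C \<Longrightarrow> v \<in> V \<Longrightarrow> (\<And>c. c \<in> C \<Longrightarrow> A v c) \<Longrightarrow> A v (join C)"
    and join_x: "clq C \<Longrightarrow> x (join C) = join (x ` C)"
    and join_y: "clq C \<Longrightarrow> y (join C) = join (y ` C)"
    and size_x [simp]: "size (x a) = size a"
    and size_y [simp]: "size (y a) = size a"
    and join_size: "E a b \<Longrightarrow> size a = size b \<Longrightarrow> size a < size (join {a, b})"
    and size_bound: "\<exists>B. \<forall>v\<in>V. size v \<le> B"
begin

abbreviation gx where "gx \<equiv> X.g"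
abbreviation gy where "gy \<equiv> Y.g"

lemma yxy [simp]: "y (x (y a)) = gx a"
  using X.gx(1)[of "y (x (y a))"] by simp

lemma xyx [simp]: "x (y (x a)) = gy a"
  using rel[of "gy a"] by simp

lemma swap: "rotations V d y x join size"
proof unfold_locales
  show "y (x (y (x a))) = a" for a by simp
qed (use join_V join_A join_x join_y join_size size_bound in auto)

lemma size_gx [simp]: "size (gx a) = size a" and size_gy [simp]: "size (gy a) = size a"
  by (simp_all add: X.g_def Y.g_def)

lemma join_join:
  assumes "clq C" "clq D" "\<And>u v. u \<in> C \<Longrightarrow> v \<in> D \<Longrightarrow> A u v"
  shows "A (join C) (join D)"
proof -
  have "A u (join D)" if "u \<in> C" for u
    using join_A[OF assms(2), of u] assms that unfolding clq_def by blast
  then show ?thesis using join_A[OF assms(1) join_V[OF assms(2)]] A_sym by blast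
qed

lemma clq_pair: "A a b \<Longrightarrow> clq {a, b}"
  unfolding clq_def using A_sym AV by auto

lemma ex_max:
  assumes "P v0" "\<And>v. P v \<Longrightarrow> v \<in> V"
  shows "\<exists>v. P v \<and> (\<forall>w. P w \<longrightarrow> size w \<le> size v)"
proof -
  obtain B where B: "\<And>v. v \<in> V \<Longrightarrow> size v \<le> B" using size_bound by blast
  then have "\<And>v. P v \<Longrightarrow> size v \<le> B" using assms(2) by blast
  then have "\<forall>v. P v \<longrightarrow> size v < Suc B" by (simp add: less_Suc_eq_le)
  with assms(1) show ?thesis by (rule ex_has_greatest_nat)
qed

lemma join_M:
  assumes "A a b" "\<And>u v. u \<in> {a, b} \<Longrightarrow> v \<in> {x a, x b} \<Longrightarrow> A u v"
  shows "join {a, b} \<in> X.M"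
proof -
  have "clq {a, b}" "clq {x a, x b}" using clq_pair assms(1) X.A_x by blast+
  then have "A (join {a, b}) (join {x a, x b})" using join_join assms(2) by blast
  then show ?thesis unfolding X.M_iff using join_x[OF \<open>clq {a, b}\<close>] by simp
qed

text \<open>If \<open>y\<close> fixes \<open>C\<close>, the relation makes \<open>y\<close> carry
  \<open>x C\<close> to \<open>gx C\<close>. So both rotations move the join of \<open>C\<close> and
  \<open>x C\<close> by at most one, and it is larger than \<open>C\<close>.\<close>

lemma yfix_xfix:
  assumes C: "C \<in> X.M" "C \<in> Y.M" and max: "\<And>D. D \<in> X.M \<Longrightarrow> D \<in> Y.M \<Longrightarrow> size D \<le> size C"
    and "y C = C"
  shows "x C = C"
proof (rule ccontr)
  assume ne: "x C \<noteq> C"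
  have o: "A u v" if "u \<in> X.orb C" "v \<in> X.orb C" for u v using X.orb_clique C that by blast
  have AC: "A C (x C)" using o by simp
  have yx: "y (x C) = gx C" using yxy[of C] assms(4) by simp
  have xxo: "x (x C) \<in> X.orb C" by (simp add: X.orb_def)
  have "join {C, x C} \<in> X.M"
    by (rule join_M[OF AC]) (use o xxo X.M_V[OF C(1)] in auto)
  moreover have "join {C, x C} \<in> Y.M"
    by (rule rotations.join_M[OF swap AC]) (use o yx assms(4) X.M_V[OF C(1)] in auto)
  moreover have "size C < size (join {C, x C})" using join_size[of C "x C"] A_neq[OF AC] ne by simp
  ultimately show False using max by force
qed

text \<open>Otherwise the orbits of \<open>C\<close> and \<open>v\<close> under \<open>x\<close>
  would be joined, and \<open>join {C, v}\<close> would be a larger competitor.\<close>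

lemma y_notin_M:
  assumes C: "C \<in> X.M" "C \<in> Y.M" and max: "\<And>D. D \<in> X.M \<Longrightarrow> D \<in> Y.M \<Longrightarrow> size D \<le> size C"
    and v: "v \<in> Y.orb C" "v \<noteq> C"
  shows "v \<notin> X.M"
proof
  assume vM: "v \<in> X.M"
  have AC: "A C v" using Y.orb_clique[OF C(2)] v by simp
  have "\<And>u w. u \<in> X.orb C \<Longrightarrow> w \<in> X.orb v \<Longrightarrow> A u w" using X.orb_complete[OF C(1) vM AC] by blast
  moreover have "A u w" if "u \<in> X.orb C" "w \<in> X.orb C" for u w using X.orb_clique C that by blast
  moreover have "A u w" if "u \<in> X.orb v" "w \<in> X.orb v" for u w using X.orb_clique vM that by blast
  ultimately have cl: "A u w" if "u \<in> X.orb C \<union> X.orb v" "w \<in> X.orb C \<union> X.orb v" for u w using that A_sym by blast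
  have "join {C, v} \<in> X.M"
    by (rule join_M[OF AC]) (use cl X.M_V[OF C(1)] X.M_V[OF vM] in auto)
  moreover have "y v \<in> Y.orb C" using v Y.orb_x by blast
  then have "join {C, v} \<in> Y.M"
    by (intro rotations.join_M[OF swap AC]) (use Y.orb_clique[OF C(2)] v X.M_V[OF C(1)] X.M_V[OF vM] in auto)
  moreover have "size v = size C" using v by (auto simp: Y.orb_def)
  then have "size C < size (join {C, v})" using join_size[of C v] A_neq[OF AC] v by simp
  ultimately show False using max by force
qed

text \<open>If a largest \<open>C\<close> is not fixed, the relation makes \<open>y C\<close>,
  \<open>gx (gy C)\<close>, \<open>gx (y C)\<close> a ring of length two around the orbit of
  \<open>C\<close> under \<open>x\<close>. By \<open>ring_two\<close> the vertex \<open>y C\<close>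
  sees the whole orbit, and a square arises whose only possible diagonal would put
  \<open>x C\<close> into \<open>Y.M\<close>.\<close>

lemma common_fixed:
  assumes "X.M \<inter> Y.M \<noteq> {}"
  shows "\<exists>v\<in>V. x v = v \<and> y v = v"
proof -
  obtain C where C: "C \<in> X.M" "C \<in> Y.M" and max: "\<And>D. D \<in> X.M \<Longrightarrow> D \<in> Y.M \<Longrightarrow> size D \<le> size C"
    using ex_max[of "\<lambda>D. D \<in> X.M \<inter> Y.M"] assms X.M_V by blast
  have "x C = C \<and> y C = C"
  proof (rule ccontr)
    assume "\<not> (x C = C \<and> y C = C)"
    then have nx: "x C \<noteq> C" and ny: "y C \<noteq> C"
      using yfix_xfix[OF C max] rotations.yfix_xfix[OF swap C(2,1)] max by blast+
    have gyC: "gy C \<noteq> C" using ny Y.gx(2)[of C] by metis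
    have nM: "y C \<notin> X.M" "gy C \<notin> X.M"
      using y_notin_M[OF C max, of "y C"] y_notin_M[OF C max, of "gy C"] ny gyC by simp_all
    have nM': "x C \<notin> Y.M"
      using rotations.y_notin_M[OF swap C(2,1), of "x C"] max nx by simp
    have AC: "A (gy C) C" "A C (y C)" "A (gy C) (y C)" using Y.orb_clique[OF C(2)] by simp_all
    have g: "gx (gy C) = y (x C)" by (metis Y.gx(2) yxy)
    have 1: "A w (gy C)" if "w \<in> X.orb C" for w
      using X.ring_two[OF C(1) AC(3) _ nM(2,1), of C w] X.orb_clique[OF C(1)] AC that A_sym g
      by (metis X.orb_self(1,2) Y.A_x)
    have 2: "A w (y C)" if "w \<in> X.orb C" for w
      using X.ring_two[OF C(1), of "y C" "gx (gy C)" C w] X.orb_clique[OF C(1)] AC that A_sym g nM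
      by (metis X.A_g X.M_g X.orb_self(1,2) Y.A_x)
    have "A (y C) (x C)" using 2[of "x C"] A_sym by simp
    moreover have "A (x C) (gx (y C))"
      using 2[of "x (x C)"] X.A_gx A_sym by (metis (no_types, opaque_lifting) X.A_g X.gx(1) X.orb_def insertCI)
    moreover have "A (gx (y C)) (gx (gy C))" using AC A_sym by simp
    moreover have "A (gx (gy C)) (y C)" using X.orb_clique[OF C(1), of "x C" C] unfolding g by simp
    moreover have "\<not> A (y C) (gx (y C))" using nM X.M_iff_g A_sym by blast
    ultimately have "A (x C) (y (x C))" using C4[of "y C" "x C" "gx (y C)" "gx (gy C)"] g by metis
    then show False using nM' Y.M_iff by blast
  qed
  then show ?thesis using C X.M_V by blast
qed

end

section \<open>Rings obtained from walks, and lifts with a prescribed value\<close>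

context rot5_clique
begin

lemma ring_extend:
  assumes "0 < l" "\<And>k. 0 \<le> k \<Longrightarrow> k < l \<Longrightarrow> E (p k) (p (k + 1)) \<and> lev (p k) = i" "p l = g (p 0)"
  shows "ring l i (extend l p) \<and> (\<forall>k. 0 \<le> k \<longrightarrow> k \<le> l \<longrightarrow> extend l p k = p k)"
proof -
  have eq: "extend l p k = p k" if "0 \<le> k" "k \<le> l" for k
  proof (cases "k = l")
    case True
    then show ?thesis using extend_g[OF assms(1), of p 0] extend_eq[of 0 l p] assms(1,3) by simp
  qed (use that extend_eq[of k l p] in simp)
  have "E (extend l p k) (extend l p (k + 1)) \<and> lev (extend l p k) = i" for k
  proof -
    let ?r = "k mod l" and ?n = "k div l"
    have r: "0 \<le> ?r" "?r < l" using assms(1) by simp_all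
    have k: "?r + ?n * l = k" by simp
    have eqv: "extend l p (k + l) = g (extend l p k)" for k using extend_g assms(1) by blast
    have "extend l p k = gp ?n (p ?r)" "extend l p (k + 1) = gp ?n (p (?r + 1))"
      using ring_gp[of "extend l p" l ?r ?n, OF eqv] ring_gp[of "extend l p" l "?r + 1" ?n, OF eqv]
        eq[of ?r] eq[of "?r + 1"] r k by (simp_all add: algebra_simps)
    then show ?thesis using assms(2)[OF r] by (simp add: gp_E gp_lev)
  qed
  then have "ring l i (extend l p)" using assms(1) extend_g[OF assms(1)] unfolding ring_def by blast
  then show ?thesis using eq by blast
qed

lemma wk_ring:
  assumes "wk (\<lambda>v. Q v \<and> lev v = i) n b (g b)" "0 < n"
  shows "\<exists>u. ring (int n) i u \<and> u 0 = b"
proof -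
  obtain p where p: "p 0 = b" "p n = g b" "\<And>k. k \<le> n \<Longrightarrow> lev (p k) = i" "\<And>k. k < n \<Longrightarrow> E (p k) (p (Suc k))"
    using assms(1) unfolding wk_def by blast
  have "ring (int n) i (extend (int n) (\<lambda>k. p (nat k))) \<and> extend (int n) (\<lambda>k. p (nat k)) 0 = b"
    using ring_extend[of "int n" "\<lambda>k. p (nat k)" i] p assms(2) by (simp add: nat_add_distrib)
  then show ?thesis by blast
qed

text \<open>The prescribed first edge will be the one from \<open>gy T\<close> to
  \<open>y T\<close>, which has \<open>T\<close> as a common lower neighbour.\<close>

lemma wk_ring_edge:
  assumes "wk (\<lambda>v. Q v \<and> lev v = i) n b (g a)" "E a b" "lev a = i" "Q a"
  shows "\<exists>u. ring (int n + 1) i u \<and> u 0 = a \<and> u 1 = b \<and> (\<forall>k\<in>{0..int n + 1}. Q (u k))"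
proof -
  have "wk (\<lambda>v. Q v \<and> lev v = i) (Suc n) a (g a)" using assms EV wk_Suc by blast
  obtain p where p: "p 0 = b" "p n = g a" "\<And>k. k \<le> n \<Longrightarrow> lev (p k) = i \<and> Q (p k)" "\<And>k. k < n \<Longrightarrow> E (p k) (p (Suc k))"
    using assms(1) unfolding wk_def by blast
  define P where "P k = (if k \<le> 0 then a else p (nat (k - 1)))" for k :: int
  have "ring (int n + 1) i (extend (int n + 1) P) \<and> (\<forall>k. 0 \<le> k \<longrightarrow> k \<le> int n + 1 \<longrightarrow> extend (int n + 1) P k = P k)"
  proof (rule ring_extend)
    fix k :: int assume k: "0 \<le> k" "k < int n + 1"
    show "E (P k) (P (k + 1)) \<and> lev (P k) = i"
    proof (cases "k = 0")
      case False
      then have "nat k = Suc (nat (k - 1))" using k by simp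
      then show ?thesis using k False p(3)[of "nat (k - 1)"] p(4)[of "nat (k - 1)"] by (simp add: P_def)
    qed (use assms p in \<open>simp add: P_def\<close>)
  qed (use p in \<open>simp_all add: P_def\<close>)
  moreover have "Q (P k)" if "k \<in> {0..int n + 1}" for k
    using that assms p(3)[of "nat (k - 1)"] by (auto simp: P_def)
  moreover have "P 0 = a" "P 1 = b" using p by (simp_all add: P_def)
  ultimately show ?thesis by (intro exI[of _ "extend (int n + 1) P"]) simp
qed

end

context metric_graph
begin

lemma geodesic_path:
  assumes "a \<in> V" "b \<in> V"
  shows "\<exists>p. p 0 = a \<and> p (d a b) = b \<and> (\<forall>k\<le>d a b. p k \<in> V \<and> d a (p k) = k \<and> d (p k) b = d a b - k) \<and>
    (\<forall>k<d a b. E (p k) (p (Suc k)))"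
proof -
  obtain p where p: "p 0 = a" "p (d a b) = b" "\<And>k. k \<le> d a b \<Longrightarrow> p k \<in> V \<and> d a (p k) + d (p k) b = d a b"
    "\<And>k. k < d a b \<Longrightarrow> E (p k) (p (Suc k))"
    using geodesic[OF assms] unfolding wk_def by blast
  have up: "d a (p k) \<le> k" if "k \<le> d a b" for k
    using that
  proof (induction k)
    case (Suc k)
    then show ?case using d_E(1)[OF p(4)[of k] assms(1)] by simp
  qed (use p in simp)
  have down: "d (p (d a b - j)) b \<le> j" if "j \<le> d a b" for j
    using that
  proof (induction j)
    case (Suc j)
    then have "Suc (d a b - Suc j) = d a b - j" by simp
    then have "E (p (d a b - Suc j)) (p (d a b - j))" using p(4)[of "d a b - Suc j"] Suc.prems by simp
    then show ?case using d_E(2)[OF E_sym assms(2)] Suc by fastforce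
  qed (use p in simp)
  have "d a (p k) = k \<and> d (p k) b = d a b - k" if "k \<le> d a b" for k
  proof -
    have "d a (p k) \<le> k" "d (p k) b \<le> d a b - k" "d a (p k) + d (p k) b = d a b"
      using up[OF that] down[of "d a b - k"] p(3)[OF that] that by simp_all
    then show ?thesis using that by linarith
  qed
  then show ?thesis using p by blast
qed

end

context rot5_clique
begin

text \<open>The lift is cheapest among those with \<open>c 0 = T\<close>, so of the two flagged
  places of its ring only the one at zero can fail to give a saving; one saving remains. If there is
  no second one, position zero is a flagged single edge, and giving up the prescribed value produces
  a cheaper lift.\<close>

lemma forced:
  assumes T: "T \<in> V" "T \<notin> M" "lev T = N" "\<And>v. v \<in> M \<Longrightarrow> N \<le> d v T" and N1: "1 \<le> N"
    and kind: "e = 0 \<and> (\<exists>z. Z = {z}) \<or> e = 1 \<and> (\<exists>z. Z = orb z) \<and> (\<forall>v. (\<forall>w\<in>Z. A v w) \<longrightarrow> N \<le> d v T)"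
    and R: "ring l (Suc N) u" and u: "E (u 0) T" "E (u 1) T"
    and far: "e = 1 \<Longrightarrow> far T N (Suc N) l u"
  shows "2 * int N + int e + 1 \<le> l \<and> (l = 2 * int N + int e + 1 \<longrightarrow>
    (\<exists>c. lift l N u c \<and> cost l c < 2 * int N + int e \<and> c 0 \<noteq> T \<and> (E (u 2) (c 0) \<or> E (u (-1)) (c 0))))"
proof -
  obtain c0 where c0: "lift l N u c0" "c0 0 = T" using lift_ex[OF R u T(3)] by blast
  obtain c where c: "lift l N u c" "c 0 = T" and min: "\<And>c'. lift l N u c' \<Longrightarrow> c' 0 = T \<Longrightarrow> cost l c \<le> cost l c'"
    using lift_minimal[OF c0(1), of "{T}"] c0(2) by auto
  let ?m = "cost l c"
  note l = ringD(1)[OF R] and lc = liftD(2-4)[OF c(1)]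
  have "\<not> ?m \<le> 1"
  proof
    assume "?m \<le> 1"
    then have "A T (g T)" using lift_dist[OF R c(1)] T(1) unfolding A_def c(2) by simp
    then show False using M_iff_g A_sym T(2) by blast
  qed
  then have m: "2 \<le> ?m" by simp
  have l2: "1 < l" using cost_le[of l c] l m by simp
  obtain \<phi> w where w: "ring ?m N w" "\<phi> 0 = 0" "\<And>k. \<phi> (k + 1) = \<phi> k + jump c k"
    "\<And>k. \<phi> (k + l) = \<phi> k + ?m" "\<And>k. w (\<phi> k) = c k" "\<And>j. \<exists>k. \<phi> k = j" "\<And>n. \<phi> (n * l) = n * ?m"
    using lift_ring[OF R c(1)] m by auto
  have w0: "w 0 = T" using w(5)[of 0] w(2) c(2) by simp
  have "far T N N ?m w" if "e = 1"
    by (rule far_lift[of l N u c \<phi>]) (use R c w far that in auto)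
  then have S: "2 * int N + int e \<le> ?m" "two_flagged ?m N w"
    using ring_bound[OF T(1,4) kind w(1)] w0 N1 by auto
  then obtain j1 j2 where j: "0 \<le> j1" "j1 < j2" "j2 < ?m" "flagged N w j1" "flagged N w j2"
    unfolding two_flagged_def by blast
  have lone: "flagged N c k" if "flagged N w (\<phi> k)" "jump c (k - 1) \<noteq> 0" "jump c k \<noteq> 0" for k
  proof -
    have 12: "jump c k = 1" "jump c (k - 1) = 1" using jump_01 that by blast+
    have "c k = w (\<phi> k)" "c (k + 1) = w (\<phi> k + 1)" "c (k - 1) = w (\<phi> k - 1)"
      using w(5)[of k] w(5)[of "k + 1"] w(5)[of "k - 1"] w(3)[of k] w(3)[of "k - 1"] 12 by simp_all
    then show ?thesis using that unfolding flagged_def by simp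
  qed
  note le = lone_edge[where F = "{T}" and l = l and c = c and u = u and i = N, OF R c(1)]
  \<comment> \<open>At a position divisible by \<open>l\<close> the value of \<open>\<phi>\<close>
    is divisible by the cost, so the exception in \<open>lone_edge\<close> does not occur strictly
    between zero and \<open>?m\<close>.\<close>
  have blk: "\<exists>k. \<phi> k = j \<and> jump c k = 0" if "flagged N w j" "0 < j" "j < ?m" for j
  proof (rule ccontr)
    assume neg: "\<not> ?thesis"
    obtain k where k: "\<phi> k = j" using w(6) by blast
    have 1: "jump c k \<noteq> 0" using neg k by blast
    have 2: "jump c (k - 1) \<noteq> 0" using neg w(3)[of "k - 1"] k by force
    have "l dvd k" using le[OF _ _ m lone[OF _ 2 1] 2 1] c(2) min k that by blast
    then obtain n where "k = n * l" by (metis dvd_def mult.commute)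
    then have "j = n * ?m" using w(7) k by blast
    then have "0 < n" using that m by (simp add: zero_less_mult_iff)
    then have "1 * ?m \<le> n * ?m" using m by (intro mult_right_mono) auto
    then show False using that(3) \<open>j = n * ?m\<close> by linarith
  qed
  obtain k2 where k2: "\<phi> k2 = j2" "jump c k2 = 0" using blk[of j2] j by auto
  note lip = jump_prefix(2)[of \<phi> c, OF w(3)]
  have ml: "?m + 1 \<le> l" using lip[of "k2 + 1" "k2 + l"] w(4)[of k2] w(3)[of k2] k2 l by simp
  have "\<exists>c. lift l N u c \<and> cost l c < 2 * int N + int e \<and> c 0 \<noteq> T \<and> (E (u 2) (c 0) \<or> E (u (-1)) (c 0))"
    if tie: "l = 2 * int N + int e + 1"
  proof -
    have "\<not> ?m + 2 \<le> l" and meq: "?m = 2 * int N + int e" using S(1) ml tie by auto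
    have noblk: "\<not> (\<exists>k1. \<phi> k1 = j1 \<and> jump c k1 = 0)"
    proof
      assume "\<exists>k1. \<phi> k1 = j1 \<and> jump c k1 = 0"
      then obtain k1 where k1: "\<phi> k1 = j1" "jump c k1 = 0" by blast
      have "\<phi> k1 < \<phi> k2" "\<phi> k2 < \<phi> k1 + ?m" using j k1 k2 by linarith+
      then have "?m + 2 \<le> l"
        using two_blocks[where \<phi> = \<phi> and l = l and c = c and u = u and i = N, OF R c(1) w(3) w(4) k1(2) k2(2)] by blast
      then show False using \<open>\<not> ?m + 2 \<le> l\<close> by blast
    qed
    then have j0: "j1 = 0" using blk[of j1] j by force
    have 1: "jump c 0 \<noteq> 0" using noblk w(2) j0 by blast
    have 2: "jump c (0 - 1) \<noteq> 0" using noblk w(3)[of "-1"] w(2) j0 by force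
    have "flagged N c 0" using lone[of 0] 1 2 j(4) w(2) j0 by simp
    then obtain v where v: "v \<in> {c (0 - 1), c (0 + 1)}" "E (u 0) v" "E (u (0 + 1)) v"
      using le[OF _ _ m _ 2 1] c(2) min by blast
    obtain c' where c': "lift l N u c'" "cost l c' < cost l c" "c' 0 = v"
      using lift_update[OF R c(1) l2 v(2,3,1) 2 1] by blast
    have "v \<noteq> T" using v(1) 1 2 c(2) unfolding jump_def by (auto split: if_splits)
    moreover have "E (u 2) v \<or> E (u (-1)) v" using v(1) lc(3)[of 1] lc(2)[of "-1"] by auto
    ultimately show ?thesis using c' meq by auto
  qed
  then show ?thesis using ml S(1) by simp
qed

end

section \<open>Displacement sets at positive distance; two fixed ends\<close>

locale rotations_apart = rotations +
  fixes N :: nat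
  assumes N1: "1 \<le> N" and N_le: "z \<in> X.M \<Longrightarrow> q \<in> Y.M \<Longrightarrow> N \<le> d z q"
begin

lemma apart_swap: "rotations_apart V d y x join size N"
  using swap N1 N_le d_sym unfolding rotations_apart_def rotations_apart_axioms_def by metis

lemma disjoint: "q \<in> Y.M \<Longrightarrow> q \<notin> X.M"
  using N_le[of q q] N1 by auto

text \<open>Two descents from \<open>q\<close> towards \<open>z\<close> that differ by \<open>y\<close> are adjacent, hence lie in \<open>Y.M\<close>.\<close>

lemma no_dip:
  assumes Z: "x z = z" "z \<in> V" and q: "f q = q" "q \<in> V" "d q z = N"
    and f: "f = y \<and> f' = gy \<or> f = gy \<and> f' = y"
    and c: "c \<in> V" "d c z < N" "d q c + d c (f z) \<le> N"
  shows False
proof -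
  interpret C: rot5_clique V d x "{z}"
    by unfold_locales (use Z in auto)
  have lev: "C.lev p = d p z" for p using C.lev_ex[of p] by simp
  have ff: "f (f' a) = a" "f' (f a) = a" "f a \<in> V \<longleftrightarrow> a \<in> V" "d (f a) (f b) = d a b" "f' a \<in> V \<longleftrightarrow> a \<in> V"
    "d (f' a) (f' b) = d a b" for a b using f by auto
  have "C.lev q = Suc (N - 1)" "C.lev c \<le> N - 1" using q c N1 unfolding lev by auto
  then obtain s where s: "E q s" "C.lev s = N - 1" "Suc (d s c) = d q c" using C.dip[of q c] q c by blast
  have sV: "s \<in> V" using s EV by blast
  have "d s (f z) \<le> N - 1" using d_tri[of s c "f z"] s c sV ff Z by auto
  then have "d (f' s) z \<le> N - 1" using ff(6)[of s "f z"] ff(2)[of z] by simp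
  moreover have "f' q = q" using ff(2)[of q] q(1) by simp
  then have "d q (f' s) = d q s" using ff(6)[of q s] by simp
  then have "E q (f' s)" using s(1) ff(5)[of s] unfolding E_def by simp
  moreover have "N \<le> Suc (d (f' s) z)" using d_E(2)[OF E_sym[OF \<open>E q (f' s)\<close>] Z(2)] q by simp
  ultimately have "A s (f' s)"
    using C.B1'[of q s "f' s" "N - 1"] s q N1 unfolding lev by simp
  then have "s \<in> Y.M" using f Y.M_iff Y.M_iff_g A_sym by blast
  moreover have "z \<in> X.M" using Z by (simp add: X.M_iff)
  ultimately have "N \<le> C.lev s" using N_le[of z s] unfolding lev by (simp add: d_sym)
  then show False using s N1 by simp
qed

text \<open>The path follows the geodesic rotated by \<open>y\<close> from \<open>q\<close> to
  \<open>y z\<close>, which equals \<open>y (x z)\<close>, and returns along its copy under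
  \<open>y x\<close> to \<open>gx q\<close>. It closes up to a ring of length \<open>2 * N\<close>
  around \<open>z\<close>. The ring bound permits this length only with two flagged places, but only
  the corner \<open>y z\<close> can be flagged.\<close>

lemma both_fixed:
  assumes z: "z \<in> V" "x z = z" and q: "q \<in> V" "y q = q" and N: "d z q = N"
  shows False
proof -
  interpret C: rot5_clique V d x "{z}"
    by unfold_locales (use z in auto)
  have lev: "C.lev p = d p z" for p using C.lev_ex[of p] by simp
  have zM: "z \<in> X.M" and qM: "q \<in> Y.M" using z q by (simp_all add: X.M_iff Y.M_iff)
  have dqz: "d q z = N" using N by (simp add: d_sym)
  have gyq: "gy q = q" using q Y.gx(1)[of q] by simp
  obtain \<gamma> where \<gamma>: "\<gamma> 0 = q" "\<gamma> N = z" "\<And>k. k \<le> N \<Longrightarrow> \<gamma> k \<in> V \<and> d q (\<gamma> k) = k \<and> d (\<gamma> k) z = N - k"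
      "\<And>k. k < N \<Longrightarrow> E (\<gamma> k) (\<gamma> (Suc k))"
    using geodesic_path[OF q(1) z(1)] dqz by auto
  define P where "P k = (if k \<le> N then y (\<gamma> k) else y (x (\<gamma> (2 * N - k))))" for k
  have xyx': "x (y (x (\<gamma> k))) = gy (\<gamma> k)" for k by simp
  have PE: "E (P k) (P (Suc k))" if "k < 2 * N" for k
  proof -
    consider "Suc k \<le> N" | "k = N" | "N < k" by linarith
    then show ?thesis
    proof cases
      case 1 then show ?thesis using \<gamma>(4)[of k] by (simp add: P_def)
    next
      case 2
      then have "E (\<gamma> N) (\<gamma> (N - 1))" using \<gamma>(4)[of "N - 1"] N1 E_sym by simp
      moreover have "2 * N - Suc N = N - 1" by simp
      moreover have "x (\<gamma> N) = \<gamma> N" using \<gamma> z by simp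
      ultimately show ?thesis using 2 X.E_x[of "\<gamma> N" "\<gamma> (N - 1)"] by (simp add: P_def)
    next
      case 3
      then have "2 * N - k = Suc (2 * N - Suc k)" using that by simp
      then show ?thesis using 3 that \<gamma>(4)[of "2 * N - Suc k"] E_sym by (simp add: P_def)
    qed
  qed
  have PN: "N \<le> C.lev (P k)" if "k \<le> 2 * N" for k
  proof (rule ccontr)
    assume neg: "\<not> N \<le> C.lev (P k)"
    show False
    proof (cases "k \<le> N")
      case True
      have "d q (P k) + d (P k) (y z) \<le> N"
        using \<gamma>(3)[OF True] Y.dx[of q "\<gamma> k"] q True by (simp add: P_def)
      then show False using no_dip[of z y q gy "P k"] neg z q dqz \<gamma>(3)[OF True] True unfolding lev by (simp add: P_def)
    next
      case False
      let ?c = "gy (\<gamma> (2 * N - k))"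
      have "C.lev ?c = C.lev (P k)" using False C.lev_x[of "P k"] by (simp add: P_def)
      moreover have "d q ?c + d ?c (gy z) \<le> N"
        using \<gamma>(3)[of "2 * N - k"] Y.dg[of q "\<gamma> (2 * N - k)"] gyq False that by simp
      ultimately show False using no_dip[of z gy q y ?c] neg z gyq q dqz \<gamma>(3)[of "2 * N - k"] False that
        unfolding lev by simp
    qed
  qed
  have P0: "P 0 = q" "P (2 * N) = gx q" using \<gamma> q N1 yxy[of q] by (simp_all add: P_def)
  have PV: "P k \<in> V" if "k \<le> 2 * N" for k using \<gamma>(3)[of k] \<gamma>(3)[of "2 * N - k"] that by (simp add: P_def)
  have kind: "(0::nat) = 0 \<and> (\<exists>w. {z} = {w}) \<or> (0::nat) = 1 \<and> (\<exists>w. {z} = X.orb w) \<and> (\<forall>v. (\<forall>w\<in>{z}. A v w) \<longrightarrow> N \<le> d v q)"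
    by simp
  have bound: "2 * int N \<le> l \<and> C.two_flagged l N u" if "C.ring l N u" "u 0 = q" for l u
    using C.ring_bound[OF q(1) N_le[OF _ qM] kind that(1)] that(2) N1 by simp
  have levq: "C.lev (P 0) = N" "C.lev (P (2 * N)) = N" using P0 dqz unfolding lev by (simp_all add: lev[symmetric])
  consider k where "k < 2 * N" "wk (\<lambda>v. True \<and> C.lev v = N) k q (gx q)" | "\<And>k. k \<le> 2 * N \<Longrightarrow> C.lev (P k) = N"
    using C.peel[of "\<lambda>_. True" "2 * N" P N] PN PE PV levq P0 by auto
  then show False
  proof cases
    case 1
    have "k \<noteq> 0"
    proof
      assume "k = 0"
      then have "q = gx q" using 1(2) unfolding \<open>k = 0\<close> wk_0 by simp
      then have "A q (gx q)" using q(1) A_refl by metis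
      then show False using disjoint[OF qM] X.M_iff_g A_sym by blast
    qed
    then obtain u where "C.ring (int k) N u" "u 0 = q" using C.wk_ring[OF 1(2)] by auto
    then show False using bound 1(1) by fastforce
  next
    case 2
    define u where "u = C.extend (2 * int N) (\<lambda>k. P (nat k))"
    have u: "C.ring (2 * int N) N u" "\<And>k. 0 \<le> k \<Longrightarrow> k \<le> 2 * int N \<Longrightarrow> u k = P (nat k)"
      using C.ring_extend[of "2 * int N" "\<lambda>k. P (nat k)" N] N1 PE 2 P0 unfolding u_def
      by (auto simp: nat_add_distrib nat_mult_distrib)
    \<comment> \<open>Inside a geodesic a flag would be a shortcut or a dip excluded by
      \<open>no_dip\<close>; at the base point it would put a vertex too close to \<open>z\<close>
      into \<open>Y.M\<close>.\<close>
    have nofl: False if k: "0 \<le> k" "k < 2 * int N" "k \<noteq> int N" and fl: "C.flagged N u k" for k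
    proof -
      obtain n where n: "k = int n" "n < 2 * N" "n \<noteq> N" using k by (metis nat_int zero_le_imp_eq_int of_nat_less_iff of_nat_mult of_nat_numeral)
      have um: "u (k - 1) = (if n = 0 then gy (\<gamma> 1) else P (n - 1))"
      proof (cases "n = 0")
        case True
        have "u (- 1 + 2 * int N) = gx (u (- 1))" using C.ringD(2)[OF u(1)] by blast
        moreover have "u (- 1 + 2 * int N) = P (2 * N - 1)"
          using u(2)[of "- 1 + 2 * int N"] N1 by (simp add: nat_diff_distrib nat_mult_distrib)
        ultimately have "u (- 1) = x (P (2 * N - 1))" using X.gx(2)[of "u (- 1)"] by metis
        moreover have "x (P (2 * N - 1)) = gy (\<gamma> 1)"
        proof (cases "N = 1")
          case True
          then show ?thesis using \<gamma>(2) z xyx[of z] by (simp add: P_def)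
        next
          case False
          then have "\<not> 2 * N - 1 \<le> N" "2 * N - (2 * N - 1) = 1" using N1 by auto
          then show ?thesis unfolding P_def by simp
        qed
        ultimately show ?thesis using True n by simp
      next
        case False
        then show ?thesis using u(2)[of "k - 1"] n by (simp add: nat_diff_distrib)
      qed
      have u0: "u k = P n" and up: "u (k + 1) = P (Suc n)"
        using u(2)[of k] u(2)[of "k + 1"] n by (simp_all add: nat_add_distrib)
      show False
      proof (cases "n = 0")
        case True
        let ?v = "\<gamma> 1"
        have v: "?v \<in> V" "d ?v z = N - 1" "E q ?v" using \<gamma>(3)[of 1] \<gamma>(4)[of 0] \<gamma>(1) N1 by auto
        have nv: "?v \<notin> Y.M" using N_le[OF zM, of ?v] v N1 by (auto simp: d_sym)
        have u1: "u (k - 1) = gy ?v" "u k = q" "u (k + 1) = y ?v"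
          using um u0 up True P0 N1 by (simp_all add: P_def)
        show False using fl unfolding C.flagged_def u1
        proof
          assume "A (gy ?v) (y ?v)"
          then have "A ?v (y (y ?v))" using Y.A_x[of "gy ?v" "y ?v"] by simp
          then show False using Y.M_square nv by blast
        next
          assume "\<exists>t. Suc (C.lev t) = N \<and> E t (gy ?v) \<and> E t q \<and> E t (y ?v)"
          then obtain t where t: "Suc (C.lev t) = N" "E t (gy ?v)" "E t q" "E t (y ?v)" by blast
          \<comment> \<open>\<open>?v\<close>, \<open>t\<close>, \<open>y ?v\<close>,
            \<open>y t\<close> form a square, and either diagonal would give a member of
            \<open>Y.M\<close> at distance less than \<open>N\<close> from \<open>z\<close>.\<close>
          have "A ?v t" using C.B1'[of q ?v t "N - 1"] v t E_sym dqz N1 unfolding lev by auto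
          moreover have "A t (y ?v)" using t EA by blast
          moreover have "A (y ?v) (y t)" using \<open>A ?v t\<close> by simp
          moreover have "A (y t) ?v" using t(2) EA Y.A_x[of t "gy ?v"] by simp
          ultimately have "A ?v (y ?v) \<or> A t (y t)" using C4 by blast
          moreover have "t \<notin> Y.M" using N_le[OF zM, of t] t(1) unfolding lev by (auto simp: d_sym)
          ultimately show False using nv unfolding Y.M_iff by blast
        qed
      next
        case n0: False
        define f where "f = (if n < N then y else gy)"
        define f' where "f' = (if n < N then gy else y)"
        define a where "a = (if n < N then n else 2 * N - n)"
        \<comment> \<open>On the second half \<open>x\<close> moves the path to the copy of the
          geodesic under \<open>gy\<close>, so that both halves are treated alike.\<close>
        define h where "h = (if n < N then id else x)"
        have a: "0 < a" "a < N" using n n0 unfolding a_def by auto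
        have ff: "d (f b) (f c) = d b c" "f q = q" "f b \<in> V \<longleftrightarrow> b \<in> V" "f = y \<and> f' = gy \<or> f = gy \<and> f' = y" for b c
          using q gyq unfolding f_def f'_def by auto
        have h: "E (h b) (h c) \<longleftrightarrow> E b c" "A (h b) (h c) \<longleftrightarrow> A b c" "C.lev (h b) = C.lev b" "h b \<in> V \<longleftrightarrow> b \<in> V" for b c
          unfolding h_def by auto
        have nb: "{h (u (k - 1)), h (u (k + 1))} = {f (\<gamma> (a - 1)), f (\<gamma> (a + 1))}"
        proof (cases "n < N")
          case True
          then have "n - 1 \<le> N" by simp
          with True show ?thesis using um up n0 unfolding h_def f_def a_def by (simp add: P_def)
        next
          case False
          then have "2 * N - (n - 1) = Suc (2 * N - n)" "2 * N - Suc n = 2 * N - n - 1" using n by auto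
          moreover have "x (P (n - 1)) = gy (\<gamma> (2 * N - (n - 1)))"
          proof (cases "n - 1 \<le> N")
            case True
            then have "n - 1 = N" "2 * N - (n - 1) = N" using False n by auto
            then show ?thesis using \<gamma>(2) z xyx[of z] by (simp add: P_def)
          qed (simp add: P_def)
          moreover have "x (P (Suc n)) = gy (\<gamma> (2 * N - Suc n))" using False n by (simp add: P_def)
          ultimately show ?thesis using um up n0 False unfolding h_def f_def a_def by auto
        qed
        have dist: "d q (f (\<gamma> (a - 1))) = a - 1" "d q (f (\<gamma> (a + 1))) = a + 1" "d (f (\<gamma> (a + 1))) (f z) = N - (a + 1)"
          using ff(1)[of q "\<gamma> (a - 1)"] ff(1)[of q "\<gamma> (a + 1)"] ff(1,2) \<gamma>(3)[of "a - 1"] \<gamma>(3)[of "a + 1"] a by auto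
        show False using fl unfolding C.flagged_def
        proof
          assume "A (u (k - 1)) (u (k + 1))"
          then have "A (h (u (k - 1))) (h (u (k + 1)))" using h by blast
          then have "A (f (\<gamma> (a - 1))) (f (\<gamma> (a + 1)))" using nb A_sym by (metis doubleton_eq_iff)
          then have "a + 1 \<le> Suc (a - 1)" using d_A(1)[OF _ q(1)] dist by metis
          then show False using a by simp
        next
          assume "\<exists>t. Suc (C.lev t) = N \<and> E t (u (k - 1)) \<and> E t (u k) \<and> E t (u (k + 1))"
          then obtain t where t: "Suc (C.lev t) = N" "E t (u (k - 1))" "E t (u (k + 1))" by blast
          have "E (h t) (h (u (k - 1)))" "E (h t) (h (u (k + 1)))" using t h by auto
          then have E: "E (h t) (f (\<gamma> (a - 1)))" "E (h t) (f (\<gamma> (a + 1)))" using nb by (metis doubleton_eq_iff)+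
          have "d q (h t) \<le> a" using d_E(1)[OF E_sym[OF E(1)] q(1)] dist a by simp
          moreover have "d (h t) (f z) \<le> N - a" using d_E(2)[OF E_sym[OF E(2)], of "f z"] dist a ff z by simp
          ultimately have "d q (h t) + d (h t) (f z) \<le> N" using a by linarith
          moreover have "h t \<in> V" using EV(1)[OF E(1)] .
          moreover have "d (h t) z < N" using h(3)[of t] t(1) unfolding lev by simp
          ultimately show False using no_dip[OF z(2,1) ff(2) q(1) dqz ff(4), of "h t"] by blast
        qed
      qed
    qed
    obtain k1 k2 where "0 \<le> k1" "k1 < k2" "k2 < 2 * int N" "C.flagged N u k1" "C.flagged N u k2"
      using bound[OF u(1)] u(2)[of 0] P0 unfolding C.two_flagged_def by auto
    then show False using nofl[of k1] nofl[of k2] by fastforce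
  qed
qed

end

section \<open>An end that is moved\<close>

lemma (in rot5) orb_ne [simp]: "orb z \<noteq> {}"
  by (simp add: orb_def)

text \<open>Maximality of \<open>T\<close> pushes its translates under \<open>y\<close> to the next
  level. The centre \<open>Z\<close> is left general because it will be enlarged by a second
  orbit.\<close>

locale side = rotations_apart V d x y join size N + C: rot5_clique V d x Z
  for V :: "'a set" and d x y join size N Z +
  fixes T
  assumes T_M: "T \<in> Y.M" and T_lev: "C.lev T = N" and T_moved: "y T \<noteq> T"
    and T_max: "D \<in> Y.M \<Longrightarrow> C.lev D = N \<Longrightarrow> size D \<le> size T"
begin

lemma TV: "T \<in> V"
  using T_M Y.M_V by blast

lemma lev_Y: "D \<in> Y.M \<Longrightarrow> N \<le> C.lev D"
  using C.lev_ex[of D] C.Z_M N_le d_sym by metis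

text \<open>Two points of the orbit on level \<open>N\<close> would have a common lower neighbour
  \<open>s\<close>. Their join is still adjacent to \<open>s\<close>, so it lies on level
  \<open>N\<close> as well and is larger than \<open>T\<close>.\<close>

lemma lev_T1:
  assumes v: "v \<in> Y.orb T" "v \<noteq> T"
  shows "C.lev v = Suc N"
proof (rule ccontr)
  assume neg: "C.lev v \<noteq> Suc N"
  have vM: "v \<in> Y.M" using v Y.orb_M T_M by blast
  have TvA: "A T v" using Y.orb_clique[OF T_M] v by simp
  then have E: "E T v" using v A_neq by blast
  have "C.lev v = N" using neg lev_Y[OF vM] C.lev_E[OF E] T_lev by simp
  then obtain s where s: "E T s" "E v s" "C.lev s = N - 1"
    using C.B2'[OF E, of "N - 1"] T_lev N1 by auto
  let ?D = "join {T, v}"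
  have "?D \<in> Y.M"
  proof (rule rotations.join_M[OF swap TvA])
    fix a b assume "a \<in> {T, v}" "b \<in> {y T, y v}"
    moreover have "y v \<in> Y.orb T" using v Y.orb_x by blast
    ultimately have "a \<in> Y.orb T" "b \<in> Y.orb T" using v by auto
    then show "A a b" using Y.orb_clique[OF T_M] by blast
  qed
  moreover have "A s ?D"
    using join_A[OF clq_pair[OF TvA] EV(2)[OF s(1)]] s EA E_sym by auto
  then have "C.lev ?D \<le> N" using C.lev_A s(3) N1 by fastforce
  ultimately have "size ?D \<le> size T" using T_max lev_Y by (metis le_antisym)
  moreover have "size T = size v" using v by (auto simp: Y.orb_def)
  then have "size T < size ?D" using join_size[OF E] by simp
  ultimately show False by simp
qed

lemma gyT: "gy T \<noteq> T"
  using T_moved Y.gx(2)[of T] by metis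

lemma lev_yT: "C.lev (y T) = Suc N" "C.lev (gy T) = Suc N"
  using lev_T1[of "y T"] lev_T1[of "gy T"] T_moved gyT by simp_all

lemma E_yT: "E (y T) T" "E (gy T) T" "E (gy T) (y T)"
proof -
  have "A (y T) T" "A (gy T) T" "A (gy T) (y T)" using Y.orb_clique[OF T_M] by simp_all
  moreover have "gy T \<noteq> y T"
  proof
    assume eq: "gy T = y T"
    have "y (y T) = T" using eq Y.gx(2)[of T] by metis
    then have "y T = T" using Y.x5[of T] by metis
    then show False using T_moved by simp
  qed
  ultimately show "E (y T) T" "E (gy T) T" "E (gy T) (y T)" using A_neq T_moved gyT by blast+
qed

text \<open>If such a \<open>c\<close> were on level \<open>N\<close> or below, a descent from
  \<open>f T\<close> towards it would pass through a neighbour of \<open>T\<close>. This puts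
  \<open>T\<close> within \<open>N\<close> of \<open>f z\<close>, hence \<open>f' T\<close> within
  \<open>N\<close> of \<open>z\<close>, against the level of \<open>f' T\<close>.\<close>

lemma side_dip:
  assumes f: "f = y \<and> f' = gy \<or> f = gy \<and> f' = y"
    and z: "z \<in> Z" and c: "c \<in> V" "d (f T) c + d c (f z) \<le> N"
  shows "Suc N \<le> C.lev c"
proof (rule ccontr)
  assume neg: "\<not> Suc N \<le> C.lev c"
  have zV: "z \<in> V" using z C.Z_V by blast
  have ff: "f' (f a) = a" "d (f' a) (f' b) = d a b" "f a \<in> V \<longleftrightarrow> a \<in> V" "C.lev (f T) = Suc N" "C.lev (f' T) = Suc N" "E (f T) T"
    for a b using f lev_yT E_yT by auto
  obtain s where s: "E (f T) s" "C.lev s = N" "Suc (d s c) = d (f T) c"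
    using C.dip[of "f T" c N] ff(4) neg c TV ff(3) by auto
  have "A s T" using C.B1'[OF s(1) ff(6) ff(4) s(2) T_lev] .
  have sV: "s \<in> V" using s EV by blast
  have fzV: "f z \<in> V" using ff(3) zV by blast
  have "d T (f z) \<le> Suc (d s (f z))" using d_A(2)[OF \<open>A s T\<close> fzV] .
  also have "d s (f z) \<le> d s c + d c (f z)" using d_tri[OF sV c(1) fzV] .
  finally have "d T (f z) \<le> N" using s c by simp
  then have "d (f' T) z \<le> N" using ff(2)[of T "f z"] ff(1)[of z] by simp
  then show False using C.lev_le[OF z, of "f' T"] ff(5) by simp
qed

lemma side_dip2:
  assumes z: "z \<in> Z" and c: "c \<in> V" "d (y (x T)) c + d c (y (x z)) \<le> N"
  shows "Suc N \<le> C.lev c"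
proof -
  have "d (gy T) (x c) = d (y (x T)) c" "d (x c) (gy z) = d c (y (x z))"
    using X.dx[of "y (x T)" c] X.dx[of c "y (x z)"] by simp_all
  then show ?thesis using side_dip[of gy y z "x c"] z c by simp
qed

lemma side_far:
  assumes "f = y \<and> f' = gy \<or> f = gy \<and> f' = y" "z \<in> Z" "c \<in> V" "d (f T) c + d c (f z) \<le> N" "w \<in> Z"
  shows "Suc N \<le> d c w"
  using side_dip[OF assms(1-4)] C.lev_le[OF assms(5)] by (rule le_trans)

lemma side_far2:
  assumes "z \<in> Z" "c \<in> V" "d (y (x T)) c + d c (y (x z)) \<le> N" "w \<in> Z"
  shows "Suc N \<le> d c w"
  using side_dip2[OF assms(1-3)] C.lev_le[OF assms(4)] by (rule le_trans)

text \<open>Let \<open>s\<close> be a common lower neighbour of \<open>T\<close> and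
  \<open>r\<close>. If \<open>r\<close> were moved further, then in the pentagon \<open>r\<close>,
  \<open>s\<close>, \<open>w\<close>, \<open>f' r\<close>, \<open>f' T\<close> the levels exclude
  some diagonals and the squares cut off by the remaining ones would have none.\<close>

lemma r_in_M:
  assumes f: "f = y \<and> f' = gy \<or> f = gy \<and> f' = y"
    and r: "C.lev r = N" "E (gy T) r" "E (y T) r" "r \<noteq> T" and w: "E T w" "C.lev w = N - 1" "E (f w) r"
  shows "r \<in> Y.M"
proof (rule ccontr)
  assume "r \<notin> Y.M"
  then have nr: "\<not> A r (f' r)" using f Y.M_iff Y.M_iff_g A_sym by blast
  have ff: "E (f' a) (f' b) \<longleftrightarrow> E a b" "f' (f a) = a" "E (f' T) r" "E r (f T)" "C.lev (f' T) = Suc N" for a b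
    using f r lev_yT E_sym by auto
  have "A T r" using C.B1'[of "y T" T r N] E_yT r lev_yT T_lev by blast
  then have Tr: "E T r" using A_neq r by blast
  then obtain s where s: "E T s" "E r s" "C.lev s = N - 1" using C.B2'[OF Tr, of "N - 1"] r T_lev N1 by auto
  have sw: "A s w" using C.B1'[of T s w "N - 1"] s w T_lev N1 by simp
  have wr: "A w (f' r)" using ff(1)[of "f w" r] ff(2) w EA by simp
  have rT: "A (f' r) (f' T)" using ff(1)[of r T] Tr E_sym EA by blast
  have "\<not> A s (f' T)" using C.lev_A[of s "f' T"] ff(5) s N1 by auto
  moreover have "\<not> A w (f' T)" using C.lev_A[of w "f' T"] ff(5) w N1 by auto
  moreover have "A (f' T) r" using ff EA by blast
  ultimately show False
    using C5[OF EA[OF s(2)] sw wr rT] C4[of r w "f' r" "f' T"] C4[of r s "f' r" "f' T"] wr rT nr EA[OF s(2)] A_sym by blast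
qed

end

section \<open>Rings around the orbit of the other end\<close>

locale side_orbit = side +
  fixes z
  assumes z_M: "z \<in> X.M" and Z_orb: "Z = X.orb z" and z_T: "d z T = N"
begin

lemma zZ: "z \<in> Z" "x z \<in> Z" "gx z \<in> Z"
  by (simp_all add: Z_orb)

text \<open>Adding a second orbit to the centre leaves \<open>T\<close> on level \<open>N\<close>,
  because \<open>N\<close> bounds all distances between the two displacement sets. So
  \<open>side_dip\<close> also keeps the rotated geodesics away from that orbit.\<close>

lemma side_extend:
  assumes v: "v \<in> X.M" "\<forall>w\<in>Z. A v w"
    and max: "\<And>D c. D \<in> Y.M \<Longrightarrow> c \<in> X.M \<Longrightarrow> d c D = N \<Longrightarrow> size D \<le> size T"
  shows "side V d x y join size N (Z \<union> X.orb v) T"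
proof -
  let ?Z = "Z \<union> X.orb v"
  have cr: "A a b" if "a \<in> X.orb v" "b \<in> Z" for a b
    using X.orb_complete[OF v(1) z_M _ that(1)] that v(2) zZ unfolding Z_orb by blast
  interpret D: rot5_clique V d x ?Z
  proof unfold_locales
    show "?Z \<subseteq> V" using C.Z_V X.orb_V X.M_V v by blast
    show "?Z \<noteq> {}" using zZ by blast
    show "A a b" if "a \<in> ?Z" "b \<in> ?Z" for a b
      using that C.Z_cl X.orb_clique[OF v(1)] cr A_sym by blast
    show "x ` ?Z = ?Z" using C.Z_x X.orb_x by (simp add: image_Un)
  qed
  have ge: "N \<le> D.lev D" if "D \<in> Y.M" for D
    using D.lev_ex[of D] D.Z_M N_le that d_sym by metis
  show ?thesis
  proof unfold_locales
    show "T \<in> Y.M" by (rule T_M)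
    show "D.lev T = N" using ge[OF T_M] D.lev_le[of z T] zZ z_T by (simp add: d_sym)
    show "y T \<noteq> T" by (rule T_moved)
    show "size D \<le> size T" if "D \<in> Y.M" "D.lev D = N" for D
      using D.lev_ex[of D] D.Z_M max that d_sym by metis
  qed
qed

text \<open>Uses the ring bound for the closed path through \<open>gy T\<close>, \<open>y T\<close>, \<open>y z\<close>, \<open>y (x z)\<close> and back to \<open>y (x T) = gx (gy T)\<close>.\<close>

lemma tie:
  fixes e :: nat
  assumes kind: "e = 0 \<and> x z = z \<or> e = 1 \<and> x z \<noteq> z \<and> (\<forall>q\<in>Y.M. \<forall>v. (\<forall>w\<in>Z. A v w) \<longrightarrow> N \<le> d v q)"
    and max: "\<And>D c. e = 1 \<Longrightarrow> D \<in> Y.M \<Longrightarrow> c \<in> X.M \<Longrightarrow> d c D = N \<Longrightarrow> size D \<le> size T"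
    and bad: "\<And>v. e = 1 \<Longrightarrow> v \<in> X.M \<Longrightarrow> d v T = N \<Longrightarrow> d (gx v) T \<noteq> N"
  shows False
proof -
  have zV: "z \<in> V" using z_M X.M_V by blast
  have dTz: "d T z = N" using z_T by (simp add: d_sym)
  obtain \<gamma> where \<gamma>: "\<gamma> 0 = T" "\<gamma> N = z" "\<And>k. k \<le> N \<Longrightarrow> \<gamma> k \<in> V \<and> d T (\<gamma> k) = k \<and> d (\<gamma> k) z = N - k"
      "\<And>k. k < N \<Longrightarrow> E (\<gamma> k) (\<gamma> (Suc k))"
    using geodesic_path[OF TV zV] dTz by auto
  \<comment> \<open>The summand \<open>e\<close> counts the edge from \<open>y z\<close> to
    \<open>y (x z)\<close>.\<close>
  define L where "L = 2 * N + e"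
  have e01: "e = 0 \<or> e = 1" using kind by blast
  define P where "P k = (if k \<le> N then y (\<gamma> k) else y (x (\<gamma> (L - k))))" for k
  have PE: "E (P k) (P (Suc k))" if "k < L" for k
  proof -
    consider "Suc k \<le> N" | "k = N" | "N < k" by linarith
    then show ?thesis
    proof cases
      case 1 then show ?thesis using \<gamma>(4)[of k] by (simp add: P_def)
    next
      case 2
      show ?thesis
      proof (cases "e = 0")
        case True
        then have "E (\<gamma> N) (\<gamma> (N - 1))" using \<gamma>(4)[of "N - 1"] N1 E_sym by simp
        moreover have "L - Suc N = N - 1" using True by (simp add: L_def)
        moreover have "x (\<gamma> N) = \<gamma> N" using \<gamma> kind True by simp
        ultimately show ?thesis using 2 X.E_x[of "\<gamma> N" "\<gamma> (N - 1)"] by (simp add: P_def)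
      next
        case False
        then have "L - Suc N = N" "E z (x z)" using kind z_M A_neq X.M_iff by (auto simp: L_def)
        then show ?thesis using 2 \<gamma>(2) by (simp add: P_def)
      qed
    next
      case 3
      then have "L - k = Suc (L - Suc k)" "L - Suc k < N" using that e01 by (auto simp: L_def)
      then show ?thesis using 3 \<gamma>(4)[of "L - Suc k"] E_sym by (simp add: P_def)
    qed
  qed
  have P0: "P 0 = y T" "P L = gx (gy T)"
    using \<gamma>(1) N1 yxy[of "gy T"] by (simp_all add: P_def L_def)
  have PV: "P k \<in> V" if "k \<le> L" for k
    using \<gamma>(3)[of k] \<gamma>(3)[of "L - k"] that e01 by (auto simp: P_def L_def)
  \<comment> \<open>\<open>Z'\<close> will be \<open>Z\<close> itself or its enlargement by the
    orbit of a vertex that occurs in \<open>far\<close>.\<close>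
  have Pside: "Suc N \<le> d (P k) w" if k: "k \<le> L" and S: "side V d x y join size N Z' T" and w: "z \<in> Z'" "w \<in> Z'" for k w Z'
  proof (cases "k \<le> N")
    case True
    have "d (y T) (P k) + d (P k) (y z) \<le> N" using True \<gamma>(3)[OF True] by (simp add: P_def)
    then show ?thesis using side.side_far[OF S, of y gy z "P k" w] w PV[OF k] by blast
  next
    case False
    then have "L - k \<le> N" using k e01 by (auto simp: L_def)
    then have "d (y (x T)) (P k) + d (P k) (y (x z)) \<le> N" using False \<gamma>(3)[of "L - k"] by (simp add: P_def)
    then show ?thesis using side.side_far2[OF S w(1), of "P k" w] w PV[OF k] by blast
  qed
  have Plev: "Suc N \<le> C.lev (P k)" if "k \<le> L" for k
    using Pside[OF that side_axioms zZ(1)] C.lev_ex[of "P k"] by metis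
  have kindC: "e = 0 \<and> (\<exists>z. Z = {z}) \<or> e = 1 \<and> (\<exists>z. Z = X.orb z) \<and> (\<forall>v. (\<forall>w\<in>Z. A v w) \<longrightarrow> N \<le> d v q)"
    if "q \<in> Y.M" for q
    using kind Z_orb X.orb_fixed that by metis
  have near: "\<And>v. v \<in> X.M \<Longrightarrow> N \<le> d v q" if "q \<in> Y.M" for q using N_le that by blast
  \<comment> \<open>Holds vacuously, since \<open>bad\<close> denies the hypotheses on
    \<open>v\<close>.\<close>
  have farT: "C.far T N (Suc N) l u" if "e = 1" for l u
    using bad[OF that] unfolding C.far_def by blast
  have forced: "2 * int N + int e + 1 \<le> l \<and> (l = 2 * int N + int e + 1 \<longrightarrow>
      (\<exists>c. C.lift l N u c \<and> C.cost l c < 2 * int N + int e \<and> c 0 \<noteq> T \<and> (E (u 2) (c 0) \<or> E (u (-1)) (c 0))))"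
    if R: "C.ring l (Suc N) u" and u: "u 0 = gy T" "u 1 = y T" for l u
    by (rule C.forced[OF TV disjoint[OF T_M] T_lev N_le[OF _ T_M] N1 kindC[OF T_M] R])
      (use u E_yT farT in auto)
  have LN: "0 < L" using N1 by (simp add: L_def)
  consider k where "k < L" "wk (\<lambda>v. True \<and> C.lev v = Suc N) k (y T) (gx (gy T))"
    | "\<And>k. k \<le> L \<Longrightarrow> C.lev (P k) = Suc N"
    using C.peel[of "\<lambda>_. True" L P "Suc N"] Plev PE PV lev_yT P0 TV by auto
  then show False
  proof cases
    case 1
    obtain u where u: "C.ring (int k + 1) (Suc N) u" "u 0 = gy T" "u 1 = y T"
      using C.wk_ring_edge[OF 1(2) E_yT(3) lev_yT(2)] by auto
    have "2 * int N + int e + 1 \<le> int k + 1"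
      using forced[OF u] by blast
    then show False using 1(1) by (simp add: L_def)
  next
    case 2
    define p where "p k = (if k \<le> 0 then gy T else P (nat (k - 1)))" for k :: int
    define l where "l = int L + 1"
    define u where "u = C.extend l p"
    have pp: "E (p k) (p (k + 1)) \<and> C.lev (p k) = Suc N" if k: "0 \<le> k" "k < l" for k
    proof (cases "k = 0")
      case True
      then show ?thesis using E_yT(3) lev_yT P0 by (simp add: p_def)
    next
      case False
      then have "nat k = Suc (nat (k - 1))" using k by simp
      then show ?thesis using k False PE[of "nat (k - 1)"] 2[of "nat (k - 1)"] by (simp add: p_def l_def)
    qed
    have u: "C.ring l (Suc N) u" "\<And>k. 0 \<le> k \<Longrightarrow> k \<le> l \<Longrightarrow> u k = p k"
      using C.ring_extend[of l p "Suc N", OF _ pp] P0 unfolding u_def by (simp_all add: l_def p_def)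
    have l: "l = 2 * int N + int e + 1" by (simp add: l_def L_def)
    have u01: "u 0 = gy T" "u 1 = y T" using u(2)[of 0] u(2)[of 1] P0 l by (simp_all add: p_def)
    have u2: "u 2 = y (\<gamma> 1)" using u(2)[of 2] N1 l by (simp add: p_def P_def)
    have um: "u (- 1) = gy (\<gamma> 1)"
    proof -
      have "gx (u (- 1)) = u (- 1 + l)" using C.ringD(2)[OF u(1), of "- 1"] by simp
      also have "\<dots> = P (L - 1)" using u(2)[of "- 1 + l"] LN by (simp add: p_def l_def nat_diff_distrib)
      finally have "u (- 1) = x (P (L - 1))" using X.gx(2)[of "u (- 1)"] by metis
      moreover have "x (P (L - 1)) = gy (\<gamma> 1)"
      proof (cases "L - 1 \<le> N")
        case True
        then have "N = 1" "e = 0" using N1 by (auto simp: L_def)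
        then show ?thesis using True \<gamma>(2) kind xyx[of z] by (simp add: P_def L_def)
      next
        case False
        then have "L - (L - 1) = 1" by simp
        then show ?thesis using False unfolding P_def by simp
      qed
      ultimately show ?thesis by simp
    qed
    obtain c where c: "C.lift l N u c" "C.cost l c < 2 * int N + int e" "c 0 \<noteq> T" "E (u 2) (c 0) \<or> E (u (- 1)) (c 0)"
      using forced[OF u(1) u01] l by blast
    let ?r = "c 0"
    have r: "C.lev ?r = N" "E (gy T) ?r" "E (y T) ?r"
      using C.liftD(2-4)[OF c(1), of 0] u01 by simp_all
    have w: "E T (\<gamma> 1)" "C.lev (\<gamma> 1) = N - 1"
    proof -
      show e: "E T (\<gamma> 1)" using \<gamma>(1) \<gamma>(4)[of 0] N1 by simp
      have "C.lev (\<gamma> 1) \<le> N - 1" using C.lev_le[OF zZ(1), of "\<gamma> 1"] \<gamma>(3)[of 1] N1 by simp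
      then show "C.lev (\<gamma> 1) = N - 1" using C.lev_E[OF E_sym[OF e]] T_lev by simp
    qed
    \<comment> \<open>The exchanged value again lies in \<open>Y.M\<close>, so the ring bound
      applies with \<open>?r\<close> in the place of \<open>T\<close> and contradicts the smaller
      cost.\<close>
    have rM: "?r \<in> Y.M"
      using r_in_M[of y gy ?r "\<gamma> 1"] r_in_M[of gy y ?r "\<gamma> 1"] r c(3,4) w unfolding u2 um by blast
    have pos: "0 < C.cost l c"
    proof (rule ccontr)
      assume "\<not> 0 < C.cost l c"
      then have "d ?r (gx ?r) = 0" using C.lift_dist[OF u(1) c(1)] by simp
      then have "A ?r (gx ?r)" using Y.M_V[OF rM] by (simp add: A_def)
      then show False using disjoint[OF rM] X.M_iff_g A_sym by blast
    qed
    obtain \<phi> w where w: "C.ring (C.cost l c) N w" "\<phi> 0 = 0" "\<And>k. \<phi> (k + 1) = \<phi> k + C.jump c k"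
      "\<And>k. \<phi> (k + l) = \<phi> k + C.cost l c" "\<And>k. w (\<phi> k) = c k" "\<And>j. \<exists>k. \<phi> k = j"
      using C.lift_ring[OF u(1) c(1) pos] by auto
    have "C.far ?r N (Suc N) l u" if e: "e = 1"
      unfolding C.far_def
    proof (intro ballI impI)
      fix v k assume v: "v \<in> X.M" "\<forall>w\<in>Z. A v w" and k: "k \<in> {0..l}"
      have S: "side V d x y join size N (Z \<union> X.orb v) T" using side_extend[OF v] max[OF e] by blast
      have m: "z \<in> Z \<union> X.orb v" "gx v \<in> Z \<union> X.orb v" using zZ by auto
      show "Suc N \<le> d (u k) (gx v)"
      proof (cases "k = 0")
        case True
        have "d (gy T) (gy T) + d (gy T) (gy z) \<le> N" using dTz by simp
        then show ?thesis using side.side_far[OF S, of gy y z "gy T" "gx v"] m u01 True TV by simp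
      next
        case False
        then have "u k = P (nat (k - 1))" "nat (k - 1) \<le> L" using u(2)[of k] k by (auto simp: p_def l_def)
        then show ?thesis using Pside[OF _ S m] by simp
      qed
    qed
    then have "C.far ?r N N (C.cost l c) w" if "e = 1"
      using C.far_lift[where \<phi> = \<phi> and w = w, OF u(1) c(1) w(2-6)] that by blast
    moreover have "w 0 = ?r" using w(5)[of 0] w(2) by simp
    ultimately have "2 * int N + int e \<le> C.cost l c"
      using C.ring_bound[OF Y.M_V[OF rM] near[OF rM] kindC[OF rM] w(1)] N1 by simp
    then show False using c(2) by simp
  qed
qed

text \<open>Suppose \<open>gx v\<close> is closer to \<open>y z\<close> than all of
  \<open>Z\<close>. The relation gives \<open>y v\<close> the same small distance to
  \<open>gx z\<close>, and minimality bounds the other two distances, so the edges from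
  \<open>gx v\<close> to \<open>gx z\<close> and from \<open>y z\<close> to \<open>y v\<close> bound
  the twisted strip excluded by \<open>strip\<close>.\<close>

lemma minimal_apex:
  assumes gz: "d (gx z) T = N"
    and min: "\<And>v c. v \<in> X.M \<Longrightarrow> d v T = N \<Longrightarrow> d (gx v) T = N \<Longrightarrow> c \<in> X.orb v \<Longrightarrow> C.lev (y z) \<le> d (y v) c"
    and v: "v \<in> X.M" "\<forall>w\<in>Z. A v w" "d v T = N" "d (gx v) T = N"
  shows "C.lev (y z) \<le> d (y z) (gx v)"
proof (rule ccontr)
  assume neg: "\<not> C.lev (y z) \<le> d (y z) (gx v)"
  have V: "z \<in> V" "v \<in> V" using z_M v X.M_V by auto
  have vZ: "v \<notin> Z"
  proof
    assume "v \<in> Z"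
    then have "gx v \<in> Z" using X.orb_g Z_orb by blast
    then show False using C.lev_le neg by blast
  qed
  then have Ezv: "E z v" using v(2) zZ(1) A_neq[of v z] E_sym by blast
  have "z \<noteq> v" using vZ zZ by blast
  let ?L = "C.lev (y z)"
  have E: "E (gx v) (gx z)" using Ezv E_sym by simp
  have "?L \<le> d (y z) (gx z)" using C.lev_le zZ by blast
  moreover have "d (y z) (gx z) \<le> Suc (d (y z) (gx v))" using d_E(1)[OF E] V by simp
  ultimately have 1: "Suc (d (y z) (gx v)) = ?L" "d (y z) (gx z) = ?L" using neg by auto
  \<comment> \<open>Moving both arguments by \<open>x\<close> and then \<open>y\<close> turns them
    into \<open>gx z\<close> and \<open>y v\<close>.\<close>
  have "d (y (x (y z))) (y (x (gx v))) = d (y z) (gx v)" by (simp only: Y.dx X.dx)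
  then have 2: "d (y v) (gx z) = d (y z) (gx v)" by (simp add: d_sym)
  have "?L \<le> d (y v) (gx v)" using min[OF v(1,3,4)] by simp
  moreover have "d (y v) (gx v) \<le> Suc (d (y v) (gx z))" using d_E(1)[OF E_sym[OF E]] V by simp
  ultimately have 3: "d (y v) (gx v) = ?L" using 1 2 by simp
  have "d (y T) (y z) = N" using z_T by (simp add: d_sym)
  then have "Suc N \<le> ?L" using side_dip[of y gy z "y z"] zZ V by simp
  then obtain n where "?L = Suc (Suc n)" using N1 by (metis Suc_le_D Suc_le_mono One_nat_def)
  then show False using strip[of "gx v" "gx z" "y z" "y v" n] E Ezv 1 2 3 by simp
qed

text \<open>As \<open>z\<close> and \<open>gx z\<close> both have distance \<open>N\<close> from
  \<open>T\<close>, the vertex \<open>y z\<close> has distance \<open>N\<close> from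
  \<open>y T\<close> and from \<open>y (x T)\<close>. The closed path thus avoids the edge counted
  by \<open>e\<close> and is too short for \<open>forced\<close>. The predicate \<open>Q\<close>
  carries the condition that becomes \<open>far\<close>.\<close>

lemma alpha:
  assumes moved: "x z \<noteq> z" and gz: "d (gx z) T = N"
    and kind: "\<And>q v. q \<in> Y.M \<Longrightarrow> (\<forall>w\<in>Z. A v w) \<Longrightarrow> N \<le> d v q"
    and max: "\<And>D c. D \<in> Y.M \<Longrightarrow> c \<in> X.M \<Longrightarrow> d c D = N \<Longrightarrow> size D \<le> size T"
    and min: "\<And>v c. v \<in> X.M \<Longrightarrow> d v T = N \<Longrightarrow> d (gx v) T = N \<Longrightarrow> c \<in> X.orb v \<Longrightarrow> C.lev (y z) \<le> d (y v) c"
  shows False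
proof -
  have zV: "z \<in> V" using z_M X.M_V by blast
  define bad where "bad v \<longleftrightarrow> v \<in> X.M \<and> (\<forall>w\<in>Z. A v w) \<and> d v T = N \<and> d (gx v) T = N" for v
  define Q where "Q p \<longleftrightarrow> (\<forall>v. bad v \<longrightarrow> C.lev p \<le> d p (gx v))" for p
  have S: "side V d x y join size N (Z \<union> X.orb v) T" if "bad v" for v
  proof (rule side_extend)
    show "v \<in> X.M" "\<forall>w\<in>Z. A v w" using that unfolding bad_def by blast+
  qed (rule max)
  have m: "z \<in> Z \<union> X.orb v" "gx z \<in> Z \<union> X.orb v" "gx v \<in> Z \<union> X.orb v" for v using zZ by auto
  have dT: "d (y T) (y z) = N" "d (y (x T)) (y z) = N"
  proof -
    show "d (y T) (y z) = N" using z_T by (simp add: d_sym)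
    have "d (y (x T)) (y z) = d (x T) (x (gx z))" by simp
    also have "\<dots> = N" unfolding X.dx using gz by (simp add: d_sym)
    finally show "d (y (x T)) (y z) = N" .
  qed
  \<comment> \<open>On the plateau the level is \<open>N + 1\<close>, and \<open>Q\<close> follows
    from the enlarged centre. On the rising part the level is tied to the distance to
    \<open>y z\<close>, and \<open>Q\<close> follows from \<open>minimal_apex\<close>.\<close>
  have half: "wk (\<lambda>p. Q p \<and> Suc N \<le> C.lev p) N a (y z)"
    if a: "a \<in> V" "C.lev a = Suc N" "d a (y z) = N"
      and int: "\<And>c w. c \<in> V \<Longrightarrow> d a c + d c (y z) \<le> N \<Longrightarrow> w \<in> Z \<Longrightarrow> Suc N \<le> d c w"
      and int': "\<And>c v. c \<in> V \<Longrightarrow> d a c + d c (y z) \<le> N \<Longrightarrow> bad v \<Longrightarrow> Suc N \<le> d c (gx v)" for a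
  proof -
    have lev: "Suc N \<le> C.lev c" if "c \<in> V" "d a c + d c (y z) \<le> N" for c
      using int[OF that] C.lev_ex[of c] by metis
    have "wk (\<lambda>v. d a v + d v (y z) = d a (y z) \<and> (C.lev v = Suc N \<or> C.lev (y z) = C.lev v + d v (y z))) (d a (y z)) a (y z)"
      by (rule C.plateau_rise) (use a zV lev in auto)
    then show ?thesis unfolding a(3)
    proof (rule wk_mono)
      fix p assume p: "p \<in> V" "d a p + d p (y z) = N \<and> (C.lev p = Suc N \<or> C.lev (y z) = C.lev p + d p (y z))"
      have "C.lev p \<le> d p (gx v)" if "bad v" for v
      proof (cases "C.lev p = Suc N")
        case True
        then show ?thesis using int'[OF p(1) _ that] p(2) by simp
      next
        case False
        then have "C.lev (y z) = C.lev p + d p (y z)" using p by blast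
        moreover have "C.lev (y z) \<le> d (y z) (gx v)"
        proof (rule minimal_apex[OF gz])
          show "C.lev (y z) \<le> d (y v) c" if "v \<in> X.M" "d v T = N" "d (gx v) T = N" "c \<in> X.orb v" for v c
            using min that .
        qed (use that in \<open>auto simp: bad_def\<close>)
        moreover have "d (y z) (gx v) \<le> d (y z) p + d p (gx v)"
          using d_tri[of "y z" p "gx v"] zV p(1) that X.M_V unfolding bad_def by simp
        ultimately show ?thesis using d_sym[of p "y z"] by simp
      qed
      then show "Q p \<and> Suc N \<le> C.lev p" using lev[OF p(1)] p(2) unfolding Q_def by simp
    qed
  qed
  have "wk (\<lambda>p. Q p \<and> Suc N \<le> C.lev p) N (y T) (y z)"
  proof (rule half)
    show "Suc N \<le> d c w" if "c \<in> V" "d (y T) c + d c (y z) \<le> N" "w \<in> Z" for c w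
      using side_far[of y gy z c w] that zZ by blast
    show "Suc N \<le> d c (gx v)" if "c \<in> V" "d (y T) c + d c (y z) \<le> N" "bad v" for c v
      using side.side_far[OF S[OF that(3)], of y gy z c "gx v"] that m by blast
  qed (use TV lev_yT dT in auto)
  moreover have "wk (\<lambda>p. Q p \<and> Suc N \<le> C.lev p) N (y (x T)) (y z)"
  proof (rule half)
    have yz: "y (x (gx z)) = y z" by simp
    show "Suc N \<le> d c w" if "c \<in> V" "d (y (x T)) c + d c (y z) \<le> N" "w \<in> Z" for c w
      using side_far2[of "gx z" c w] that zZ unfolding yz by blast
    show "Suc N \<le> d c (gx v)" if "c \<in> V" "d (y (x T)) c + d c (y z) \<le> N" "bad v" for c v
      using side.side_far2[OF S[OF that(3)], of "gx z" c "gx v"] that m unfolding yz by blast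
    have "y (x T) = gx (gy T)" using yxy[of "gy T"] by simp
    then show "C.lev (y (x T)) = Suc N" using lev_yT by simp
  qed (use TV dT in auto)
  ultimately have wk: "wk (\<lambda>p. Q p \<and> Suc N \<le> C.lev p) (N + N) (y T) (y (x T))"
    using wk_trans wk_rev by blast
  have yx: "y (x T) = gx (gy T)" using yxy[of "gy T"] by simp
  obtain p where p: "p 0 = y T" "p (N + N) = gx (gy T)" "\<And>k. k \<le> N + N \<Longrightarrow> p k \<in> V \<and> Q (p k) \<and> Suc N \<le> C.lev (p k)"
    "\<And>k. k < N + N \<Longrightarrow> E (p k) (p (Suc k))"
    using wk unfolding wk_def yx by blast
  have Qlow: "Q w" if "E v w" "Q v" "C.lev v = Suc (C.lev w)" for v w
    unfolding Q_def
  proof (intro allI impI)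
    fix b assume b: "bad b"
    have "gx b \<in> V" using b X.M_V unfolding bad_def by simp
    then have "d v (gx b) \<le> Suc (d w (gx b))" using d_E(2)[OF E_sym[OF that(1)]] by blast
    moreover have "C.lev v \<le> d v (gx b)" using that(2) b unfolding Q_def by blast
    ultimately show "C.lev w \<le> d w (gx b)" using that(3) by simp
  qed
  have "(\<exists>k<N + N. wk (\<lambda>v. Q v \<and> C.lev v = Suc N) k (p 0) (p (N + N))) \<or> (\<forall>k\<le>N + N. C.lev (p k) = Suc N)"
    by (rule C.peel) (use Qlow p lev_yT TV in auto)
  then have "\<exists>k\<le>N + N. wk (\<lambda>v. Q v \<and> C.lev v = Suc N) k (y T) (gx (gy T))"
  proof
    assume "\<forall>k\<le>N + N. C.lev (p k) = Suc N"
    then have "wk (\<lambda>v. Q v \<and> C.lev v = Suc N) (N + N - 0) (p 0) (p (N + N))" using p by (intro wkI) auto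
    then show ?thesis using p by auto
  next
    assume "\<exists>k<N + N. wk (\<lambda>v. Q v \<and> C.lev v = Suc N) k (p 0) (p (N + N))"
    then show ?thesis using p(1,2) by (auto intro: less_imp_le)
  qed
  then obtain k where k: "k \<le> N + N" "wk (\<lambda>v. Q v \<and> C.lev v = Suc N) k (y T) (gx (gy T))" by blast
  have "Q (gy T)"
    unfolding Q_def
  proof (intro allI impI)
    fix v assume b: "bad v"
    have "d (gy T) (gy T) + d (gy T) (gy z) \<le> N" using z_T by (simp add: d_sym)
    then show "C.lev (gy T) \<le> d (gy T) (gx v)"
      using side.side_far[OF S[OF b], of gy y z "gy T" "gx v"] m TV lev_yT by simp
  qed
  then obtain u where u: "C.ring (int k + 1) (Suc N) u" "u 0 = gy T" "u 1 = y T" "\<forall>k\<in>{0..int k + 1}. Q (u k)"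
    using C.wk_ring_edge[OF k(2) E_yT(3) lev_yT(2)] by auto
  have far: "C.far T N (Suc N) (int k + 1) u"
    unfolding C.far_def
  proof (intro ballI impI)
    fix v j assume v: "v \<in> X.M" "\<forall>w\<in>Z. A v w" "d v T = N" "d (gx v) T = N" "j \<in> {0..int k + 1}"
    then have "C.lev (u j) \<le> d (u j) (gx v)" using u(4) unfolding Q_def bad_def by blast
    then show "Suc N \<le> d (u j) (gx v)" using C.ringD(4)[OF u(1)] by simp
  qed
  have kindT: "(1::nat) = 0 \<and> (\<exists>z. Z = {z}) \<or> (1::nat) = 1 \<and> (\<exists>z. Z = X.orb z) \<and> (\<forall>v. (\<forall>w\<in>Z. A v w) \<longrightarrow> N \<le> d v T)"
    using kind[OF T_M] Z_orb by blast
  have "2 * int N + int 1 + 1 \<le> int k + 1"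
    using C.forced[OF TV disjoint[OF T_M] T_lev N_le[OF _ T_M] N1 kindT u(1)] u(2,3) E_yT far by auto
  then show False using k(1) by simp
qed

end

section \<open>Excluding a positive distance\<close>

context rotations_apart
begin

lemma side_orbitI:
  assumes z: "z \<in> X.M" "d z T = N" and T: "T \<in> Y.M" "y T \<noteq> T"
    and max: "\<And>D c. D \<in> Y.M \<Longrightarrow> c \<in> X.orb z \<Longrightarrow> d c D = N \<Longrightarrow> size D \<le> size T"
  shows "side_orbit V d x y join size N (X.orb z) T z"
proof -
  interpret C: rot5_clique V d x "X.orb z"
    by unfold_locales (use X.orb_V[of z] X.M_V z X.orb_clique X.orb_x in auto)
  have ge: "N \<le> C.lev D" if "D \<in> Y.M" for D
    using C.lev_ex[of D] C.Z_M N_le that d_sym by metis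
  show ?thesis
  proof unfold_locales
    show "C.lev T = N" using ge[OF T(1)] C.lev_le[of z T] z by (simp add: d_sym)
    show "size D \<le> size T" if "D \<in> Y.M" "C.lev D = N" for D
      using C.lev_ex[of D] max that d_sym by metis
  qed (use z T in auto)
qed

lemma no_fixed_pair:
  assumes "z0 \<in> V" "x z0 = z0" "q0 \<in> Y.M" "d z0 q0 = N"
  shows False
proof -
  let ?P = "\<lambda>q. q \<in> Y.M \<and> (\<exists>z\<in>V. x z = z \<and> d z q = N)"
  obtain T where T: "?P T" and max: "\<And>q. ?P q \<Longrightarrow> size q \<le> size T"
    using ex_max[of ?P q0] assms Y.M_V by blast
  then obtain z where z: "z \<in> V" "x z = z" "d z T = N" by blast
  have "z \<in> X.M" using z by (simp add: X.M_iff)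
  show False
  proof (cases "y T = T")
    case True
    then show False using both_fixed z T Y.M_V by blast
  next
    case False
    have "side_orbit V d x y join size N (X.orb z) T z"
      using z T False \<open>z \<in> X.M\<close> max by (intro side_orbitI) (auto simp: X.orb_fixed)
    from side_orbit.tie[OF this, of 0] show False using z by simp
  qed
qed

text \<open>\<open>no_fixed_pair\<close>, used for both orders of the rotations, excludes pairs with
  a fixed member. What remains depends on whether some \<open>z\<close> has its translate
  \<open>gx z\<close> at the same distance \<open>N\<close> from \<open>T\<close>.\<close>

lemma no_pair:
  assumes "z0 \<in> X.M" "q0 \<in> Y.M" "d z0 q0 = N"
  shows False
proof -
  have nx: False if "z \<in> V" "x z = z" "q \<in> Y.M" "d z q = N" for z q
    using no_fixed_pair that by blast
  have ny: False if "q \<in> V" "y q = q" "z \<in> X.M" "d z q = N" for z q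
    using rotations_apart.no_fixed_pair[OF apart_swap that(1-3)] that(4) by (simp add: d_sym)
  let ?P = "\<lambda>q. q \<in> Y.M \<and> (\<exists>z\<in>X.M. d z q = N)"
  obtain T where T: "?P T" and max: "\<And>q. ?P q \<Longrightarrow> size q \<le> size T"
    using ex_max[of ?P q0] assms Y.M_V by blast
  have Tm: "y T \<noteq> T" using ny T Y.M_V by blast
  have moved: "x z \<noteq> z" if "z \<in> X.M" "d z T = N" for z using nx T X.M_V that by blast
  \<comment> \<open>Otherwise the join of the orbit would be fixed by \<open>x\<close> and at
    distance \<open>N\<close> from \<open>q\<close>.\<close>
  have kind: "N \<le> d v q" if z: "z \<in> X.M" and q: "q \<in> Y.M" and v: "\<forall>w\<in>X.orb z. A v w" for z q v
  proof (rule ccontr)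
    assume neg: "\<not> N \<le> d v q"
    let ?J = "join (X.orb z)"
    have c: "clq (X.orb z)" using X.orb_clq z by blast
    have "v \<in> V" using v AV X.orb_self(1) by blast
    then have "A v ?J" using join_A[OF c] v by blast
    then have "d ?J q \<le> Suc (d v q)" using d_A(2) Y.M_V q by blast
    moreover have JV: "?J \<in> V" using join_V c by blast
    moreover have Jx: "x ?J = ?J" using join_x[OF c] X.orb_x by simp
    moreover have "N \<le> d ?J q" using N_le[of ?J q] q JV Jx by (simp add: X.M_iff)
    ultimately show False using nx[OF JV Jx q] neg by simp
  qed
  have SO: "side_orbit V d x y join size N (X.orb z) T z" if "z \<in> X.M" "d z T = N" for z
    using that T Tm max X.orb_M by (intro side_orbitI) blast+
  let ?C = "\<lambda>z. z \<in> X.M \<and> d z T = N \<and> d (gx z) T = N"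
  show False
  proof (cases "\<exists>z. ?C z")
    case False
    obtain z where z: "z \<in> X.M" "d z T = N" using T by blast
    show False
      by (rule side_orbit.tie[OF SO[OF z], of 1]) (use moved[OF z] kind[OF z(1)] max False in auto)
  next
    case True
    \<comment> \<open>The level of \<open>y v\<close> with respect to the orbit of
      \<open>v\<close>.\<close>
    define f where "f v = Min (d (y v) ` X.orb v)" for v
    obtain z where z: "?C z" and min: "\<And>v. ?C v \<Longrightarrow> f z \<le> f v"
      using ex_has_least_nat[of ?C _ f] True by blast
    interpret S: side_orbit V d x y join size N "X.orb z" T z using SO z by blast
    have "S.C.lev (y z) \<le> f z"
      unfolding f_def using X.orb_self(1)[of z] S.C.lev_le by (intro Min.boundedI) auto
    moreover have "f v \<le> d (y v) c" if "c \<in> X.orb v" for v c unfolding f_def using that by simp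
    ultimately have "S.C.lev (y z) \<le> d (y v) c" if "?C v" "c \<in> X.orb v" for v c
      using min[OF that(1)] that(2) by (meson le_trans)
    then show False using S.alpha moved[of z] z kind[of z] max by blast
  qed
qed

end

theorem (in rotations) fixed_vertex:
  assumes "X.M \<noteq> {}" "Y.M \<noteq> {}"
  shows "\<exists>v\<in>V. x v = v \<and> y v = v"
proof (cases "X.M \<inter> Y.M = {}")
  case False
  then show ?thesis using common_fixed by blast
next
  case True
  define N where "N = (LEAST n. \<exists>z\<in>X.M. \<exists>q\<in>Y.M. d z q = n)"
  have "\<exists>z\<in>X.M. \<exists>q\<in>Y.M. d z q = N"
    unfolding N_def by (rule LeastI_ex) (use assms in blast)
  then obtain z q where zq: "z \<in> X.M" "q \<in> Y.M" "d z q = N" by blast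
  have le: "N \<le> d z q" if "z \<in> X.M" "q \<in> Y.M" for z q unfolding N_def using that by (intro Least_le) blast
  have "N \<noteq> 0" using zq d_zero[of z q] X.M_V Y.M_V True by blast
  then have "rotations_apart V d x y join size N" using le by unfold_locales auto
  from rotations_apart.no_pair[OF this zq] show ?thesis ..
qed

section \<open>An invariant clique of an automorphism of order five\<close>

text \<open>Five is prime, so a permutation of order five without fixed points has only orbits of
  size five, and \<open>\<phi>\<close> is constant on each.\<close>

lemma dvd_sum_order_five:
  fixes \<phi> :: "'b \<Rightarrow> int"
  assumes "finite S" "\<And>s. s \<in> S \<Longrightarrow> h s \<in> S" "\<And>s. s \<in> S \<Longrightarrow> h (h (h (h (h s)))) = s"
    "\<And>s. s \<in> S \<Longrightarrow> h s \<noteq> s" "\<And>s. s \<in> S \<Longrightarrow> \<phi> (h s) = \<phi> s"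
  shows "5 dvd sum \<phi> S"
  using assms
proof (induction S rule: finite_psubset_induct)
  case (psubset S)
  show ?case
  proof (cases "S = {}")
    case False
    then obtain s where s: "s \<in> S" by blast
    let ?O = "{s, h s, h (h s), h (h (h s)), h (h (h (h s)))}"
    have O: "h s \<in> S" "h (h s) \<in> S" "h (h (h s)) \<in> S" "h (h (h (h s))) \<in> S" using psubset.prems(1) s by blast+
    have p5: "h (h (h (h (h s)))) = s" using psubset.prems(2) s by blast
    have 1: "h s \<noteq> s" using psubset.prems(3) s by blast
    have 2: "h (h s) \<noteq> s" using 1 p5 by metis
    have 3: "h (h (h s)) \<noteq> s" using 1 2 p5 by metis
    have 4: "h (h (h (h s))) \<noteq> s" using 1 p5 by metis
    have inj: "a = b" if "h a = h b" "a \<in> S" "b \<in> S" for a b using psubset.prems(2) that by metis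
    have ne: "h s \<noteq> h (h s)" "h s \<noteq> h (h (h s))" "h s \<noteq> h (h (h (h s)))" "h (h s) \<noteq> h (h (h s))"
      "h (h s) \<noteq> h (h (h (h s)))" "h (h (h s)) \<noteq> h (h (h (h s)))"
      using inj 1 2 3 O s by metis+
    have "sum \<phi> ?O = 5 * \<phi> s" using 1 2 3 4 ne psubset.prems(4) s O by simp
    moreover have "5 dvd sum \<phi> (S - ?O)"
    proof (rule psubset.IH)
      show "S - ?O \<subset> S" using s by blast
      show "h t \<in> S - ?O" if t: "t \<in> S - ?O" for t
      proof -
        have "h t \<noteq> h u" if "u \<in> ?O" for u using inj[of t u] t that O s by blast
        then have "h t \<notin> h ` ?O" by blast
        then have "h t \<notin> ?O" using p5 by simp
        moreover have "h t \<in> S" using psubset.prems(1) t by simp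
        ultimately show ?thesis by simp
      qed
    qed (use psubset.prems in simp_all)
    moreover have "sum \<phi> S = sum \<phi> ?O + sum \<phi> (S - ?O)"
      using O s psubset.hyps(1) by (subst sum.union_disjoint[symmetric]) (auto intro!: sum.cong)
    ultimately show ?thesis by simp
  qed simp
qed

context bridged
begin

text \<open>If the step to \<open>v\<close> left the ball around \<open>w\<close>, a descent from
  \<open>v\<close> towards \<open>c\<close> would end at a neighbour of \<open>a\<close>, and
  \<open>a\<close> would be closer to \<open>c\<close> than it is.\<close>

lemma ball_convex:
  assumes "c \<in> V" "w \<in> V" "d c w \<le> r" "d a w \<le> r" "E a v" "d c a = Suc (d c v)"
  shows "d v w \<le> r"
proof (rule ccontr)
  assume neg: "\<not> d v w \<le> r"
  interpret C: bridged_clique V d "{w}" by unfold_locales (use assms in auto)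
  have lev: "C.lev p = d p w" for p using C.lev_ex[of p] by simp
  have V: "a \<in> V" "v \<in> V" using assms EV by blast+
  have r: "C.lev a = r" "C.lev v = Suc r" using neg d_E(2)[OF assms(5,2)] assms(4) unfolding lev by auto
  obtain s where s: "E v s" "C.lev s = r" "Suc (d s c) = d v c"
    using C.dip[OF V(2) assms(1) r(2)] assms(3) unfolding lev by blast
  have "A s a" using C.B1'[OF s(1) E_sym[OF assms(5)] r(2) s(2) r(1)] .
  then have "d a c \<le> Suc (d s c)" using d_A(2) assms(1) by blast
  then show False using s(3) assms(6) d_sym[of a c] d_sym[of v c] by simp
qed

text \<open>The Euler characteristic of a finite convex set is one: a clique is paired with the clique obtained by
  toggling a common lower neighbour of its vertices of highest level.\<close>

lemma euler_sum:
  assumes K: "finite K" "K \<subseteq> V" "c \<in> K"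
    and convex: "\<And>a v. a \<in> K \<Longrightarrow> E a v \<Longrightarrow> d c a = Suc (d c v) \<Longrightarrow> v \<in> K"
  shows "(\<Sum>\<sigma> | \<sigma> \<subseteq> K \<and> (\<forall>a\<in>\<sigma>. \<forall>b\<in>\<sigma>. A a b). (- 1 :: int) ^ card \<sigma>) = 0"
proof -
  let ?C = "{\<sigma>. \<sigma> \<subseteq> K \<and> (\<forall>a\<in>\<sigma>. \<forall>b\<in>\<sigma>. A a b)}"
  have cV: "c \<in> V" using K by blast
  interpret C: bridged_clique V d "{c}" by unfold_locales (use cV in auto)
  have lev: "C.lev p = d p c" for p using C.lev_ex[of p] by simp
  define top where "top \<sigma> = {v \<in> \<sigma>. C.lev v = Max (C.lev ` \<sigma>)}" for \<sigma>
  define P where "P \<tau> = (SOME p. p \<in> K \<and> (\<forall>a\<in>\<tau>. E a p \<and> C.lev a = Suc (C.lev p)))" for \<tau>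
  \<comment> \<open>\<open>P\<close> depends only on the vertices of highest level, which toggling
    does not change, so \<open>f\<close> is an involution. The cliques \<open>{}\<close> and
    \<open>{c}\<close> have nothing to toggle and are exchanged with each other; since the empty
    clique is counted, the total is zero.\<close>
  define f where "f \<sigma> = (if \<sigma> = {} then {c} else if \<sigma> = {c} then {} else
      let p = P (top \<sigma>) in if p \<in> \<sigma> then \<sigma> - {p} else insert p \<sigma>)" for \<sigma>
  have fin: "finite \<sigma>" if "\<sigma> \<in> ?C" for \<sigma> using that K(1) finite_subset by blast
  have main: "f \<sigma> \<in> ?C \<and> f (f \<sigma>) = \<sigma> \<and> (- 1 :: int) ^ card (f \<sigma>) = - ((- 1) ^ card \<sigma>)" if \<sigma>: "\<sigma> \<in> ?C" for \<sigma>
  proof (cases "\<sigma> = {} \<or> \<sigma> = {c}")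
    case True
    then show ?thesis using K cV by (auto simp: f_def)
  next
    case False
    note f\<sigma> = fin[OF \<sigma>]
    let ?\<tau> = "top \<sigma>" and ?m = "Max (C.lev ` \<sigma>)" and ?p = "P (top \<sigma>)"
    have le: "C.lev v \<le> ?m" if "v \<in> \<sigma>" for v using that f\<sigma> by simp
    have "?m \<in> C.lev ` \<sigma>" using f\<sigma> False by (intro Max_in) auto
    then have \<tau>ne: "?\<tau> \<noteq> {}" unfolding top_def by auto
    have "?m \<noteq> 0"
    proof
      assume "?m = 0"
      then have "v = c" if "v \<in> \<sigma>" for v using le[OF that] \<sigma> K that C.lev_0[of v] by auto
      then show False using False by blast
    qed
    then obtain m where m: "?m = Suc m" by (metis not0_implies_Suc)
    have sub: "?\<tau> \<subseteq> \<sigma>" unfolding top_def by blast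
    have "\<exists>v\<in>V. C.lev v = m \<and> (\<forall>a\<in>?\<tau>. E a v)"
    proof (rule C.clique_lower)
      show "finite ?\<tau>" using f\<sigma> sub finite_subset by blast
      show "?\<tau> \<subseteq> V" using sub \<sigma> K by blast
      show "C.lev a = Suc m" if "a \<in> ?\<tau>" for a using that m unfolding top_def by simp
    qed (use \<tau>ne sub \<sigma> in auto)
    then obtain v where v: "C.lev v = m" "\<forall>a\<in>?\<tau>. E a v" by blast
    have lt: "C.lev a = Suc m" if "a \<in> ?\<tau>" for a using that m unfolding top_def by simp
    have "v \<in> K"
    proof -
      obtain a where a: "a \<in> ?\<tau>" using \<tau>ne by blast
      then have "d c a = Suc (d c v)" using lt[OF a] v(1) d_sym[of c] unfolding lev by simp
      then show ?thesis using convex a v sub \<sigma> by blast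
    qed
    then have "\<exists>p. p \<in> K \<and> (\<forall>a\<in>?\<tau>. E a p \<and> C.lev a = Suc (C.lev p))" using v lt by auto
    then have "?p \<in> K \<and> (\<forall>a\<in>?\<tau>. E a ?p \<and> C.lev a = Suc (C.lev ?p))"
      unfolding P_def[of ?\<tau>] by (rule someI_ex)
    then have p: "?p \<in> K" "\<And>a. a \<in> ?\<tau> \<Longrightarrow> E a ?p" "\<And>a. a \<in> ?\<tau> \<Longrightarrow> C.lev a = Suc (C.lev ?p)"
      by blast+
    obtain t where t: "t \<in> ?\<tau>" using \<tau>ne by blast
    have lp: "C.lev ?p = m" using p(3)[OF t] lt[OF t] by simp
    have Ap: "A b ?p" if b: "b \<in> \<sigma>" for b
    proof (cases "b \<in> ?\<tau>")
      case True then show ?thesis using p EA by blast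
    next
      case False
      then have "C.lev b \<noteq> ?m" using b unfolding top_def by simp
      then have "C.lev b \<le> m" using le[OF b] m by simp
      moreover have "A b t" using \<sigma> b t sub by blast
      then have tb: "E t b" "C.lev t \<le> Suc (C.lev b)" using A_neq[of b t] False t E_sym C.lev_A by blast+
      ultimately have "C.lev b = m" using lt[OF t] by linarith
      then show ?thesis using C.B1'[OF tb(1) p(2)[OF t] lt[OF t] _ lp] by blast
    qed
    define \<sigma>' where "\<sigma>' = (if ?p \<in> \<sigma> then \<sigma> - {?p} else insert ?p \<sigma>)"
    have f1: "f \<sigma> = \<sigma>'" using False by (simp add: f_def \<sigma>'_def Let_def)
    have pn: "?p \<notin> ?\<tau>" using p(3) by force
    have ts: "?\<tau> \<subseteq> \<sigma>'" using sub pn unfolding \<sigma>'_def by auto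
    have C': "\<sigma>' \<in> ?C"
      using \<sigma> p(1) Ap A_sym K unfolding \<sigma>'_def by auto
    have "Max (C.lev ` \<sigma>') = Suc m"
    proof (rule Max_eqI)
      show "finite (C.lev ` \<sigma>')" using fin[OF C'] by simp
      show "y \<le> Suc m" if "y \<in> C.lev ` \<sigma>'" for y using that le m lp unfolding \<sigma>'_def by (auto split: if_splits)
      show "Suc m \<in> C.lev ` \<sigma>'" using t ts lt by force
    qed
    then have top': "top \<sigma>' = ?\<tau>" using lp m unfolding top_def \<sigma>'_def by (auto split: if_splits)
    have "\<sigma>' \<noteq> {}" "\<sigma>' \<noteq> {c}" using ts t lt C.lev_0[of c] cV by fastforce+
    then have "f \<sigma>' = \<sigma>" unfolding f_def top' by (auto simp: Let_def \<sigma>'_def)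
    moreover have "(- 1 :: int) ^ card \<sigma>' = - ((- 1) ^ card \<sigma>)"
    proof (cases "?p \<in> \<sigma>")
      case True
      then have "card \<sigma> = Suc (card \<sigma>')" using card_Suc_Diff1[OF f\<sigma> True] by (simp add: \<sigma>'_def del: card_Diff_insert)
      then show ?thesis by simp
    next
      case False
      then have "card \<sigma>' = Suc (card \<sigma>)" using f\<sigma> by (simp add: \<sigma>'_def)
      then show ?thesis by simp
    qed
    ultimately show ?thesis using f1 C' by simp
  qed
  have "(\<Sum>\<sigma>\<in>?C. (- 1 :: int) ^ card \<sigma>) = (\<Sum>\<sigma>\<in>?C. - ((- 1) ^ card \<sigma>))"
    by (rule sum.reindex_bij_witness[of _ f f]) (use main in auto)
  then show ?thesis by (simp add: sum_negf)
qed

end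

context rot5
begin

lemma finite_ball:
  assumes "\<And>a. a \<in> V \<Longrightarrow> finite {b. E a b}" "c \<in> V"
  shows "finite {p \<in> V. d c p \<le> n}"
proof (induction n)
  case 0
  have "{p \<in> V. d c p \<le> 0} \<subseteq> {c}" using d_zero assms(2) by auto
  then show ?case using finite_subset by blast
next
  case (Suc n)
  have "{p \<in> V. d c p \<le> Suc n} \<subseteq> {p \<in> V. d c p \<le> n} \<union> (\<Union>a\<in>{p \<in> V. d c p \<le> n}. {b. E a b})"
  proof
    fix p assume p: "p \<in> {p \<in> V. d c p \<le> Suc n}"
    show "p \<in> {p \<in> V. d c p \<le> n} \<union> (\<Union>a\<in>{p \<in> V. d c p \<le> n}. {b. E a b})"
    proof (cases "d c p \<le> n")
      case False
      then have "d c p = Suc n" using p by auto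
      then obtain q where "E p q" "d c q = n" using d_geo' assms(2) p by blast
      then have "q \<in> {p \<in> V. d c p \<le> n}" "p \<in> {b. E q b}" using EV(2) E_sym by auto
      then show ?thesis by blast
    qed (use p in auto)
  qed
  then show ?case using Suc assms(1) by (auto intro: finite_subset)
qed

text \<open>The intersection \<open>K\<close> of equal balls around an orbit is finite, invariant
  and closed under steps towards \<open>c\<close>. The signed count of its nonempty cliques is minus
  one, which is not divisible by five, so some clique is preserved.\<close>

theorem invariant_clique:
  assumes "V \<noteq> {}" "\<And>a. a \<in> V \<Longrightarrow> finite {b. E a b}"
  shows "\<exists>C. clq C \<and> x ` C = C"
proof -
  obtain c where c: "c \<in> V" using assms(1) by blast
  define r where "r = Max (d c ` orb c)"
  define K where "K = {p \<in> V. \<forall>w\<in>orb c. d p w \<le> r}"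
  have oV: "orb c \<subseteq> V" using orb_V c by blast
  have cK: "c \<in> K" using c unfolding K_def r_def by simp
  have finK: "finite K"
  proof (rule finite_subset[OF _ finite_ball[OF assms(2) c]])
    show "K \<subseteq> {p \<in> V. d c p \<le> r}" unfolding K_def using d_sym[of c] by auto
  qed
  have KV: "K \<subseteq> V" unfolding K_def by blast
  have xK: "x p \<in> K" if "p \<in> K" for p
    unfolding K_def
  proof (intro CollectI conjI ballI)
    show "x p \<in> V" using that KV by auto
    fix w assume "w \<in> orb c"
    then obtain w' where "w' \<in> orb c" "w = x w'" using orb_x by blast
    then show "d (x p) w \<le> r" using that unfolding K_def by simp
  qed
  have conv: "v \<in> K" if a: "a \<in> K" "E a v" "d c a = Suc (d c v)" for a v
    unfolding K_def
  proof (intro CollectI conjI ballI)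
    show "v \<in> V" using a EV by blast
    fix w assume w: "w \<in> orb c"
    show "d v w \<le> r"
      by (rule ball_convex[OF c _ _ _ a(2,3)]) (use w oV cK a(1) in \<open>auto simp: K_def\<close>)
  qed
  let ?C = "{\<sigma>. \<sigma> \<subseteq> K \<and> (\<forall>a\<in>\<sigma>. \<forall>b\<in>\<sigma>. A a b)}"
  let ?\<phi> = "\<lambda>\<sigma>. (- 1 :: int) ^ card \<sigma>"
  have sum0: "sum ?\<phi> ?C = 0" by (rule euler_sum[OF finK KV cK]) (rule conv)
  have finC: "finite ?C" using finK by (rule finite_subset[rotated, OF finite_Pow_iff[THEN iffD2]]) auto
  have "sum ?\<phi> ?C = ?\<phi> {} + sum ?\<phi> (?C - {{}})" using sum.remove[OF finC, of "{}" ?\<phi>] by simp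
  then have m1: "sum ?\<phi> (?C - {{}}) = - 1" using sum0 by simp
  show ?thesis
  proof (rule ccontr)
    assume neg: "\<not> ?thesis"
    have "5 dvd sum ?\<phi> (?C - {{}})"
    proof (rule dvd_sum_order_five[of _ "\<lambda>\<sigma>. x ` \<sigma>"])
      show "x ` \<sigma> \<in> ?C - {{}}" if "\<sigma> \<in> ?C - {{}}" for \<sigma> using that xK by auto
      show "x ` \<sigma> \<noteq> \<sigma>" if s: "\<sigma> \<in> ?C - {{}}" for \<sigma>
      proof
        assume "x ` \<sigma> = \<sigma>"
        moreover have "clq \<sigma>" using s finK KV finite_subset[of \<sigma> K] unfolding clq_def by auto
        ultimately show False using neg by blast
      qed
      show "?\<phi> (x ` \<sigma>) = ?\<phi> \<sigma>" for \<sigma> by (simp add: card_image inj_on_def)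
    qed (use finC in \<open>auto simp: image_image\<close>)
    then show False using m1 by simp
  qed
qed

end

section \<open>Coverings of complexes and the universal cover\<close>

text \<open>Coverings are described on the 1-skeleton: edges at a vertex lift uniquely, and the
  third edge of a triangle lifts between the lifts of the other two.\<close>

definition covering :: "'a set set \<Rightarrow> 'b set \<Rightarrow> ('b \<Rightarrow> 'b \<Rightarrow> bool) \<Rightarrow> ('b \<Rightarrow> 'a) \<Rightarrow> bool" where
  "covering X Y H p \<longleftrightarrow>
     (\<forall>y\<in>Y. {p y} \<in> X) \<and>
     (\<forall>y z. H y z \<longrightarrow> y \<in> Y \<and> z \<in> Y \<and> H z y \<and> p y \<noteq> p z \<and> {p y, p z} \<in> X) \<and>
     (\<forall>y\<in>Y. \<forall>b. b \<noteq> p y \<and> {p y, b} \<in> X \<longrightarrow> (\<exists>z. H y z \<and> p z = b)) \<and>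
     (\<forall>y z w. H y z \<and> H y w \<and> p z = p w \<longrightarrow> z = w) \<and>
     (\<forall>y z w. H y z \<and> H y w \<and> p z \<noteq> p w \<and> {p y, p z, p w} \<in> X \<longrightarrow> H z w)"

text \<open>Lifting of closed edge paths replaces simple connectedness; the type argument is the type of the vertices of
  the coverings.\<close>

definition loops_lift :: "'a set set \<Rightarrow> 'b itself \<Rightarrow> bool" where
  "loops_lift X (_ :: 'b itself) \<longleftrightarrow> (\<forall>(Y :: 'b set) H p. covering X Y H p \<longrightarrow>
     (\<forall>n y. y 0 \<in> Y \<and> (\<forall>i<n. H (y i) (y (Suc i))) \<and> p (y n) = p (y 0) \<longrightarrow> y n = y (0::nat)))"

text \<open>A vertex of the universal cover is recorded by its label in the complex and its neighbours that are closer to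
  the base point.\<close>

datatype 'a cover_vertex = Cover_Vertex (lab: 'a) (low: "'a cover_vertex fset")

text \<open>The link conditions are written in \<open>X\<close> itself with repeated vertices
  allowed, so that degenerate cycles need no separate treatment later.\<close>

locale large_links =
  fixes X :: "'a set set"
  assumes simplex_finite: "\<sigma> \<in> X \<Longrightarrow> finite \<sigma> \<and> \<sigma> \<noteq> {}"
    and face: "\<sigma> \<in> X \<Longrightarrow> \<tau> \<subseteq> \<sigma> \<Longrightarrow> \<tau> \<noteq> {} \<Longrightarrow> \<tau> \<in> X"
    and locfin: "finite {b. {a, b} \<in> X}"
    and link_flag: "finite \<sigma> \<Longrightarrow> \<sigma> \<noteq> {} \<Longrightarrow> (\<And>u v. u \<in> \<sigma> \<Longrightarrow> v \<in> \<sigma> \<Longrightarrow> {a, u, v} \<in> X) \<Longrightarrow> insert a \<sigma> \<in> X"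
    and link4: "{a, b1, b2} \<in> X \<Longrightarrow> {a, b2, b3} \<in> X \<Longrightarrow> {a, b3, b4} \<in> X \<Longrightarrow> {a, b4, b1} \<in> X \<Longrightarrow>
      {a, b1, b3} \<in> X \<or> {a, b2, b4} \<in> X"
    and link5: "{a, b1, b2} \<in> X \<Longrightarrow> {a, b2, b3} \<in> X \<Longrightarrow> {a, b3, b4} \<in> X \<Longrightarrow> {a, b4, b5} \<in> X \<Longrightarrow> {a, b5, b1} \<in> X \<Longrightarrow>
      {a, b1, b3} \<in> X \<or> {a, b1, b4} \<in> X \<or> {a, b2, b4} \<in> X \<or> {a, b2, b5} \<in> X \<or> {a, b3, b5} \<in> X"
begin

definition t :: "'a \<Rightarrow> 'a \<Rightarrow> 'a \<Rightarrow> bool" where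
  "t a b c \<longleftrightarrow> {a, b, c} \<in> X"

lemma t_perm: "t a b c \<longleftrightarrow> t b a c" "t a b c \<longleftrightarrow> t a c b"
  unfolding t_def by (simp_all add: insert_commute)

lemma t_rot: "t a b c \<longleftrightarrow> t c a b"
  unfolding t_def by (simp add: insert_commute)

lemma t_edge: "t a b c \<Longrightarrow> t a b b" "t a b c \<Longrightarrow> t a a b" "t a b c \<Longrightarrow> t a a c" "t a b c \<Longrightarrow> t b b c" "t a b c \<Longrightarrow> t a c c"
  unfolding t_def by (auto intro: face)

lemma t4: "t a b1 b2 \<Longrightarrow> t a b2 b3 \<Longrightarrow> t a b3 b4 \<Longrightarrow> t a b4 b1 \<Longrightarrow> t a b1 b3 \<or> t a b2 b4"
  unfolding t_def by (rule link4)

lemma t5: "t a b1 b2 \<Longrightarrow> t a b2 b3 \<Longrightarrow> t a b3 b4 \<Longrightarrow> t a b4 b5 \<Longrightarrow> t a b5 b1 \<Longrightarrow>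
    t a b1 b3 \<or> t a b1 b4 \<or> t a b2 b4 \<or> t a b2 b5 \<or> t a b3 b5"
  unfolding t_def by (rule link5)

text \<open>The link of \<open>a\<close> is flag, so all four vertices span a simplex.\<close>

lemma t_flag: "t a b c \<Longrightarrow> t a c e \<Longrightarrow> t a b e \<Longrightarrow> t b c e"
proof -
  assume t: "t a b c" "t a c e" "t a b e"
  have "insert a {b, c, e} \<in> X"
  proof (rule link_flag)
    fix u v assume "u \<in> {b, c, e}" "v \<in> {b, c, e}"
    moreover have "t a b b" "t a c c" "t a e e" using t t_edge t_perm by metis+
    ultimately show "{a, u, v} \<in> X" using t unfolding t_def by (auto simp: insert_commute)
  qed auto
  then show ?thesis unfolding t_def by (rule face) auto
qed

definition level_adj :: "'a cover_vertex \<Rightarrow> 'a cover_vertex \<Rightarrow> bool" where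
  "level_adj w w' \<longleftrightarrow> lab w \<noteq> lab w' \<and> (\<exists>c. c |\<in>| low w \<and> c |\<in>| low w' \<and> t (lab w) (lab w') (lab c))"

lemma level_adj_sym: "level_adj w w' \<Longrightarrow> level_adj w' w"
  unfolding level_adj_def using t_perm by metis

text \<open>The edge from \<open>lab w\<close> to \<open>z\<close> lifts to an edge from \<open>w\<close> to the next level.\<close>

definition ascends :: "'a cover_vertex \<Rightarrow> 'a \<Rightarrow> bool" where
  "ascends w z \<longleftrightarrow> lab w \<noteq> z \<and> t (lab w) z z \<and> (\<forall>c. c |\<in>| low w \<longrightarrow> \<not> t (lab w) z (lab c))"

text \<open>The set of lower neighbours is spelled out here and named \<open>S\<close> afterwards.
  The equation for \<open>fset\<close> can only be met by a finite set; finiteness is the content of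
  \<open>S_finite\<close>.\<close>

primrec L :: "'a \<Rightarrow> nat \<Rightarrow> 'a cover_vertex set" where
  "L r0 0 = {Cover_Vertex r0 {||}}"
| "L r0 (Suc n) = {Cover_Vertex z \<sigma> | z \<sigma>. \<exists>w\<in>L r0 n. ascends w z \<and> fset \<sigma> = {u \<in> L r0 n. u = w \<or> level_adj w u \<and> t (lab w) (lab u) z}}"

definition S :: "'a \<Rightarrow> nat \<Rightarrow> 'a cover_vertex \<Rightarrow> 'a \<Rightarrow> 'a cover_vertex set" where
  "S r0 n w z = {u \<in> L r0 n. u = w \<or> level_adj w u \<and> t (lab w) (lab u) z}"

text \<open>The local structure at a vertex of the universal cover, in the order: the lower neighbours form a simplex
  with the vertex; the neighbours at the same level are the lifts of the vertices joined to a lower neighbour;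
  triangles lift.\<close>

definition inv_low :: "'a cover_vertex \<Rightarrow> bool" where
  "inv_low w \<longleftrightarrow> t (lab w) (lab w) (lab w) \<and> lab w \<notin> lab ` fset (low w) \<and>
     (\<forall>c c'. c |\<in>| low w \<longrightarrow> c' |\<in>| low w \<longrightarrow> t (lab w) (lab c) (lab c') \<and> (c = c' \<or> level_adj c c'))"

definition inv_ex :: "'a cover_vertex set \<Rightarrow> 'a cover_vertex \<Rightarrow> bool" where
  "inv_ex M w \<longleftrightarrow> (\<forall>z c. z \<noteq> lab w \<longrightarrow> z \<notin> lab ` fset (low w) \<longrightarrow> c |\<in>| low w \<longrightarrow> t (lab w) z (lab c) \<longrightarrow>
        (\<exists>w'\<in>M. level_adj w w' \<and> lab w' = z))"

definition inv_uniq :: "'a cover_vertex set \<Rightarrow> 'a cover_vertex \<Rightarrow> bool" where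
  "inv_uniq M w \<longleftrightarrow> (\<forall>w'\<in>M. \<forall>w''\<in>M. level_adj w w' \<longrightarrow> level_adj w w'' \<longrightarrow> lab w' = lab w'' \<longrightarrow> w' = w'')"

definition inv_low_tri :: "'a cover_vertex set \<Rightarrow> 'a cover_vertex \<Rightarrow> bool" where
  "inv_low_tri M w \<longleftrightarrow> (\<forall>w'\<in>M. level_adj w w' \<longrightarrow> lab w' \<notin> lab ` fset (low w) \<and>
     (\<forall>c. c |\<in>| low w \<longrightarrow> t (lab w) (lab w') (lab c) \<longrightarrow> c |\<in>| low w'))"

definition inv_tri :: "'a cover_vertex set \<Rightarrow> 'a cover_vertex \<Rightarrow> bool" where
  "inv_tri M w \<longleftrightarrow> (\<forall>w'\<in>M. \<forall>w''\<in>M. level_adj w w' \<longrightarrow> level_adj w w'' \<longrightarrow> lab w' \<noteq> lab w'' \<longrightarrow>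
     t (lab w) (lab w') (lab w'') \<longrightarrow> level_adj w' w'')"

definition inv_at :: "'a cover_vertex set \<Rightarrow> 'a cover_vertex \<Rightarrow> bool" where
  "inv_at M w \<longleftrightarrow> inv_low w \<and> inv_ex M w \<and> inv_uniq M w \<and> inv_low_tri M w \<and> inv_tri M w"

lemma invD:
  assumes "inv_at M w"
  shows "t (lab w) (lab w) (lab w)" "lab w \<notin> lab ` fset (low w)"
    "\<And>c c'. c |\<in>| low w \<Longrightarrow> c' |\<in>| low w \<Longrightarrow> t (lab w) (lab c) (lab c')"
    "\<And>c c'. c |\<in>| low w \<Longrightarrow> c' |\<in>| low w \<Longrightarrow> c \<noteq> c' \<Longrightarrow> level_adj c c'"
    "\<And>z c. z \<noteq> lab w \<Longrightarrow> z \<notin> lab ` fset (low w) \<Longrightarrow> c |\<in>| low w \<Longrightarrow> t (lab w) z (lab c) \<Longrightarrow>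
        (\<exists>w'\<in>M. level_adj w w' \<and> lab w' = z)"
    "\<And>w' w''. w' \<in> M \<Longrightarrow> w'' \<in> M \<Longrightarrow> level_adj w w' \<Longrightarrow> level_adj w w'' \<Longrightarrow> lab w' = lab w'' \<Longrightarrow> w' = w''"
    "\<And>w'. w' \<in> M \<Longrightarrow> level_adj w w' \<Longrightarrow> lab w' \<notin> lab ` fset (low w)"
    "\<And>w' c. w' \<in> M \<Longrightarrow> level_adj w w' \<Longrightarrow> c |\<in>| low w \<Longrightarrow> t (lab w) (lab w') (lab c) \<Longrightarrow> c |\<in>| low w'"
    "\<And>w' w''. w' \<in> M \<Longrightarrow> w'' \<in> M \<Longrightarrow> level_adj w w' \<Longrightarrow> level_adj w w'' \<Longrightarrow> lab w' \<noteq> lab w'' \<Longrightarrow>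
        t (lab w) (lab w') (lab w'') \<Longrightarrow> level_adj w' w''"
proof -
  have i: "inv_low w" "inv_ex M w" "inv_uniq M w" "inv_low_tri M w" "inv_tri M w"
    using assms unfolding inv_at_def by simp_all
  show "t (lab w) (lab w) (lab w)" "lab w \<notin> lab ` fset (low w)" using i(1) unfolding inv_low_def by simp_all
  show "t (lab w) (lab c) (lab c')" if "c |\<in>| low w" "c' |\<in>| low w" for c c'
    using i(1) that unfolding inv_low_def by simp
  show "level_adj c c'" if "c |\<in>| low w" "c' |\<in>| low w" "c \<noteq> c'" for c c'
    using i(1) that unfolding inv_low_def by blast
  show "\<exists>w'\<in>M. level_adj w w' \<and> lab w' = z"
    if "z \<noteq> lab w" "z \<notin> lab ` fset (low w)" "c |\<in>| low w" "t (lab w) z (lab c)" for z c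
    using i(2) that unfolding inv_ex_def by blast
  show "w' = w''" if "w' \<in> M" "w'' \<in> M" "level_adj w w'" "level_adj w w''" "lab w' = lab w''" for w' w''
    using i(3) that unfolding inv_uniq_def by blast
  show "lab w' \<notin> lab ` fset (low w)" if "w' \<in> M" "level_adj w w'" for w'
    using i(4) that unfolding inv_low_tri_def by blast
  show "c |\<in>| low w'" if "w' \<in> M" "level_adj w w'" "c |\<in>| low w" "t (lab w) (lab w') (lab c)" for w' c
    using i(4) that unfolding inv_low_tri_def by blast
  show "level_adj w' w''" if "w' \<in> M" "w'' \<in> M" "level_adj w w'" "level_adj w w''" "lab w' \<noteq> lab w''"
    "t (lab w) (lab w') (lab w'')" for w' w''
    using i(5) that unfolding inv_tri_def by blast
qed

lemma L_Suc: "u \<in> L r0 (Suc n) \<longleftrightarrow> (\<exists>w\<in>L r0 n. ascends w (lab u) \<and> fset (low u) = S r0 n w (lab u))"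
  unfolding S_def by (cases u) auto

text \<open>By uniqueness of horizontal lifts, labels are injective on \<open>S\<close>, and they
  are neighbours of \<open>lab w\<close> in a locally finite complex.\<close>

lemma S_finite:
  assumes "\<forall>w\<in>L r0 n. inv_at (L r0 n) w" "w \<in> L r0 n"
  shows "finite (S r0 n w z)"
proof (rule finite_imageD)
  have "lab ` S r0 n w z \<subseteq> {b. {lab w, b} \<in> X}"
  proof
    fix b assume "b \<in> lab ` S r0 n w z"
    then have "t (lab w) b b" using invD(1)[OF assms(1)[rule_format, OF assms(2)]] t_edge(1) unfolding S_def by auto
    then show "b \<in> {b. {lab w, b} \<in> X}" by (simp add: t_def)
  qed
  then show "finite (lab ` S r0 n w z)" using locfin finite_subset by blast
  show "inj_on lab (S r0 n w z)"
    using invD(6)[OF assms(1)[rule_format, OF assms(2)]] assms(2) unfolding S_def inj_on_def level_adj_def by force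
qed

text \<open>Two members of \<open>S\<close> not adjacent would, together with \<open>z\<close> and lower neighbours of \<open>w\<close>,
  form a cycle of length four or five without diagonals in the link of \<open>w\<close>.\<close>

lemma S_clique:
  assumes inv: "\<forall>w\<in>L r0 n. inv_at (L r0 n) w" and w: "w \<in> L r0 n" "ascends w z"
    and u: "u \<in> S r0 n w z" "u' \<in> S r0 n w z"
  shows "t z (lab u) (lab u') \<and> (u = u' \<or> level_adj u u')"
proof -
  note I = invD[OF inv[rule_format, OF w(1)]]
  have ww: "t z (lab w) (lab w)" using w(2) t_perm t_edge unfolding ascends_def by metis
  have up: "t z (lab w) (lab u) \<and> t z (lab u) (lab u)" if "u \<in> S r0 n w z" for u
    using that ww t_perm t_edge unfolding S_def by (metis (mono_tags, lifting) mem_Collect_eq)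
  show ?thesis
  proof (cases "u = w \<or> u' = w \<or> u = u'")
    case True
    have H: "level_adj w v" "t z (lab w) (lab v)" "t z (lab v) (lab w)" if "v \<in> S r0 n w z" "v \<noteq> w" for v
      using that t_rot[of "lab w" "lab v" z] t_perm(2)[of z "lab w" "lab v"] unfolding S_def by auto
    consider "u = u'" | "u = w" "u' \<noteq> w" | "u \<noteq> w" "u' = w" using True by blast
    then show ?thesis
    proof cases
      case 1 then show ?thesis using up u by blast
    next
      case 2 then show ?thesis using H[OF u(2)] by blast
    next
      case 3 then show ?thesis using H[OF u(1)] level_adj_sym by blast
    qed
  next
    case False
    then have H: "u \<in> L r0 n" "u' \<in> L r0 n" "level_adj w u" "level_adj w u'" "t (lab w) (lab u) z" "t (lab w) (lab u') z"
      using u unfolding S_def by auto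
    then obtain c c' where c: "c |\<in>| low w" "t (lab w) (lab u) (lab c)" and c': "c' |\<in>| low w" "t (lab w) (lab u') (lab c')"
      unfolding level_adj_def by blast
    have nz: "\<not> t (lab w) z (lab c)" "\<not> t (lab w) z (lab c')" using w(2) c c' unfolding ascends_def by auto
    have cc: "t (lab w) (lab c) (lab c')" using I(3) c c' by blast
    have z: "t (lab w) z (lab u)" "t (lab w) (lab u') z" using H t_perm by metis+
    have "t (lab w) (lab u) (lab u')"
    proof (rule ccontr)
      assume neg: "\<not> t (lab w) (lab u) (lab u')"
      have c'u': "t (lab w) (lab c') (lab u')" and cu': "t (lab w) (lab c) (lab u') \<longleftrightarrow> t (lab w) (lab u') (lab c)"
        using c' t_perm by metis+
      have "\<not> t (lab w) (lab u) (lab c')"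
        using t4[of "lab w" z "lab u" "lab c'" "lab u'"] z c'u' nz neg by blast
      moreover have "\<not> t (lab w) (lab c) (lab u')"
        using t4[of "lab w" z "lab u" "lab c" "lab u'"] z c nz neg by blast
      ultimately show False using t5[of "lab w" z "lab u" "lab c" "lab c'" "lab u'"] z c cc c'u' nz neg by blast
    qed
    then have "t (lab u) (lab u') z" using t_flag H by blast
    moreover have "lab u \<noteq> lab u'" using I(6)[OF H(1-4)] False by blast
    then have "level_adj u u'" using I(9)[OF H(1-4)] \<open>t (lab w) (lab u) (lab u')\<close> by blast
    ultimately show ?thesis using t_perm by metis
  qed
qed

text \<open>If some \<open>c\<close> below \<open>u\<close> were joined to \<open>z\<close>, the
  square \<open>w z c c0\<close> in the link of \<open>u\<close> would have a diagonal, and either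
  one joins \<open>z\<close> to a lower neighbour of \<open>w\<close>.\<close>

lemma ascends_S:
  assumes inv: "\<forall>w\<in>L r0 n. inv_at (L r0 n) w" and w: "w \<in> L r0 n" "ascends w z" and u: "u \<in> S r0 n w z"
  shows "ascends u z"
proof (cases "u = w")
  case False
  have u': "u \<in> L r0 n" "level_adj w u" "t (lab w) (lab u) z" using u False unfolding S_def by auto
  note I = invD[OF inv[rule_format, OF u'(1)]] and Iw = invD[OF inv[rule_format, OF w(1)]]
  obtain c0 where c0: "c0 |\<in>| low w" "c0 |\<in>| low u" "t (lab w) (lab u) (lab c0)" using u'(2) unfolding level_adj_def by blast
  have nw: "\<not> t (lab w) z (lab c)" if "c |\<in>| low w" for c using w(2) that unfolding ascends_def by blast
  have "lab u \<noteq> z" using nw[OF c0(1)] c0(3) by blast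
  moreover have "t (lab u) z z" using u'(3) t_edge t_perm by metis
  moreover have "\<not> t (lab u) z (lab c)" if c: "c |\<in>| low u" for c
  proof
    assume zc: "t (lab u) z (lab c)"
    have uw: "t (lab u) (lab w) z" "t (lab u) (lab c) (lab c0)" "t (lab u) (lab c0) (lab w)"
      using u' c0 I(3)[OF c c0(2)] t_perm by metis+
    have "t (lab u) (lab w) (lab c) \<or> t (lab u) z (lab c0)" using t4 uw zc by blast
    then show False
    proof
      assume wc: "t (lab u) (lab w) (lab c)"
      then have "c |\<in>| low w" using I(8)[OF w(1) level_adj_sym[OF u'(2)] c] by blast
      moreover have "t (lab w) z (lab c)" using t_flag[OF uw(1) zc wc] .
      ultimately show False using nw by blast
    next
      assume zc0: "t (lab u) z (lab c0)"
      have "t (lab w) z (lab c0)" using t_flag[OF uw(1) zc0] uw(3) t_perm by metis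
      then show False using nw c0 by blast
    qed
  qed
  ultimately show ?thesis unfolding ascends_def by blast
qed (use w in simp)

text \<open>Makes a vertex of the next level determined by its label and any one of its lower
  neighbours.\<close>

lemma S_eq:
  assumes inv: "\<forall>w\<in>L r0 n. inv_at (L r0 n) w" and w: "w \<in> L r0 n" "ascends w z" and u: "u \<in> S r0 n w z"
  shows "S r0 n u z = S r0 n w z"
proof -
  have sub: "S r0 n w z \<subseteq> S r0 n u z" if w: "w \<in> L r0 n" "ascends w z" and u: "u \<in> S r0 n w z" for w u
  proof
    fix v assume v: "v \<in> S r0 n w z"
    then have "t z (lab u) (lab v) \<and> (u = v \<or> level_adj u v)" using S_clique[OF inv w u v] by blast
    then show "v \<in> S r0 n u z" using v t_perm unfolding S_def by (metis (mono_tags, lifting) mem_Collect_eq)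
  qed
  have uL: "u \<in> L r0 n" using u unfolding S_def by blast
  have "w \<in> S r0 n w z" using w unfolding S_def by blast
  then have "w \<in> S r0 n u z" using sub[OF w u] by blast
  then show ?thesis using sub[OF w u] sub[OF uL ascends_S[OF inv w u]] by blast
qed

lemma L_lower:
  assumes inv: "\<forall>w\<in>L r0 n. inv_at (L r0 n) w" and w: "w \<in> L r0 (Suc n)" "v |\<in>| low w"
  shows "v \<in> L r0 n" "ascends v (lab w)" "fset (low w) = S r0 n v (lab w)"
proof -
  obtain w0 where w0: "w0 \<in> L r0 n" "ascends w0 (lab w)" "fset (low w) = S r0 n w0 (lab w)" using w(1) L_Suc by blast
  have v: "v \<in> S r0 n w0 (lab w)" using w(2) w0(3) by simp
  show "v \<in> L r0 n" using v unfolding S_def by blast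
  show "ascends v (lab w)" by (rule ascends_S[OF inv w0(1,2) v])
  have "S r0 n v (lab w) = S r0 n w0 (lab w)" by (rule S_eq[OF inv w0(1,2) v])
  then show "fset (low w) = S r0 n v (lab w)" using w0(3) by simp
qed

lemma L_low_ne: "w \<in> L r0 (Suc n) \<Longrightarrow> \<exists>v. v |\<in>| low w"
proof -
  assume "w \<in> L r0 (Suc n)"
  then obtain w0 where "w0 \<in> L r0 n" "fset (low w) = S r0 n w0 (lab w)" using L_Suc by blast
  then have "w0 \<in> fset (low w)" unfolding S_def by blast
  then show ?thesis by blast
qed

lemma L_make:
  assumes inv: "\<forall>w\<in>L r0 n. inv_at (L r0 n) w" and v: "v \<in> L r0 n" "ascends v z"
  shows "\<exists>w\<in>L r0 (Suc n). lab w = z \<and> v |\<in>| low w"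
proof -
  have "finite (S r0 n v z)" by (rule S_finite[OF inv v(1)])
  then have f: "fset (Abs_fset (S r0 n v z)) = S r0 n v z" by (simp add: Abs_fset_inverse)
  have "v \<in> S r0 n v z" using v unfolding S_def by blast
  then show ?thesis using v f L_Suc[of "Cover_Vertex z (Abs_fset (S r0 n v z))" r0 n]
    by (intro bexI[of _ "Cover_Vertex z (Abs_fset (S r0 n v z))"]) auto
qed

lemma L_unique:
  assumes inv: "\<forall>w\<in>L r0 n. inv_at (L r0 n) w" and w: "w \<in> L r0 (Suc n)" "w' \<in> L r0 (Suc n)"
    "lab w = lab w'" "v |\<in>| low w" "v |\<in>| low w'"
  shows "w = w'"
proof -
  have "fset (low w) = fset (low w')"
    using L_lower(3)[OF inv w(1,4)] L_lower(3)[OF inv w(2,5)] w(3) by simp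
  then have "low w = low w'" by (simp add: fset_inject)
  then show ?thesis using w(3) by (simp add: cover_vertex.expand)
qed

lemma low_mem:
  assumes inv: "\<forall>w\<in>L r0 n. inv_at (L r0 n) w" and w: "w \<in> L r0 (Suc n)" "v |\<in>| low w"
  shows "u |\<in>| low w \<longleftrightarrow> u \<in> L r0 n \<and> (u = v \<or> level_adj v u \<and> t (lab v) (lab u) (lab w))"
proof -
  have "u |\<in>| low w \<longleftrightarrow> u \<in> S r0 n v (lab w)" using L_lower(3)[OF inv w] by simp
  then show ?thesis unfolding S_def by simp
qed

lemma low_clique:
  assumes inv: "\<forall>w\<in>L r0 n. inv_at (L r0 n) w" and w: "w \<in> L r0 (Suc n)" and c: "c |\<in>| low w" "c' |\<in>| low w"
  shows "t (lab w) (lab c) (lab c') \<and> (c = c' \<or> level_adj c c')"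
proof -
  note l = L_lower[OF inv w c(1)]
  have "c \<in> S r0 n c (lab w)" "c' \<in> S r0 n c (lab w)" using l(3) c by simp_all
  from S_clique[OF inv l(1,2) this] show ?thesis .
qed

text \<open>A common lower neighbour \<open>v\<close> of \<open>w\<close> and \<open>w'\<close>
  spans a simplex with \<open>c\<close> and \<open>w'\<close>, so \<open>c\<close> occurs in the
  lower set of \<open>w'\<close> as computed from \<open>v\<close>.\<close>

lemma low_transfer:
  assumes inv: "\<forall>w\<in>L r0 n. inv_at (L r0 n) w" and w: "w \<in> L r0 (Suc n)" "w' \<in> L r0 (Suc n)"
    and H: "level_adj w w'" and c: "c |\<in>| low w" "t (lab w) (lab w') (lab c)"
  shows "c |\<in>| low w'"
proof -
  obtain v where v: "v |\<in>| low w" "v |\<in>| low w'" "t (lab w) (lab w') (lab v)" using H unfolding level_adj_def by blast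
  show ?thesis
  proof (cases "c = v")
    case False
    have vc: "t (lab w) (lab v) (lab c)" "level_adj v c" using low_clique[OF inv w(1) v(1) c(1)] False by blast+
    have "t (lab v) (lab c) (lab w')"
      using t_flag[of "lab w" "lab v" "lab c" "lab w'"] vc(1) c(2) v(3) t_perm(2) by blast
    moreover have "c \<in> L r0 n" using L_lower(1)[OF inv w(1) c(1)] .
    ultimately show ?thesis using low_mem[OF inv w(2) v(2)] vc(2) by blast
  qed (use v in simp)
qed

text \<open>The clauses are reduced, through a lower neighbour \<open>v\<close>, to the local
  structure at \<open>v\<close> one level below. For \<open>inv_tri\<close> the square condition in
  the link of \<open>w\<close> supplies a lower neighbour common to all three vertices.\<close>

lemma inv_step:
  assumes inv: "\<forall>w\<in>L r0 n. inv_at (L r0 n) w" and w: "w \<in> L r0 (Suc n)"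
  shows "inv_at (L r0 (Suc n)) w"
proof -
  let ?M = "L r0 (Suc n)"
  have edge: "lab v \<noteq> lab w" "t (lab v) (lab w) (lab w)" "\<And>c. c |\<in>| low v \<Longrightarrow> \<not> t (lab v) (lab w) (lab c)"
    if "w \<in> L r0 (Suc n)" "v |\<in>| low w" for v w
    using L_lower(2)[OF inv that] unfolding ascends_def by auto
  have "inv_low w"
    unfolding inv_low_def
  proof (intro conjI allI impI)
    obtain v where "v |\<in>| low w" using L_low_ne[OF w] by blast
    then show "t (lab w) (lab w) (lab w)" using edge(2)[OF w] t_edge(4) by blast
    show "lab w \<notin> lab ` fset (low w)" using edge(1)[OF w] by force
    show "t (lab w) (lab c) (lab c')" "c = c' \<or> level_adj c c'" if "c |\<in>| low w" "c' |\<in>| low w" for c c'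
      using low_clique[OF inv w that] by blast+
  qed
  moreover have "inv_ex ?M w"
    unfolding inv_ex_def
  proof (intro allI impI)
    fix z v assume z: "z \<noteq> lab w" "z \<notin> lab ` fset (low w)" and v: "v |\<in>| low w" "t (lab w) z (lab v)"
    note vL = L_lower(1)[OF inv w v(1)] and I = invD[OF inv[rule_format, OF L_lower(1)[OF inv w v(1)]]]
    have vz: "t (lab v) z (lab w)" using v(2) t_perm t_rot by metis
    have zv: "lab v \<noteq> z" using z(2) v(1) by auto
    have "ascends v z"
      unfolding ascends_def
    proof (intro conjI allI impI)
      show "lab v \<noteq> z" by (rule zv)
      show "t (lab v) z z" using t_edge(1)[OF vz] .
      fix c assume c: "c |\<in>| low v"
      show "\<not> t (lab v) z (lab c)"
      proof
        assume zc: "t (lab v) z (lab c)"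
        have "z \<notin> lab ` fset (low v)" using edge(3)[OF w v(1)] vz t_perm(2) by auto
        then obtain u where u: "u \<in> L r0 n" "level_adj v u" "lab u = z" using I(5)[OF _ _ c zc] zv by auto
        then have "u |\<in>| low w" using low_mem[OF inv w v(1)] vz by blast
        then show False using z(2) u(3) by auto
      qed
    qed
    then obtain w' where w': "w' \<in> ?M" "lab w' = z" "v |\<in>| low w'" using L_make[OF inv vL] by blast
    then have "level_adj w w'" using v z(1) unfolding level_adj_def by auto
    then show "\<exists>w'\<in>?M. level_adj w w' \<and> lab w' = z" using w' by blast
  qed
  moreover have "inv_uniq ?M w"
    unfolding inv_uniq_def
  proof (intro ballI impI)
    fix w' w'' assume w': "w' \<in> ?M" "w'' \<in> ?M" "level_adj w w'" "level_adj w w''" "lab w' = lab w''"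
    obtain v where v: "v |\<in>| low w" "v |\<in>| low w'" "t (lab w) (lab w') (lab v)" using w'(3) unfolding level_adj_def by blast
    have "v |\<in>| low w''" using low_transfer[OF inv w w'(2,4) v(1)] v(3) w'(5) by simp
    then show "w' = w''" using L_unique[OF inv w'(1,2,5) v(2)] by blast
  qed
  moreover have "inv_low_tri ?M w"
    unfolding inv_low_tri_def
  proof (intro ballI impI conjI allI)
    fix w' assume w': "w' \<in> ?M" "level_adj w w'"
    show "c |\<in>| low w'" if "c |\<in>| low w" "t (lab w) (lab w') (lab c)" for c
      using low_transfer[OF inv w w' that] .
    obtain v where v: "v |\<in>| low w" "v |\<in>| low w'" using w'(2) unfolding level_adj_def by blast
    show "lab w' \<notin> lab ` fset (low w)"
    proof
      assume "lab w' \<in> lab ` fset (low w)"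
      then obtain u where u: "u |\<in>| low w" "lab w' = lab u" by auto
      have "u \<noteq> v" using edge(1)[OF w'(1) v(2)] u(2) by auto
      then have "level_adj v u" using low_clique[OF inv w v(1) u(1)] by blast
      then obtain c where "c |\<in>| low v" "t (lab v) (lab u) (lab c)" unfolding level_adj_def by blast
      then show False using edge(3)[OF w'(1) v(2)] u(2) by simp
    qed
  qed
  moreover have "inv_tri ?M w"
    unfolding inv_tri_def
  proof (intro ballI impI)
    fix w' w'' assume w': "w' \<in> ?M" "w'' \<in> ?M" "level_adj w w'" "level_adj w w''" "lab w' \<noteq> lab w''" "t (lab w) (lab w') (lab w'')"
    obtain v where v: "v |\<in>| low w" "v |\<in>| low w'" "t (lab w) (lab w') (lab v)" using w'(3) unfolding level_adj_def by blast
    obtain u where u: "u |\<in>| low w" "u |\<in>| low w''" "t (lab w) (lab w'') (lab u)" using w'(4) unfolding level_adj_def by blast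
    have uv: "t (lab w) (lab u) (lab v)" using low_clique[OF inv w u(1) v(1)] by blast
    have fin: "level_adj w' w''" if "t (lab w) (lab w') (lab c)" "t (lab w) (lab w'') (lab c)" "c |\<in>| low w" for c
    proof -
      have "c |\<in>| low w'" "c |\<in>| low w''" using low_transfer[OF inv w _ _ that(3)] w' that by blast+
      moreover have "t (lab w') (lab w'') (lab c)" using t_flag[OF w'(6) that(2,1)] .
      ultimately show ?thesis using w'(5) unfolding level_adj_def by blast
    qed
    have "t (lab w) (lab v) (lab w')" using v(3) t_perm(2) by blast
    then have "t (lab w) (lab w') (lab u) \<or> t (lab w) (lab w'') (lab v)"
      using t4[OF w'(6) u(3) uv] by blast
    then show "level_adj w' w''" using fin[OF _ u(3) u(1)] fin[OF v(3) _ v(1)] by blast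
  qed
  ultimately show ?thesis unfolding inv_at_def by blast
qed

lemma inv_root:
  assumes "{r0} \<in> X" "w \<in> L r0 0"
  shows "inv_at (L r0 0) w"
  using assms unfolding inv_at_def inv_low_def inv_ex_def inv_uniq_def inv_low_tri_def inv_tri_def level_adj_def
  by (simp add: t_def)

lemma inv_all: "{r0} \<in> X \<Longrightarrow> w \<in> L r0 n \<Longrightarrow> inv_at (L r0 n) w"
proof (induction n arbitrary: w)
  case (Suc n)
  then show ?case using inv_step by blast
qed (use inv_root in blast)

end

section \<open>Graph distance\<close>

definition gdist :: "('a \<Rightarrow> 'a \<Rightarrow> bool) \<Rightarrow> 'a \<Rightarrow> 'a \<Rightarrow> nat" where
  "gdist E a b = (LEAST n. (E ^^ n) a b)"

lemma relpowp_sym: "(\<And>a b. E a b \<Longrightarrow> E b a) \<Longrightarrow> (E ^^ n) a b \<Longrightarrow> (E ^^ n) b a"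
proof (induction n arbitrary: a b)
  case (Suc n)
  then obtain c where c: "(E ^^ n) a c" "E c b" by (auto elim: relpowp_Suc_E)
  then show ?case using Suc.IH[OF Suc.prems(1) c(1)] relpowp_Suc_I2[of E b c n a] Suc.prems(1) by blast
qed simp

lemma metric_graph_gdist:
  assumes sym: "\<And>a b. E a b \<Longrightarrow> E b a" and irr: "\<And>a. \<not> E a a" and V: "\<And>a b. E a b \<Longrightarrow> a \<in> V"
    and conn: "\<And>a b. a \<in> V \<Longrightarrow> b \<in> V \<Longrightarrow> E\<^sup>*\<^sup>* a b"
  shows "metric_graph V (gdist E)" "metric_graph.E V (gdist E) = E"
proof -
  have attain: "(E ^^ gdist E a b) a b" if "a \<in> V" "b \<in> V" for a b
  proof -
    have "\<exists>n. (E ^^ n) a b" using conn[OF that] rtranclp_imp_relpowp by metis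
    then show ?thesis unfolding gdist_def by (rule LeastI_ex)
  qed
  have least: "gdist E a b \<le> n" if "(E ^^ n) a b" for a b n
    unfolding gdist_def using that by (rule Least_le)
  show M: "metric_graph V (gdist E)"
  proof unfold_locales
    show "gdist E a b = gdist E b a" for a b
      unfolding gdist_def using relpowp_sym[of E] sym by metis
    show "gdist E a a = 0" for a using least[of 0 a a] by simp
    show "a = b" if "a \<in> V" "b \<in> V" "gdist E a b = 0" for a b using attain[OF that(1,2)] that(3) by simp
    show "gdist E a c \<le> gdist E a b + gdist E b c" if "a \<in> V" "b \<in> V" "c \<in> V" for a b c
      using least[OF relpowp_trans[OF attain[of a b] attain[of b c]]] that by simp
    show "\<exists>c\<in>V. gdist E a c = 1 \<and> gdist E c b = n" if ab: "a \<in> V" "b \<in> V" "gdist E a b = Suc n" for a b n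
    proof -
      have "(E ^^ Suc n) a b" using attain[OF ab(1,2)] ab(3) by simp
      then obtain c where c: "E a c" "(E ^^ n) c b" using relpowp_Suc_D2 by metis
      have cV: "c \<in> V" using V[OF sym[OF c(1)]] .
      have "gdist E a c \<le> 1" "gdist E c b \<le> n" using least[of 1 a c, unfolded relpowp_1] least[of n c b] c by blast+
      moreover have "gdist E a b \<le> gdist E a c + gdist E c b"
        using least[OF relpowp_trans[OF attain[of a c] attain[of c b]]] ab cV by simp
      ultimately show ?thesis using cV ab(3) by (intro bexI[of _ c]) auto
    qed
  qed
  show "metric_graph.E V (gdist E) = E"
  proof (intro ext iffI)
    fix a b
    show "E a b" if "metric_graph.E V (gdist E) a b"
      using that attain[of a b] unfolding metric_graph.E_def[OF M] by auto
    assume E: "E a b"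
    then have ab: "a \<in> V" "b \<in> V" using V sym by blast+
    have "gdist E a b \<noteq> 0" using attain[OF ab] E irr by (metis relpowp_0_E)
    moreover have "gdist E a b \<le> 1" using least[of 1 a b, unfolded relpowp_1] E by blast
    ultimately show "metric_graph.E V (gdist E) a b" using ab unfolding metric_graph.E_def[OF M] by simp
  qed
qed

context large_links
begin

text \<open>The nesting depth of the lower sets determines the level.\<close>

lemma L_disjoint: "w \<in> L r0 n \<Longrightarrow> w \<in> L r0 m \<Longrightarrow> {r0} \<in> X \<Longrightarrow> n = m"
proof (induction n arbitrary: w m)
  case 0
  then have "low w = {||}" by simp
  then show ?case using L_low_ne[of w r0] 0 by (cases m) auto
next
  case (Suc n)
  note inv = ballI[OF inv_all[OF Suc.prems(3)]]
  obtain v where v: "v |\<in>| low w" using L_low_ne[OF Suc.prems(1)] by blast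
  then obtain k where k: "m = Suc k" using Suc.prems(2) by (cases m) auto
  have "v \<in> L r0 n" using L_lower(1)[OF inv Suc.prems(1) v] by blast
  moreover have "v \<in> L r0 k" using L_lower(1)[OF inv _ v] Suc.prems(2) k by blast
  ultimately show ?case using Suc.IH Suc.prems(3) k by blast
qed

definition cover_vertices :: "'a \<Rightarrow> 'a cover_vertex set" where
  "cover_vertices r0 = (\<Union>n. L r0 n)"

definition cover_adj :: "'a \<Rightarrow> 'a cover_vertex \<Rightarrow> 'a cover_vertex \<Rightarrow> bool" where
  "cover_adj r0 y z \<longleftrightarrow> (\<exists>n. y \<in> L r0 n \<and> z \<in> L r0 n \<and> level_adj y z \<or> y \<in> L r0 n \<and> z \<in> L r0 (Suc n) \<and> y |\<in>| low z \<or>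
     z \<in> L r0 n \<and> y \<in> L r0 (Suc n) \<and> z |\<in>| low y)"

lemma cover_adj_sym: "cover_adj r0 y z \<Longrightarrow> cover_adj r0 z y"
  unfolding cover_adj_def using level_adj_sym by blast

lemma cover_adj_cases:
  assumes r0: "{r0} \<in> X" and y: "y \<in> L r0 n" and "cover_adj r0 y z"
  obtains (low) "z |\<in>| low y" | (hor) "z \<in> L r0 n" "level_adj y z" | (up) "z \<in> L r0 (Suc n)" "y |\<in>| low z"
proof -
  obtain m where m: "y \<in> L r0 m \<and> z \<in> L r0 m \<and> level_adj y z \<or> y \<in> L r0 m \<and> z \<in> L r0 (Suc m) \<and> y |\<in>| low z \<or>
     z \<in> L r0 m \<and> y \<in> L r0 (Suc m) \<and> z |\<in>| low y" using assms(3) unfolding cover_adj_def by blast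
  then show ?thesis using that L_disjoint[OF y _ r0] by metis
qed

lemma nbI_low: "{r0} \<in> X \<Longrightarrow> y \<in> L r0 n \<Longrightarrow> z |\<in>| low y \<Longrightarrow> cover_adj r0 y z"
proof (cases n)
  case (Suc m)
  assume r0: "{r0} \<in> X" and y: "y \<in> L r0 n" "z |\<in>| low y"
  have "z \<in> L r0 m" using L_lower(1)[OF ballI[OF inv_all[OF r0]] _ y(2)] y(1) Suc by blast
  then show ?thesis using y Suc unfolding cover_adj_def by blast
qed simp

lemma cover_adj_label:
  assumes r0: "{r0} \<in> X" and y: "y \<in> L r0 n"
  shows "z |\<in>| low y \<Longrightarrow> lab z \<noteq> lab y \<and> t (lab y) (lab z) (lab z)"
    and "z \<in> L r0 n \<Longrightarrow> level_adj y z \<Longrightarrow> lab z \<notin> lab ` fset (low y) \<and> (\<exists>c. c |\<in>| low y \<and> t (lab y) (lab z) (lab c))"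
    and "z \<in> L r0 (Suc n) \<Longrightarrow> y |\<in>| low z \<Longrightarrow> ascends y (lab z)"
proof -
  note inv = ballI[OF inv_all[OF r0]] and I = invD[OF inv_all[OF r0 y]]
  show "lab z \<noteq> lab y \<and> t (lab y) (lab z) (lab z)" if "z |\<in>| low y" using I(2) imageI[OF that, of lab] I(3)[OF that that] by metis
  show "lab z \<notin> lab ` fset (low y) \<and> (\<exists>c. c |\<in>| low y \<and> t (lab y) (lab z) (lab c))" if "z \<in> L r0 n" "level_adj y z"
    using I(7)[OF that] that(2) unfolding level_adj_def by blast
  show "ascends y (lab z)" if "z \<in> L r0 (Suc n)" "y |\<in>| low z" using L_lower(2)[OF inv that] .
qed

text \<open>Edges of the cover go down, stay on a level or go up. Neighbours with equal labels are
  of the same type, since a label that equals or is joined to that of a lower neighbour cannot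
  ascend, and horizontal labels differ from lower ones.\<close>

lemma covering_lab:
  assumes r0: "{r0} \<in> X"
  shows "covering X (cover_vertices r0) (cover_adj r0) lab"
  unfolding covering_def
proof (intro conjI ballI allI impI; (elim conjE)?)
  note inv = ballI[OF inv_all[OF r0]]
  fix y assume "y \<in> cover_vertices r0"
  then obtain n where y: "y \<in> L r0 n" unfolding cover_vertices_def by blast
  note I = invD[OF inv_all[OF r0 y]]
  show "{lab y} \<in> X" using I(1) unfolding t_def by simp
  fix b assume b: "b \<noteq> lab y" "{lab y, b} \<in> X"
  have tb: "t (lab y) b b" using b(2) by (simp add: t_def)
  show "\<exists>z. cover_adj r0 y z \<and> lab z = b"
  proof (cases "b \<in> lab ` fset (low y)")
    case True
    then show ?thesis using nbI_low[OF r0 y] by auto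
  next
    case nlow: False
    show ?thesis
    proof (cases "\<exists>c. c |\<in>| low y \<and> t (lab y) b (lab c)")
      case True
      then show ?thesis using I(5)[OF b(1) nlow] y unfolding cover_adj_def by blast
    next
      case False
      then have "ascends y b" using b(1) tb unfolding ascends_def by auto
      then show ?thesis using L_make[OF inv y] y unfolding cover_adj_def by blast
    qed
  qed
next
  note inv = ballI[OF inv_all[OF r0]]
  fix y z assume cover_adj: "cover_adj r0 y z"
  then obtain n where y: "y \<in> L r0 n" unfolding cover_adj_def by blast
  obtain m where z: "z \<in> L r0 m" using cover_adj unfolding cover_adj_def by blast
  show "y \<in> cover_vertices r0" "z \<in> cover_vertices r0" using y z unfolding cover_vertices_def by blast+
  show "cover_adj r0 z y" using cover_adj cover_adj_sym by blast
  from r0 y cover_adj have *: "lab y \<noteq> lab z \<and> t (lab y) (lab z) (lab z)"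
  proof (cases rule: cover_adj_cases)
    case low then show ?thesis using cover_adj_label(1)[OF r0 y low] by metis
  next
    case hor then show ?thesis using t_edge(1) unfolding level_adj_def by blast
  next
    case up then show ?thesis using cover_adj_label(3)[OF r0 y up] unfolding ascends_def by blast
  qed
  then show "lab y \<noteq> lab z" "{lab y, lab z} \<in> X" unfolding t_def by simp_all
next
  note inv = ballI[OF inv_all[OF r0]]
  fix y z w assume cover_adj: "cover_adj r0 y z" "cover_adj r0 y w" and eq: "lab z = lab w"
  then obtain n where y: "y \<in> L r0 n" unfolding cover_adj_def by blast
  note I = invD[OF inv_all[OF r0 y]] and l = cover_adj_label[OF r0 y]
  have lowinj: "z = w" if "z |\<in>| low y" "w |\<in>| low y"
    using I(4)[OF that] eq unfolding level_adj_def by blast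
  have up: "z = w" if "z \<in> L r0 (Suc n)" "y |\<in>| low z" "w \<in> L r0 (Suc n)" "y |\<in>| low w"
    using L_unique[OF inv that(1,3) eq that(2,4)] .
  from r0 y cover_adj(1) show "z = w"
  proof (cases rule: cover_adj_cases)
    case low
    from r0 y cover_adj(2) show ?thesis
    proof (cases rule: cover_adj_cases)
      case hor then show ?thesis using l(2)[OF hor] imageI[OF low, of lab] eq by metis
    next
      case up then show ?thesis using l(1)[OF low] l(3)[OF up] low eq unfolding ascends_def by metis
    qed (use low lowinj in blast)
  next
    case hor
    from r0 y cover_adj(2) show ?thesis
    proof (cases rule: cover_adj_cases)
      case low then show ?thesis using l(2)[OF hor] imageI[OF low, of lab] eq by metis
    next
      case up then show ?thesis using l(2)[OF hor] l(3)[OF up] eq unfolding ascends_def by metis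
    qed (use hor I(6) eq in blast)
  next
    case up': up
    from r0 y cover_adj(2) show ?thesis
    proof (cases rule: cover_adj_cases)
      case low then show ?thesis using l(1)[OF low] l(3)[OF up'] low eq unfolding ascends_def by metis
    next
      case hor then show ?thesis using l(2)[OF hor] l(3)[OF up'] eq unfolding ascends_def by metis
    qed (use up' up in blast)
  qed
next
  note inv = ballI[OF inv_all[OF r0]]
  fix y z w assume cover_adj: "cover_adj r0 y z" "cover_adj r0 y w" and ne: "lab z \<noteq> lab w" and "{lab y, lab z, lab w} \<in> X"
  then have t: "t (lab y) (lab z) (lab w)" "t (lab y) (lab w) (lab z)" by (simp_all add: t_def insert_commute)
  obtain n where y: "y \<in> L r0 n" using cover_adj(1) unfolding cover_adj_def by blast
  note I = invD[OF inv_all[OF r0 y]] and l = cover_adj_label[OF r0 y]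
  have H: "cover_adj r0 z w" if zw: "z \<in> L r0 k" "w \<in> L r0 k" "level_adj z w" for k using zw unfolding cover_adj_def by blast
  have lh: "cover_adj r0 z w" if zw: "z |\<in>| low y" "w \<in> L r0 n" "level_adj y w" "t (lab y) (lab w) (lab z)" for z w
    using cover_adj_sym[OF nbI_low[OF r0 zw(2) I(8)[OF zw(2,3,1,4)]]] .
  have lu: False if zw: "z |\<in>| low y" "w \<in> L r0 (Suc n)" "y |\<in>| low w" "t (lab y) (lab w) (lab z)" for z w
    using l(3)[OF zw(2,3)] zw(1,4) unfolding ascends_def by blast
  have hu: "cover_adj r0 z w" if zw: "z \<in> L r0 n" "level_adj y z" "w \<in> L r0 (Suc n)" "y |\<in>| low w" "t (lab y) (lab z) (lab w)" for z w
    using low_mem[OF inv zw(3,4), of z] zw nbI_low[OF r0 zw(3), of z] cover_adj_sym by blast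
  from r0 y cover_adj(1) show "cover_adj r0 z w"
  proof (cases rule: cover_adj_cases)
    case z: low
    from r0 y cover_adj(2) show ?thesis
    proof (cases rule: cover_adj_cases)
      case w: low
      obtain m where n: "n = Suc m" using y z by (cases n) auto
      have "z \<in> L r0 m" "w \<in> L r0 m" using L_lower(1)[OF inv _ z] L_lower(1)[OF inv _ w] y n by blast+
      then show ?thesis using H I(4)[OF z w] ne by blast
    qed (use z lh lu t in blast)+
  next
    case z: hor
    from r0 y cover_adj(2) show ?thesis
    proof (cases rule: cover_adj_cases)
      case w: low then show ?thesis using lh[OF w z t(1)] cover_adj_sym by blast
    next
      case w: hor then show ?thesis using H[OF z(1) w(1)] I(9)[OF z(1) w(1) z(2) w(2) ne t(1)] by blast
    next
      case w: up then show ?thesis using hu[OF z w t(1)] by blast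
    qed
  next
    case z: up
    from r0 y cover_adj(2) show ?thesis
    proof (cases rule: cover_adj_cases)
      case w: low then show ?thesis using lu[OF w z t(1)] by blast
    next
      case w: hor then show ?thesis using hu[OF w z t(2)] cover_adj_sym by blast
    next
      case w: up
      have "t (lab z) (lab w) (lab y)" using t(1) t_rot by metis
      then have "level_adj z w" using ne z(2) w(2) unfolding level_adj_def by blast
      then show ?thesis using H[OF z(1) w(1)] by blast
    qed
  qed
qed

end

definition cadj :: "'a set set \<Rightarrow> 'a \<Rightarrow> 'a \<Rightarrow> bool" where
  "cadj X a b \<longleftrightarrow> a \<noteq> b \<and> {a, b} \<in> X"

lemma coveringD:
  assumes "covering X Y H p"
  shows "y \<in> Y \<Longrightarrow> {p y} \<in> X"
    "H y z \<Longrightarrow> y \<in> Y" "H y z \<Longrightarrow> z \<in> Y" "H y z \<Longrightarrow> H z y" "H y z \<Longrightarrow> p y \<noteq> p z" "H y z \<Longrightarrow> {p y, p z} \<in> X"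
    "y \<in> Y \<Longrightarrow> b \<noteq> p y \<Longrightarrow> {p y, b} \<in> X \<Longrightarrow> \<exists>z. H y z \<and> p z = b"
    "H y z \<Longrightarrow> H y w \<Longrightarrow> p z = p w \<Longrightarrow> z = w"
    "H y z \<Longrightarrow> H y w \<Longrightarrow> p z \<noteq> p w \<Longrightarrow> {p y, p z, p w} \<in> X \<Longrightarrow> H z w"
proof -
  note a = assms[unfolded covering_def]
  show "y \<in> Y \<Longrightarrow> {p y} \<in> X" using a by (elim conjE) blast
  have 2: "\<forall>y z. H y z \<longrightarrow> y \<in> Y \<and> z \<in> Y \<and> H z y \<and> p y \<noteq> p z \<and> {p y, p z} \<in> X" using a by (elim conjE)
  then show "H y z \<Longrightarrow> y \<in> Y" "H y z \<Longrightarrow> z \<in> Y" "H y z \<Longrightarrow> H z y" "H y z \<Longrightarrow> p y \<noteq> p z" "H y z \<Longrightarrow> {p y, p z} \<in> X"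
    by blast+
  have 3: "\<forall>y\<in>Y. \<forall>b. b \<noteq> p y \<and> {p y, b} \<in> X \<longrightarrow> (\<exists>z. H y z \<and> p z = b)" using a by (elim conjE)
  then show "y \<in> Y \<Longrightarrow> b \<noteq> p y \<Longrightarrow> {p y, b} \<in> X \<Longrightarrow> \<exists>z. H y z \<and> p z = b" by blast
  have 4: "\<forall>y z w. H y z \<and> H y w \<and> p z = p w \<longrightarrow> z = w" using a by (elim conjE)
  then show "H y z \<Longrightarrow> H y w \<Longrightarrow> p z = p w \<Longrightarrow> z = w" by blast
  have 5: "\<forall>y z w. H y z \<and> H y w \<and> p z \<noteq> p w \<and> {p y, p z, p w} \<in> X \<longrightarrow> H z w" using a by (elim conjE)
  then show "H y z \<Longrightarrow> H y w \<Longrightarrow> p z \<noteq> p w \<Longrightarrow> {p y, p z, p w} \<in> X \<Longrightarrow> H z w" by blast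
qed

text \<open>Closed neighbourhoods, so that constant steps of a lifted path need no special
  case.\<close>

definition near :: "'b set \<Rightarrow> ('b \<Rightarrow> 'b \<Rightarrow> bool) \<Rightarrow> 'b \<Rightarrow> 'b \<Rightarrow> bool" where
  "near Y H w z \<longleftrightarrow> z \<in> Y \<and> w \<in> Y \<and> (w = z \<or> H w z)"

lemma near_covering:
  assumes "covering X Y H p"
  shows near_ex: "w \<in> Y \<Longrightarrow> {p w, b} \<in> X \<Longrightarrow> \<exists>z. near Y H w z \<and> p z = b"
    and near_unique: "near Y H w z \<Longrightarrow> near Y H w z' \<Longrightarrow> p z = p z' \<Longrightarrow> z = z'"
    and near_sym: "near Y H w z \<Longrightarrow> near Y H z w"
    and near_triangle: "near Y H y z \<Longrightarrow> near Y H y w \<Longrightarrow> {p y, p z, p w} \<in> X \<Longrightarrow> near Y H z w"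
proof -
  note c = coveringD[OF assms]
  show "\<exists>z. near Y H w z \<and> p z = b" if "w \<in> Y" "{p w, b} \<in> X" for w b
    using c(7)[OF that(1), of b] that c(3) unfolding near_def by (cases "b = p w") auto
  show "z = z'" if "near Y H w z" "near Y H w z'" "p z = p z'" for w z z'
    using that c(5)[of w z] c(5)[of w z'] c(8)[of w z z'] unfolding near_def by auto
  show sym: "near Y H z w" if "near Y H w z" for w z using that c(4) unfolding near_def by auto
  show "near Y H z w" if t: "near Y H y z" "near Y H y w" "{p y, p z, p w} \<in> X" for y z w
  proof (cases "y = z \<or> y = w")
    case True then show ?thesis using t sym unfolding near_def by auto
  next
    case False
    then have H: "H y z" "H y w" using t unfolding near_def by auto
    show ?thesis
    proof (cases "p z = p w")
      case True then show ?thesis using c(8)[OF H] c(3)[OF H(1)] unfolding near_def by auto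
    next
      case ne: False then show ?thesis using c(9)[OF H ne t(3)] c(3) H unfolding near_def by auto
    qed
  qed
qed

section \<open>The complex as its own universal cover\<close>

locale large_links_sc = large_links +
  assumes connected: "{a} \<in> X \<Longrightarrow> {b} \<in> X \<Longrightarrow> (cadj X)\<^sup>*\<^sup>* a b"
    and lift: "loops_lift X TYPE('a cover_vertex)"
begin

abbreviation Vs :: "'a set" where "Vs \<equiv> {a. {a} \<in> X}"
abbreviation dst where "dst \<equiv> gdist (cadj X)"

lemma cadj_sym: "cadj X a b \<Longrightarrow> cadj X b a"
  by (auto simp: cadj_def insert_commute)

lemma cadj_V: "cadj X a b \<Longrightarrow> {a} \<in> X"
  unfolding cadj_def using face[of "{a, b}" "{a}"] by simp

lemma cadj_graph: "metric_graph Vs dst" "metric_graph.E Vs dst = cadj X"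
proof -
  have irr: "\<not> cadj X a a" for a by (simp add: cadj_def)
  have V: "a \<in> Vs" if "cadj X a b" for a b using cadj_V[OF that] by simp
  have conn: "(cadj X)\<^sup>*\<^sup>* a b" if "a \<in> Vs" "b \<in> Vs" for a b using connected that by simp
  show "metric_graph Vs dst" by (rule metric_graph_gdist(1)) (fact cadj_sym irr V conn)+
  show "metric_graph.E Vs dst = cadj X" by (rule metric_graph_gdist(2)) (fact cadj_sym irr V conn)+
qed

sublocale metric_graph Vs dst
  by (rule cadj_graph(1))

lemma E_cadj: "E = cadj X"
  by (rule cadj_graph(2))

lemma root: "Cover_Vertex r0 {||} \<in> L r0 0"
  by simp

lemma to_root: "{r0} \<in> X \<Longrightarrow> w \<in> L r0 n \<Longrightarrow> (cover_adj r0)\<^sup>*\<^sup>* w (Cover_Vertex r0 {||})"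
proof (induction n arbitrary: w)
  case (Suc n)
  obtain v where v: "v |\<in>| low w" using L_low_ne[OF Suc.prems(2)] by blast
  then have "v \<in> L r0 n" using L_lower(1)[OF ballI[OF inv_all[OF Suc.prems(1)]] Suc.prems(2)] by blast
  then show ?case using nbI_low[OF Suc.prems v] Suc.IH Suc.prems(1) converse_rtranclp_into_rtranclp[of "cover_adj r0" w v] by blast
qed simp

text \<open>A path in the cover between two vertices of equal label projects to a closed path, which
  must lift to a closed path.\<close>

lemma lab_inj:
  assumes r0: "{r0} \<in> X" and w: "w \<in> cover_vertices r0" "w' \<in> cover_vertices r0" "lab w = lab w'"
  shows "w = w'"
proof -
  have 1: "(cover_adj r0)\<^sup>*\<^sup>* w (Cover_Vertex r0 {||})" "(cover_adj r0)\<^sup>*\<^sup>* w' (Cover_Vertex r0 {||})"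
    using to_root[OF r0] w unfolding cover_vertices_def by blast+
  have "(cover_adj r0)\<^sup>*\<^sup>* (Cover_Vertex r0 {||}) w'"
    using 1(2) symp_rtranclp[of "cover_adj r0"] cover_adj_sym by (metis sympI sympD)
  then have "(cover_adj r0)\<^sup>*\<^sup>* w w'" using 1(1) by simp
  then obtain n where "(cover_adj r0 ^^ n) w w'" using rtranclp_imp_relpowp by metis
  then obtain f where f: "f 0 = w" "f n = w'" "\<forall>i<n. cover_adj r0 (f i) (f (Suc i))" unfolding relpowp_fun_conv by blast
  have "f n = f 0"
    using lift[unfolded loops_lift_def, rule_format, OF covering_lab[OF r0], of f n] f w by simp
  then show ?thesis using f by simp
qed

lemma lab_edge:
  assumes r0: "{r0} \<in> X" and w: "w \<in> cover_vertices r0" "w' \<in> cover_vertices r0" "cadj X (lab w) (lab w')"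
  shows "cover_adj r0 w w'"
proof -
  note c = coveringD[OF covering_lab[OF r0]]
  obtain z where "cover_adj r0 w z" "lab z = lab w'" using c(7)[OF w(1), of "lab w'"] w(3) unfolding cadj_def by auto
  then show ?thesis using lab_inj[OF r0 _ w(2)] c(3) by blast
qed

lemma lab_ex_relpow:
  assumes r0: "{r0} \<in> X"
  shows "(cadj X ^^ n) r0 b \<Longrightarrow> \<exists>w k. k \<le> n \<and> w \<in> L r0 k \<and> lab w = b"
proof (induction n arbitrary: b)
  case 0
  then show ?case using root[of r0] by (intro exI[of _ "Cover_Vertex r0 {||}"] exI[of _ 0]) simp
next
  case (Suc n)
  then obtain c where c: "(cadj X ^^ n) r0 c" "cadj X c b" by (auto elim: relpowp_Suc_E)
  obtain w k where w: "k \<le> n" "w \<in> L r0 k" "lab w = c" using Suc.IH[OF c(1)] by blast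
  have wL: "w \<in> cover_vertices r0" using w unfolding cover_vertices_def by blast
  obtain z where z: "cover_adj r0 w z" "lab z = b"
    using coveringD(7)[OF covering_lab[OF r0] wL, of b] c(2) w(3) unfolding cadj_def by auto
  from r0 w(2) z(1) show ?case
  proof (cases rule: cover_adj_cases)
    case low
    then obtain m where k: "k = Suc m" using w(2) by (cases k) auto
    have "z \<in> L r0 m" using L_lower(1)[OF ballI[OF inv_all[OF r0]] _ low] w(2) k by blast
    then show ?thesis using z w k by (intro exI[of _ z] exI[of _ m]) simp
  next
    case hor then show ?thesis using z w by (intro exI[of _ z] exI[of _ k]) simp
  next
    case up then show ?thesis using z w by (intro exI[of _ z] exI[of _ "Suc k"]) simp
  qed
qed

lemma relpow_level: "{r0} \<in> X \<Longrightarrow> w \<in> L r0 n \<Longrightarrow> (cadj X ^^ n) r0 (lab w)"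
proof (induction n arbitrary: w)
  case (Suc n)
  obtain v where v: "v |\<in>| low w" using L_low_ne[OF Suc.prems(2)] by blast
  then have "v \<in> L r0 n" using L_lower(1)[OF ballI[OF inv_all[OF Suc.prems(1)]] Suc.prems(2)] by blast
  then have "(cadj X ^^ n) r0 (lab v)" using Suc by blast
  moreover have "cadj X (lab v) (lab w)"
    using coveringD(5,6)[OF covering_lab[OF Suc.prems(1)] nbI_low[OF Suc.prems v]] by (auto simp: cadj_def insert_commute)
  ultimately show ?case by auto
qed simp

text \<open>Paths lift to the cover and climb at most one level per step; injectivity of the labels
  identifies the end of the lift.\<close>

lemma dist_level:
  assumes r0: "{r0} \<in> X" and w: "w \<in> L r0 n"
  shows "dst r0 (lab w) = n"
  unfolding gdist_def
proof (rule Least_equality)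
  show "(cadj X ^^ n) r0 (lab w)" using relpow_level[OF assms] .
  fix m assume "(cadj X ^^ m) r0 (lab w)"
  then obtain w' k where w': "k \<le> m" "w' \<in> L r0 k" "lab w' = lab w" using lab_ex_relpow[OF r0] by blast
  then have "w' = w" using lab_inj[OF r0, of w' w] w unfolding cover_vertices_def by blast
  then have "k = n" using L_disjoint[OF _ w r0] w'(2) by blast
  then show "n \<le> m" using w'(1) by simp
qed

lemma lab_ex:
  assumes r0: "{r0} \<in> X" and b: "{b} \<in> X"
  shows "\<exists>w \<in> L r0 (dst r0 b). lab w = b"
proof -
  have "\<exists>n. (cadj X ^^ n) r0 b" using connected[OF r0 b] rtranclp_imp_relpowp by metis
  then obtain w k where "w \<in> L r0 k" "lab w = b" using lab_ex_relpow[OF r0] by blast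
  then show ?thesis using dist_level[OF r0] by blast
qed

lemma lift_lower:
  assumes r0: "{r0} \<in> X" and v: "v \<in> L r0 (Suc n)" and u: "cadj X (lab v) u" "dst r0 u = n"
  shows "\<exists>u'. lab u' = u \<and> u' |\<in>| low v"
proof -
  have "{u} \<in> X" using cadj_V[OF cadj_sym[OF u(1)]] .
  then obtain u' where u': "u' \<in> L r0 n" "lab u' = u" using lab_ex[OF r0] u(2) by blast
  have "cover_adj r0 v u'" using lab_edge[OF r0, of v u'] v u' u(1) unfolding cover_vertices_def by blast
  with r0 v show ?thesis
  proof (cases rule: cover_adj_cases)
    case hor then show ?thesis using L_disjoint[OF u'(1) hor(1) r0] by simp
  next
    case up then show ?thesis using L_disjoint[OF u'(1) up(1) r0] by simp
  qed (use u' in blast)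
qed

text \<open>Seen from \<open>a\<close>, both \<open>b\<close> and \<open>c\<close> lie on level one,
  and their edge needs a common lower neighbour, which can only be the root.\<close>

lemma tri:
  assumes "cadj X a b" "cadj X b c" "cadj X a c"
  shows "{a, b, c} \<in> X"
proof -
  have V: "{a} \<in> X" "{b} \<in> X" "{c} \<in> X" using assms cadj_V cadj_sym by blast+
  have "E a b" "E a c" using assms E_cadj by simp_all
  then have d1: "dst a b = 1" "dst a c = 1" unfolding E_def by simp_all
  obtain b' where b': "b' \<in> L a 1" "lab b' = b" using lab_ex[OF V(1,2)] d1 by auto
  obtain c' where c': "c' \<in> L a 1" "lab c' = c" using lab_ex[OF V(1,3)] d1 by auto
  have "cover_adj a b' c'" using lab_edge[OF V(1), of b' c'] b' c' assms(2) unfolding cover_vertices_def by blast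
  with V(1) b'(1) have "level_adj b' c'"
  proof (cases rule: cover_adj_cases)
    case low
    then have "c' \<in> L a 0" using L_lower(1)[OF ballI[OF inv_all[OF V(1)]] _ low, of 0] b'(1) by simp
    then show ?thesis using L_disjoint[OF c'(1) _ V(1)] by fastforce
  next
    case up then show ?thesis using L_disjoint[OF c'(1) up(1) V(1)] by simp
  qed
  then obtain v where v: "v |\<in>| low b'" "t b c (lab v)" using b' c' unfolding level_adj_def by auto
  then have "v \<in> L a 0" using L_lower(1)[OF ballI[OF inv_all[OF V(1)]] _ v(1), of 0] b'(1) by simp
  then have "t b c a" using v(2) by simp
  then show ?thesis unfolding t_def by (simp add: insert_commute)
qed

lemma flag:
  assumes "finite \<sigma>" "\<sigma> \<noteq> {}" "\<And>a b. a \<in> \<sigma> \<Longrightarrow> b \<in> \<sigma> \<Longrightarrow> {a, b} \<in> X"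
  shows "\<sigma> \<in> X"
proof -
  obtain a where a: "a \<in> \<sigma>" using assms(2) by blast
  have "insert a \<sigma> \<in> X"
  proof (rule link_flag[OF assms(1,2)])
    fix u v assume uv: "u \<in> \<sigma>" "v \<in> \<sigma>"
    show "{a, u, v} \<in> X"
    proof (cases "a = u \<or> a = v \<or> u = v")
      case True then show ?thesis using assms(3) a uv by (auto simp: insert_commute)
    next
      case False
      then show ?thesis using tri[of a u v] assms(3) a uv unfolding cadj_def by blast
    qed
  qed
  then show ?thesis using a by (simp add: insert_absorb)
qed

lemma A_edge: "A a b \<longleftrightarrow> {a, b} \<in> X"
  using face[of "{a, b}"] unfolding A_iff E_cadj cadj_def by auto

lemma lower_A1:
  assumes "c \<in> Vs" "E v u" "E v w" "dst c v = Suc n" "dst c u = n" "dst c w = n"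
  shows "A u w"
proof -
  have c: "{c} \<in> X" and v: "{v} \<in> X" using assms(1) EV(1)[OF assms(2)] by simp_all
  obtain v' where v': "v' \<in> L c (Suc n)" "lab v' = v" using lab_ex[OF c v] assms(4) by auto
  obtain u' where u': "lab u' = u" "u' |\<in>| low v'" using lift_lower[OF c v'(1)] assms(2,5) v'(2) unfolding E_cadj by auto
  obtain w' where w': "lab w' = w" "w' |\<in>| low v'" using lift_lower[OF c v'(1)] assms(3,6) v'(2) unfolding E_cadj by auto
  have "t v u w" using invD(3)[OF inv_all[OF c v'(1)] u'(2) w'(2)] u' w' v' by simp
  then show ?thesis unfolding A_edge using t_edge(4)[of v u w] face[of "{v, u, w}" "{u, w}"] by (simp add: t_def)
qed

lemma common_lower:
  assumes "c \<in> Vs" "E u w" "dst c u = Suc n" "dst c w = Suc n"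
  shows "\<exists>v. E u v \<and> E w v \<and> dst c v = n"
proof -
  have c: "{c} \<in> X" and uw: "{u} \<in> X" "{w} \<in> X" using assms(1) EV[OF assms(2)] by simp_all
  obtain u' where u': "u' \<in> L c (Suc n)" "lab u' = u" using lab_ex[OF c uw(1)] assms(3) by auto
  obtain w' where w': "w' \<in> L c (Suc n)" "lab w' = w" using lab_ex[OF c uw(2)] assms(4) by auto
  have "cover_adj c u' w'" using lab_edge[OF c, of u' w'] u' w' assms(2) unfolding cover_vertices_def E_cadj by blast
  with c u'(1) have "level_adj u' w'"
  proof (cases rule: cover_adj_cases)
    case low
    then have "w' \<in> L c n" using L_lower(1)[OF ballI[OF inv_all[OF c]] u'(1) low] by blast
    then show ?thesis using L_disjoint[OF w'(1) _ c] by fastforce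
  next
    case up then show ?thesis using L_disjoint[OF w'(1) up(1) c] by simp
  qed
  then obtain v where v: "v |\<in>| low u'" "v |\<in>| low w'" unfolding level_adj_def by blast
  have "v \<in> L c n" using L_lower(1)[OF ballI[OF inv_all[OF c]] u'(1) v(1)] by blast
  then have "dst c (lab v) = n" using dist_level[OF c] by blast
  moreover have "cadj X u (lab v)" "cadj X w (lab v)"
    using coveringD(5,6)[OF covering_lab[OF c] nbI_low[OF c u'(1) v(1)]] coveringD(5,6)[OF covering_lab[OF c] nbI_low[OF c w'(1) v(2)]]
      u' w' unfolding cadj_def by auto
  ultimately show ?thesis unfolding E_cadj by blast
qed

text \<open>Seen from \<open>a\<close>, the edge from \<open>c\<close> to \<open>e\<close> lies on
  level two. Its common lower neighbour \<open>m\<close> is adjacent to all five vertices, so the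
  pentagon lies in the link of \<open>m\<close>.\<close>

lemma pentagon:
  assumes "A a b" "A b c" "A c e" "A e f" "A f a"
  shows "A a c \<or> A a e \<or> A b e \<or> A b f \<or> A c f"
proof (rule ccontr)
  assume neg: "\<not> ?thesis"
  have V: "a \<in> Vs" "b \<in> Vs" "c \<in> Vs" "e \<in> Vs" "f \<in> Vs" using assms AV by blast+
  have ne: "a \<noteq> b" "b \<noteq> c" "c \<noteq> e" "e \<noteq> f" "f \<noteq> a" using neg assms A_sym by blast+
  have d: "dst a b = 1" "dst a f = 1"
    using A_neq[OF assms(1) ne(1)] A_neq[OF assms(5) ne(5)] unfolding E_def by (simp_all add: d_sym)
  have c2: "dst a c = Suc 1" using neg V d_A(1)[OF assms(2) V(1)] d unfolding A_def by auto
  have e2: "dst a e = Suc 1" using neg V d_A(1)[OF A_sym[OF assms(4)] V(1)] d unfolding A_def by auto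
  obtain m where m: "E c m" "E e m" "dst a m = 1" using common_lower[OF V(1) A_neq[OF assms(3) ne(3)] c2 e2] by blast
  have mb: "A m b" using lower_A1[OF V(1) m(1) _ c2 m(3) d(1)] A_neq[OF assms(2) ne(2)] E_sym by blast
  have mf: "A m f" using lower_A1[OF V(1) m(2) _ e2 m(3) d(2)] A_neq[OF assms(4) ne(4)] by blast
  have ma: "A m a" using m V EV(2)[OF m(1)] unfolding A_def by (simp add: d_sym)
  have tr: "{m, u, v} \<in> X" if "A m u" "A m v" "A u v" for u v
  proof (cases "m = u \<or> m = v \<or> u = v")
    case True then show ?thesis using that unfolding A_edge by (auto simp: insert_commute)
  next
    case False
    then show ?thesis using tri[of m u v] that A_neq unfolding E_cadj by blast
  qed
  have mc: "A m c" "A m e" using m EA E_sym by blast+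
  have "{m, a, c} \<in> X \<or> {m, a, e} \<in> X \<or> {m, b, e} \<in> X \<or> {m, b, f} \<in> X \<or> {m, c, f} \<in> X"
    using link5[of m a b c e f] tr mb mf ma mc assms by blast
  moreover have "A u v" if "{m, u, v} \<in> X" for u v unfolding A_edge using face[OF that, of "{u, v}"] by blast
  ultimately show False using neg by blast
qed

sublocale bridged Vs dst
  by unfold_locales (fact lower_A1, fact common_lower, fact pentagon)

end

section \<open>The complex of simplices\<close>

text \<open>Turns invariant simplices into fixed vertices. A barycentric subdivision could create
  short cycles in links, whereas here the link conditions are inherited.\<close>

definition star :: "'a set set \<Rightarrow> 'a set set set" where
  "star X = {K. K \<noteq> {} \<and> {} \<notin> K \<and> \<Union>K \<in> X}"

context large_links_sc
begin

lemma star_vertex: "{\<sigma>} \<in> star X \<longleftrightarrow> \<sigma> \<in> X"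
  using simplex_finite unfolding star_def by auto

lemma star_pair: "{\<sigma>, \<tau>} \<in> star X \<longleftrightarrow> \<sigma> \<in> X \<and> \<tau> \<in> X \<and> (\<forall>a\<in>\<sigma>. \<forall>b\<in>\<tau>. {a, b} \<in> X)"
proof
  assume s: "{\<sigma>, \<tau>} \<in> star X"
  then have u: "\<sigma> \<union> \<tau> \<in> X" "\<sigma> \<noteq> {}" "\<tau> \<noteq> {}" unfolding star_def by auto
  then show "\<sigma> \<in> X \<and> \<tau> \<in> X \<and> (\<forall>a\<in>\<sigma>. \<forall>b\<in>\<tau>. {a, b} \<in> X)" using face[OF u(1)] by auto
next
  assume a: "\<sigma> \<in> X \<and> \<tau> \<in> X \<and> (\<forall>a\<in>\<sigma>. \<forall>b\<in>\<tau>. {a, b} \<in> X)"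
  have "\<sigma> \<union> \<tau> \<in> X"
  proof (rule flag)
    show "finite (\<sigma> \<union> \<tau>)" "\<sigma> \<union> \<tau> \<noteq> {}" using a simplex_finite by auto
    show "{u, v} \<in> X" if "u \<in> \<sigma> \<union> \<tau>" "v \<in> \<sigma> \<union> \<tau>" for u v
      using that a face[of \<sigma> "{u, v}"] face[of \<tau> "{u, v}"] by (auto simp: insert_commute)
  qed
  then show "{\<sigma>, \<tau>} \<in> star X" using a simplex_finite unfolding star_def by auto
qed

lemma star_flag:
  assumes "finite K" "K \<noteq> {}" "\<And>\<sigma> \<tau>. \<sigma> \<in> K \<Longrightarrow> \<tau> \<in> K \<Longrightarrow> {\<sigma>, \<tau>} \<in> star X"
  shows "K \<in> star X"
proof -
  have K: "\<sigma> \<in> X" if "\<sigma> \<in> K" for \<sigma> using assms(3)[OF that that] star_vertex by simp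
  have "\<Union>K \<in> X"
  proof (rule flag)
    show "finite (\<Union>K)" using assms(1) K simplex_finite by blast
    show "\<Union>K \<noteq> {}" using assms(2) K simplex_finite by blast
    show "{a, b} \<in> X" if "a \<in> \<Union>K" "b \<in> \<Union>K" for a b using that assms(3) star_pair by blast
  qed
  then show ?thesis using assms(2) K simplex_finite unfolding star_def by blast
qed

lemma star_face: "K \<in> star X \<Longrightarrow> T \<subseteq> K \<Longrightarrow> T \<noteq> {} \<Longrightarrow> T \<in> star X"
proof -
  assume K: "K \<in> star X" and T: "T \<subseteq> K" "T \<noteq> {}"
  have "{} \<notin> T" using K T(1) unfolding star_def by auto
  then have "\<Union>T \<noteq> {}" using T(2) by auto
  moreover have "\<Union>K \<in> X" using K unfolding star_def by simp
  ultimately have "\<Union>T \<in> X" using face[of "\<Union>K" "\<Union>T"] Union_mono[OF T(1)] by simp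
  then show ?thesis using \<open>{} \<notin> T\<close> T(2) unfolding star_def by simp
qed

lemma star_triple: "{\<sigma>, \<tau>, \<rho>} \<in> star X \<longleftrightarrow> {\<sigma>, \<tau>} \<in> star X \<and> {\<sigma>, \<rho>} \<in> star X \<and> {\<tau>, \<rho>} \<in> star X"
proof
  assume "{\<sigma>, \<tau>, \<rho>} \<in> star X"
  then show "{\<sigma>, \<tau>} \<in> star X \<and> {\<sigma>, \<rho>} \<in> star X \<and> {\<tau>, \<rho>} \<in> star X" using star_face by auto
next
  assume a: "{\<sigma>, \<tau>} \<in> star X \<and> {\<sigma>, \<rho>} \<in> star X \<and> {\<tau>, \<rho>} \<in> star X"
  then have s: "{\<sigma>} \<in> star X" "{\<tau>} \<in> star X" "{\<rho>} \<in> star X" using star_face by auto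
  show "{\<sigma>, \<tau>, \<rho>} \<in> star X"
    by (rule star_flag[of "{\<sigma>, \<tau>, \<rho>}"]) (use a s in \<open>auto simp: insert_commute\<close>)
qed

definition joined :: "'a set \<Rightarrow> 'a set \<Rightarrow> bool" where
  "joined \<sigma> \<tau> \<longleftrightarrow> (\<forall>a\<in>\<sigma>. \<forall>b\<in>\<tau>. A a b)"

lemma star_joined: "{\<sigma>, \<tau>} \<in> star X \<longleftrightarrow> \<sigma> \<in> X \<and> \<tau> \<in> X \<and> joined \<sigma> \<tau>"
  unfolding star_pair joined_def A_edge ..

lemma joined_C4:
  assumes "joined s1 s2" "joined s2 s3" "joined s3 s4" "joined s4 s1"
  shows "joined s1 s3 \<or> joined s2 s4"
proof (rule ccontr)
  assume "\<not> ?thesis"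
  then obtain a1 a3 a2 a4 where "a1 \<in> s1" "a3 \<in> s3" "\<not> A a1 a3" "a2 \<in> s2" "a4 \<in> s4" "\<not> A a2 a4"
    unfolding joined_def by blast
  then show False using C4[of a1 a2 a3 a4] assms unfolding joined_def by blast
qed

text \<open>Different missing diagonals may be witnessed by different vertices. Squares and
  pentagons of vertices transfer the failures until two of them occur in the one square
  \<open>p1 p2 q3 q4\<close>.\<close>

lemma joined_C5:
  assumes j: "joined s1 s2" "joined s2 s3" "joined s3 s4" "joined s4 s5" "joined s5 s1"
  shows "joined s1 s3 \<or> joined s1 s4 \<or> joined s2 s4 \<or> joined s2 s5 \<or> joined s3 s5"
proof (rule ccontr)
  assume neg: "\<not> ?thesis"
  text \<open>A vertex with a non-neighbour in the second next clique is joined to the one after it.\<close>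
  have key: "A p s" if j: "joined s1 s2" "joined s2 s3" "joined s3 s4" "joined s4 s5" "joined s5 s1" and n: "\<not> joined s2 s5"
    and p: "p \<in> s1" "q \<in> s3" "\<not> A p q" "s \<in> s4" for s1 s2 s3 s4 s5 p q s
  proof (rule ccontr)
    assume np: "\<not> A p s"
    obtain u v where uv: "u \<in> s2" "v \<in> s5" "\<not> A u v" using n unfolding joined_def by blast
    have e: "A p u" "A u q" "A q s" "A s v" "A v p" using j p uv unfolding joined_def by blast+
    consider "A u s" | "A q v" using C5[OF e] p(3) np uv(3) by blast
    then show False
    proof cases
      case 1 then show False using C4[OF e(1) 1 e(4,5)] np uv by blast
    next
      case 2 then show False using C4[OF e(1,2) 2 e(5)] p uv by blast
    qed
  qed
  obtain p1 q3 where 13: "p1 \<in> s1" "q3 \<in> s3" "\<not> A p1 q3" using neg unfolding joined_def by blast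
  obtain p2 q4 where 24: "p2 \<in> s2" "q4 \<in> s4" "\<not> A p2 q4" using neg unfolding joined_def by blast
  have "A p1 q4" using key[OF j _ 13 24(2)] neg by blast
  moreover have "A p1 p2" "A p2 q3" "A q3 q4" using j 13 24 unfolding joined_def by blast+
  ultimately show False using C4[of p1 p2 q3 q4] 13 24 A_sym by blast
qed

lemma star_link4:
  assumes "{s, s1, s2} \<in> star X" "{s, s2, s3} \<in> star X" "{s, s3, s4} \<in> star X" "{s, s4, s1} \<in> star X"
  shows "{s, s1, s3} \<in> star X \<or> {s, s2, s4} \<in> star X"
proof -
  have v: "s \<in> X" "s1 \<in> X" "s2 \<in> X" "s3 \<in> X" "s4 \<in> X" "joined s s1" "joined s s2" "joined s s3" "joined s s4"
    using assms unfolding star_triple star_joined by simp_all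
  have j: "joined s1 s2" "joined s2 s3" "joined s3 s4" "joined s4 s1"
    using assms unfolding star_triple star_joined by simp_all
  show ?thesis using joined_C4[OF j] v unfolding star_triple star_joined by simp
qed

lemma star_link5:
  assumes "{s, s1, s2} \<in> star X" "{s, s2, s3} \<in> star X" "{s, s3, s4} \<in> star X" "{s, s4, s5} \<in> star X" "{s, s5, s1} \<in> star X"
  shows "{s, s1, s3} \<in> star X \<or> {s, s1, s4} \<in> star X \<or> {s, s2, s4} \<in> star X \<or> {s, s2, s5} \<in> star X \<or> {s, s3, s5} \<in> star X"
proof -
  have v: "s \<in> X" "s1 \<in> X" "s2 \<in> X" "s3 \<in> X" "s4 \<in> X" "s5 \<in> X"
    "joined s s1" "joined s s2" "joined s s3" "joined s s4" "joined s s5"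
    using assms unfolding star_triple star_joined by simp_all
  have j: "joined s1 s2" "joined s2 s3" "joined s3 s4" "joined s4 s5" "joined s5 s1"
    using assms unfolding star_triple star_joined by simp_all
  show ?thesis using joined_C5[OF j] v unfolding star_triple star_joined by simp
qed

lemma star_connected:
  assumes "\<sigma> \<in> X" "\<tau> \<in> X"
  shows "(cadj (star X))\<^sup>*\<^sup>* \<sigma> \<tau>"
proof -
  have s1: "(cadj (star X))\<^sup>*\<^sup>* \<sigma> {a}" "(cadj (star X))\<^sup>*\<^sup>* {a} \<sigma>" if a: "a \<in> \<sigma>" "\<sigma> \<in> X" for \<sigma> a
  proof -
    have "{a} \<in> X" "\<forall>b\<in>\<sigma>. {a, b} \<in> X" using face[OF a(2)] a(1) by auto
    then have "{\<sigma>, {a}} \<in> star X" "{{a}, \<sigma>} \<in> star X" using a(2) unfolding star_pair by (auto simp: insert_commute)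
    then show "(cadj (star X))\<^sup>*\<^sup>* \<sigma> {a}" "(cadj (star X))\<^sup>*\<^sup>* {a} \<sigma>" unfolding cadj_def
      by (cases "\<sigma> = {a}"; auto)+
  qed
  obtain a b where ab: "a \<in> \<sigma>" "b \<in> \<tau>" using assms simplex_finite by blast
  have "{a} \<in> X" "{b} \<in> X" using ab assms face by auto
  then have "(cadj X)\<^sup>*\<^sup>* a b" using connected by blast
  then have "(cadj (star X))\<^sup>*\<^sup>* {a} {b}"
  proof (induction rule: rtranclp_induct)
    case (step b c)
    have "{b} \<in> X" "{c} \<in> X" using cadj_V[OF step(2)] cadj_V[OF cadj_sym[OF step(2)]] by blast+
    then have "{{b}, {c}} \<in> star X" "b \<noteq> c" using step(2) unfolding star_pair cadj_def by simp_all
    then have "cadj (star X) {b} {c}" unfolding cadj_def by simp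
    then show ?case using step.IH by simp
  qed simp
  then show ?thesis using s1[OF ab(1) assms(1)] s1[OF ab(2) assms(2)] by auto
qed

text \<open>A covering of the complex of simplices restricts to a covering over the vertices; a loop of simplices is
  moved to a loop of vertices by choosing a vertex in each simplex.\<close>

lemma star_lift:
  assumes "loops_lift X TYPE('b)"
  shows "loops_lift (star X) TYPE('b)"
  unfolding loops_lift_def
proof (intro allI impI; elim conjE)
  fix Y H p n and y :: "nat \<Rightarrow> 'b"
  assume cov: "covering (star X) Y H p" and y0: "y 0 \<in> Y" and step: "\<forall>i<n. H (y i) (y (Suc i))" and closed: "p (y n) = p (y 0)"
  note c = coveringD[OF cov]
  define Y' where "Y' = {y \<in> Y. is_singleton (p y)}"
  define H' where "H' y z \<longleftrightarrow> H y z \<and> y \<in> Y' \<and> z \<in> Y'" for y z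
  define p' where "p' y = the_elem (p y)" for y
  have p': "p y = {p' y}" if "y \<in> Y'" for y using that unfolding Y'_def p'_def by (simp add: is_singleton_the_elem)
  have Y': "y \<in> Y'" "p' y = a" if "y \<in> Y" "p y = {a}" for y a using that unfolding Y'_def p'_def by auto
  have pair: "{{a}, {b}} \<in> star X \<longleftrightarrow> {a, b} \<in> X" for a b
    using face[of "{a, b}"] unfolding star_pair by auto
  have cov': "covering X Y' H' p'"
    unfolding covering_def
  proof (intro conjI ballI allI impI; (elim conjE)?)
    show "{p' y} \<in> X" if "y \<in> Y'" for y
      using c(1)[of y] that p'[OF that] star_vertex unfolding Y'_def by auto
    show "y \<in> Y'" "z \<in> Y'" "H' z y" if "H' y z" for y z using that c(4) unfolding H'_def by blast+
    show "p' y \<noteq> p' z" "{p' y, p' z} \<in> X" if "H' y z" for y z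
      using that c(5,6)[of y z] p'[of y] p'[of z] pair unfolding H'_def by auto
    show "\<exists>z. H' y z \<and> p' z = b" if y: "y \<in> Y'" and b: "b \<noteq> p' y" "{p' y, b} \<in> X" for y b
    proof -
      have "\<exists>z. H y z \<and> p z = {b}"
        using c(7)[of y "{b}"] y b p'[OF y] pair unfolding Y'_def by auto
      then show ?thesis using Y' c(3) y unfolding H'_def by blast
    qed
    show "z = w" if "H' y z" "H' y w" "p' z = p' w" for y z w
      using that c(8)[of y z w] p'[of z] p'[of w] unfolding H'_def by auto
    show "H' z w" if "H' y z" "H' y w" "p' z \<noteq> p' w" "{p' y, p' z, p' w} \<in> X" for y z w
    proof -
      have e: "{p' y, p' z} \<in> X" "{p' y, p' w} \<in> X" "{p' z, p' w} \<in> X" using face[OF that(4)] by auto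
      have Y: "y \<in> Y'" "z \<in> Y'" "w \<in> Y'" using that unfolding H'_def by blast+
      have "{p y, p z, p w} \<in> star X" unfolding p'[OF Y(1)] p'[OF Y(2)] p'[OF Y(3)] star_triple pair using e by blast
      then show ?thesis using that c(9)[of y z w] Y p'[OF Y(2)] p'[OF Y(3)] unfolding H'_def by auto
    qed
  qed
  have yY: "y i \<in> Y" if "i \<le> n" for i
  proof (cases i)
    case (Suc j)
    then show ?thesis using step that c(3)[of "y j" "y (Suc j)"] by simp
  qed (use y0 in simp)
  define R where "R = near Y H"
  note ex = near_ex[OF cov, folded R_def] and uniq = near_unique[OF cov, folded R_def]
    and Rsym = near_sym[OF cov, folded R_def] and Rtri = near_triangle[OF cov, folded R_def]
  define u where "u \<sigma> = (SOME a. a \<in> \<sigma>)" for \<sigma> :: "'a set"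
  have u: "u \<sigma> \<in> \<sigma>" if "\<sigma> \<in> X" for \<sigma> unfolding u_def using simplex_finite[OF that] by (simp add: some_in_eq)
  have pX: "p (y i) \<in> X" if "i \<le> n" for i using c(1)[OF yY[OF that]] star_vertex by simp
  have single: "{\<sigma>, {a}} \<in> star X" if "\<sigma> \<in> X" "a \<in> \<sigma>" for \<sigma> a
    unfolding star_pair using that face[OF that(1)] by auto
  have "\<exists>z. R (y i) z \<and> p z = {u (p (y i))}" if "i \<le> n" for i
    using ex[OF yY[OF that] single[OF pX[OF that] u[OF pX[OF that]]]] .
  then obtain f where f: "\<And>i. i \<le> n \<Longrightarrow> R (y i) (f i) \<and> p (f i) = {u (p (y i))}" by metis
  have fY': "f i \<in> Y'" "p' (f i) = u (p (y i))" if "i \<le> n" for i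
    using f[OF that] Y'[of "f i"] unfolding R_def near_def by auto
  have fstep: "f i = f (Suc i) \<or> H' (f i) (f (Suc i))" if i: "i < n" for i
  proof -
    have H: "H (y i) (y (Suc i))" using step i by blast
    then have R: "R (y i) (y (Suc i))" using c(2,3) unfolding R_def near_def by blast
    let ?s = "p (y i)" and ?t = "p (y (Suc i))"
    have X: "?s \<in> X" "?t \<in> X" using pX[of i] pX[of "Suc i"] i by auto
    have st: "{?s, ?t} \<in> star X" using c(6)[OF H] .
    have pr: "{?s, {u ?s}} \<in> star X" "{?t, {u ?t}} \<in> star X" using single X u by blast+
    have "\<forall>b\<in>?t. {u ?s, b} \<in> X" "{u ?s} \<in> X" using st u[OF X(1)] face[OF X(1)] unfolding star_pair by auto
    then have 1: "{{u ?s}, ?t} \<in> star X" "{{u ?s}, {u ?t}} \<in> star X"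
      using X(2) u[OF X(2)] face[OF X(2), of "{u ?t}"] unfolding star_pair by auto
    have "R (f i) (y (Suc i))"
      using Rtri[OF _ R, of "f i"] f[of i] i st pr 1 unfolding star_triple by auto
    then have R1: "R (y (Suc i)) (f i)" by (rule Rsym)
    have R2: "R (y (Suc i)) (f (Suc i))" using f[of "Suc i"] i by auto
    have "{?t, {u ?s}, {u ?t}} \<in> star X" using pr 1 unfolding star_triple by (simp add: insert_commute)
    moreover have "p (f i) = {u ?s}" "p (f (Suc i)) = {u ?t}" using f[of i] f[of "Suc i"] i by simp_all
    ultimately have "R (f i) (f (Suc i))" using Rtri[OF R1 R2] by simp
    then show ?thesis using fY'[of i] fY'[of "Suc i"] i unfolding R_def near_def H'_def by auto
  qed
  have "(H')\<^sup>*\<^sup>* (f 0) (f i)" if "i \<le> n" for i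
    using that
  proof (induction i)
    case (Suc i)
    then show ?case using fstep[of i] by (auto intro: rtranclp.rtrancl_into_rtrancl)
  qed simp
  then obtain m where "(H' ^^ m) (f 0) (f n)" using rtranclp_imp_relpowp by (metis order_refl)
  then obtain h where h: "h 0 = f 0" "h m = f n" "\<forall>i<m. H' (h i) (h (Suc i))" unfolding relpowp_fun_conv by blast
  have "h m = h 0"
    using assms[unfolded loops_lift_def, rule_format, OF cov', of h m] h fY' closed by simp
  then have "f n = f 0" using h by simp
  then have "R (f 0) (y n)" "R (f 0) (y 0)" using f[of n] f[of 0] Rsym by auto
  then show "y n = y 0" using uniq closed by blast
qed

theorem star_large_links:
  assumes "loops_lift X TYPE('a set cover_vertex)"
  shows "large_links_sc (star X)"
proof unfold_locales
  show "finite K \<and> K \<noteq> {}" if "K \<in> star X" for K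
  proof -
    have "K \<subseteq> Pow (\<Union>K)" by blast
    then show ?thesis using that simplex_finite finite_subset unfolding star_def by blast
  qed
  show "T \<in> star X" if "K \<in> star X" "T \<subseteq> K" "T \<noteq> {}" for K T using star_face that .
  show "finite {\<tau>. {\<sigma>, \<tau>} \<in> star X}" for \<sigma>
  proof (cases "\<exists>a. a \<in> \<sigma>")
    case True
    then obtain a where "a \<in> \<sigma>" by blast
    then have "{\<tau>. {\<sigma>, \<tau>} \<in> star X} \<subseteq> Pow {b. {a, b} \<in> X}" unfolding star_pair by blast
    then show ?thesis using locfin[of a] by (meson finite_Pow_iff finite_subset)
  next
    case False
    then have "{\<tau>. {\<sigma>, \<tau>} \<in> star X} = {}" unfolding star_def by auto
    then show ?thesis by simp
  qed
  show "insert s T \<in> star X" if T: "finite T" "T \<noteq> {}" "\<And>u v. u \<in> T \<Longrightarrow> v \<in> T \<Longrightarrow> {s, u, v} \<in> star X" for s T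
  proof (rule star_flag)
    fix u v assume uv: "u \<in> insert s T" "v \<in> insert s T"
    obtain w where "w \<in> T" using T(2) by blast
    then have "{s, w} \<in> star X" using T(3)[of w w] by simp
    then have ss: "{s, s} \<in> star X" using star_face[of "{s, w}" "{s, s}"] by blast
    have pr: "{u, v} \<in> star X" if "u \<in> T" "v \<in> T" for u v using T(3)[OF that] star_triple by blast
    have ps: "{s, u} \<in> star X" "{u, s} \<in> star X" if "u \<in> T" for u
      using T(3)[OF that that] by (simp_all add: insert_commute)
    show "{u, v} \<in> star X" using uv ss pr ps by blast
  qed (use T in auto)
  show "(cadj (star X))\<^sup>*\<^sup>* \<sigma> \<tau>" if "{\<sigma>} \<in> star X" "{\<tau>} \<in> star X" for \<sigma> \<tau>
    using star_connected that star_vertex by blast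
  show "loops_lift (star X) TYPE('a set cover_vertex)" using star_lift assms .
qed (use star_link4 star_link5 in blast)+

end

section \<open>Automorphisms acting on the complex of simplices\<close>

lemma gdist_bij:
  assumes "bij f" "\<And>a b. E (f a) (f b) \<longleftrightarrow> E a b"
  shows "gdist E (f a) (f b) = gdist E a b"
proof -
  have "(E ^^ n) (f a) (f b) \<longleftrightarrow> (E ^^ n) a b" for n
  proof (induction n arbitrary: b)
    case 0
    show ?case using assms(1) by (simp add: bij_def inj_eq)
  next
    case (Suc n)
    have "(E ^^ Suc n) (f a) (f b) \<longleftrightarrow> (\<exists>c. (E ^^ n) (f a) c \<and> E c (f b))" by auto
    also have "\<dots> \<longleftrightarrow> (\<exists>c. (E ^^ n) (f a) (f c) \<and> E (f c) (f b))"
      using assms(1) by (metis bij_pointE)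
    also have "\<dots> \<longleftrightarrow> (E ^^ Suc n) a b" using Suc assms(2) by auto
    finally show ?case .
  qed
  then show ?thesis unfolding gdist_def by simp
qed

context large_links_sc
begin

lemma invariant_simplex:
  assumes "X \<noteq> {}" and f: "bij f" "\<And>\<sigma>. f ` \<sigma> \<in> X \<longleftrightarrow> \<sigma> \<in> X" "\<And>a. f (f (f (f (f a)))) = a"
  shows "\<exists>\<sigma>\<in>X. f ` \<sigma> = \<sigma>"
proof -
  have cad: "cadj X (f a) (f b) \<longleftrightarrow> cadj X a b" for a b
    using f(2)[of "{a, b}"] f(1) unfolding cadj_def by (simp add: bij_def inj_eq)
  interpret F: rot5 Vs dst f
  proof unfold_locales
    show "f a \<in> Vs \<longleftrightarrow> a \<in> Vs" for a using f(2)[of "{a}"] by simp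
    show "dst (f a) (f b) = dst a b" for a b by (rule gdist_bij[where f = f and E = "cadj X", OF f(1) cad])
  qed (use f in simp)
  obtain \<sigma> where "\<sigma> \<in> X" using assms(1) by blast
  then have "Vs \<noteq> {}" using simplex_finite[of \<sigma>] face[of \<sigma> "{_}"] by blast
  moreover have "finite {b. E a b}" for a
    unfolding E_cadj cadj_def by (rule finite_subset[OF _ locfin[of a]]) auto
  ultimately obtain C where C: "clq C" "f ` C = C" using F.invariant_clique by blast
  then have "C \<in> X" using flag unfolding clq_def A_edge by blast
  then show ?thesis using C by blast
qed

text \<open>The rotations act on \<open>star X\<close> with union as join and cardinality as size:
  two different adjacent simplices of equal size have a strictly larger union.\<close>

theorem common_invariant_simplex:
  assumes X: "X \<noteq> {}" "\<exists>B. \<forall>\<sigma>\<in>X. card \<sigma> \<le> B" and lift': "loops_lift X TYPE('a set cover_vertex)"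
    and f: "bij f" "\<And>\<sigma>. f ` \<sigma> \<in> X \<longleftrightarrow> \<sigma> \<in> X" "\<And>a. f (f (f (f (f a)))) = a"
    and h: "bij h" "\<And>\<sigma>. h ` \<sigma> \<in> X \<longleftrightarrow> \<sigma> \<in> X" "\<And>a. h (h (h (h (h a)))) = a"
    and fh: "\<And>a. f (h (f (h a))) = a"
  shows "\<exists>\<sigma>\<in>X. f ` \<sigma> = \<sigma> \<and> h ` \<sigma> = \<sigma>"
proof -
  interpret K: large_links_sc "star X" by (rule star_large_links[OF lift'])
  have rot: "bij ((`) f)" "cadj (star X) (f ` \<sigma>) (f ` \<tau>) \<longleftrightarrow> cadj (star X) \<sigma> \<tau>" "{f ` \<sigma>} \<in> star X \<longleftrightarrow> {\<sigma>} \<in> star X"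
    if f: "bij f" "\<And>\<sigma>. f ` \<sigma> \<in> X \<longleftrightarrow> \<sigma> \<in> X" for f :: "'a \<Rightarrow> 'a" and \<sigma> \<tau>
  proof -
    have inj: "f ` \<sigma> = f ` \<tau> \<longleftrightarrow> \<sigma> = \<tau>" for \<sigma> \<tau> using f(1) by (simp add: bij_def inj_image_eq_iff)
    show "bij ((`) f)"
    proof (rule bijI)
      show "inj ((`) f)" using inj by (auto simp: inj_def)
      show "surj ((`) f)" using f(1) by (metis bij_def surjI image_f_inv_f)
    qed
    have "f ` \<sigma> \<union> f ` \<tau> \<in> X \<longleftrightarrow> \<sigma> \<union> \<tau> \<in> X" using f(2)[of "\<sigma> \<union> \<tau>"] by (simp add: image_Un)
    then show "cadj (star X) (f ` \<sigma>) (f ` \<tau>) \<longleftrightarrow> cadj (star X) \<sigma> \<tau>"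
      unfolding cadj_def inj by (auto simp: star_def)
    show "{f ` \<sigma>} \<in> star X \<longleftrightarrow> {\<sigma>} \<in> star X" unfolding star_vertex using f(2) .
  qed
  have K: "C \<in> star X" if "K.clq C" for C
    using that star_flag unfolding K.clq_def K.A_edge by blast
  interpret R: rotations K.Vs K.dst "(`) f" "(`) h" Union card
  proof unfold_locales
    show "(f ` \<sigma> \<in> K.Vs) = (\<sigma> \<in> K.Vs)" "(h ` \<sigma> \<in> K.Vs) = (\<sigma> \<in> K.Vs)" for \<sigma>
      using rot(3)[OF f(1,2)] rot(3)[OF h(1,2)] by simp_all
    show "K.dst (f ` \<sigma>) (f ` \<tau>) = K.dst \<sigma> \<tau>" for \<sigma> \<tau>
      by (rule gdist_bij[where f = "(`) f" and E = "cadj (star X)"]) (rule rot(1,2)[OF f(1,2)])+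
    show "K.dst (h ` \<sigma>) (h ` \<tau>) = K.dst \<sigma> \<tau>" for \<sigma> \<tau>
      by (rule gdist_bij[where f = "(`) h" and E = "cadj (star X)"]) (rule rot(1,2)[OF h(1,2)])+
    show "\<Union> C \<in> K.Vs" if "K.clq C" for C using K[OF that] star_vertex by (simp add: star_def)
    show "K.A v (\<Union> C)" if C: "K.clq C" and v: "v \<in> K.Vs" and "\<And>c. c \<in> C \<Longrightarrow> K.A v c" for C v
    proof -
      have "\<Union>C \<in> X" using K[OF C] by (simp add: star_def)
      moreover have "v \<in> X" using v star_vertex by simp
      moreover have "\<forall>a\<in>v. \<forall>b\<in>c. {a, b} \<in> X" if "c \<in> C" for c
        using \<open>\<And>c. c \<in> C \<Longrightarrow> K.A v c\<close>[OF that] unfolding K.A_edge star_pair by blast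
      ultimately have "{v, \<Union>C} \<in> star X" unfolding star_pair by blast
      then show ?thesis unfolding K.A_edge .
    qed
    show "f ` \<Union> C = \<Union> ((`) f ` C)" "h ` \<Union> C = \<Union> ((`) h ` C)" for C by blast+
    show "card (f ` \<sigma>) = card \<sigma>" "card (h ` \<sigma>) = card \<sigma>" for \<sigma>
      using f(1) h(1) by (meson bij_betw_def card_image inj_on_subset subset_UNIV)+
    show "card \<sigma> < card (\<Union> {\<sigma>, \<tau>})" if "K.E \<sigma> \<tau>" "card \<sigma> = card \<tau>" for \<sigma> \<tau>
    proof -
      have "\<sigma> \<in> X" "\<tau> \<in> X" "\<sigma> \<noteq> \<tau>" using that(1) unfolding K.E_cadj cadj_def star_pair by blast+
      moreover from this have "\<not> \<tau> \<subseteq> \<sigma>" using card_subset_eq[of \<sigma> \<tau>] simplex_finite that(2) by auto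
      ultimately show ?thesis using simplex_finite by (auto intro!: psubset_card_mono)
    qed
    show "\<exists>B. \<forall>v\<in>K.Vs. card v \<le> B" using X(2) star_vertex by simp
  qed (simp_all add: image_image f(3) h(3) fh)
  have M: "rot5.M K.Vs K.dst ((`) f) \<noteq> {}" if r: "rot5 K.Vs K.dst ((`) f)" and e: "\<exists>\<sigma>\<in>X. f ` \<sigma> = \<sigma>" for f :: "'a \<Rightarrow> 'a"
  proof -
    obtain \<sigma> where s: "\<sigma> \<in> X" "f ` \<sigma> = \<sigma>" using e by blast
    then have V: "\<sigma> \<in> K.Vs" using star_vertex by simp
    then have "K.A \<sigma> (f ` \<sigma>)" unfolding s(2) K.A_refl .
    then have "\<sigma> \<in> rot5.M K.Vs K.dst ((`) f)" using V unfolding rot5.M_def[OF r] by blast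
    then show ?thesis by blast
  qed
  have "R.X.M \<noteq> {}" using M[OF R.X.rot5_axioms invariant_simplex[OF X(1) f]] .
  moreover have "R.Y.M \<noteq> {}" using M[OF R.Y.rot5_axioms invariant_simplex[OF X(1) h]] .
  ultimately have "\<exists>v\<in>K.Vs. f ` v = v \<and> h ` v = v" using R.fixed_vertex by blast
  then show ?thesis using star_vertex by auto
qed

end

section \<open>Loops of the realization\<close>

lemma closed_simplex_iff:
  assumes "simplicial_complex X" "\<sigma> \<in> X"
  shows "x \<in> closed_simplex X \<sigma> \<longleftrightarrow> (\<forall>v. v \<notin> \<sigma> \<longrightarrow> x v = 0) \<and> (\<forall>v. 0 \<le> x v) \<and> sum x \<sigma> = 1"
proof -
  have fin: "finite \<sigma>" using assms unfolding simplicial_complex_def by blast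
  have "sum x (support x) = sum x \<sigma>" if "support x \<subseteq> \<sigma>"
    using fin that by (intro sum.mono_neutral_left) (auto simp: support_def)
  moreover have "support x \<in> X" if "support x \<subseteq> \<sigma>" "sum x \<sigma> = 1"
  proof -
    have "support x \<noteq> {}"
    proof
      assume "support x = {}"
      then have "sum x \<sigma> = 0" by (intro sum.neutral) (auto simp: support_def)
      then show False using that by simp
    qed
    then show ?thesis using assms that unfolding simplicial_complex_def by blast
  qed
  moreover have "support x \<subseteq> \<sigma> \<longleftrightarrow> (\<forall>v. v \<notin> \<sigma> \<longrightarrow> x v = 0)" by (auto simp: support_def)
  ultimately show ?thesis unfolding closed_simplex_def realization_points_def by auto
qed

lemma closed_closed_simplex:
  assumes "simplicial_complex X" "\<sigma> \<in> X"
  shows "closed (closed_simplex X \<sigma>)"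
proof -
  have eq: "closed_simplex X \<sigma> = (\<Inter>v\<in>-\<sigma>. {x. x v = 0}) \<inter> (\<Inter>v. {x. 0 \<le> x v}) \<inter> {x. sum x \<sigma> = 1}"
    using closed_simplex_iff[OF assms] by auto
  have c: "continuous_on UNIV (\<lambda>x :: 'a \<Rightarrow> real. x v)" for v by (rule continuous_on_product_coordinates)
  show ?thesis unfolding eq
    by (intro closed_Int closed_INT ballI closed_Collect_eq closed_Collect_le continuous_on_sum c continuous_on_const)
qed

lemma closedin_realization:
  assumes "C \<subseteq> realization_points X" "\<And>\<sigma>. \<sigma> \<in> X \<Longrightarrow> closed (C \<inter> closed_simplex X \<sigma>)"
  shows "closedin (realization X) C"
  unfolding closedin_def topspace_realization
proof (intro conjI)
  show "openin (realization X) (realization_points X - C)"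
    unfolding openin_realization
  proof (intro conjI ballI)
    fix \<sigma> assume "\<sigma> \<in> X"
    have "closed_simplex X \<sigma> - C \<inter> closed_simplex X \<sigma> = (realization_points X - C) \<inter> closed_simplex X \<sigma>"
      unfolding closed_simplex_def by blast
    moreover have "closedin (top_of_set (closed_simplex X \<sigma>)) (C \<inter> closed_simplex X \<sigma>)"
      using assms(2)[OF \<open>\<sigma> \<in> X\<close>] by (simp add: closed_subset)
    ultimately show "openin (top_of_set (closed_simplex X \<sigma>)) ((realization_points X - C) \<inter> closed_simplex X \<sigma>)"
      by (metis openin_diff openin_subtopology_self topspace_euclidean_subtopology)
  qed blast
qed (rule assms)

lemma closedin_realizationD:
  assumes "simplicial_complex X" "closedin (realization X) C" "\<sigma> \<in> X"
  shows "closed (C \<inter> closed_simplex X \<sigma>)"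
proof -
  have "openin (top_of_set (closed_simplex X \<sigma>)) ((realization_points X - C) \<inter> closed_simplex X \<sigma>)"
    using assms(2,3) unfolding closedin_def topspace_realization openin_realization by blast
  then have "closedin (top_of_set (closed_simplex X \<sigma>)) (closed_simplex X \<sigma> - (realization_points X - C) \<inter> closed_simplex X \<sigma>)"
    by (metis closedin_diff closedin_topspace topspace_euclidean_subtopology)
  moreover have "closed_simplex X \<sigma> - (realization_points X - C) \<inter> closed_simplex X \<sigma> = C \<inter> closed_simplex X \<sigma>"
    unfolding closed_simplex_def by blast
  ultimately show ?thesis
    using closedin_closed_trans closed_closed_simplex[OF assms(1,3)] by metis
qed

text \<open>The preimage of a closed set is a finite union over \<open>F\<close>, and on each closed
  simplex the weak topology agrees with the product topology.\<close>

lemma continuous_map_realization: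
  assumes sc: "simplicial_complex X" and f: "continuous_on S f" "finite F" "F \<subseteq> X"
    "\<And>s. s \<in> S \<Longrightarrow> \<exists>\<sigma>\<in>F. f s \<in> closed_simplex X \<sigma>"
  shows "continuous_map (top_of_set S) (realization X) f"
  unfolding continuous_map_closedin
proof (intro conjI allI impI)
  show "f \<in> topspace (top_of_set S) \<rightarrow> topspace (realization X)"
    using f(4) unfolding closed_simplex_def by fastforce
  fix C assume C: "closedin (realization X) C"
  have "{s \<in> topspace (top_of_set S). f s \<in> C} = (\<Union>\<sigma>\<in>F. S \<inter> f -` (C \<inter> closed_simplex X \<sigma>))"
    using f(4) by auto
  moreover have "closedin (top_of_set S) (S \<inter> f -` (C \<inter> closed_simplex X \<sigma>))" if "\<sigma> \<in> F" for \<sigma>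
    using continuous_closedin_preimage[OF f(1)] closedin_realizationD[OF sc C] f(3) that by blast
  ultimately show "closedin (top_of_set S) {s \<in> topspace (top_of_set S). f s \<in> C}"
    using f(2) by (metis (no_types, lifting) closedin_Union finite_imageI imageE)
qed

definition open_star :: "'a set set \<Rightarrow> 'a \<Rightarrow> ('a \<Rightarrow> real) set" where
  "open_star X c = {x \<in> realization_points X. c \<in> support x}"

lemma open_star:
  assumes "simplicial_complex X"
  shows "openin (realization X) (open_star X c)"
proof -
  have "closedin (realization X) {x \<in> realization_points X. x c = 0}"
  proof (rule closedin_realization)
    fix \<sigma> assume \<sigma>: "\<sigma> \<in> X"
    have "{x \<in> realization_points X. x c = 0} \<inter> closed_simplex X \<sigma> = closed_simplex X \<sigma> \<inter> {x. x c = 0}"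
      unfolding closed_simplex_def by blast
    moreover have "closed {x :: 'a \<Rightarrow> real. x c = 0}"
      by (intro closed_Collect_eq continuous_on_product_coordinates continuous_on_const)
    ultimately show "closed ({x \<in> realization_points X. x c = 0} \<inter> closed_simplex X \<sigma>)"
      using closed_closed_simplex[OF assms \<sigma>] by (simp add: closed_Int)
  qed blast
  moreover have "realization_points X - {x \<in> realization_points X. x c = 0} = open_star X c"
    unfolding open_star_def support_def by blast
  ultimately show ?thesis unfolding closedin_def topspace_realization by metis
qed

text \<open>The edge path through the vertices \<open>v 0, \<dots>, v n\<close>, passing \<open>v i\<close> at time \<open>i\<close>.\<close>

definition tent :: "(nat \<Rightarrow> 'a) \<Rightarrow> nat \<Rightarrow> real \<Rightarrow> 'a \<Rightarrow> real" where
  "tent v n s u = (\<Sum>i\<in>{i. i \<le> n \<and> v i = u}. max 0 (1 - \<bar>s - real i\<bar>))"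

lemma continuous_on_tent: "continuous_on UNIV (tent v n)"
proof (rule continuous_on_coordinatewise_then_product)
  fix u
  show "continuous_on UNIV (\<lambda>s. tent v n s u)"
    unfolding tent_def by (intro continuous_on_sum continuous_intros)
qed

lemma tent_support:
  assumes "u \<in> support (tent v n s)"
  shows "\<exists>i\<le>n. v i = u \<and> \<bar>s - real i\<bar> < 1"
proof (rule ccontr)
  assume neg: "\<not> ?thesis"
  have "tent v n s u = 0"
    unfolding tent_def by (rule sum.neutral) (use neg in \<open>auto simp: max_def\<close>)
  then show False using assms by (simp add: support_def)
qed

text \<open>Between \<open>m\<close> and \<open>m + 1\<close> only two hat functions can be nonzero,
  and these two add up to one.\<close>

lemma tent_simplex:
  assumes sc: "simplicial_complex X" and m: "m < n" "real m \<le> s" "s \<le> real (Suc m)" and e: "{v m, v (Suc m)} \<in> X"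
  shows "tent v n s \<in> closed_simplex X {v m, v (Suc m)}"
proof -
  have near: "i = m \<or> i = Suc m" if "\<bar>s - real i\<bar> < 1" for i
    using that m by linarith
  have z: "tent v n s u = 0" if "u \<notin> {v m, v (Suc m)}" for u
    using tent_support[of u v n s] near that by (auto simp: support_def)
  have nn: "0 \<le> tent v n s u" for u unfolding tent_def by (rule sum_nonneg) simp
  let ?f = "\<lambda>i. max 0 (1 - \<bar>s - real i\<bar>)"
  have "sum (tent v n s) {v m, v (Suc m)} = (\<Sum>u\<in>v ` {..n}. tent v n s u)"
    by (rule sum.mono_neutral_left) (use m z in auto)
  also have "\<dots> = (\<Sum>i\<le>n. ?f i)"
    unfolding tent_def using sum.image_gen[of "{..n}" ?f v] by simp
  also have "\<dots> = (\<Sum>i\<in>{m, Suc m}. ?f i)"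
  proof (rule sum.mono_neutral_right)
    show "\<forall>i\<in>{..n} - {m, Suc m}. ?f i = 0"
    proof
      fix i assume "i \<in> {..n} - {m, Suc m}"
      then have "\<not> \<bar>s - real i\<bar> < 1" using near by blast
      then show "?f i = 0" by simp
    qed
  qed (use m in auto)
  also have "\<dots> = 1" using m by (simp add: max_def)
  finally show ?thesis using z nn closed_simplex_iff[OF sc e] by blast
qed

text \<open>Downward induction on the row: the lifts of adjacent rows are adjacent, so one closes up if the other does.\<close>

lemma grid_lift:
  assumes cov: "covering X Y H p" and sc: "simplicial_complex X"
    and quad: "\<And>i j. i < k \<Longrightarrow> j < k \<Longrightarrow> {c i j, c i (Suc j), c (Suc i) j, c (Suc i) (Suc j)} \<in> X"
    and per: "\<And>i. i \<le> k \<Longrightarrow> c i k = c i 0"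
    and last: "\<And>j. j < k \<Longrightarrow> {c k 0, c k j, c k (Suc j)} \<in> X"
    and l: "i \<le> k" "l 0 \<in> Y" "\<And>j. j \<le> k \<Longrightarrow> p (l j) = c i j" "\<And>j. j < k \<Longrightarrow> near Y H (l j) (l (Suc j))"
  shows "l k = l 0"
  using l
proof (induction i arbitrary: l rule: inc_induct)
  case base
  note R = near_unique[OF cov] near_sym[OF cov] near_triangle[OF cov]
  have "near Y H (l 0) (l j)" if "j \<le> k" for j
    using that
  proof (induction j)
    case 0 then show ?case using base unfolding near_def by simp
  next
    case (Suc j)
    have "near Y H (l j) (l 0)" using R(2) Suc by simp
    moreover have "near Y H (l j) (l (Suc j))" using base(3) Suc.prems by simp
    moreover have "{p (l j), p (l 0), p (l (Suc j))} \<in> X"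
      using last[of j] base(2)[of j] base(2)[of 0] base(2)[of "Suc j"] Suc.prems by (simp add: insert_commute)
    ultimately show ?case by (rule R(3))
  qed
  from this[of k] this[of 0] show ?case using R(1) base(2)[of k] base(2)[of 0] per[of k] by simp
next
  case (step i)
  note R = near_unique[OF cov] near_sym[OF cov] near_triangle[OF cov]
  have face: "T \<in> X" if "S \<in> X" "T \<subseteq> S" "T \<noteq> {}" for S T
    using sc that unfolding simplicial_complex_def by blast
  have lY: "l j \<in> Y" if "j \<le> k" for j
    using that step.prems(1) step.prems(3)[of "j - 1"] unfolding near_def by (cases j) auto
  have "\<exists>z. near Y H (l j) z \<and> p z = c (Suc i) j" if j: "j \<le> k" for j
  proof -
    have "{c i j, c (Suc i) j} \<in> X"
    proof (cases "j = k")
      case True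
      then show ?thesis
        using quad[of i 0] face per[of i] per[of "Suc i"] step.hyps by (cases "k = 0") (auto elim!: face)
    next
      case False
      then show ?thesis using face[OF quad[of i j]] j step.hyps by auto
    qed
    then show ?thesis using near_ex[OF cov lY[OF j]] step.prems(2)[OF j] by simp
  qed
  then obtain l' where l': "\<And>j. j \<le> k \<Longrightarrow> near Y H (l j) (l' j) \<and> p (l' j) = c (Suc i) j" by metis
  have "l' k = l' 0"
  proof (rule step.IH)
    show "l' 0 \<in> Y" using l'[of 0] unfolding near_def by simp
    show "p (l' j) = c (Suc i) j" if "j \<le> k" for j using l' that by blast
    fix j assume j: "j < k"
    note q = quad[OF _ j, of i] and pl = step.prems(2)[of j] step.prems(2)[of "Suc j"]
    have tri: "{c i j, c i (Suc j), c (Suc i) (Suc j)} \<in> X" "{c i j, c (Suc i) j, c (Suc i) (Suc j)} \<in> X"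
      "{c i j, c (Suc i) (Suc j)} \<in> X"
      using q step.hyps by (auto elim!: face)
    obtain e where e: "near Y H (l j) e" "p e = c (Suc i) (Suc j)"
      using near_ex[OF cov lY[of j], of "c (Suc i) (Suc j)"] tri(3) pl j by auto
    have "near Y H (l (Suc j)) e"
      using R(3)[OF step.prems(3)[OF j] e(1)] tri(1) pl e(2) j by simp
    then have "e = l' (Suc j)" using R(1) l'[of "Suc j"] e(2) j by auto
    moreover have "near Y H (l' j) e"
      using R(3)[of "l j" "l' j" e] l'[of j] e tri(2) pl j by simp
    ultimately show "near Y H (l' j) (l' (Suc j))" by simp
  qed
  then have "near Y H (l' 0) (l k)" "near Y H (l' 0) (l 0)" using R(2) l'[of k] l'[of 0] by auto
  then show ?case using R(1) step.prems(2)[of k] step.prems(2)[of 0] per[of i] step.hyps by simp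
qed

text \<open>Simplicial approximation of a null homotopy: the points of a fine grid are labelled by
  vertices whose open stars contain the image of a small ball, and the labels are lifted row by
  row.\<close>

theorem simply_connected_loops_lift:
  assumes sc: "simplicial_complex X" and simply: "simply_connected_space (realization X)"
  shows "loops_lift X TYPE('b)"
  unfolding loops_lift_def
proof (intro allI impI; elim conjE)
  fix Y :: "'b set" and H p n and y :: "nat \<Rightarrow> 'b"
  assume cov: "covering X Y H p" and y0: "y 0 \<in> Y" and step: "\<forall>i<n. H (y i) (y (Suc i))" and closed: "p (y n) = p (y 0)"
  note cD = coveringD[OF cov]
  show "y n = y 0"
  proof (cases "n = 0")
    case n0: False
    define v where "v i = p (y i)" for i
    have vE: "{v i, v (Suc i)} \<in> X" "v i \<noteq> v (Suc i)" if "i < n" for i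
      using cD(5,6)[of "y i" "y (Suc i)"] step that unfolding v_def by blast+
    define \<gamma> where "\<gamma> s = tent v n (real n * s)" for s
    have in_edge: "\<exists>m<n. real m \<le> real n * s \<and> real n * s \<le> real (Suc m)" if s: "s \<in> {0..1}" for s
    proof (cases "s = 1")
      case True
      then show ?thesis using n0 by (intro exI[of _ "n - 1"]) auto
    next
      case False
      then have s1: "real n * s < real n" using s n0 by simp
      have "0 \<le> real n * s" using s by simp
      then have "real (nat \<lfloor>real n * s\<rfloor>) \<le> real n * s" "real n * s < real (nat \<lfloor>real n * s\<rfloor>) + 1" by linarith+
      then obtain m where m: "real m \<le> real n * s" "real n * s < real m + 1" by blast
      then have "m < n" using s1 by linarith
      then show ?thesis using m by (intro exI[of _ m]) simp
    qed
    have \<gamma>c: "continuous_map (top_of_set {0..1}) (realization X) \<gamma>"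
    proof (rule continuous_map_realization[OF sc, of _ _ "(\<lambda>m. {v m, v (Suc m)}) ` {..<n}"])
      have "continuous_on {0..1} (tent v n \<circ> (\<lambda>s. real n * s))"
        by (intro continuous_on_compose continuous_intros continuous_on_subset[OF continuous_on_tent]) auto
      then show "continuous_on {0..1} \<gamma>" by (simp add: \<gamma>_def[abs_def] comp_def)
      show "\<exists>\<sigma>\<in>(\<lambda>m. {v m, v (Suc m)}) ` {..<n}. \<gamma> s \<in> closed_simplex X \<sigma>" if "s \<in> {0..1}" for s
        using in_edge[OF that] tent_simplex[OF sc] vE(1) unfolding \<gamma>_def by blast
    qed (use vE in auto)
    have end_support: "u = v 0" if "u \<in> support (\<gamma> s)" "s = 0 \<or> s = 1" for u s
    proof -
      have "u \<in> support (tent v n (real n * s))" using that(1) unfolding \<gamma>_def .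
      from tent_support[OF this] obtain i where i: "i \<le> n" "v i = u" "\<bar>real n * s - real i\<bar> < 1" by blast
      then have "i = 0 \<or> i = n" using that(2) by auto
      then show ?thesis using i closed unfolding v_def by auto
    qed
    have \<gamma>01: "\<gamma> 1 = \<gamma> 0"
    proof -
      have single: "\<gamma> s = (\<lambda>u. if u = v 0 then 1 else 0)" if "s = 0 \<or> s = 1" for s
      proof -
        have s: "s \<in> {0..1}" using that by auto
        have "\<gamma> s \<in> realization_points X" using continuous_map_image_subset_topspace[OF \<gamma>c] s by auto
        then have "sum (\<gamma> s) (support (\<gamma> s)) = 1" "support (\<gamma> s) \<in> X" unfolding realization_points_def by auto
        moreover have "support (\<gamma> s) \<subseteq> {v 0}" using end_support that by blast
        moreover have "support (\<gamma> s) \<noteq> {}" using calculation sc unfolding simplicial_complex_def by blast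
        ultimately have "support (\<gamma> s) = {v 0}" "\<gamma> s (v 0) = 1" by (auto simp: subset_singleton_iff)
        moreover from this have "\<gamma> s u = 0" if "u \<noteq> v 0" for u using that unfolding support_def by blast
        ultimately show ?thesis by (intro ext) simp
      qed
      show ?thesis using single[of 0] single[of 1] by simp
    qed
    have pc: "pathin (realization X) (\<lambda>_. \<gamma> 0)"
    proof -
      have "(0 :: real) \<in> {0..1}" by simp
      then have "\<gamma> 0 \<in> realization_points X" using continuous_map_image_subset_topspace[OF \<gamma>c] by force
      then show ?thesis unfolding pathin_def by simp
    qed
    have "homotopic_with (\<lambda>r. r 1 = r 0) (top_of_set {0..1}) (realization X) \<gamma> (\<lambda>_. \<gamma> 0)"
      using simply[unfolded simply_connected_space_def, rule_format, of \<gamma> "\<lambda>_. \<gamma> 0"] \<gamma>c \<gamma>01 pc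
      unfolding pathin_def by blast
    then obtain h :: "real \<times> real \<Rightarrow> 'a \<Rightarrow> real" where h': "continuous_map (prod_topology (top_of_set {0..1}) (top_of_set {0..1})) (realization X) h"
      "\<forall>x. h (0, x) = \<gamma> x" "\<forall>x. h (1, x) = \<gamma> 0" "\<forall>t\<in>{0..1}. h (t, 1) = h (t, 0)"
      unfolding homotopic_with_def by blast
    note h = h'(1) h'(2)[rule_format] h'(3)[rule_format] h'(4)[rule_format]
    define Sq :: "(real \<times> real) set" where "Sq = {0..1} \<times> {0..1}"
    have hc: "continuous_map (top_of_set Sq) (realization X) h"
      using h(1) unfolding Sq_def by simp
    have hpt: "h z \<in> realization_points X" if "z \<in> Sq" for z
      using continuous_map_image_subset_topspace[OF hc] that by auto
    define G where "G = {U. open U \<and> (\<exists>c. \<forall>z\<in>U \<inter> Sq. h z \<in> open_star X c)}"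
    have "Sq \<subseteq> \<Union>G"
    proof
      fix z assume z: "z \<in> Sq"
      have "support (h z) \<in> X" using hpt[OF z] unfolding realization_points_def by simp
      then obtain c where "c \<in> support (h z)" using sc unfolding simplicial_complex_def by blast
      then have c: "h z \<in> open_star X c" using hpt[OF z] unfolding open_star_def by simp
      have "openin (top_of_set Sq) {z \<in> topspace (top_of_set Sq). h z \<in> open_star X c}"
        using openin_continuous_map_preimage[OF hc open_star[OF sc]] .
      then obtain U where U: "open U" "{z \<in> Sq. h z \<in> open_star X c} = Sq \<inter> U" by (auto simp: openin_open)
      then have "U \<in> G" unfolding G_def by auto
      then show "z \<in> \<Union>G" using U z c by auto
    qed
    moreover have "compact Sq" unfolding Sq_def by (intro compact_Times) auto
    moreover have "\<And>U. U \<in> G \<Longrightarrow> open U" unfolding G_def by blast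
    ultimately obtain e where e: "0 < e" "\<forall>z\<in>Sq. \<exists>U\<in>G. ball z e \<subseteq> U" using Heine_Borel_lemma[of Sq G] by metis
    then have star: "\<exists>c. \<forall>z'\<in>ball z e \<inter> Sq. h z' \<in> open_star X c" if "z \<in> Sq" for z
      using that unfolding G_def by blast
    obtain q :: nat where q: "2 / e < real q" "q \<noteq> 0" using reals_Archimedean2[of "2 / e"] e(1)
      by (metis divide_pos_pos of_nat_0 order_less_asym zero_less_numeral)
    \<comment> \<open>A multiple of \<open>n\<close>, so that the times at which the edge path
      passes its vertices are grid points.\<close>
    define k where "k = n * q"
    have k: "0 < k" "2 / e < real k"
    proof -
      show "0 < k" using n0 q by (simp add: k_def)
      have "q \<le> k" using n0 by (simp add: k_def)
      then have "real q \<le> real k" by simp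
      then show "2 / e < real k" using q(1) by simp
    qed
    define P :: "nat \<Rightarrow> nat \<Rightarrow> real \<times> real" where "P i j = (real i / real k, real j / real k)" for i j
    have PS: "P i j \<in> Sq" if "i \<le> k" "j \<le> k" for i j using that k(1) unfolding P_def Sq_def by simp
    have Pd: "P i' j' \<in> ball (P i j) e" if "i' \<in> {i, Suc i} \<or> i \<in> {i', Suc i'}" "j' \<in> {j, Suc j} \<or> j \<in> {j', Suc j'}" for i j i' j'
    proof -
      have "\<bar>real i - real i'\<bar> \<le> 1" "\<bar>real j - real j'\<bar> \<le> 1" using that by auto
      then have a: "\<bar>real i / real k - real i' / real k\<bar> \<le> 1 / real k" "\<bar>real j / real k - real j' / real k\<bar> \<le> 1 / real k"
        using k(1) by (simp_all add: divide_right_mono flip: diff_divide_distrib)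
      have "dist (P i j) (P i' j') \<le> \<bar>real i / real k - real i' / real k\<bar> + \<bar>real j / real k - real j' / real k\<bar>"
        unfolding P_def dist_Pair_Pair dist_real_def power2_abs by (rule sqrt_sum_squares_le_sum_abs)
      also have "\<dots> \<le> 2 / real k" using a by simp
      also have "\<dots> < e" using k e(1) by (simp add: field_simps)
      finally show ?thesis by simp
    qed
    have "\<exists>c. \<forall>z'\<in>ball (P i j) e \<inter> Sq. h z' \<in> open_star X c" if "i \<le> k" "j \<le> k" for i j using star[OF PS[OF that]] .
    then obtain c0 where c0: "\<And>i j. i \<le> k \<Longrightarrow> j \<le> k \<Longrightarrow> \<forall>z'\<in>ball (P i j) e \<inter> Sq. h z' \<in> open_star X (c0 i j)" by metis
    \<comment> \<open>The last column repeats the labels of the first, which closes the rows. In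
      exchange such a label is only controlled at grid points of the last column.\<close>
    define c where "c i j = c0 i (if j = k then 0 else j)" for i j
    have hk: "h (P i k) = h (P i 0)" if "i \<le> k" for i
      using h(4)[of "real i / real k"] that k(1) unfolding P_def by simp
    have csup: "c i j \<in> support (h (P i' j'))"
      if b: "i \<le> k" "j \<le> k" "i' \<le> k" "j' \<le> k" and near: "i' \<in> {i, Suc i} \<or> i \<in> {i', Suc i'}" "j' = j \<or> j' = Suc j \<and> j < k" for i j i' j'
    proof (cases "j = k")
      case True
      then have "j' = k" using near by simp
      have "h (P i' 0) \<in> open_star X (c0 i 0)" using c0[of i 0] Pd[of i' i 0 0] PS[of i' 0] b near by auto
      then show ?thesis using hk[OF b(3)] True \<open>j' = k\<close> unfolding c_def open_star_def by simp
    next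
      case False
      have "h (P i' j') \<in> open_star X (c0 i j)" using c0[of i j] Pd[of i' i j' j] PS[of i' j'] b near by auto
      then show ?thesis using False unfolding c_def open_star_def by simp
    qed
    have face: "T \<in> X" if "S \<in> X" "T \<subseteq> S" "T \<noteq> {}" for S T
      using sc that unfolding simplicial_complex_def by blast
    have supX: "support (h (P i j)) \<in> X" if "i \<le> k" "j \<le> k" for i j
      using hpt[OF PS[OF that]] unfolding realization_points_def by simp
    \<comment> \<open>All four labels lie in the support at the grid point
      \<open>P i (Suc j)\<close>; the right-hand column is taken so that the case
      \<open>Suc j = k\<close> is included.\<close>
    have quad: "{c i j, c i (Suc j), c (Suc i) j, c (Suc i) (Suc j)} \<in> X" if ij: "i < k" "j < k" for i j
    proof (rule face[OF supX[of i "Suc j"]])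
      show "{c i j, c i (Suc j), c (Suc i) j, c (Suc i) (Suc j)} \<subseteq> support (h (P i (Suc j)))"
        using csup[of i j i "Suc j"] csup[of i "Suc j" i "Suc j"] csup[of "Suc i" j i "Suc j"]
          csup[of "Suc i" "Suc j" i "Suc j"] ij by auto
    qed (use ij in auto)
    have per: "c i k = c i 0" for i using k(1) unfolding c_def by simp
    have last: "{c k 0, c k j, c k (Suc j)} \<in> X" if j: "j < k" for j
    proof (rule face[OF supX[of k 0]])
      have "h (P k j) = \<gamma> 0" for j using h(3) k(1) unfolding P_def by simp
      then show "{c k 0, c k j, c k (Suc j)} \<subseteq> support (h (P k 0))"
        using csup[of k 0 k 0] csup[of k j k j] csup[of k "Suc j" k "Suc j"] j by auto
    qed (use j in auto)
    text \<open>The bottom row of the grid follows the given path.\<close>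
    have row0: "c 0 j \<in> support (tent v n (real j / real q))" if "j \<le> k" for j
    proof -
      have "c 0 j \<in> support (\<gamma> (real j / real k))" using csup[of 0 j 0 j] that h(2) unfolding P_def by simp
      moreover have "real n * (real j / real k) = real j / real q" using n0 q by (simp add: k_def)
      ultimately show ?thesis unfolding \<gamma>_def by simp
    qed
    have bot: "\<exists>m\<le>n. v m = c 0 j \<and> \<bar>real j / real q - real m\<bar> < 1" if "j \<le> k" for j
      using tent_support[OF row0[OF that]] by blast
    then obtain m where m: "\<And>j. j \<le> k \<Longrightarrow> m j \<le> n \<and> v (m j) = c 0 j \<and> \<bar>real j / real q - real (m j)\<bar> < 1" by metis
    have yY: "y i \<in> Y" if "i \<le> n" for i
      using that y0 step cD(3)[of "y (i - 1)" "y i"] by (cases i) auto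
    \<comment> \<open>At the grid point of time \<open>i\<close> the only admissible vertex of the
      path is its \<open>i\<close>-th one.\<close>
    have exact: "m (i * q) = i" if "i \<le> n" for i
    proof -
      have "i * q \<le> k" using that by (simp add: k_def)
      then have "\<bar>real i - real (m (i * q))\<bar> < 1" using m[of "i * q"] q(2) by simp
      then show ?thesis by linarith
    qed
    have "y (m k) = y (m 0)"
    proof (rule grid_lift[where c = c and k = k and i = 0 and l = "\<lambda>j. y (m j)", OF cov sc])
      show "c i k = c i 0" for i by (rule per)
      show "y (m 0) \<in> Y" using yY m by simp
      show "p (y (m j)) = c 0 j" if "j \<le> k" for j using m[OF that] unfolding v_def by simp
      fix j assume j: "j < k"
      let ?s = "real j / real q" and ?s' = "real (Suc j) / real q"
      have d: "?s' = ?s + 1 / real q" "1 / real q \<le> 1" using q(2) by (simp_all add: add_divide_distrib)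
      have mj: "m j \<le> n" "\<bar>?s - real (m j)\<bar> < 1" "m (Suc j) \<le> n" "\<bar>?s' - real (m (Suc j))\<bar> < 1" using m[of j] m[of "Suc j"] j by auto
      define a where "a = j div q"
      have a: "real a \<le> ?s" "?s' \<le> real a + 1"
      proof -
        have "a * q \<le> j" "Suc j \<le> (a + 1) * q" unfolding a_def using q(2) by (auto simp: div_times_less_eq_dividend dividend_less_div_times Suc_le_eq)
        then have "real (a * q) \<le> real j" "real (Suc j) \<le> real ((a + 1) * q)" by (simp_all only: of_nat_le_iff)
        then show "real a \<le> ?s" "?s' \<le> real a + 1" using q(2) by (simp_all add: field_simps)
      qed
      have near: "i \<in> {a, Suc a}" if "real a \<le> s" "s \<le> real a + 1" "\<bar>s - real i\<bar> < 1" for s i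
      proof -
        have "real i < real (a + 2)" "real a < real (i + 1)" using that by auto
        then have "i < a + 2" "a < i + 1" by (simp_all only: of_nat_less_iff)
        then show ?thesis by auto
      qed
      have "?s \<le> ?s'" by (rule divide_right_mono) auto
      then have "m j \<in> {a, Suc a}" "m (Suc j) \<in> {a, Suc a}"
        using near[OF _ _ mj(2)] near[OF _ _ mj(4)] a by linarith+
      then have "m j = m (Suc j) \<or> m (Suc j) = Suc (m j) \<or> m j = Suc (m (Suc j))" by auto
      then show "near Y H (y (m j)) (y (m (Suc j)))"
        using step yY mj cD(4) unfolding near_def by (metis Suc_le_lessD)
    qed (use quad last in auto)
    then show ?thesis using exact[of n] exact[of 0] by (simp add: k_def)
  qed simp
qed

text \<open>The points supported in one component of the edge graph form a clopen set, because every
  closed simplex is contained in it or disjoint from it.\<close>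

lemma connected_realization_cadj:
  assumes sc: "simplicial_complex X" and conn: "connected_space (realization X)" and ab: "{a} \<in> X" "{b} \<in> X"
  shows "(cadj X)\<^sup>*\<^sup>* a b"
proof -
  define C where "C = {b. (cadj X)\<^sup>*\<^sup>* a b}"
  have face: "\<tau> \<in> X" if "\<sigma> \<in> X" "\<tau> \<subseteq> \<sigma>" "\<tau> \<noteq> {}" for \<sigma> \<tau>
    using sc that unfolding simplicial_complex_def by blast
  have step: "v \<in> C" if "\<sigma> \<in> X" "u \<in> \<sigma>" "v \<in> \<sigma>" "u \<in> C" for \<sigma> u v
  proof (cases "u = v")
    case False
    then have "cadj X u v" using face[OF that(1), of "{u, v}"] that(2,3) unfolding cadj_def by blast
    then show ?thesis using that(4) unfolding C_def by auto
  qed (use that in simp)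
  define U where "U = {x \<in> realization_points X. support x \<subseteq> C}"
  have cs: "closed_simplex X \<sigma> \<inter> U \<in> {{}, closed_simplex X \<sigma>}" "closed_simplex X \<sigma> - U \<in> {{}, closed_simplex X \<sigma>}"
    if \<sigma>: "\<sigma> \<in> X" for \<sigma>
  proof -
    have "closed_simplex X \<sigma> \<subseteq> U \<or> closed_simplex X \<sigma> \<inter> U = {}"
    proof (cases "\<sigma> \<subseteq> C")
      case True
      then show ?thesis unfolding closed_simplex_def U_def by blast
    next
      case False
      then have "\<sigma> \<inter> C = {}" using step[OF \<sigma>] by blast
      moreover have "support x \<noteq> {}" if "x \<in> realization_points X" for x
        using that sc unfolding realization_points_def simplicial_complex_def by blast
      ultimately show ?thesis unfolding closed_simplex_def U_def by blast
    qed
    then show "closed_simplex X \<sigma> \<inter> U \<in> {{}, closed_simplex X \<sigma>}" "closed_simplex X \<sigma> - U \<in> {{}, closed_simplex X \<sigma>}"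
      by blast+
  qed
  have "openin (realization X) U"
    unfolding openin_realization
  proof (intro conjI ballI)
    fix \<sigma> assume "\<sigma> \<in> X"
    then show "openin (top_of_set (closed_simplex X \<sigma>)) (U \<inter> closed_simplex X \<sigma>)"
      using cs(1)[of \<sigma>] by (auto simp: Int_commute)
  qed (auto simp: U_def)
  moreover have "closedin (realization X) U"
    unfolding closedin_def topspace_realization openin_realization
  proof (intro conjI ballI)
    fix \<sigma> assume "\<sigma> \<in> X"
    then consider "closed_simplex X \<sigma> - U = {}" | "closed_simplex X \<sigma> - U = closed_simplex X \<sigma>"
      using cs(2) by blast
    then have "openin (top_of_set (closed_simplex X \<sigma>)) (closed_simplex X \<sigma> - U)"
      by cases (simp_all only: openin_empty openin_subtopology_self)
    moreover have "(realization_points X - U) \<inter> closed_simplex X \<sigma> = closed_simplex X \<sigma> - U"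
      unfolding closed_simplex_def by blast
    ultimately show "openin (top_of_set (closed_simplex X \<sigma>)) ((realization_points X - U) \<inter> closed_simplex X \<sigma>)"
      by simp
  qed (auto simp: U_def)
  ultimately have "U = {} \<or> U = realization_points X"
    using conn unfolding connected_space_clopen_in topspace_realization by blast
  moreover have pt: "(\<lambda>v. if v = c then 1 else 0) \<in> realization_points X" "support (\<lambda>v. if v = c then 1 else (0::real)) = {c}"
    if "{c} \<in> X" for c
    using that unfolding realization_points_def support_def by auto
  then have "(\<lambda>v. if v = a then 1 else 0) \<in> U" using ab(1) unfolding U_def C_def by auto
  ultimately have "(\<lambda>v. if v = b then 1 else 0) \<in> U" using pt(1)[OF ab(2)] by auto
  then show ?thesis using pt(2)[OF ab(2)] unfolding U_def C_def by auto
qed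

section \<open>Barycenters and compact sets\<close>

definition barycenter :: "'a set \<Rightarrow> 'a \<Rightarrow> real" where
  "barycenter \<sigma> v = (if v \<in> \<sigma> then 1 / real (card \<sigma>) else 0)"

lemma barycenter:
  assumes "simplicial_complex X" "\<sigma> \<in> X"
  shows "barycenter \<sigma> \<in> realization_points X" "support (barycenter \<sigma>) = \<sigma>"
proof -
  have fin: "finite \<sigma>" "\<sigma> \<noteq> {}" using assms unfolding simplicial_complex_def by blast+
  then show s: "support (barycenter \<sigma>) = \<sigma>" unfolding support_def barycenter_def by auto
  have "sum (barycenter \<sigma>) \<sigma> = (\<Sum>v\<in>\<sigma>. 1 / real (card \<sigma>))" by (rule sum.cong) (simp_all add: barycenter_def)
  also have "\<dots> = 1" using fin by simp
  finally show "barycenter \<sigma> \<in> realization_points X"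
    unfolding realization_points_def s using assms by (simp add: s barycenter_def)
qed

lemma finite_functions_closed:
  fixes D :: "('a \<Rightarrow> real) set"
  assumes "finite D"
  shows "closed D"
proof -
  have "closed {x}" for x :: "'a \<Rightarrow> real"
  proof -
    have "{x} = (\<Inter>v. {y. y v = x v})" by auto
    moreover have "closed {y. y v = x v}" for v
      by (intro closed_Collect_eq continuous_on_product_coordinates continuous_on_const)
    ultimately show ?thesis using closed_INT[of UNIV "\<lambda>v. {y. y v = x v}"] by simp
  qed
  then have "closed (\<Union>x\<in>D. {x})" using assms by (intro closed_UN) auto
  then show ?thesis by simp
qed

text \<open>Choosing one point in the interior of each of infinitely many simplices gives a closed discrete set.\<close>

lemma finite_compact_supports:
  assumes sc: "simplicial_complex X" and K: "compactin (realization X) K"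
  shows "finite (support ` K)"
proof -
  have KX: "K \<subseteq> realization_points X" using compactin_subset_topspace[OF K] by simp
  obtain D where D: "D \<subseteq> K" "inj_on support D" "support ` D = support ` K" using subset_image_inj[of "support ` K" support K] by auto
  have closed: "closedin (realization X) D'" if D': "D' \<subseteq> D" for D'
  proof (rule closedin_realization)
    fix \<sigma> assume \<sigma>: "\<sigma> \<in> X"
    have "support ` (D' \<inter> closed_simplex X \<sigma>) \<subseteq> Pow \<sigma>" unfolding closed_simplex_def by blast
    moreover have "finite (Pow \<sigma>)" using sc \<sigma> unfolding simplicial_complex_def by simp
    moreover have "inj_on support (D' \<inter> closed_simplex X \<sigma>)" by (rule inj_on_subset[OF D(2)]) (use D' in blast)
    ultimately have "finite (D' \<inter> closed_simplex X \<sigma>)" by (meson finite_imageD finite_subset)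
    then show "closed (D' \<inter> closed_simplex X \<sigma>)" by (rule finite_functions_closed)
  qed (use D' D(1) KX in blast)
  let ?U = "\<lambda>x. realization_points X - (D - {x})"
  have op: "openin (realization X) (?U x)" for x
    using closed[of "D - {x}"] unfolding closedin_def by auto
  have "K \<subseteq> \<Union>(insert (realization_points X - D) (?U ` D))" using KX by auto
  moreover have "openin (realization X) (realization_points X - D)" using closed[of D] unfolding closedin_def by auto
  ultimately obtain F where F: "finite F" "F \<subseteq> insert (realization_points X - D) (?U ` D)" "K \<subseteq> \<Union>F"
    using compactinD[OF K, of "insert (realization_points X - D) (?U ` D)"] op by auto
  have UF: "?U x \<in> F" if x: "x \<in> D" for x
  proof -
    obtain S where "S \<in> F" "x \<in> S" using x D(1) F(3) by blast
    then show ?thesis using F(2) x by auto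
  qed
  have "inj_on ?U D"
    using D(1) KX by (intro inj_onI) blast
  moreover have "finite (?U ` D)" by (rule finite_subset[OF _ F(1)]) (use UF in blast)
  ultimately have "finite D" by (rule finite_imageD[rotated])
  then have "finite (support ` D)" by (rule finite_imageI)
  then show ?thesis unfolding D(3) .
qed

lemma realization_map_support:
  assumes "inj_on f (support x)" "finite (support x)" "\<And>v. 0 \<le> x v"
  shows "support (realization_map f x) = f ` support x"
proof -
  have "realization_map f x w \<noteq> 0 \<longleftrightarrow> w \<in> f ` support x" for w
  proof (cases "w \<in> f ` support x")
    case True
    then obtain v where v: "v \<in> support x" "w = f v" by blast
    have "{v' \<in> support x. f v' = w} = {v}" using assms(1) v by (auto dest: inj_onD)
    then show ?thesis using v True unfolding realization_map_def by (simp add: support_def)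
  next
    case False
    then have "{v' \<in> support x. f v' = w} = {}" by blast
    then have "realization_map f x w = 0" unfolding realization_map_def by (simp only: sum.empty)
    then show ?thesis using False by simp
  qed
  then show ?thesis unfolding support_def[of "realization_map f x"] by auto
qed

lemma realization_map_barycenter:
  assumes "inj_on f \<sigma>" "finite \<sigma>" "\<sigma> \<noteq> {}"
  shows "realization_map f (barycenter \<sigma>) = barycenter (f ` \<sigma>)"
proof
  fix w
  have s: "support (barycenter \<sigma>) = \<sigma>" using assms(2,3) unfolding support_def barycenter_def by auto
  show "realization_map f (barycenter \<sigma>) w = barycenter (f ` \<sigma>) w"
  proof (cases "w \<in> f ` \<sigma>")
    case True
    then obtain v where v: "v \<in> \<sigma>" "w = f v" by blast
    have "{v' \<in> \<sigma>. f v' = w} = {v}" using assms(1) v by (auto dest: inj_onD)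
    then show ?thesis using v True assms(1) unfolding realization_map_def s by (simp add: barycenter_def card_image)
  next
    case False
    then have "{v' \<in> \<sigma>. f v' = w} = {}" by blast
    then have "realization_map f (barycenter \<sigma>) w = 0" unfolding realization_map_def s by (simp only: sum.empty)
    then show ?thesis using False by (simp add: barycenter_def)
  qed
qed

section \<open>Geometric actions\<close>

lemma k_large_link4:
  assumes L: "k_large 6 L" and b: "distinct [b1, b2, b3, b4]"
    and e: "{b1, b2} \<in> L" "{b2, b3} \<in> L" "{b3, b4} \<in> L" "{b4, b1} \<in> L"
  shows "{b1, b3} \<in> L \<or> {b2, b4} \<in> L"
proof -
  let ?vs = "[b1, b2, b3, b4]" and ?C = "{{b1, b2}, {b2, b3}, {b3, b4}, {b4, b1}}"
  have "is_cycle L 4 ?C"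
    unfolding is_cycle_def
  proof (intro conjI exI[of _ ?vs])
    show "?C \<subseteq> edges L" using e b unfolding edges_def by auto
    have eq: "{i :: nat. i < 4} = {0, 1, 2, 3}" by auto
    have m: "Suc 0 mod 4 = (1 :: nat)" "Suc 1 mod 4 = (2 :: nat)" "Suc 2 mod 4 = (3 :: nat)" "Suc 3 mod 4 = (0 :: nat)"
      by simp_all
    have nth: "?vs ! 0 = b1" "?vs ! 1 = b2" "?vs ! 2 = b3" "?vs ! 3 = b4"
      by simp_all
    show "?C = {{?vs ! i, ?vs ! (Suc i mod 4)} | i. i < 4}"
      unfolding setcompr_eq_image eq image_insert image_empty m nth ..
  qed (use b in auto)
  moreover have "(4 :: nat) \<le> 4" "(4 :: nat) < 6" by simp_all
  ultimately obtain d where "is_diagonal L ?C d" using L unfolding k_large_def by blast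
  then have d: "d \<in> L" "card d = 2" "d \<subseteq> {b1, b2, b3, b4}" "d \<notin> ?C" unfolding is_diagonal_def edges_def by auto
  obtain u v where "d = {u, v}" "u \<noteq> v" using d(2) by (auto simp: card_2_iff)
  then have "d = {b1, b3} \<or> d = {b2, b4}" using d(3,4) by (auto simp: insert_commute)
  then show ?thesis using d(1) by blast
qed

lemma k_large_link5:
  assumes L: "k_large 6 L" and b: "distinct [b1, b2, b3, b4, b5]"
    and e: "{b1, b2} \<in> L" "{b2, b3} \<in> L" "{b3, b4} \<in> L" "{b4, b5} \<in> L" "{b5, b1} \<in> L"
  shows "{b1, b3} \<in> L \<or> {b1, b4} \<in> L \<or> {b2, b4} \<in> L \<or> {b2, b5} \<in> L \<or> {b3, b5} \<in> L"
proof -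
  let ?vs = "[b1, b2, b3, b4, b5]" and ?C = "{{b1, b2}, {b2, b3}, {b3, b4}, {b4, b5}, {b5, b1}}"
  have "is_cycle L 5 ?C"
    unfolding is_cycle_def
  proof (intro conjI exI[of _ ?vs])
    show "?C \<subseteq> edges L" using e b unfolding edges_def by auto
    have eq: "{i :: nat. i < 5} = {0, 1, 2, 3, 4}" by auto
    have m: "Suc 0 mod 5 = (1 :: nat)" "Suc 1 mod 5 = (2 :: nat)" "Suc 2 mod 5 = (3 :: nat)" "Suc 3 mod 5 = (4 :: nat)" "Suc 4 mod 5 = (0 :: nat)"
      by simp_all
    have nth: "?vs ! 0 = b1" "?vs ! 1 = b2" "?vs ! 2 = b3" "?vs ! 3 = b4" "?vs ! 4 = b5"
      by simp_all
    show "?C = {{?vs ! i, ?vs ! (Suc i mod 5)} | i. i < 5}"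
      unfolding setcompr_eq_image eq image_insert image_empty m nth ..
  qed (use b in auto)
  moreover have "(4 :: nat) \<le> 5" "(5 :: nat) < 6" by simp_all
  ultimately obtain d where "is_diagonal L ?C d" using L unfolding k_large_def by blast
  then have d: "d \<in> L" "card d = 2" "d \<subseteq> \<Union>?C" "d \<notin> ?C" unfolding is_diagonal_def edges_def by blast+
  obtain u v where uv: "d = {u, v}" "u \<noteq> v" using d(2) unfolding card_2_iff by blast
  then have "u = b1 \<or> u = b2 \<or> u = b3 \<or> u = b4 \<or> u = b5" "v = b1 \<or> v = b2 \<or> v = b3 \<or> v = b4 \<or> v = b5"
    using d(3) by simp_all blast+
  then have "d = {b1, b3} \<or> d = {b1, b4} \<or> d = {b2, b4} \<or> d = {b2, b5} \<or> d = {b3, b5}"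
    using d(4) uv by (elim disjE) (simp_all add: insert_commute)
  then show ?thesis using d(1) by blast
qed

locale geometric_systolic =
  fixes X :: "'a set set" and G :: "('g, 'm) monoid_scheme" and \<phi> :: "'g \<Rightarrow> 'a \<Rightarrow> 'a"
  assumes sys: "systolic_complex X" and geo: "geometric_action G X \<phi>"
begin

lemma sc: "simplicial_complex X" and X_ne: "X \<noteq> {}"
  using sys unfolding systolic_complex_def by auto

lemma face: "\<sigma> \<in> X \<Longrightarrow> \<tau> \<subseteq> \<sigma> \<Longrightarrow> \<tau> \<noteq> {} \<Longrightarrow> \<tau> \<in> X"
  using sc unfolding simplicial_complex_def by blast

lemma finite_simplex: "\<sigma> \<in> X \<Longrightarrow> finite \<sigma> \<and> \<sigma> \<noteq> {}"
  using sc unfolding simplicial_complex_def by blast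

lemma vertices_iff: "a \<in> vertices X \<longleftrightarrow> {a} \<in> X"
  using face unfolding vertices_def by blast

lemma simplex_vertices: "\<sigma> \<in> X \<Longrightarrow> \<sigma> \<subseteq> vertices X"
  unfolding vertices_def by blast

sublocale A: group_action G "vertices X" \<phi>
  using geo unfolding geometric_action_def by blast

lemma act_bij: "g \<in> carrier G \<Longrightarrow> bij_betw (\<phi> g) (vertices X) (vertices X)"
  and act_simplex: "g \<in> carrier G \<Longrightarrow> \<sigma> \<subseteq> vertices X \<Longrightarrow> \<phi> g ` \<sigma> \<in> X \<longleftrightarrow> \<sigma> \<in> X"
  using geo unfolding geometric_action_def simplicial_automorphism_def by blast+

lemma act_inj: "g \<in> carrier G \<Longrightarrow> \<sigma> \<in> X \<Longrightarrow> inj_on (\<phi> g) \<sigma>"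
  using act_bij simplex_vertices unfolding bij_betw_def by (meson inj_on_subset)

text \<open>A compact set has finitely many supports. If its translates cover the realization, the
  barycenter of a simplex exhibits this simplex as a translate of one of them.\<close>

lemma finite_orbits: "\<exists>F. finite F \<and> F \<subseteq> X \<and> (\<forall>\<sigma>\<in>X. \<exists>g\<in>carrier G. \<exists>\<tau>\<in>F. \<sigma> = \<phi> g ` \<tau>)"
proof -
  obtain K where K: "compactin (realization X) K" "(\<Union>g\<in>carrier G. realization_map (\<phi> g) ` K) = realization_points X"
    using geo unfolding geometric_action_def cocompact_def topspace_realization by blast
  have KX: "K \<subseteq> realization_points X" using compactin_subset_topspace[OF K(1)] by simp
  have "\<exists>g\<in>carrier G. \<exists>\<tau>\<in>support ` K. \<sigma> = \<phi> g ` \<tau>" if \<sigma>: "\<sigma> \<in> X" for \<sigma>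
  proof -
    have "barycenter \<sigma> \<in> (\<Union>g\<in>carrier G. realization_map (\<phi> g) ` K)" using barycenter(1)[OF sc \<sigma>] K(2) by simp
    then obtain g x where g: "g \<in> carrier G" "x \<in> K" "barycenter \<sigma> = realization_map (\<phi> g) x" by blast
    then have x: "support x \<in> X" "\<And>v. 0 \<le> x v" using KX unfolding realization_points_def by auto
    have "\<sigma> = \<phi> g ` support x"
      using realization_map_support[of "\<phi> g" x] act_inj[OF g(1) x(1)] finite_simplex[OF x(1)] x(2) g(3) barycenter(2)[OF sc \<sigma>] by simp
    then show ?thesis using g by blast
  qed
  moreover have "support ` K \<subseteq> X" using KX unfolding realization_points_def by blast
  ultimately show ?thesis using finite_compact_supports[OF sc K(1)] by blast
qed

text \<open>Proper discontinuity is applied to the compact set consisting of the two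
  barycenters.\<close>

lemma finite_transporter:
  assumes "\<sigma> \<in> X" "\<tau> \<in> X"
  shows "finite {g \<in> carrier G. \<phi> g ` \<sigma> = \<tau>}"
proof -
  let ?K = "{barycenter \<sigma>, barycenter \<tau>}"
  have "compactin (realization X) ?K"
    using barycenter(1)[OF sc] assms by (intro finite_imp_compactin) auto
  then have fin: "finite {g \<in> carrier G. realization_map (\<phi> g) ` ?K \<inter> ?K \<noteq> {}}"
    using geo unfolding geometric_action_def properly_discontinuous_def by blast
  have "realization_map (\<phi> g) (barycenter \<sigma>) = barycenter \<tau>" if "g \<in> carrier G" "\<phi> g ` \<sigma> = \<tau>" for g
    using realization_map_barycenter[OF act_inj[OF that(1) assms(1)]] finite_simplex[OF assms(1)] that(2) by simp
  then have "{g \<in> carrier G. \<phi> g ` \<sigma> = \<tau>} \<subseteq> {g \<in> carrier G. realization_map (\<phi> g) ` ?K \<inter> ?K \<noteq> {}}" by auto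
  then show ?thesis using fin finite_subset by blast
qed

text \<open>Every edge at \<open>a\<close> is the translate of one of finitely many simplices by an
  element that carries some vertex \<open>c\<close> of it to \<open>a\<close>, and there are
  finitely many such elements.\<close>

lemma locally_finite: "finite {b. {a, b} \<in> X}"
proof (cases "{a} \<in> X")
  case True
  obtain F where F: "finite F" "F \<subseteq> X" "\<forall>\<sigma>\<in>X. \<exists>g\<in>carrier G. \<exists>\<tau>\<in>F. \<sigma> = \<phi> g ` \<tau>"
    using finite_orbits by (elim exE conjE)
  let ?B = "\<Union>\<tau>\<in>F. \<Union>c\<in>\<tau>. \<Union>g\<in>{g \<in> carrier G. \<phi> g ` {c} = {a}}. \<phi> g ` \<tau>"
  have "finite ?B"
  proof (intro finite_UN_I F(1))
    fix \<tau> c assume t: "\<tau> \<in> F" "c \<in> \<tau>"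
    then have "\<tau> \<in> X" using F(2) by blast
    then show "finite {g \<in> carrier G. \<phi> g ` {c} = {a}}" using finite_transporter[OF _ True] face[of \<tau> "{c}"] t(2) by blast
  next
    show "finite \<tau>" if "\<tau> \<in> F" for \<tau> using F(2) that finite_simplex by blast
    then show "finite (\<phi> g ` \<tau>)" if "\<tau> \<in> F" for \<tau> g using that by blast
  qed
  moreover have "{b. {a, b} \<in> X} \<subseteq> ?B"
  proof
    fix b assume "b \<in> {b. {a, b} \<in> X}"
    then have "{a, b} \<in> X" by simp
    from bspec[OF F(3) this] obtain g \<tau> where g: "g \<in> carrier G" "\<tau> \<in> F" "{a, b} = \<phi> g ` \<tau>" by (elim bexE)
    then obtain c where c: "c \<in> \<tau>" "a = \<phi> g c" by blast
    then have "g \<in> {g \<in> carrier G. \<phi> g ` {c} = {a}}" "b \<in> \<phi> g ` \<tau>" using g by auto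
    then show "b \<in> ?B" using g(2) c(1) by blast
  qed
  ultimately show ?thesis using finite_subset by blast
next
  case False
  then have "{b. {a, b} \<in> X} = {}" using face by blast
  then show ?thesis by simp
qed

lemma bounded_dimension: "\<exists>B. \<forall>\<sigma>\<in>X. card \<sigma> \<le> B"
proof -
  obtain F where F: "finite F" "F \<subseteq> X" "\<forall>\<sigma>\<in>X. \<exists>g\<in>carrier G. \<exists>\<tau>\<in>F. \<sigma> = \<phi> g ` \<tau>"
    using finite_orbits by (elim exE conjE)
  have "card \<sigma> \<le> Max (card ` F)" if s: "\<sigma> \<in> X" for \<sigma>
  proof -
    obtain g \<tau> where g: "g \<in> carrier G" "\<tau> \<in> F" "\<sigma> = \<phi> g ` \<tau>" using bspec[OF F(3) s] by (elim bexE)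
    then have "card \<sigma> = card \<tau>" using act_inj F(2) by (simp add: card_image subset_iff)
    then show ?thesis using g(2) F(1) by simp
  qed
  then show ?thesis by blast
qed

lemma link_mem: "\<sigma> \<in> link X a \<longleftrightarrow> \<sigma> \<noteq> {} \<and> a \<notin> \<sigma> \<and> insert a \<sigma> \<in> X"
  unfolding link_def by blast

lemma k_large_link: "{a} \<in> X \<Longrightarrow> k_large 6 (link X a)"
  using sys vertices_iff unfolding systolic_complex_def by blast

sublocale large_links_sc X
proof unfold_locales
  show "finite \<sigma> \<and> \<sigma> \<noteq> {}" if "\<sigma> \<in> X" for \<sigma> using finite_simplex[OF that] .
  show "\<tau> \<in> X" if "\<sigma> \<in> X" "\<tau> \<subseteq> \<sigma>" "\<tau> \<noteq> {}" for \<sigma> \<tau> using face[OF that] .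
  show "finite {b. {a, b} \<in> X}" for a by (rule locally_finite)
  show "insert a \<sigma> \<in> X" if \<sigma>: "finite \<sigma>" "\<sigma> \<noteq> {}" "\<And>u v. u \<in> \<sigma> \<Longrightarrow> v \<in> \<sigma> \<Longrightarrow> {a, u, v} \<in> X" for a \<sigma>
  proof -
    obtain u0 where u0: "u0 \<in> \<sigma>" using \<sigma>(2) by blast
    have aX: "{a} \<in> X" using face[OF \<sigma>(3)[OF u0 u0], of "{a}"] by blast
    show ?thesis
    proof (cases "\<sigma> \<subseteq> {a}")
      case True
      then have "insert a \<sigma> = {a}" by blast
      with aX show ?thesis by (simp only:)
    next
      case False
      let ?s = "\<sigma> - {a}"
      have fl: "flag_complex (link X a)" using k_large_link[OF aX] unfolding k_large_def by blast
      have pt: "{u} \<in> link X a" if "u \<in> ?s" for u using \<sigma>(3)[of u u] that by (auto simp: link_mem)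
      have "?s \<subseteq> vertices (link X a)" using pt unfolding vertices_def by blast
      moreover have "{u, v} \<in> edges (link X a)" if "u \<in> ?s" "v \<in> ?s" "u \<noteq> v" for u v
        using \<sigma>(3)[of u v] that by (auto simp: link_mem edges_def)
      ultimately have "?s \<in> link X a" using fl False \<sigma>(1) unfolding flag_complex_def by blast
      then show ?thesis by (simp add: link_mem)
    qed
  qed
  have lk: "{u, v} \<in> link X a \<longleftrightarrow> {a, u, v} \<in> X" if "a \<noteq> u" "a \<noteq> v" for a u v
    using that by (simp add: link_mem)
  show "{a, b1, b3} \<in> X \<or> {a, b2, b4} \<in> X"
    if e: "{a, b1, b2} \<in> X" "{a, b2, b3} \<in> X" "{a, b3, b4} \<in> X" "{a, b4, b1} \<in> X" for a b1 b2 b3 b4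
  proof (cases "distinct [a, b1, b2, b3, b4]")
    case True
    have "{a} \<in> X" using face[OF e(1), of "{a}"] by blast
    then show ?thesis using k_large_link4[OF k_large_link, of a b1 b2 b3 b4] True e lk by auto
  next
    case False
    then show ?thesis
      using e face[OF e(1), of "{a, b1}"] face[OF e(1), of "{a, b2}"] face[OF e(2), of "{a, b3}"] face[OF e(3), of "{a, b4}"]
      by (auto simp: insert_commute)
  qed
  show "{a, b1, b3} \<in> X \<or> {a, b1, b4} \<in> X \<or> {a, b2, b4} \<in> X \<or> {a, b2, b5} \<in> X \<or> {a, b3, b5} \<in> X"
    if e: "{a, b1, b2} \<in> X" "{a, b2, b3} \<in> X" "{a, b3, b4} \<in> X" "{a, b4, b5} \<in> X" "{a, b5, b1} \<in> X" for a b1 b2 b3 b4 b5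
  proof (cases "distinct [a, b1, b2, b3, b4, b5]")
    case True
    have "{a} \<in> X" using face[OF e(1), of "{a}"] by blast
    then show ?thesis using k_large_link5[OF k_large_link, of a b1 b2 b3 b4 b5] True e lk by auto
  next
    case False
    then show ?thesis
      using e face[OF e(1), of "{a, b1}"] face[OF e(1), of "{a, b2}"] face[OF e(2), of "{a, b3}"] face[OF e(3), of "{a, b4}"]
        face[OF e(4), of "{a, b5}"]
      by (auto simp: insert_commute)
  qed
  show "(cadj X)\<^sup>*\<^sup>* a b" if "{a} \<in> X" "{b} \<in> X" for a b
    using connected_realization_cadj[OF sc _ that] sys unfolding systolic_complex_def by blast
  show "loops_lift X TYPE('a cover_vertex)"
    using simply_connected_loops_lift[OF sc] sys unfolding systolic_complex_def by blast
qed

theorem finite_order: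
  assumes a: "\<alpha> \<in> carrier G" "\<beta> \<in> carrier G" and pow: "\<alpha> [^]\<^bsub>G\<^esub> (5 :: nat) = \<one>\<^bsub>G\<^esub>" "\<beta> [^]\<^bsub>G\<^esub> (5 :: nat) = \<one>\<^bsub>G\<^esub>"
    "(\<alpha> \<otimes>\<^bsub>G\<^esub> \<beta>) [^]\<^bsub>G\<^esub> (2 :: nat) = \<one>\<^bsub>G\<^esub>"
  shows "\<not> inj (\<lambda>n :: nat. (\<alpha> \<otimes>\<^bsub>G\<^esub> inv\<^bsub>G\<^esub> \<beta>) [^]\<^bsub>G\<^esub> n)"
proof -
  interpret group G by (rule group_hom.axioms(1)[OF A.group_hom])
  \<comment> \<open>Extended by the identity outside the vertex set, to obtain a bijection of the
    whole type.\<close>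
  define ext where "ext g v = (if v \<in> vertices X then \<phi> g v else v)" for g v
  have ext_comp: "ext g (ext h v) = ext (g \<otimes>\<^bsub>G\<^esub> h) v" if "g \<in> carrier G" "h \<in> carrier G" for g h v
  proof (cases "v \<in> vertices X")
    case True
    then have "\<phi> h v \<in> vertices X" using bij_betwE[OF act_bij[OF that(2)]] by blast
    then show ?thesis using A.composition_rule[OF True that] True by (simp add: ext_def)
  qed (simp add: ext_def)
  have ext_one: "ext \<one>\<^bsub>G\<^esub> v = v" for v
    using fun_cong[OF A.id_eq_one, of v, symmetric] by (cases "v \<in> vertices X") (simp_all add: ext_def)
  have bij: "bij (ext g)" if "g \<in> carrier G" for g
    using ext_comp[OF that, of "inv\<^bsub>G\<^esub> g"] ext_comp[of "inv\<^bsub>G\<^esub> g" g] that ext_one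
    by (intro o_bij[of "ext (inv\<^bsub>G\<^esub> g)"]) (auto simp: fun_eq_iff)
  have ext_eq: "ext g ` \<sigma> = \<phi> g ` \<sigma>" if "\<sigma> \<subseteq> vertices X" for g \<sigma>
    using that unfolding ext_def by (intro image_cong) auto
  have simp: "ext g ` \<sigma> \<in> X \<longleftrightarrow> \<sigma> \<in> X" if g: "g \<in> carrier G" for g \<sigma>
  proof -
    have 1: "ext g ` \<sigma> \<in> X" if "\<sigma> \<in> X" "g \<in> carrier G" for g \<sigma>
      using act_simplex[OF that(2) simplex_vertices[OF that(1)]] ext_eq[OF simplex_vertices[OF that(1)]] that(1) by simp
    have "ext (inv\<^bsub>G\<^esub> g) ` ext g ` \<sigma> = \<sigma>" using ext_comp[of "inv\<^bsub>G\<^esub> g" g] g ext_one by (simp add: image_image)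
    then show ?thesis using 1[of \<sigma> g] 1[of "ext g ` \<sigma>" "inv\<^bsub>G\<^esub> g"] g by auto
  qed
  have five: "ext g (ext g (ext g (ext g (ext g v)))) = v" if "g \<in> carrier G" "g [^]\<^bsub>G\<^esub> (5 :: nat) = \<one>\<^bsub>G\<^esub>" for g v
    using that ext_one[of v] by (simp add: ext_comp numeral_eq_Suc m_assoc)
  have two: "ext \<alpha> (ext \<beta> (ext \<alpha> (ext \<beta> v))) = v" for v
    using pow(3) a ext_one[of v] by (simp add: ext_comp numeral_eq_Suc m_assoc)
  have "loops_lift X TYPE('a set cover_vertex)"
    using simply_connected_loops_lift[OF sc] sys unfolding systolic_complex_def by blast
  then obtain \<sigma> where \<sigma>: "\<sigma> \<in> X" "ext \<alpha> ` \<sigma> = \<sigma>" "ext \<beta> ` \<sigma> = \<sigma>"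
    using common_invariant_simplex[OF X_ne bounded_dimension _ bij[OF a(1)] simp[OF a(1)] five[OF a(1) pow(1)]
      bij[OF a(2)] simp[OF a(2)] five[OF a(2) pow(2)] two] by blast
  let ?w = "\<alpha> \<otimes>\<^bsub>G\<^esub> inv\<^bsub>G\<^esub> \<beta>"
  have "ext (inv\<^bsub>G\<^esub> \<beta>) ` ext \<beta> ` \<sigma> = \<sigma>" using ext_comp[of "inv\<^bsub>G\<^esub> \<beta>" \<beta>] a ext_one by (simp add: image_image)
  then have "ext (inv\<^bsub>G\<^esub> \<beta>) ` \<sigma> = \<sigma>" using \<sigma>(3) by simp
  moreover have img: "ext (g \<otimes>\<^bsub>G\<^esub> h) ` \<sigma> = ext g ` ext h ` \<sigma>" if "g \<in> carrier G" "h \<in> carrier G" for g h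
    using ext_comp[OF that] by (simp add: image_image)
  ultimately have w: "ext ?w ` \<sigma> = \<sigma>" using \<sigma>(2) a by simp
  have "ext (?w [^]\<^bsub>G\<^esub> n) ` \<sigma> = \<sigma>" for n :: nat
  proof (induction n)
    case 0 then show ?case using ext_one by (simp add: image_def)
  next
    case (Suc n) then show ?case using img[of "?w [^]\<^bsub>G\<^esub> n" ?w] w a by simp
  qed
  then have "range (\<lambda>n :: nat. ?w [^]\<^bsub>G\<^esub> n) \<subseteq> {g \<in> carrier G. \<phi> g ` \<sigma> = \<sigma>}"
    using a ext_eq[OF simplex_vertices[OF \<sigma>(1)]] by auto
  then have "finite (range (\<lambda>n :: nat. ?w [^]\<^bsub>G\<^esub> n))" using finite_transporter[OF \<sigma>(1,1)] finite_subset by blast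
  then show ?thesis using finite_imageD by blast
qed

end

section \<open>The triangle groups\<close>

text \<open>The sign of a letter is ignored, as the generators will act by involutions.\<close>

primrec word_eval :: "('x \<Rightarrow> 'b \<Rightarrow> 'b) \<Rightarrow> 'x word \<Rightarrow> 'b \<Rightarrow> 'b" where
  "word_eval f [] v = v"
| "word_eval f (l # w) v = f (fst l) (word_eval f w v)"

lemma word_eval_append: "word_eval f (u @ w) v = word_eval f u (word_eval f w v)"
  by (induction u) simp_all

lemma word_eval_pres_eq:
  assumes "pres_eq R u w" "\<And>x v. f x (f x v) = v" "\<And>w v. w \<in> R \<Longrightarrow> word_eval f w v = v"
  shows "word_eval f u v = word_eval f w v"
  using assms(1) by (induction arbitrary: v) (simp_all add: word_eval_append assms(2,3))

lemma pres_class_power: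
  "pres_class R w [^]\<^bsub>presented_group R\<^esub> (n :: nat) = pres_class R (concat (replicate n w))"
proof (induction n)
  case 0
  then show ?case by (simp add: presented_group_def)
next
  case (Suc n)
  have "concat (replicate n w) @ w = w @ concat (replicate n w)" by (induction n) simp_all
  then show ?case using Suc by (simp add: nat_pow_def presented_group_mult)
qed

lemma inj_pres_class_power:
  assumes "\<And>x v. f x (f x v) = v" "\<And>w v. w \<in> R \<Longrightarrow> word_eval f w v = v"
    and inj: "inj (\<lambda>n. (word_eval f w ^^ n) v)"
  shows "inj (\<lambda>n :: nat. pres_class R w [^]\<^bsub>presented_group R\<^esub> n)"
proof (rule injI)
  have pow: "word_eval f (concat (replicate n w)) v = (word_eval f w ^^ n) v" for n
    by (induction n) (simp_all add: word_eval_append)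
  fix m n :: nat
  assume "pres_class R w [^]\<^bsub>presented_group R\<^esub> m = pres_class R w [^]\<^bsub>presented_group R\<^esub> n"
  then have "pres_eq R (concat (replicate m w)) (concat (replicate n w))"
    unfolding pres_class_power pres_class_eq_iff .
  then have "(word_eval f w ^^ m) v = (word_eval f w ^^ n) v"
    using word_eval_pres_eq[of R _ _ f v] assms(1,2) unfolding pow[symmetric] by blast
  then show "m = n" using inj by (simp add: inj_def)
qed

lemma linear_word_eval: "(\<And>x. linear (f x)) \<Longrightarrow> linear (word_eval f w)"
proof (induction w)
  case Nil
  then show ?case by (simp add: linear_id[unfolded id_def])
next
  case (Cons l w)
  then show ?case using linear_compose[of "word_eval f w" "f (fst l)"] by (simp add: o_def)
qed

text \<open>The values satisfy \<open>a (n + 2) = c * a (n + 1) - a n\<close> with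
  \<open>2 \<le> c\<close>, so as long as they are nonnegative their increments do not
  decrease.\<close>

lemma strict_mono_linear_orbit:
  fixes W :: "'v :: real_vector \<Rightarrow> 'v" and d :: "'v \<Rightarrow> real"
  assumes W: "linear W" and d: "linear d" and rec: "W (W v) = c *\<^sub>R W v - v"
    and c: "2 \<le> c" and pos: "0 \<le> d v" "d v < d (W v)"
  shows "strict_mono (\<lambda>n. d ((W ^^ n) v))"
proof -
  have r: "(W ^^ Suc (Suc n)) v = c *\<^sub>R (W ^^ Suc n) v - (W ^^ n) v" for n
  proof (induction n)
    case 0
    then show ?case using rec by simp
  next
    case (Suc n)
    have "(W ^^ Suc (Suc (Suc n))) v = W ((W ^^ Suc (Suc n)) v)" by simp
    also have "\<dots> = W (c *\<^sub>R (W ^^ Suc n) v - (W ^^ n) v)" by (simp only: Suc)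
    also have "\<dots> = c *\<^sub>R (W ^^ Suc (Suc n)) v - (W ^^ Suc n) v"
      using W by (simp add: linear_diff linear_scale)
    finally show ?case .
  qed
  have "0 \<le> d ((W ^^ n) v) \<and> d ((W ^^ n) v) < d ((W ^^ Suc n) v)" for n
  proof (induction n)
    case 0
    then show ?case using pos by simp
  next
    case (Suc n)
    have "d ((W ^^ Suc (Suc n)) v) = c * d ((W ^^ Suc n) v) - d ((W ^^ n) v)"
      unfolding r using d by (simp add: linear_diff linear_scale)
    moreover have "2 * d ((W ^^ Suc n) v) \<le> c * d ((W ^^ Suc n) v)"
      using Suc c by (intro mult_right_mono) auto
    ultimately show ?case using Suc by linarith
  qed
  then show ?thesis by (simp add: strict_mono_Suc_iff)
qed

definition golden :: real where
  "golden = (1 + sqrt 5) / 2"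

lemma golden_square: "golden * golden = golden + 1"
  unfolding golden_def by (simp add: field_simps)

lemma golden_ge: "1 \<le> golden"
  unfolding golden_def by simp

lemma golden_square': "golden * (golden * x) = golden * x + x"
  using golden_square by (metis distrib_right mult.assoc mult_1)

text \<open>The geometric representation, scaled so that the coefficients lie in \<open>\<int>[golden]\<close>: the two coefficients linking
  a pair of generators have product \<open>4 cos\<^sup>2 (\<pi> / k)\<close>, which is \<open>golden + 1\<close> for \<open>k = 5\<close> and \<open>2\<close> for \<open>k = 4\<close>.\<close>

fun reflection :: "real \<Rightarrow> triangle_gen \<Rightarrow> real \<times> real \<times> real \<Rightarrow> real \<times> real \<times> real" where
  "reflection q gen_r (a, b, c) = ((golden + 1) * c - a, b, c)"
| "reflection q gen_s (a, b, c) = (a, q * c - b, c)"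
| "reflection q gen_t (a, b, c) = (a, b, a + b - c)"

lemma reflection_involution: "reflection q x (reflection q x v) = v"
  by (cases v; cases x) simp_all

lemma linear_reflection: "linear (reflection q x)"
proof (rule linearI)
  show "reflection q x (u + v) = reflection q x u + reflection q x v" for u v
    by (cases u; cases v; cases x) (simp_all add: algebra_simps)
  show "reflection q x (k *\<^sub>R v) = k *\<^sub>R reflection q x v" for k v
    by (cases v; cases x) (simp_all add: algebra_simps)
qed

lemma reflection_relators:
  assumes "j = 4 \<and> q = 2 \<or> j = 5 \<and> q = golden + 1" "w \<in> triangle_relators 2 j 5"
  shows "word_eval (reflection q) w v = v"
proof -
  obtain a b c where v: "v = (a, b, c)" by (cases v)
  have "word_eval (reflection q) (word_power [gen_s, gen_t] j) v = v"
    using assms(1)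
  proof
    assume "j = 4 \<and> q = 2"
    then show ?thesis by (simp add: v word_power_def numeral_eq_Suc algebra_simps)
  next
    assume "j = 5 \<and> q = golden + 1"
    then show ?thesis by (simp add: v word_power_def eval_nat_numeral algebra_simps golden_square golden_square')
  qed
  moreover have "word_eval (reflection q) (word_power [gen_r, gen_t] 5) v = v"
    by (simp add: v word_power_def eval_nat_numeral algebra_simps golden_square golden_square')
  moreover have "word_eval (reflection q) (word_power [gen_r, gen_s] 2) v = v"
    by (simp add: v word_power_def eval_nat_numeral)
  moreover have "word_eval (reflection q) (word_power [x] 2) v = v" for x
    by (simp add: word_power_def eval_nat_numeral reflection_involution)
  ultimately show ?thesis using assms(2) unfolding triangle_relators_def by auto
qed

lemma (in group) involution_products:
  assumes G: "r \<in> carrier G" "s \<in> carrier G" "t \<in> carrier G"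
    and sq: "r \<otimes> r = \<one>" "s \<otimes> s = \<one>" "t \<otimes> t = \<one>"
    and rs: "(r \<otimes> s) [^] (2 :: nat) = \<one>" and st: "(s \<otimes> t) [^] j = \<one>" and rt: "(r \<otimes> t) [^] (5 :: nat) = \<one>"
    and j: "j = 4 \<or> j = (5 :: nat)"
  obtains \<alpha> \<beta> where "\<alpha> \<in> carrier G" "\<beta> \<in> carrier G" "\<alpha> [^] (5 :: nat) = \<one>" "\<beta> [^] (5 :: nat) = \<one>"
    "(\<alpha> \<otimes> \<beta>) [^] (2 :: nat) = \<one>"
    "\<alpha> \<otimes> inv \<beta> = (if j = 4 then r \<otimes> (s \<otimes> (t \<otimes> (r \<otimes> (s \<otimes> t)))) else r \<otimes> (t \<otimes> (s \<otimes> t)))"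
proof -
  have invs: "inv r = r" "inv s = s" "inv t = t" using G sq by (simp_all add: inv_equality)
  have c: "x \<otimes> (x \<otimes> y) = y" if "x \<in> carrier G" "y \<in> carrier G" "x \<otimes> x = \<one>" for x y
    using that by (simp add: m_assoc[symmetric])
  have simps: "r \<otimes> (r \<otimes> y) = y" "s \<otimes> (s \<otimes> y) = y" "t \<otimes> (t \<otimes> y) = y" if "y \<in> carrier G" for y
    using c G sq that by simp_all
  have "r \<otimes> s = inv (r \<otimes> s)"
    using G rs by (intro inv_equality[symmetric]) (simp_all add: numeral_eq_Suc)
  then have comm: "r \<otimes> s = s \<otimes> r" using G by (simp add: inv_mult_group invs)
  have ts: "t \<otimes> s = inv (s \<otimes> t)" using G by (simp add: inv_mult_group invs)
  show thesis
  proof (cases "j = 4")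
    case False
    then have j: "j = 5" using j by simp
    show thesis
    proof (rule that[of "r \<otimes> t" "t \<otimes> s"])
      show "(t \<otimes> s) [^] (5 :: nat) = \<one>" unfolding ts using G st j by (simp add: nat_pow_inv)
      have "(r \<otimes> t) \<otimes> (t \<otimes> s) = r \<otimes> s" using G by (simp add: m_assoc simps)
      then show "((r \<otimes> t) \<otimes> (t \<otimes> s)) [^] (2 :: nat) = \<one>" using rs by simp
      show "(r \<otimes> t) \<otimes> inv (t \<otimes> s) = (if j = 4 then r \<otimes> (s \<otimes> (t \<otimes> (r \<otimes> (s \<otimes> t)))) else r \<otimes> (t \<otimes> (s \<otimes> t)))"
        using G j by (simp add: inv_mult_group invs m_assoc)
    qed (use G rt in simp_all)
  next
    case True
    let ?b = "t \<otimes> (s \<otimes> (r \<otimes> (t \<otimes> (s \<otimes> t))))"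
    \<comment> \<open>\<open>?b\<close> is the conjugate of \<open>r t\<close> by
      \<open>t s\<close>, multiplied out.\<close>
    have conj: "?b [^] n = (t \<otimes> s) \<otimes> (r \<otimes> t) [^] n \<otimes> (s \<otimes> t)" for n :: nat
      using G by (induction n) (simp_all add: m_assoc simps sq)
    show thesis
    proof (rule that[of "r \<otimes> t" ?b])
      show "?b [^] (5 :: nat) = \<one>" using G by (simp add: conj rt m_assoc simps sq)
      \<comment> \<open>The product turns out to be the square of \<open>s t\<close>; its own square
        is trivial by the relation for \<open>j = 4\<close>.\<close>
      have "(r \<otimes> t) \<otimes> ?b = (r \<otimes> s) \<otimes> (r \<otimes> (t \<otimes> (s \<otimes> t)))" using G by (simp add: m_assoc simps)
      also have "\<dots> = (s \<otimes> r) \<otimes> (r \<otimes> (t \<otimes> (s \<otimes> t)))" by (simp only: comm)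
      also have "\<dots> = (s \<otimes> t) [^] (2 :: nat)" using G by (simp add: m_assoc simps numeral_eq_Suc)
      finally have "((r \<otimes> t) \<otimes> ?b) [^] (2 :: nat) = (s \<otimes> t) [^] (4 :: nat)" using G by (simp add: nat_pow_pow)
      then show "((r \<otimes> t) \<otimes> ?b) [^] (2 :: nat) = \<one>" using st True by simp
      show "(r \<otimes> t) \<otimes> inv ?b = (if j = 4 then r \<otimes> (s \<otimes> (t \<otimes> (r \<otimes> (s \<otimes> t)))) else r \<otimes> (t \<otimes> (s \<otimes> t)))"
        using G True by (simp add: inv_mult_group invs m_assoc simps)
    qed (use G rt in simp_all)
  qed
qed

theorem theorem1p1:
  fixes j :: nat
  assumes "j \<in> {4, 5}"
  shows "\<not> systolic_group TYPE('a) (triangle_group 2 j 5)"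
proof
  define R where "R = triangle_relators 2 j 5"
  let ?G = "presented_group R"
  \<comment> \<open>The word of \<alpha> times the inverse of \<beta>. For \<open>j = 4\<close> it
    is the square of the Coxeter element \<open>r s t\<close>, for \<open>j = 5\<close> the product
    of the reflections \<open>r\<close> and \<open>t s t\<close>.\<close>
  let ?w = "map (\<lambda>x. (x, True)) (if j = 4 then [gen_r, gen_s, gen_t, gen_r, gen_s, gen_t] else [gen_r, gen_t, gen_s, gen_t])"
  define e where "e x = pres_class R [(x, True)]" for x
  interpret group ?G by (rule group_presented_group)
  assume "systolic_group TYPE('a) (triangle_group 2 j 5)"
  then obtain X :: "'a set set" and \<phi> where "systolic_complex X" "geometric_action ?G X \<phi>"
    unfolding systolic_group_def triangle_group_def R_def by blast
  then interpret geometric_systolic X ?G \<phi> by unfold_locales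
  have e: "e x \<in> carrier ?G" for x unfolding e_def by (simp add: presented_group_def)
  have rel: "pres_class R (map (\<lambda>x. (x, True)) xs) [^]\<^bsub>?G\<^esub> n = \<one>\<^bsub>?G\<^esub>" if "word_power xs n \<in> R" for xs n
  proof -
    have "pres_eq R (word_power xs n) []" using pres_eq.relator[OF that, of "[]" "[]"] by simp
    then show ?thesis unfolding pres_class_power word_power_def[symmetric] by (simp add: presented_group_def pres_class_eq_iff)
  qed
  have sq: "e x \<otimes>\<^bsub>?G\<^esub> e x = \<one>\<^bsub>?G\<^esub>" for x
  proof -
    have "word_power [x] 2 \<in> R" by (cases x) (simp_all add: R_def triangle_relators_def)
    then have "e x [^]\<^bsub>?G\<^esub> (2 :: nat) = \<one>\<^bsub>?G\<^esub>" using rel unfolding e_def by force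
    then show ?thesis using e[of x] by (simp add: numeral_2_eq_2)
  qed
  have j: "j = 4 \<or> j = 5" using assms by simp
  have rels: "(e gen_r \<otimes>\<^bsub>?G\<^esub> e gen_s) [^]\<^bsub>?G\<^esub> (2 :: nat) = \<one>\<^bsub>?G\<^esub>" "(e gen_s \<otimes>\<^bsub>?G\<^esub> e gen_t) [^]\<^bsub>?G\<^esub> j = \<one>\<^bsub>?G\<^esub>"
    "(e gen_r \<otimes>\<^bsub>?G\<^esub> e gen_t) [^]\<^bsub>?G\<^esub> (5 :: nat) = \<one>\<^bsub>?G\<^esub>"
    using rel[of "[gen_r, gen_s]" 2] rel[of "[gen_s, gen_t]" j] rel[of "[gen_r, gen_t]" 5]
    by (simp_all add: R_def triangle_relators_def e_def presented_group_mult)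
  obtain \<alpha> \<beta> where ab: "\<alpha> \<in> carrier ?G" "\<beta> \<in> carrier ?G" "\<alpha> [^]\<^bsub>?G\<^esub> (5 :: nat) = \<one>\<^bsub>?G\<^esub>"
      "\<beta> [^]\<^bsub>?G\<^esub> (5 :: nat) = \<one>\<^bsub>?G\<^esub>" "(\<alpha> \<otimes>\<^bsub>?G\<^esub> \<beta>) [^]\<^bsub>?G\<^esub> (2 :: nat) = \<one>\<^bsub>?G\<^esub>"
    and "\<alpha> \<otimes>\<^bsub>?G\<^esub> inv\<^bsub>?G\<^esub> \<beta> = (if j = 4
      then e gen_r \<otimes>\<^bsub>?G\<^esub> (e gen_s \<otimes>\<^bsub>?G\<^esub> (e gen_t \<otimes>\<^bsub>?G\<^esub> (e gen_r \<otimes>\<^bsub>?G\<^esub> (e gen_s \<otimes>\<^bsub>?G\<^esub> e gen_t))))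
      else e gen_r \<otimes>\<^bsub>?G\<^esub> (e gen_t \<otimes>\<^bsub>?G\<^esub> (e gen_s \<otimes>\<^bsub>?G\<^esub> e gen_t)))"
    by (rule involution_products[OF e e e sq sq sq rels j])
  then have w: "\<alpha> \<otimes>\<^bsub>?G\<^esub> inv\<^bsub>?G\<^esub> \<beta> = pres_class R ?w" by (simp add: e_def presented_group_mult)
  define q where "q = (if j = 4 then 2 else golden + 1)"
  let ?W = "word_eval (reflection q) ?w"
  \<comment> \<open>Both vectors are \<open>?W e - e\<close> for \<open>e = (1, 0, 0)\<close>, the
    root of \<open>r\<close>, so they lie in the image of \<open>?W - 1\<close>. In both cases
    \<open>?W\<close> has trace \<open>3 * golden + 1\<close>, determinant one and eigenvalue one.
    Its characteristic polynomial is therefore \<open>X - 1\<close> times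
    \<open>X^2 - 3 * golden * X + 1\<close>, and the second factor vanishes on that image.\<close>
  let ?v = "if j = 4 then (1 + 2 * golden, 2 * golden, 1 + golden) else (3 * golden, 1 + golden, 1 + golden)"
  have "strict_mono (\<lambda>n. fst ((?W ^^ n) ?v))"
  proof (rule strict_mono_linear_orbit)
    show "linear ?W" by (intro linear_word_eval linear_reflection)
    show "linear (fst :: real \<times> real \<times> real \<Rightarrow> real)" by (rule linear_fst)
    show "?W (?W ?v) = (3 * golden) *\<^sub>R ?W ?v - ?v"
      by (simp add: q_def algebra_simps golden_square golden_square')
    show "2 \<le> 3 * golden" "0 \<le> fst ?v" using golden_ge by simp_all
    show "fst ?v < fst (?W ?v)" using golden_ge by (simp add: q_def algebra_simps golden_square golden_square')
  qed
  then have "inj (fst \<circ> (\<lambda>n. (?W ^^ n) ?v))" unfolding o_def by (rule strict_mono_imp_inj_on)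
  then have "inj (\<lambda>n. (?W ^^ n) ?v)" by (rule inj_on_imageI2)
  moreover have "word_eval (reflection q) w v = v" if "w \<in> R" for w v
    using reflection_relators[of j q w v] that assms unfolding q_def R_def by auto
  ultimately have "inj (\<lambda>n :: nat. pres_class R ?w [^]\<^bsub>?G\<^esub> n)"
    by (intro inj_pres_class_power[of "reflection q" R ?w ?v] reflection_involution)
  then show False using finite_order[OF ab] unfolding w by simp
qed

end
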